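(* Let $H$ be a quasi-Hopf algebra, $\mathcal A$ an $H$-bimodule algebra, $\mathbb A$ a unital associative algebra and $(\delta,\Psi)$ a two-sided coaction of $H$ on $\mathbb A$. Let $\mathcal A\bowtie_\delta\mathbb A$ be the space $\mathcal A\otimes\mathbb A$ (elements written $\varphi\bowtie_\delta u$) with multiplication $$(\varphi\bowtie_\delta u)(\varphi'\bowtie_\delta u')=(\Omega^1_\delta\cdot\varphi\cdot\Omega^5_\delta)(\Omega^2_\delta u_{(-1)}\cdot\varphi'\cdot S^{-1}(u_{(1)})\Omega^4_\delta)\bowtie_\delta\Omega^3_\delta u_{(0)}u',$$ and let $\mathbb A\bowtie_\delta\mathcal A$ be the space $\mathbb A\otimes\mathcal A$ with multiplication $$(u\bowtie_\delta\varphi)(u'\bowtie_\delta\varphi')=uu'_{(0)}\Omega'^3_\delta\bowtie_\delta(\Omega'^2_\delta S^{-1}(u'_{(-1)})\cdot\varphi\cdot u'_{(1)}\Omega'^4_\delta)(\Omega'^1_\delta\cdot\varphi'\cdot\Omega'^5_\delta).$$ Then $\mathcal A\bowtie_\delta\mathbb A$ and $\mathbb A\bowtie_\delta\mathcal A$ are associative algebras with units $1_{\mathcal A}\bowtie_\delta1_{\mathbb A}$ and $1_{\mathbb A}\bowtie_\delta1_{\mathcal A}$ respectively, containing $\mathbb A\equiv1_{\mathcal A}\bowtie_\delta\mathbb A$, respectively $\mathbb A\equiv\mathbb A\bowtie_\delta1_{\mathcal A}$, as unital subalgebra. Consequently, if $\mathbb A$ is an $H$-bicomodule algebra and $\mathcal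 A$ is an $H$-bimodule algebra, then $\mathcal A\bowtie\mathbb A:=\mathcal A\bowtie_{\delta_l}\mathbb A$, $\mathcal A\blacktriangleright\!\blacktriangleleft\mathbb A:=\mathcal A\bowtie_{\delta_r}\mathbb A$, $\mathbb A\bowtie\mathcal A:=\mathbb A\bowtie_{\delta_l}\mathcal A$ and $\mathbb A\blacktriangleright\!\blacktriangleleft\mathcal A:=\mathbb A\bowtie_{\delta_r}\mathcal A$ are associative algebras containing $\mathbb A$ as unital subalgebra.
   Context: All algebras and spaces are over a field $k$, $\otimes=\otimes_k$; summation is understood. A quasi-bialgebra $(H,\Delta,\varepsilon,\Phi)$: a unital associative algebra $H$, algebra maps $\Delta:H\to H\otimes H$ ($\Delta(h)=h_1\otimes h_2$), $\varepsilon:H\to k$, and an invertible $\Phi=X^1\otimes X^2\otimes X^3\in H^{\otimes3}$, $\Phi^{-1}=x^1\otimes x^2\otimes x^3$, with $(id\otimes\Delta)(\Delta(h))=\Phi(\Delta\otimes id)(\Delta(h))\Phi^{-1}$, $(id\otimes\varepsilon)\Delta=id=(\varepsilon\otimes id)\Delta$, $(1\otimes\Phi)(id\otimes\Delta\otimes id)(\Phi)(\Phi\otimes1)=(id\otimes id\otimes\Delta)(\Phi)(\Delta\otimes id\otimes id)(\Phi)$, $(id\otimes\varepsilon\otimes id)(\Phi)=1\otimes1$. A quasi-Hopf algebra is a quasi-bialgebra with an algebra anti-automorphism $S$ (so $S$ is bijective) and $\alpha,\beta\in H$ such that $S(h_1)\alpha h_2=\varepsilon(h)\alpha$, $h_1\beta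 S(h_2)=\varepsilon(h)\beta$, $X^1\beta S(X^2)\alpha X^3=1$, $S(x^1)\alpha x^2\beta S(x^3)=1$; by rescaling one assumes $\varepsilon(\alpha)=\varepsilon(\beta)=1$ and $\varepsilon\circ S=\varepsilon$. Drinfeld twist: $f=f^1\otimes f^2=(S\otimes S)(\Delta^{cop}(x^1))\,\gamma\,\Delta(x^2\beta S(x^3))\in H\otimes H$, where $\Delta^{cop}(h)=h_2\otimes h_1$, $\gamma=S(A^2)\alpha A^3\otimes S(A^1)\alpha A^4$, $A^1\otimes A^2\otimes A^3\otimes A^4=(\Phi\otimes1)(\Delta\otimes id\otimes id)(\Phi^{-1})$; it is invertible, $f^{-1}=g^1\otimes g^2$. An $H$-bimodule algebra: an $H$-bimodule $\mathcal A$ with a bilinear multiplication and a two-sided unit $1_{\mathcal A}$ such that $(\varphi\varphi')\varphi''=(X^1\cdot\varphi\cdot x^1)[(X^2\cdot\varphi'\cdot x^2)(X^3\cdot\varphi''\cdot x^3)]$, $h\cdot(\varphi\varphi')=(h_1\cdot\varphi)(h_2\cdot\varphi')$, $(\varphi\varphi')\cdot h=(\varphi\cdot h_1)(\varphi'\cdot h_2)$, $h\cdot1_{\mathcal A}=\varepsilon(h)1_{\mathcal A}=1_{\mathcal A}\cdot h$. A two-sided coaction $(\delta,\Psi)$ of $H$ on a unital associative algebra $\mathbb A$: an algebra map $\delta:\mathbb A\to H\otimes\mathbb A\otimes H$, $\delta(u)=u_{(-1)}\otimes u_{(0)}\otimes u_{(1)}$, and an invertible $\Psi=\Psi^1\otimes\cdots\otimes\Psi^5\in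 H^{\otimes2}\otimes\mathbb A\otimes H^{\otimes2}$ with $(id_H\otimes\delta\otimes id_H)(\delta(u))\Psi=\Psi(\Delta\otimes id_{\mathbb A}\otimes\Delta)(\delta(u))$; $(1_H\otimes\Psi\otimes1_H)(id_H\otimes\Delta\otimes id_{\mathbb A}\otimes\Delta\otimes id_H)(\Psi)(\Phi\otimes1_{\mathbb A}\otimes\Phi^{-1})=(id_H^{\otimes2}\otimes\delta\otimes id_H^{\otimes2})(\Psi)(\Delta\otimes id_H\otimes id_{\mathbb A}\otimes id_H\otimes\Delta)(\Psi)$; $(\varepsilon\otimes id_{\mathbb A}\otimes\varepsilon)\delta=id_{\mathbb A}$; $(id_H\otimes\varepsilon\otimes id_{\mathbb A}\otimes\varepsilon\otimes id_H)(\Psi)=(\varepsilon\otimes id_H\otimes id_{\mathbb A}\otimes id_H\otimes\varepsilon)(\Psi)=1_H\otimes1_{\mathbb A}\otimes1_H$. Write $\Psi^{-1}=\overline\Psi^1\otimes\cdots\otimes\overline\Psi^5$ and put $\Omega_\delta=\overline\Psi^1\otimes\overline\Psi^2\otimes\overline\Psi^3\otimes S^{-1}(f^1\overline\Psi^4)\otimes S^{-1}(f^2\overline\Psi^5)$, $\Omega'_\delta=S^{-1}(\Psi^1g^1)\otimes S^{-1}(\Psi^2g^2)\otimes\Psi^3\otimes\Psi^4\otimes\Psi^5$, with components $\Omega^1_\delta\otimes\cdots\otimes\Omega^5_\delta$ and $\Omega'^1_\delta\otimes\cdots\otimes\Omega'^5_\delta$. A right $H$-comodule algebra: a unital associative algebra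 $\mathfrak A$, an algebra map $\rho:\mathfrak A\to\mathfrak A\otimes H$ and an invertible $\Phi_\rho\in\mathfrak A\otimes H\otimes H$ with $\Phi_\rho(\rho\otimes id)(\rho(a))=(id\otimes\Delta)(\rho(a))\Phi_\rho$, $(1\otimes\Phi)(id\otimes\Delta\otimes id)(\Phi_\rho)(\Phi_\rho\otimes1)=(id\otimes id\otimes\Delta)(\Phi_\rho)(\rho\otimes id\otimes id)(\Phi_\rho)$, $(id\otimes\varepsilon)\rho=id$, $(id\otimes\varepsilon\otimes id)(\Phi_\rho)=(id\otimes id\otimes\varepsilon)(\Phi_\rho)=1\otimes1$. A left $H$-comodule algebra: a unital associative algebra $\mathfrak B$, an algebra map $\lambda:\mathfrak B\to H\otimes\mathfrak B$ and an invertible $\Phi_\lambda\in H\otimes H\otimes\mathfrak B$ with $(id\otimes\lambda)(\lambda(b))\Phi_\lambda=\Phi_\lambda(\Delta\otimes id)(\lambda(b))$, $(1\otimes\Phi_\lambda)(id\otimes\Delta\otimes id)(\Phi_\lambda)(\Phi\otimes1)=(id\otimes id\otimes\lambda)(\Phi_\lambda)(\Delta\otimes id\otimes id)(\Phi_\lambda)$, $(\varepsilon\otimes id)\lambda=id$, $(id\otimes\varepsilon\otimes id)(\Phi_\lambda)=(\varepsilon\otimes id\otimes id)(\Phi_\lambda)=1\otimes1$. An $H$-bicomodule algebra $(\mathbb A,\lambda,\rho,\Phi_\lambda,\Phi_\rho,\Phi_{\lambda,\rho})$: $(\mathbb A,\lambda,\Phi_\lambda)$ is a left and $(\mathbb A,\rho,\Phi_\rho)$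 a right $H$-comodule algebra, and $\Phi_{\lambda,\rho}\in H\otimes\mathbb A\otimes H$ is invertible with $\Phi_{\lambda,\rho}(\lambda\otimes id)(\rho(u))=(id\otimes\rho)(\lambda(u))\Phi_{\lambda,\rho}$, $(1\otimes\Phi_{\lambda,\rho})(id\otimes\lambda\otimes id)(\Phi_{\lambda,\rho})(\Phi_\lambda\otimes1)=(id\otimes id\otimes\rho)(\Phi_\lambda)(\Delta\otimes id\otimes id)(\Phi_{\lambda,\rho})$, $(1\otimes\Phi_\rho)(id\otimes\rho\otimes id)(\Phi_{\lambda,\rho})(\Phi_{\lambda,\rho}\otimes1)=(id\otimes id\otimes\Delta)(\Phi_{\lambda,\rho})(\lambda\otimes id\otimes id)(\Phi_\rho)$. To an $H$-bicomodule algebra $\mathbb A$ one associates two two-sided coactions (known fact): $\delta_l=(\lambda\otimes id_H)\rho$, $\Psi_l=(id_H\otimes\lambda\otimes id_H^{\otimes2})\big((\Phi_{\lambda,\rho}\otimes1_H)(\lambda\otimes id_H^{\otimes2})(\Phi_\rho^{-1})\big)[\Phi_\lambda\otimes1_H^{\otimes2}]$; $\delta_r=(id_H\otimes\rho)\lambda$, $\Psi_r=(id_H^{\otimes2}\otimes\rho\otimes id_H)\big((1_H\otimes\Phi_{\lambda,\rho}^{-1})(id_H^{\otimes2}\otimes\rho)(\Phi_\lambda)\big)[1_H^{\otimes2}\otimes\Phi_\rho^{-1}]$. *)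

theory Defs
  imports Complex_Main "HOL-Library.Poly_Mapping" "HOL-Algebra.Module"
begin

section \<open>Algebras over a field\<close>

text \<open>
  An associative algebra over the field \<open>'k\<close> is a (not necessarily commutative) ring together
  with a scalar multiplication; the locale \<open>algebra\<close> of the library is restricted to
  commutative rings and therefore not used.
  The algebras that are given are types of sort \<open>{ring, monoid_mult}\<close>. (This sort is
  \<open>ring_1\<close> without the requirement that 0 differs from 1.) Algebras that are constructed
  have an explicit carrier.
\<close>

definition alg_of :: "('k::field \<Rightarrow> 'v::{ring,monoid_mult} \<Rightarrow> 'v) \<Rightarrow> ('k, 'v) module" where
  "alg_of s = \<lparr>carrier = UNIV, mult = (*), one = 1, zero = 0, add = (+), smult = s\<rparr>"

definition k_algebra :: "('k::field, 'v) module \<Rightarrow> bool" where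
  "k_algebra A \<longleftrightarrow> ring A \<and> Module.module (alg_of ((*) :: 'k \<Rightarrow> 'k \<Rightarrow> 'k)) A \<and>
     (\<forall>c. \<forall>x\<in>carrier A. \<forall>y\<in>carrier A.
        (c \<odot>\<^bsub>A\<^esub> x) \<otimes>\<^bsub>A\<^esub> y = c \<odot>\<^bsub>A\<^esub> (x \<otimes>\<^bsub>A\<^esub> y) \<and>
        x \<otimes>\<^bsub>A\<^esub> (c \<odot>\<^bsub>A\<^esub> y) = c \<odot>\<^bsub>A\<^esub> (x \<otimes>\<^bsub>A\<^esub> y))"

definition alg_hom :: "('k::field, 'v) module \<Rightarrow> ('k, 'w) module \<Rightarrow> ('v \<Rightarrow> 'w) set" where
  "alg_hom A B = {g \<in> ring_hom A B. \<forall>c. \<forall>x\<in>carrier A. g (c \<odot>\<^bsub>A\<^esub> x) = c \<odot>\<^bsub>B\<^esub> g x}"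

definition bilin :: "('k::field \<Rightarrow> 'u::ab_group_add \<Rightarrow> 'u) \<Rightarrow> ('k \<Rightarrow> 'v::ab_group_add \<Rightarrow> 'v) \<Rightarrow>
    ('k \<Rightarrow> 'w::ab_group_add \<Rightarrow> 'w) \<Rightarrow> ('u \<Rightarrow> 'v \<Rightarrow> 'w) \<Rightarrow> bool" where
  "bilin s1 s2 s3 g \<longleftrightarrow>
     (\<forall>x. Vector_Spaces.linear s2 s3 (g x)) \<and> (\<forall>y. Vector_Spaces.linear s1 s3 (\<lambda>x. g x y))"


section \<open>Tensor products\<close>

text \<open>
  A tensor product of several spaces is the free vector space on the set of all tuples modulo
  the span of the multilinearity relations. This avoids any bracketing of iterated tensor
  products, so no reassociation isomorphisms are needed.

  A space is presented by a set of relations in the free vector space \<open>'x \<Rightarrow>\<^sub>0 'k\<close> on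
  a set of generators: \<open>vrel s\<close> presents the vector space \<open>'v\<close> with scalar
  multiplication \<open>s\<close> on all its elements as generators, and \<open>R \<boxtimes> Q\<close> presents the tensor
  product of the spaces presented by \<open>R\<close> and \<open>Q\<close> on the pairs of generators.
\<close>

definition fscale :: "'k::field \<Rightarrow> ('x \<Rightarrow>\<^sub>0 'k) \<Rightarrow> ('x \<Rightarrow>\<^sub>0 'k)" where
  "fscale c p = Poly_Mapping.map ((*) c) p"

definition push :: "('x \<Rightarrow> 'y) \<Rightarrow> ('x \<Rightarrow>\<^sub>0 'k::field) \<Rightarrow> ('y \<Rightarrow>\<^sub>0 'k)" where
  "push g p = (\<Sum>x\<in>Poly_Mapping.keys p. Poly_Mapping.single (g x) (Poly_Mapping.lookup p x))"

definition vrel :: "('k::field \<Rightarrow> 'v::ab_group_add \<Rightarrow> 'v) \<Rightarrow> ('v \<Rightarrow>\<^sub>0 'k) set" where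
  "vrel s =
     {Poly_Mapping.single (x + y) 1 - Poly_Mapping.single x 1 - Poly_Mapping.single y 1 | x y. True} \<union>
     {Poly_Mapping.single (s c x) 1 - Poly_Mapping.single x c | c x. True}"

definition trel :: "('x \<Rightarrow>\<^sub>0 'k::field) set \<Rightarrow> ('y \<Rightarrow>\<^sub>0 'k) set \<Rightarrow> ('x \<times> 'y \<Rightarrow>\<^sub>0 'k) set"
    (infixr \<open>\<boxtimes>\<close> 75) where
  "R \<boxtimes> Q = {push (\<lambda>x. (x, y)) r | r y. r \<in> R} \<union> {push (\<lambda>y. (x, y)) q | x q. q \<in> Q}"

definition formal_sum :: "'x list \<Rightarrow> ('x \<Rightarrow>\<^sub>0 'k::field)" where
  "formal_sum xs = (\<Sum>x\<leftarrow>xs. Poly_Mapping.single x 1)"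

text \<open>
  \<open>tens R xs\<close> is the sum of the pure tensors listed in \<open>xs\<close>, as a coset of the span of
  the relations. Conversely \<open>terms t\<close> is some way of writing the tensor \<open>t\<close> as a sum of
  pure tensors, so that a list comprehension over \<open>terms t\<close> renders the notation
  \<open>t = t\<^sup>1 \<otimes> \<dots> \<otimes> t\<^sup>n\<close> with implicit summation. For relations built from
  \<open>vrel\<close> and \<open>\<boxtimes>\<close> every coset has such a form, because scalars can be absorbed into a
  tensor factor.
\<close>

definition tens :: "('x \<Rightarrow>\<^sub>0 'k::field) set \<Rightarrow> 'x list \<Rightarrow> ('x \<Rightarrow>\<^sub>0 'k) set" where
  "tens R xs = {p. p - formal_sum xs \<in> Modules.module.span fscale R}"

definition terms :: "('x \<Rightarrow>\<^sub>0 'k::field) set \<Rightarrow> 'x list" where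
  "terms t = (SOME xs. formal_sum xs \<in> t)"

text \<open>The tensor space presented by \<open>R\<close>, with multiplication \<open>m\<close> and unit \<open>e\<close>.\<close>

definition tspace :: "('x \<Rightarrow>\<^sub>0 'k::field) set \<Rightarrow>
    (('x \<Rightarrow>\<^sub>0 'k) set \<Rightarrow> ('x \<Rightarrow>\<^sub>0 'k) set \<Rightarrow> ('x \<Rightarrow>\<^sub>0 'k) set) \<Rightarrow> ('x \<Rightarrow>\<^sub>0 'k) set \<Rightarrow>
    ('k, ('x \<Rightarrow>\<^sub>0 'k) set) module" where
  "tspace R m e =
     \<lparr>carrier = Set.range (tens R), mult = m, one = e, zero = tens R [],
      add = (\<lambda>t t'. {p + q | p q. p \<in> t \<and> q \<in> t'}),
      smult = (\<lambda>c t. {fscale c p + q | p q. p \<in> t \<and> q \<in> Modules.module.span fscale R})\<rparr>"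

instantiation prod :: (times, times) times
begin
definition times_prod :: "'a \<times> 'b \<Rightarrow> 'a \<times> 'b \<Rightarrow> 'a \<times> 'b" where
  "times_prod x y = (fst x * fst y, snd x * snd y)"
instance ..
end

instantiation prod :: (one, one) one
begin
definition one_prod :: "'a \<times> 'b" where "one_prod = (1, 1)"
instance ..
end

text \<open>The tensor product of algebras, with its componentwise multiplication.\<close>

definition talg :: "('x::{times,one} \<Rightarrow>\<^sub>0 'k::field) set \<Rightarrow> ('k, ('x \<Rightarrow>\<^sub>0 'k) set) module" where
  "talg R = tspace R (\<lambda>t t'. tens R [x * y. x \<leftarrow> terms t, y \<leftarrow> terms t']) (tens R [1])"


section \<open>Quasi-Hopf algebras\<close>

record (overloaded) ('k::zero, 'h) quasi_bialg =
  hscale :: "'k \<Rightarrow> 'h \<Rightarrow> 'h"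
  comul :: "'h \<Rightarrow> ('h \<times> 'h \<Rightarrow>\<^sub>0 'k) set"
  counit :: "'h \<Rightarrow> 'k"
  reassoc :: "('h \<times> 'h \<times> 'h \<Rightarrow>\<^sub>0 'k) set"

record (overloaded) ('k::zero, 'h) quasi_hopf = "('k, 'h) quasi_bialg" +
  antipode :: "'h \<Rightarrow> 'h"
  alpha :: 'h
  beta :: 'h

abbreviation "H1 H \<equiv> vrel (hscale H)"
abbreviation "HH H \<equiv> H1 H \<boxtimes> H1 H"
abbreviation "HHH H \<equiv> H1 H \<boxtimes> H1 H \<boxtimes> H1 H"
abbreviation "HHHH H \<equiv> H1 H \<boxtimes> H1 H \<boxtimes> H1 H \<boxtimes> H1 H"

abbreviation "reassoc_inv H \<equiv> inv\<^bsub>talg (HHH H)\<^esub> (reassoc H)"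

locale quasi_bialgebra =
  fixes H :: "('k::field, 'h::{ring,monoid_mult}, 'm) quasi_bialg_scheme"
  assumes algebra: "k_algebra (alg_of (hscale H))"
    and comul_hom: "comul H \<in> alg_hom (alg_of (hscale H)) (talg (HH H))"
    and counit_hom: "counit H \<in> alg_hom (alg_of (hscale H)) (alg_of (*))"
    and reassoc_unit: "reassoc H \<in> Units (talg (HHH H))"
    and quasi_coassoc:
      "tens (HHH H) [(a, b1, b2). (a, b) \<leftarrow> terms (comul H h), (b1, b2) \<leftarrow> terms (comul H b)] =
       reassoc H \<otimes>\<^bsub>talg (HHH H)\<^esub>
       tens (HHH H) [(a1, a2, b). (a, b) \<leftarrow> terms (comul H h), (a1, a2) \<leftarrow> terms (comul H a)]
       \<otimes>\<^bsub>talg (HHH H)\<^esub> reassoc_inv H"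
    and counit_right: "(\<Sum>(a, b)\<leftarrow>terms (comul H h). hscale H (counit H b) a) = h"
    and counit_left: "(\<Sum>(a, b)\<leftarrow>terms (comul H h). hscale H (counit H a) b) = h"
    and pentagon:
      "tens (HHHH H) [(1, x, y, z). (x, y, z) \<leftarrow> terms (reassoc H)]
       \<otimes>\<^bsub>talg (HHHH H)\<^esub>
       tens (HHHH H) [(x, y1, y2, z). (x, y, z) \<leftarrow> terms (reassoc H), (y1, y2) \<leftarrow> terms (comul H y)]
       \<otimes>\<^bsub>talg (HHHH H)\<^esub>
       tens (HHHH H) [(x, y, z, 1). (x, y, z) \<leftarrow> terms (reassoc H)] =
       tens (HHHH H) [(x, y, z1, z2). (x, y, z) \<leftarrow> terms (reassoc H), (z1, z2) \<leftarrow> terms (comul H z)]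
       \<otimes>\<^bsub>talg (HHHH H)\<^esub>
       tens (HHHH H) [(x1, x2, y, z). (x, y, z) \<leftarrow> terms (reassoc H), (x1, x2) \<leftarrow> terms (comul H x)]"
    and reassoc_counit:
      "tens (HH H) [(hscale H (counit H y) x, z). (x, y, z) \<leftarrow> terms (reassoc H)] = tens (HH H) [(1, 1)]"

locale quasi_hopf_algebra = quasi_bialgebra H
  for H :: "('k::field, 'h::{ring,monoid_mult}) quasi_hopf" +
  assumes antipode_linear: "Vector_Spaces.linear (hscale H) (hscale H) (antipode H)"
    and antipode_bij: "bij (antipode H)"
    and antipode_mult: "antipode H (x * y) = antipode H y * antipode H x"
    and antipode_one: "antipode H 1 = 1"
    and antipode_alpha:
      "(\<Sum>(h1, h2)\<leftarrow>terms (comul H h). antipode H h1 * alpha H * h2) = hscale H (counit H h) (alpha H)"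
    and antipode_beta:
      "(\<Sum>(h1, h2)\<leftarrow>terms (comul H h). h1 * beta H * antipode H h2) = hscale H (counit H h) (beta H)"
    and antipode_reassoc:
      "(\<Sum>(x, y, z)\<leftarrow>terms (reassoc H). x * beta H * antipode H y * alpha H * z) = 1"
    and antipode_reassoc_inv:
      "(\<Sum>(x, y, z)\<leftarrow>terms (reassoc_inv H). antipode H x * alpha H * y * beta H * antipode H z) = 1"
    and counit_alpha: "counit H (alpha H) = 1"
    and counit_beta: "counit H (beta H) = 1"
    and counit_antipode: "counit H (antipode H h) = counit H h"

abbreviation "antipode_inv H \<equiv> inv_into UNIV (antipode H)"

definition twist_A :: "('k::field, 'h::{ring,monoid_mult}) quasi_hopf \<Rightarrow> ('h \<times> 'h \<times> 'h \<times> 'h \<Rightarrow>\<^sub>0 'k) set" where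
  "twist_A H =
     tens (HHHH H) [(x, y, z, 1). (x, y, z) \<leftarrow> terms (reassoc H)]
     \<otimes>\<^bsub>talg (HHHH H)\<^esub>
     tens (HHHH H) [(x1, x2, y, z). (x, y, z) \<leftarrow> terms (reassoc_inv H), (x1, x2) \<leftarrow> terms (comul H x)]"

definition twist_gamma :: "('k::field, 'h::{ring,monoid_mult}) quasi_hopf \<Rightarrow> ('h \<times> 'h \<Rightarrow>\<^sub>0 'k) set" where
  "twist_gamma H =
     tens (HH H) [(antipode H a2 * alpha H * a3, antipode H a1 * alpha H * a4).
       (a1, a2, a3, a4) \<leftarrow> terms (twist_A H)]"

definition drinfeld_twist :: "('k::field, 'h::{ring,monoid_mult}) quasi_hopf \<Rightarrow> ('h \<times> 'h \<Rightarrow>\<^sub>0 'k) set" where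
  "drinfeld_twist H =
     tens (HH H) [(antipode H x2 * c1 * d1, antipode H x1 * c2 * d2).
       (x, y, z) \<leftarrow> terms (reassoc_inv H),
       (x1, x2) \<leftarrow> terms (comul H x),
       (c1, c2) \<leftarrow> terms (twist_gamma H),
       (d1, d2) \<leftarrow> terms (comul H (y * beta H * antipode H z))]"


section \<open>Bimodule algebras\<close>

record ('k, 'h, 'a) bimodule_alg =
  bscale :: "'k \<Rightarrow> 'a \<Rightarrow> 'a"
  lact :: "'h \<Rightarrow> 'a \<Rightarrow> 'a"
  ract :: "'a \<Rightarrow> 'h \<Rightarrow> 'a"
  bmult :: "'a \<Rightarrow> 'a \<Rightarrow> 'a"
  bunit :: 'a

locale bimodule_algebra =
  fixes H :: "('k::field, 'h::{ring,monoid_mult}, 'm) quasi_bialg_scheme"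
    and A :: "('k, 'h, 'a::ab_group_add) bimodule_alg"
  assumes space: "vector_space (bscale A)"
    and lact_bilin: "bilin (hscale H) (bscale A) (bscale A) (lact A)"
    and ract_bilin: "bilin (bscale A) (hscale H) (bscale A) (ract A)"
    and bmult_bilin: "bilin (bscale A) (bscale A) (bscale A) (bmult A)"
    and lact_one: "lact A 1 p = p"
    and lact_mult: "lact A (h * h') p = lact A h (lact A h' p)"
    and ract_one: "ract A p 1 = p"
    and ract_mult: "ract A p (h * h') = ract A (ract A p h) h'"
    and lact_ract: "ract A (lact A h p) h' = lact A h (ract A p h')"
    and bunit_left: "bmult A (bunit A) p = p"
    and bunit_right: "bmult A p (bunit A) = p"
    and quasi_assoc:
      "bmult A (bmult A p p') p'' =
       (\<Sum>(X1, X2, X3)\<leftarrow>terms (reassoc H). \<Sum>(x1, x2, x3)\<leftarrow>terms (reassoc_inv H).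
          bmult A (ract A (lact A X1 p) x1)
            (bmult A (ract A (lact A X2 p') x2) (ract A (lact A X3 p'') x3)))"
    and lact_bmult:
      "lact A h (bmult A p p') = (\<Sum>(h1, h2)\<leftarrow>terms (comul H h). bmult A (lact A h1 p) (lact A h2 p'))"
    and ract_bmult:
      "ract A (bmult A p p') h = (\<Sum>(h1, h2)\<leftarrow>terms (comul H h). bmult A (ract A p h1) (ract A p' h2))"
    and lact_bunit: "lact A h (bunit A) = bscale A (counit H h) (bunit A)"
    and ract_bunit: "ract A (bunit A) h = bscale A (counit H h) (bunit A)"


section \<open>Two-sided coactions\<close>

text \<open>Here and below \<open>s\<close> is the scalar multiplication of an algebra \<open>'u\<close> on which \<open>H\<close> coacts.\<close>

abbreviation "HUH H s \<equiv> H1 H \<boxtimes> vrel s \<boxtimes> H1 H"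
abbreviation "HHUHH H s \<equiv> H1 H \<boxtimes> H1 H \<boxtimes> vrel s \<boxtimes> H1 H \<boxtimes> H1 H"
abbreviation "HHHUHHH H s \<equiv> H1 H \<boxtimes> H1 H \<boxtimes> H1 H \<boxtimes> vrel s \<boxtimes> H1 H \<boxtimes> H1 H \<boxtimes> H1 H"

locale two_sided_coaction =
  fixes H :: "('k::field, 'h::{ring,monoid_mult}, 'm) quasi_bialg_scheme"
    and s :: "'k \<Rightarrow> 'u::{ring,monoid_mult} \<Rightarrow> 'u"
    and \<delta> :: "'u \<Rightarrow> ('h \<times> 'u \<times> 'h \<Rightarrow>\<^sub>0 'k) set"
    and \<Psi> :: "('h \<times> 'h \<times> 'u \<times> 'h \<times> 'h \<Rightarrow>\<^sub>0 'k) set"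
  assumes algebra: "k_algebra (alg_of s)"
    and coact_hom: "\<delta> \<in> alg_hom (alg_of s) (talg (HUH H s))"
    and psi_unit: "\<Psi> \<in> Units (talg (HHUHH H s))"
    and coact_coassoc:
      "tens (HHUHH H s) [(a, b, v, c, d). (a, w, d) \<leftarrow> terms (\<delta> u), (b, v, c) \<leftarrow> terms (\<delta> w)]
       \<otimes>\<^bsub>talg (HHUHH H s)\<^esub> \<Psi> =
       \<Psi> \<otimes>\<^bsub>talg (HHUHH H s)\<^esub>
       tens (HHUHH H s) [(a1, a2, v, d1, d2). (a, v, d) \<leftarrow> terms (\<delta> u),
         (a1, a2) \<leftarrow> terms (comul H a), (d1, d2) \<leftarrow> terms (comul H d)]"
    and psi_pentagon:
      "tens (HHHUHHH H s) [(1, a, b, v, c, d, 1). (a, b, v, c, d) \<leftarrow> terms \<Psi>]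
       \<otimes>\<^bsub>talg (HHHUHHH H s)\<^esub>
       tens (HHHUHHH H s) [(a, b1, b2, v, c1, c2, d). (a, b, v, c, d) \<leftarrow> terms \<Psi>,
         (b1, b2) \<leftarrow> terms (comul H b), (c1, c2) \<leftarrow> terms (comul H c)]
       \<otimes>\<^bsub>talg (HHHUHHH H s)\<^esub>
       tens (HHHUHHH H s) [(X, Y, Z, 1, x, y, z). (X, Y, Z) \<leftarrow> terms (reassoc H),
         (x, y, z) \<leftarrow> terms (reassoc_inv H)] =
       tens (HHHUHHH H s) [(a, b, v1, v, v2, c, d). (a, b, w, c, d) \<leftarrow> terms \<Psi>,
         (v1, v, v2) \<leftarrow> terms (\<delta> w)]
       \<otimes>\<^bsub>talg (HHHUHHH H s)\<^esub>
       tens (HHHUHHH H s) [(a1, a2, b, v, c, d1, d2). (a, b, v, c, d) \<leftarrow> terms \<Psi>,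
         (a1, a2) \<leftarrow> terms (comul H a), (d1, d2) \<leftarrow> terms (comul H d)]"
    and coact_counit: "(\<Sum>(a, v, d)\<leftarrow>terms (\<delta> u). s (counit H a * counit H d) v) = u"
    and psi_counit_inner:
      "tens (HUH H s) [(a, s (counit H b * counit H c) v, d). (a, b, v, c, d) \<leftarrow> terms \<Psi>] =
       tens (HUH H s) [(1, 1, 1)]"
    and psi_counit_outer:
      "tens (HUH H s) [(b, s (counit H a * counit H d) v, c). (a, b, v, c, d) \<leftarrow> terms \<Psi>] =
       tens (HUH H s) [(1, 1, 1)]"

definition Omega :: "('k::field, 'h::{ring,monoid_mult}) quasi_hopf \<Rightarrow> ('k \<Rightarrow> 'u::{ring,monoid_mult} \<Rightarrow> 'u) \<Rightarrow>
    ('h \<times> 'h \<times> 'u \<times> 'h \<times> 'h \<Rightarrow>\<^sub>0 'k) set \<Rightarrow> ('h \<times> 'h \<times> 'u \<times> 'h \<times> 'h \<Rightarrow>\<^sub>0 'k) set" where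
  "Omega H s \<Psi> =
     tens (HHUHH H s) [(a, b, v, antipode_inv H (f1 * c), antipode_inv H (f2 * d)).
       (a, b, v, c, d) \<leftarrow> terms (inv\<^bsub>talg (HHUHH H s)\<^esub> \<Psi>),
       (f1, f2) \<leftarrow> terms (drinfeld_twist H)]"

definition Omega' :: "('k::field, 'h::{ring,monoid_mult}) quasi_hopf \<Rightarrow> ('k \<Rightarrow> 'u::{ring,monoid_mult} \<Rightarrow> 'u) \<Rightarrow>
    ('h \<times> 'h \<times> 'u \<times> 'h \<times> 'h \<Rightarrow>\<^sub>0 'k) set \<Rightarrow> ('h \<times> 'h \<times> 'u \<times> 'h \<times> 'h \<Rightarrow>\<^sub>0 'k) set" where
  "Omega' H s \<Psi> =
     tens (HHUHH H s) [(antipode_inv H (a * g1), antipode_inv H (b * g2), v, c, d).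
       (a, b, v, c, d) \<leftarrow> terms \<Psi>,
       (g1, g2) \<leftarrow> terms (inv\<^bsub>talg (HH H)\<^esub> (drinfeld_twist H))]"


section \<open>Generalized diagonal crossed products\<close>

text \<open>
  \<open>lprod\<close> and \<open>rprod\<close> are the defining formulas for the product of two pure tensors, as
  lists of pure tensors. The multiplications of \<open>lcross\<close> and \<open>rcross\<close> extend them
  additively to all tensors, by way of chosen representations of the two factors.
\<close>

definition lprod :: "('k::field, 'h::{ring,monoid_mult}) quasi_hopf \<Rightarrow> ('k, 'h, 'a::ab_group_add) bimodule_alg \<Rightarrow>
    ('k \<Rightarrow> 'u::{ring,monoid_mult} \<Rightarrow> 'u) \<Rightarrow> ('u \<Rightarrow> ('h \<times> 'u \<times> 'h \<Rightarrow>\<^sub>0 'k) set) \<Rightarrow>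
    ('h \<times> 'h \<times> 'u \<times> 'h \<times> 'h \<Rightarrow>\<^sub>0 'k) set \<Rightarrow> 'a \<times> 'u \<Rightarrow> 'a \<times> 'u \<Rightarrow> ('a \<times> 'u) list" where
  "lprod H A s \<delta> \<Psi> = (\<lambda>(p, u) (p', u').
     [(bmult A (ract A (lact A w1 p) w5)
               (ract A (lact A (w2 * um) p') (antipode_inv H up * w4)),
       w3 * u0 * u').
      (w1, w2, w3, w4, w5) \<leftarrow> terms (Omega H s \<Psi>),
      (um, u0, up) \<leftarrow> terms (\<delta> u)])"

definition rprod :: "('k::field, 'h::{ring,monoid_mult}) quasi_hopf \<Rightarrow> ('k, 'h, 'a::ab_group_add) bimodule_alg \<Rightarrow>
    ('k \<Rightarrow> 'u::{ring,monoid_mult} \<Rightarrow> 'u) \<Rightarrow> ('u \<Rightarrow> ('h \<times> 'u \<times> 'h \<Rightarrow>\<^sub>0 'k) set) \<Rightarrow>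
    ('h \<times> 'h \<times> 'u \<times> 'h \<times> 'h \<Rightarrow>\<^sub>0 'k) set \<Rightarrow> 'u \<times> 'a \<Rightarrow> 'u \<times> 'a \<Rightarrow> ('u \<times> 'a) list" where
  "rprod H A s \<delta> \<Psi> = (\<lambda>(u, p) (u', p').
     [(u * u0 * w3,
       bmult A (ract A (lact A (w2 * antipode_inv H um) p) (up * w4))
               (ract A (lact A w1 p') w5)).
      (w1, w2, w3, w4, w5) \<leftarrow> terms (Omega' H s \<Psi>),
      (um, u0, up) \<leftarrow> terms (\<delta> u')])"

abbreviation "AU A s \<equiv> vrel (bscale A) \<boxtimes> vrel s"
abbreviation "UA s A \<equiv> vrel s \<boxtimes> vrel (bscale A)"

definition lcross :: "('k::field, 'h::{ring,monoid_mult}) quasi_hopf \<Rightarrow> ('k, 'h, 'a::ab_group_add) bimodule_alg \<Rightarrow>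
    ('k \<Rightarrow> 'u::{ring,monoid_mult} \<Rightarrow> 'u) \<Rightarrow> ('u \<Rightarrow> ('h \<times> 'u \<times> 'h \<Rightarrow>\<^sub>0 'k) set) \<Rightarrow>
    ('h \<times> 'h \<times> 'u \<times> 'h \<times> 'h \<Rightarrow>\<^sub>0 'k) set \<Rightarrow> ('k, ('a \<times> 'u \<Rightarrow>\<^sub>0 'k) set) module" where
  "lcross H A s \<delta> \<Psi> =
     tspace (AU A s)
       (\<lambda>t t'. tens (AU A s) [z. x \<leftarrow> terms t, y \<leftarrow> terms t', z \<leftarrow> lprod H A s \<delta> \<Psi> x y])
       (tens (AU A s) [(bunit A, 1)])"

definition rcross :: "('k::field, 'h::{ring,monoid_mult}) quasi_hopf \<Rightarrow> ('k, 'h, 'a::ab_group_add) bimodule_alg \<Rightarrow>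
    ('k \<Rightarrow> 'u::{ring,monoid_mult} \<Rightarrow> 'u) \<Rightarrow> ('u \<Rightarrow> ('h \<times> 'u \<times> 'h \<Rightarrow>\<^sub>0 'k) set) \<Rightarrow>
    ('h \<times> 'h \<times> 'u \<times> 'h \<times> 'h \<Rightarrow>\<^sub>0 'k) set \<Rightarrow> ('k, ('u \<times> 'a \<Rightarrow>\<^sub>0 'k) set) module" where
  "rcross H A s \<delta> \<Psi> =
     tspace (UA s A)
       (\<lambda>t t'. tens (UA s A) [z. x \<leftarrow> terms t, y \<leftarrow> terms t', z \<leftarrow> rprod H A s \<delta> \<Psi> x y])
       (tens (UA s A) [(1, bunit A)])"

definition lincl :: "('k::field, 'h, 'a::ab_group_add) bimodule_alg \<Rightarrow>
    ('k \<Rightarrow> 'u::{ring,monoid_mult} \<Rightarrow> 'u) \<Rightarrow> 'u \<Rightarrow> ('a \<times> 'u \<Rightarrow>\<^sub>0 'k) set" where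
  "lincl A s u = tens (AU A s) [(bunit A, u)]"

definition rincl :: "('k::field, 'h, 'a::ab_group_add) bimodule_alg \<Rightarrow>
    ('k \<Rightarrow> 'u::{ring,monoid_mult} \<Rightarrow> 'u) \<Rightarrow> 'u \<Rightarrow> ('u \<times> 'a \<Rightarrow>\<^sub>0 'k) set" where
  "rincl A s u = tens (UA s A) [(u, bunit A)]"


section \<open>Comodule and bicomodule algebras\<close>

abbreviation "UH H s \<equiv> vrel s \<boxtimes> H1 H"
abbreviation "UHH H s \<equiv> vrel s \<boxtimes> H1 H \<boxtimes> H1 H"
abbreviation "UHHH H s \<equiv> vrel s \<boxtimes> H1 H \<boxtimes> H1 H \<boxtimes> H1 H"
abbreviation "HU H s \<equiv> H1 H \<boxtimes> vrel s"
abbreviation "HHU H s \<equiv> H1 H \<boxtimes> H1 H \<boxtimes> vrel s"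
abbreviation "HHHU H s \<equiv> H1 H \<boxtimes> H1 H \<boxtimes> H1 H \<boxtimes> vrel s"
abbreviation "HHUH H s \<equiv> H1 H \<boxtimes> H1 H \<boxtimes> vrel s \<boxtimes> H1 H"
abbreviation "HUHH H s \<equiv> H1 H \<boxtimes> vrel s \<boxtimes> H1 H \<boxtimes> H1 H"

locale right_comodule_algebra =
  fixes H :: "('k::field, 'h::{ring,monoid_mult}, 'm) quasi_bialg_scheme"
    and s :: "'k \<Rightarrow> 'u::{ring,monoid_mult} \<Rightarrow> 'u"
    and \<rho> :: "'u \<Rightarrow> ('u \<times> 'h \<Rightarrow>\<^sub>0 'k) set"
    and \<Phi> :: "('u \<times> 'h \<times> 'h \<Rightarrow>\<^sub>0 'k) set"
  assumes algebra: "k_algebra (alg_of s)"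
    and coact_hom: "\<rho> \<in> alg_hom (alg_of s) (talg (UH H s))"
    and phi_unit: "\<Phi> \<in> Units (talg (UHH H s))"
    and coact_coassoc:
      "\<Phi> \<otimes>\<^bsub>talg (UHH H s)\<^esub>
       tens (UHH H s) [(w, b, a). (v, a) \<leftarrow> terms (\<rho> u), (w, b) \<leftarrow> terms (\<rho> v)] =
       tens (UHH H s) [(v, a1, a2). (v, a) \<leftarrow> terms (\<rho> u), (a1, a2) \<leftarrow> terms (comul H a)]
       \<otimes>\<^bsub>talg (UHH H s)\<^esub> \<Phi>"
    and phi_pentagon:
      "tens (UHHH H s) [(1, x, y, z). (x, y, z) \<leftarrow> terms (reassoc H)]
       \<otimes>\<^bsub>talg (UHHH H s)\<^esub>
       tens (UHHH H s) [(v, a1, a2, b). (v, a, b) \<leftarrow> terms \<Phi>, (a1, a2) \<leftarrow> terms (comul H a)]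
       \<otimes>\<^bsub>talg (UHHH H s)\<^esub>
       tens (UHHH H s) [(v, a, b, 1). (v, a, b) \<leftarrow> terms \<Phi>] =
       tens (UHHH H s) [(v, a, b1, b2). (v, a, b) \<leftarrow> terms \<Phi>, (b1, b2) \<leftarrow> terms (comul H b)]
       \<otimes>\<^bsub>talg (UHHH H s)\<^esub>
       tens (UHHH H s) [(w, c, a, b). (v, a, b) \<leftarrow> terms \<Phi>, (w, c) \<leftarrow> terms (\<rho> v)]"
    and coact_counit: "(\<Sum>(v, a)\<leftarrow>terms (\<rho> u). s (counit H a) v) = u"
    and phi_counit_inner:
      "tens (UH H s) [(s (counit H a) v, b). (v, a, b) \<leftarrow> terms \<Phi>] = tens (UH H s) [(1, 1)]"
    and phi_counit_outer:
      "tens (UH H s) [(s (counit H b) v, a). (v, a, b) \<leftarrow> terms \<Phi>] = tens (UH H s) [(1, 1)]"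

locale left_comodule_algebra =
  fixes H :: "('k::field, 'h::{ring,monoid_mult}, 'm) quasi_bialg_scheme"
    and s :: "'k \<Rightarrow> 'u::{ring,monoid_mult} \<Rightarrow> 'u"
    and lam :: "'u \<Rightarrow> ('h \<times> 'u \<Rightarrow>\<^sub>0 'k) set"
    and \<Phi> :: "('h \<times> 'h \<times> 'u \<Rightarrow>\<^sub>0 'k) set"
  assumes algebra: "k_algebra (alg_of s)"
    and coact_hom: "lam \<in> alg_hom (alg_of s) (talg (HU H s))"
    and phi_unit: "\<Phi> \<in> Units (talg (HHU H s))"
    and coact_coassoc:
      "tens (HHU H s) [(a, b, w). (a, v) \<leftarrow> terms (lam u), (b, w) \<leftarrow> terms (lam v)]
       \<otimes>\<^bsub>talg (HHU H s)\<^esub> \<Phi> =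
       \<Phi> \<otimes>\<^bsub>talg (HHU H s)\<^esub>
       tens (HHU H s) [(a1, a2, v). (a, v) \<leftarrow> terms (lam u), (a1, a2) \<leftarrow> terms (comul H a)]"
    and phi_pentagon:
      "tens (HHHU H s) [(1, a, b, v). (a, b, v) \<leftarrow> terms \<Phi>]
       \<otimes>\<^bsub>talg (HHHU H s)\<^esub>
       tens (HHHU H s) [(a, b1, b2, v). (a, b, v) \<leftarrow> terms \<Phi>, (b1, b2) \<leftarrow> terms (comul H b)]
       \<otimes>\<^bsub>talg (HHHU H s)\<^esub>
       tens (HHHU H s) [(x, y, z, 1). (x, y, z) \<leftarrow> terms (reassoc H)] =
       tens (HHHU H s) [(a, b, c, w). (a, b, v) \<leftarrow> terms \<Phi>, (c, w) \<leftarrow> terms (lam v)]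
       \<otimes>\<^bsub>talg (HHHU H s)\<^esub>
       tens (HHHU H s) [(a1, a2, b, v). (a, b, v) \<leftarrow> terms \<Phi>, (a1, a2) \<leftarrow> terms (comul H a)]"
    and coact_counit: "(\<Sum>(a, v)\<leftarrow>terms (lam u). s (counit H a) v) = u"
    and phi_counit_inner:
      "tens (HU H s) [(a, s (counit H b) v). (a, b, v) \<leftarrow> terms \<Phi>] = tens (HU H s) [(1, 1)]"
    and phi_counit_outer:
      "tens (HU H s) [(b, s (counit H a) v). (a, b, v) \<leftarrow> terms \<Phi>] = tens (HU H s) [(1, 1)]"

locale bicomodule_algebra =
  left: left_comodule_algebra H s lam \<Phi>l + right: right_comodule_algebra H s \<rho> \<Phi>r
  for H :: "('k::field, 'h::{ring,monoid_mult}, 'm) quasi_bialg_scheme"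
    and s :: "'k \<Rightarrow> 'u::{ring,monoid_mult} \<Rightarrow> 'u"
    and lam :: "'u \<Rightarrow> ('h \<times> 'u \<Rightarrow>\<^sub>0 'k) set"
    and \<rho> :: "'u \<Rightarrow> ('u \<times> 'h \<Rightarrow>\<^sub>0 'k) set"
    and \<Phi>l :: "('h \<times> 'h \<times> 'u \<Rightarrow>\<^sub>0 'k) set"
    and \<Phi>r :: "('u \<times> 'h \<times> 'h \<Rightarrow>\<^sub>0 'k) set"
    and \<Phi>lr :: "('h \<times> 'u \<times> 'h \<Rightarrow>\<^sub>0 'k) set" +
  assumes philr_unit: "\<Phi>lr \<in> Units (talg (HUH H s))"
    and bicoassoc:
      "\<Phi>lr \<otimes>\<^bsub>talg (HUH H s)\<^esub>
       tens (HUH H s) [(a, w, b). (v, b) \<leftarrow> terms (\<rho> u), (a, w) \<leftarrow> terms (lam v)] =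
       tens (HUH H s) [(a, w, b). (a, v) \<leftarrow> terms (lam u), (w, b) \<leftarrow> terms (\<rho> v)]
       \<otimes>\<^bsub>talg (HUH H s)\<^esub> \<Phi>lr"
    and philr_pentagon_left:
      "tens (HHUH H s) [(1, a, v, b). (a, v, b) \<leftarrow> terms \<Phi>lr]
       \<otimes>\<^bsub>talg (HHUH H s)\<^esub>
       tens (HHUH H s) [(a, c, w, b). (a, v, b) \<leftarrow> terms \<Phi>lr, (c, w) \<leftarrow> terms (lam v)]
       \<otimes>\<^bsub>talg (HHUH H s)\<^esub>
       tens (HHUH H s) [(a, b, v, 1). (a, b, v) \<leftarrow> terms \<Phi>l] =
       tens (HHUH H s) [(a, b, w, c). (a, b, v) \<leftarrow> terms \<Phi>l, (w, c) \<leftarrow> terms (\<rho> v)]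
       \<otimes>\<^bsub>talg (HHUH H s)\<^esub>
       tens (HHUH H s) [(a1, a2, v, b). (a, v, b) \<leftarrow> terms \<Phi>lr, (a1, a2) \<leftarrow> terms (comul H a)]"
    and philr_pentagon_right:
      "tens (HUHH H s) [(1, v, a, b). (v, a, b) \<leftarrow> terms \<Phi>r]
       \<otimes>\<^bsub>talg (HUHH H s)\<^esub>
       tens (HUHH H s) [(a, w, c, b). (a, v, b) \<leftarrow> terms \<Phi>lr, (w, c) \<leftarrow> terms (\<rho> v)]
       \<otimes>\<^bsub>talg (HUHH H s)\<^esub>
       tens (HUHH H s) [(a, v, b, 1). (a, v, b) \<leftarrow> terms \<Phi>lr] =
       tens (HUHH H s) [(a, v, b1, b2). (a, v, b) \<leftarrow> terms \<Phi>lr, (b1, b2) \<leftarrow> terms (comul H b)]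
       \<otimes>\<^bsub>talg (HUHH H s)\<^esub>
       tens (HUHH H s) [(c, w, a, b). (v, a, b) \<leftarrow> terms \<Phi>r, (c, w) \<leftarrow> terms (lam v)]"

definition delta_l :: "('k::field, 'h::{ring,monoid_mult}, 'm) quasi_bialg_scheme \<Rightarrow>
    ('k \<Rightarrow> 'u::{ring,monoid_mult} \<Rightarrow> 'u) \<Rightarrow> ('u \<Rightarrow> ('h \<times> 'u \<Rightarrow>\<^sub>0 'k) set) \<Rightarrow>
    ('u \<Rightarrow> ('u \<times> 'h \<Rightarrow>\<^sub>0 'k) set) \<Rightarrow> 'u \<Rightarrow> ('h \<times> 'u \<times> 'h \<Rightarrow>\<^sub>0 'k) set" where
  "delta_l H s lam \<rho> u =
     tens (HUH H s) [(a, w, b). (v, b) \<leftarrow> terms (\<rho> u), (a, w) \<leftarrow> terms (lam v)]"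

definition delta_r :: "('k::field, 'h::{ring,monoid_mult}, 'm) quasi_bialg_scheme \<Rightarrow>
    ('k \<Rightarrow> 'u::{ring,monoid_mult} \<Rightarrow> 'u) \<Rightarrow> ('u \<Rightarrow> ('h \<times> 'u \<Rightarrow>\<^sub>0 'k) set) \<Rightarrow>
    ('u \<Rightarrow> ('u \<times> 'h \<Rightarrow>\<^sub>0 'k) set) \<Rightarrow> 'u \<Rightarrow> ('h \<times> 'u \<times> 'h \<Rightarrow>\<^sub>0 'k) set" where
  "delta_r H s lam \<rho> u =
     tens (HUH H s) [(a, w, b). (a, v) \<leftarrow> terms (lam u), (w, b) \<leftarrow> terms (\<rho> v)]"

definition Psi_l :: "('k::field, 'h::{ring,monoid_mult}, 'm) quasi_bialg_scheme \<Rightarrow>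
    ('k \<Rightarrow> 'u::{ring,monoid_mult} \<Rightarrow> 'u) \<Rightarrow> ('u \<Rightarrow> ('h \<times> 'u \<Rightarrow>\<^sub>0 'k) set) \<Rightarrow>
    ('h \<times> 'h \<times> 'u \<Rightarrow>\<^sub>0 'k) set \<Rightarrow> ('u \<times> 'h \<times> 'h \<Rightarrow>\<^sub>0 'k) set \<Rightarrow> ('h \<times> 'u \<times> 'h \<Rightarrow>\<^sub>0 'k) set \<Rightarrow>
    ('h \<times> 'h \<times> 'u \<times> 'h \<times> 'h \<Rightarrow>\<^sub>0 'k) set" where
  "Psi_l H s lam \<Phi>l \<Phi>r \<Phi>lr =
     tens (HHUHH H s) [(a, c, w, b, d).
       (a, v, b, d) \<leftarrow> terms
         (tens (HUHH H s) [(a, v, b, 1). (a, v, b) \<leftarrow> terms \<Phi>lr]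
          \<otimes>\<^bsub>talg (HUHH H s)\<^esub>
          tens (HUHH H s) [(c, w, a, b). (v, a, b) \<leftarrow> terms (inv\<^bsub>talg (UHH H s)\<^esub> \<Phi>r),
            (c, w) \<leftarrow> terms (lam v)]),
       (c, w) \<leftarrow> terms (lam v)]
     \<otimes>\<^bsub>talg (HHUHH H s)\<^esub>
     tens (HHUHH H s) [(a, b, v, 1, 1). (a, b, v) \<leftarrow> terms \<Phi>l]"

definition Psi_r :: "('k::field, 'h::{ring,monoid_mult}, 'm) quasi_bialg_scheme \<Rightarrow>
    ('k \<Rightarrow> 'u::{ring,monoid_mult} \<Rightarrow> 'u) \<Rightarrow> ('u \<Rightarrow> ('u \<times> 'h \<Rightarrow>\<^sub>0 'k) set) \<Rightarrow>
    ('h \<times> 'h \<times> 'u \<Rightarrow>\<^sub>0 'k) set \<Rightarrow> ('u \<times> 'h \<times> 'h \<Rightarrow>\<^sub>0 'k) set \<Rightarrow> ('h \<times> 'u \<times> 'h \<Rightarrow>\<^sub>0 'k) set \<Rightarrow>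
    ('h \<times> 'h \<times> 'u \<times> 'h \<times> 'h \<Rightarrow>\<^sub>0 'k) set" where
  "Psi_r H s \<rho> \<Phi>l \<Phi>r \<Phi>lr =
     tens (HHUHH H s) [(a, b, w, c, d).
       (a, b, v, d) \<leftarrow> terms
         (tens (HHUH H s) [(1, a, v, b). (a, v, b) \<leftarrow> terms (inv\<^bsub>talg (HUH H s)\<^esub> \<Phi>lr)]
          \<otimes>\<^bsub>talg (HHUH H s)\<^esub>
          tens (HHUH H s) [(a, b, w, c). (a, b, v) \<leftarrow> terms \<Phi>l, (w, c) \<leftarrow> terms (\<rho> v)]),
       (w, c) \<leftarrow> terms (\<rho> v)]
     \<otimes>\<^bsub>talg (HHUHH H s)\<^esub>
     tens (HHUHH H s) [(1, 1, v, a, b). (v, a, b) \<leftarrow> terms (inv\<^bsub>talg (UHH H s)\<^esub> \<Phi>r)]"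

end

theory Submission
  imports Defs
begin

text \<open>
  Two sums of pure tensors are equal if and only if every multilinear form takes the same value on
  both, because linear functionals separate the elements of a quotient of a vector space. All
  identities between tensors are therefore read off from multilinear forms, where the summation of
  Sweedler's notation is an ordinary finite sum whose order can be changed freely.

  The families \<open>h \<mapsto> \<Delta>(S(h))\<close> with \<open>\<Delta>(\<alpha>), \<Delta>(\<beta>)\<close> and \<open>h \<mapsto> (S \<otimes> S)\<Delta>\<^sup>c\<^sup>o\<^sup>p(h)\<close> with
  \<open>\<gamma>\<close> and its counterpart \<open>\<delta>\<close> both satisfy the axioms of an antipode with respect to \<open>\<Delta>\<close>, and
  any two such families are intertwined by a unique element. This is the Drinfeld twist \<open>f\<close>;
  the uniqueness also gives its compatibility with \<open>\<Phi>\<close>.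

  An \<open>H\<close>-bimodule algebra is a module algebra of \<open>H \<otimes> H\<^sup>o\<^sup>p\<close>. By the properties of \<open>f\<close>, a two-sided coaction
  turns into a one-sided coaction \<open>u \<mapsto> (u\<^sub>(\<^sub>-\<^sub>1\<^sub>) \<otimes> S\<^sup>-\<^sup>1(u\<^sub>(\<^sub>1\<^sub>))) \<otimes> u\<^sub>(\<^sub>0\<^sub>)\<close> of \<open>H \<otimes> H\<^sup>o\<^sup>p\<close> which is coassociative
  up to \<open>\<Omega>\<close>, and the pentagon of \<open>\<Psi>\<close> turns into the one that makes the associated smash
  product associative. The other crossed product is the same construction for the opposite multiplications.

  The pentagon of \<open>\<Psi>\<^sub>l\<close> is a composition of pentagons and naturality squares of a
  bicomodule algebra. Exchanging left and right and inverting all associators is a symmetry of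
  the axioms which exchanges \<open>(\<delta>\<^sub>l, \<Psi>\<^sub>l)\<close> and \<open>(\<delta>\<^sub>r, \<Psi>\<^sub>r)\<close>.
\<close>

section \<open>Multilinear forms\<close>

text \<open>Tensors are cosets and \<open>terms\<close> chooses an unspecified list for each of
  them, so no argument may depend on the list. Forms provide this independence, but cancelling an
  inverse tensor under sums is clumsy. Cancellations of associators are therefore carried out in
  abstract monoids and instantiated with tensor algebras. The statement gives f by a closed formula
  and uses f^{-1}, so invertibility has to be proved along with the identities. Read as the
  canonical map between two duals, the formula has a twin that runs in the opposite direction and
  turns out to be the inverse. Each property of f is then a comparison of two elements that
  intertwine the same families and agree on evaluation. The laborious input is the pair of zigzag
  identities of the reversed family: evaluation and coevaluation of a product of two objects are
  nested, which forces reassociations of six tensor factors. The counit rules for the outer legs of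
  \<Phi> and for the mixed associator of a bicomodule algebra are consequences of the pentagons,
  obtained by cancellation.\<close>

instance prod :: (monoid_mult, monoid_mult) monoid_mult
  by standard (auto simp: times_prod_def one_prod_def mult.assoc)

lemma times_Pair [simp]: "(a, b) * (c, d) = (a * c, b * d)"
  by (simp add: times_prod_def)

lemma fst_times [simp]: "fst (x * y) = fst x * fst y" and snd_times [simp]: "snd (x * y) = snd x * snd y"
  by (simp_all add: times_prod_def)

lemma fst_one [simp]: "fst 1 = 1" and snd_one [simp]: "snd 1 = 1"
  by (simp_all add: one_prod_def)

text \<open>The value at \<open>formal_sum xs\<close> of the linear functional that extends F from
  the generators to the free vector space.\<close>

definition sm :: "'x list \<Rightarrow> ('x \<Rightarrow> 'k::field) \<Rightarrow> 'k" where
  "sm xs F = (\<Sum>x\<leftarrow>xs. F x)"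

lemma sm_Nil [simp]: "sm [] F = 0"
  and sm_Cons [simp]: "sm (x # xs) F = F x + sm xs F"
  and sm_append [simp]: "sm (xs @ ys) F = sm xs F + sm ys F"
  and sm_map [simp]: "sm (map g zs) F = sm zs (\<lambda>x. F (g x))"
  by (simp_all add: sm_def o_def)

lemma sm_concat [simp]: "sm (concat xss) F = sm xss (\<lambda>xs. sm xs F)"
  by (induction xss) auto

lemma sm_zero [simp]: "sm xs (\<lambda>x. 0) = 0"
  by (induction xs) auto

lemma sm_add: "sm xs (\<lambda>x. F x + G x) = sm xs F + sm xs G"
  by (induction xs) (auto simp: algebra_simps)

lemma sm_diff: "sm xs (\<lambda>x. F x - G x) = sm xs F - sm xs G"
  by (induction xs) (auto simp: algebra_simps)

lemma sm_scale: "sm xs (\<lambda>x. c * F x) = c * sm xs F"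
  by (induction xs) (auto simp: algebra_simps)

lemma sm_scale_right: "sm xs (\<lambda>x. F x * c) = sm xs F * c"
  by (induction xs) (auto simp: algebra_simps)

lemma sm_swap: "sm xs (\<lambda>x. sm ys (\<lambda>y. F x y)) = sm ys (\<lambda>y. sm xs (\<lambda>x. F x y))"
  by (induction xs) (auto simp: sm_add)

lemma sm_cong: "(\<And>a. F a = G a) \<Longrightarrow> sm L F = sm L G"
  by presburger

text \<open>
  The rules \<open>sm_perm\<close> below prove that two nested sums agree up to the order of summation. Some summation
  ranges depend on outer summation variables, hence a whole block of sums is moved at once.
\<close>

lemma sm_bring1: "(\<And>a. F a = sm M1 (\<lambda>m1. G m1 a)) \<Longrightarrow>
    sm L F = sm M1 (\<lambda>m1. sm L (\<lambda>a. G m1 a))"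
  by (subst sm_cong[where F = F], assumption) (simp add: sm_swap[of L])

lemma sm_bring2: "(\<And>a. F a = sm M1 (\<lambda>m1. sm (M2 m1) (\<lambda>m2. G m1 m2 a))) \<Longrightarrow>
    sm L F = sm M1 (\<lambda>m1. sm (M2 m1) (\<lambda>m2. sm L (\<lambda>a. G m1 m2 a)))"
  by (subst sm_cong[where F = F], assumption) (simp add: sm_swap[of L])

lemma sm_bring3: "(\<And>a. F a = sm M1 (\<lambda>m1. sm (M2 m1) (\<lambda>m2. sm (M3 m1 m2) (\<lambda>m3. G m1 m2 m3 a)))) \<Longrightarrow>
    sm L F = sm M1 (\<lambda>m1. sm (M2 m1) (\<lambda>m2. sm (M3 m1 m2) (\<lambda>m3. sm L (\<lambda>a. G m1 m2 m3 a))))"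
  by (subst sm_cong[where F = F], assumption) (simp add: sm_swap[of L])

lemma sm_bring4: "(\<And>a. F a = sm M1 (\<lambda>m1. sm (M2 m1) (\<lambda>m2. sm (M3 m1 m2) (\<lambda>m3. sm (M4 m1 m2 m3) (\<lambda>m4. G m1 m2 m3
  m4 a))))) \<Longrightarrow>
    sm L F = sm M1 (\<lambda>m1. sm (M2 m1) (\<lambda>m2. sm (M3 m1 m2) (\<lambda>m3. sm (M4 m1 m2 m3) (\<lambda>m4. sm L (\<lambda>a. G m1 m2 m3 m4 a)))))"
  by (subst sm_cong[where F = F], assumption) (simp add: sm_swap[of L])

lemma sm_bring5: "(\<And>a. F a = sm M1 (\<lambda>m1. sm (M2 m1) (\<lambda>m2. sm (M3 m1 m2) (\<lambda>m3. sm (M4 m1 m2 m3) (\<lambda>m4. sm (M5 m1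
  m2 m3 m4) (\<lambda>m5. G m1 m2 m3 m4 m5 a)))))) \<Longrightarrow>
    sm L F = sm M1 (\<lambda>m1. sm (M2 m1) (\<lambda>m2. sm (M3 m1 m2) (\<lambda>m3. sm (M4 m1 m2 m3) (\<lambda>m4. sm (M5 m1 m2 m3 m4) (\<lambda>m5.
      sm L (\<lambda>a. G m1 m2 m3 m4 m5 a))))))"
  by (subst sm_cong[where F = F], assumption) (simp add: sm_swap[of L])

lemma sm_bring6: "(\<And>a. F a = sm M1 (\<lambda>m1. sm (M2 m1) (\<lambda>m2. sm (M3 m1 m2) (\<lambda>m3. sm (M4 m1 m2 m3) (\<lambda>m4. sm (M5 m1
  m2 m3 m4) (\<lambda>m5. sm (M6 m1 m2 m3 m4 m5) (\<lambda>m6. G m1 m2 m3 m4 m5 m6 a))))))) \<Longrightarrow>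
    sm L F = sm M1 (\<lambda>m1. sm (M2 m1) (\<lambda>m2. sm (M3 m1 m2) (\<lambda>m3. sm (M4 m1 m2 m3) (\<lambda>m4. sm (M5 m1 m2 m3 m4) (\<lambda>m5.
      sm (M6 m1 m2 m3 m4 m5) (\<lambda>m6. sm L (\<lambda>a. G m1 m2 m3 m4 m5 m6 a)))))))"
  by (subst sm_cong[where F = F], assumption) (simp add: sm_swap[of L])

lemma sm_bring7: "(\<And>a. F a = sm M1 (\<lambda>m1. sm (M2 m1) (\<lambda>m2. sm (M3 m1 m2) (\<lambda>m3. sm (M4 m1 m2 m3) (\<lambda>m4. sm (M5 m1
  m2 m3 m4) (\<lambda>m5. sm (M6 m1 m2 m3 m4 m5) (\<lambda>m6. sm (M7 m1 m2 m3 m4 m5 m6) (\<lambda>m7. G m1 m2 m3 m4 m5 m6 m7 a)))))))) \<Longrightarrow>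
    sm L F = sm M1 (\<lambda>m1. sm (M2 m1) (\<lambda>m2. sm (M3 m1 m2) (\<lambda>m3. sm (M4 m1 m2 m3) (\<lambda>m4. sm (M5 m1 m2 m3 m4) (\<lambda>m5.
      sm (M6 m1 m2 m3 m4 m5) (\<lambda>m6. sm (M7 m1 m2 m3 m4 m5 m6) (\<lambda>m7. sm L (\<lambda>a. G m1 m2 m3 m4 m5 m6 m7 a))))))))"
  by (subst sm_cong[where F = F], assumption) (simp add: sm_swap[of L])

lemma sm_bring8: "(\<And>a. F a = sm M1 (\<lambda>m1. sm (M2 m1) (\<lambda>m2. sm (M3 m1 m2) (\<lambda>m3. sm (M4 m1 m2 m3) (\<lambda>m4. sm (M5 m1
  m2 m3 m4) (\<lambda>m5. sm (M6 m1 m2 m3 m4 m5) (\<lambda>m6. sm (M7 m1 m2 m3 m4 m5 m6) (\<lambda>m7. sm (M8 m1 m2 m3 m4 m5 m6 m7)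
    (\<lambda>m8. G m1 m2 m3 m4 m5 m6 m7 m8 a))))))))) \<Longrightarrow>
    sm L F = sm M1 (\<lambda>m1. sm (M2 m1) (\<lambda>m2. sm (M3 m1 m2) (\<lambda>m3. sm (M4 m1 m2 m3) (\<lambda>m4. sm (M5 m1 m2 m3 m4) (\<lambda>m5.
      sm (M6 m1 m2 m3 m4 m5) (\<lambda>m6. sm (M7 m1 m2 m3 m4 m5 m6) (\<lambda>m7. sm (M8 m1 m2 m3 m4 m5 m6 m7) (\<lambda>m8. sm L (\<lambda>a.
        G m1 m2 m3 m4 m5 m6 m7 m8 a)))))))))"
  by (subst sm_cong[where F = F], assumption) (simp add: sm_swap[of L])

lemma sm_bring9: "(\<And>a. F a = sm M1 (\<lambda>m1. sm (M2 m1) (\<lambda>m2. sm (M3 m1 m2) (\<lambda>m3. sm (M4 m1 m2 m3) (\<lambda>m4. sm (M5 m1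
  m2 m3 m4) (\<lambda>m5. sm (M6 m1 m2 m3 m4 m5) (\<lambda>m6. sm (M7 m1 m2 m3 m4 m5 m6) (\<lambda>m7. sm (M8 m1 m2 m3 m4 m5 m6 m7)
    (\<lambda>m8. sm (M9 m1 m2 m3 m4 m5 m6 m7 m8) (\<lambda>m9. G m1 m2 m3 m4 m5 m6 m7 m8 m9 a)))))))))) \<Longrightarrow>
    sm L F = sm M1 (\<lambda>m1. sm (M2 m1) (\<lambda>m2. sm (M3 m1 m2) (\<lambda>m3. sm (M4 m1 m2 m3) (\<lambda>m4. sm (M5 m1 m2 m3 m4) (\<lambda>m5.
      sm (M6 m1 m2 m3 m4 m5) (\<lambda>m6. sm (M7 m1 m2 m3 m4 m5 m6) (\<lambda>m7. sm (M8 m1 m2 m3 m4 m5 m6 m7) (\<lambda>m8. sm (M9 m1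
        m2 m3 m4 m5 m6 m7 m8) (\<lambda>m9. sm L (\<lambda>a. G m1 m2 m3 m4 m5 m6 m7 m8 m9 a))))))))))"
  by (subst sm_cong[where F = F], assumption) (simp add: sm_swap[of L])

lemma sm_bring10: "(\<And>a. F a = sm M1 (\<lambda>m1. sm (M2 m1) (\<lambda>m2. sm (M3 m1 m2) (\<lambda>m3. sm (M4 m1 m2 m3) (\<lambda>m4. sm (M5 m1
  m2 m3 m4) (\<lambda>m5. sm (M6 m1 m2 m3 m4 m5) (\<lambda>m6. sm (M7 m1 m2 m3 m4 m5 m6) (\<lambda>m7. sm (M8 m1 m2 m3 m4 m5 m6 m7)
    (\<lambda>m8. sm (M9 m1 m2 m3 m4 m5 m6 m7 m8) (\<lambda>m9. sm (M10 m1 m2 m3 m4 m5 m6 m7 m8 m9) (\<lambda>m10. G m1 m2 m3 m4 m5 m6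
      m7 m8 m9 m10 a))))))))))) \<Longrightarrow>
    sm L F = sm M1 (\<lambda>m1. sm (M2 m1) (\<lambda>m2. sm (M3 m1 m2) (\<lambda>m3. sm (M4 m1 m2 m3) (\<lambda>m4. sm (M5 m1 m2 m3 m4) (\<lambda>m5.
      sm (M6 m1 m2 m3 m4 m5) (\<lambda>m6. sm (M7 m1 m2 m3 m4 m5 m6) (\<lambda>m7. sm (M8 m1 m2 m3 m4 m5 m6 m7) (\<lambda>m8. sm (M9 m1
        m2 m3 m4 m5 m6 m7 m8) (\<lambda>m9. sm (M10 m1 m2 m3 m4 m5 m6 m7 m8 m9) (\<lambda>m10. sm L (\<lambda>a. G m1 m2 m3 m4 m5 m6 m7
          m8 m9 m10 a)))))))))))"
  by (subst sm_cong[where F = F], assumption) (simp add: sm_swap[of L])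

lemma sm_bring11: "(\<And>a. F a = sm M1 (\<lambda>m1. sm (M2 m1) (\<lambda>m2. sm (M3 m1 m2) (\<lambda>m3. sm (M4 m1 m2 m3) (\<lambda>m4. sm (M5 m1
  m2 m3 m4) (\<lambda>m5. sm (M6 m1 m2 m3 m4 m5) (\<lambda>m6. sm (M7 m1 m2 m3 m4 m5 m6) (\<lambda>m7. sm (M8 m1 m2 m3 m4 m5 m6 m7)
    (\<lambda>m8. sm (M9 m1 m2 m3 m4 m5 m6 m7 m8) (\<lambda>m9. sm (M10 m1 m2 m3 m4 m5 m6 m7 m8 m9) (\<lambda>m10. sm (M11 m1 m2 m3 m4
      m5 m6 m7 m8 m9 m10) (\<lambda>m11. G m1 m2 m3 m4 m5 m6 m7 m8 m9 m10 m11 a)))))))))))) \<Longrightarrow>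
    sm L F = sm M1 (\<lambda>m1. sm (M2 m1) (\<lambda>m2. sm (M3 m1 m2) (\<lambda>m3. sm (M4 m1 m2 m3) (\<lambda>m4. sm (M5 m1 m2 m3 m4) (\<lambda>m5.
      sm (M6 m1 m2 m3 m4 m5) (\<lambda>m6. sm (M7 m1 m2 m3 m4 m5 m6) (\<lambda>m7. sm (M8 m1 m2 m3 m4 m5 m6 m7) (\<lambda>m8. sm (M9 m1
        m2 m3 m4 m5 m6 m7 m8) (\<lambda>m9. sm (M10 m1 m2 m3 m4 m5 m6 m7 m8 m9) (\<lambda>m10. sm (M11 m1 m2 m3 m4 m5 m6 m7 m8
          m9 m10) (\<lambda>m11. sm L (\<lambda>a. G m1 m2 m3 m4 m5 m6 m7 m8 m9 m10 m11 a))))))))))))"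
  by (subst sm_cong[where F = F], assumption) (simp add: sm_swap[of L])

lemma sm_bring12: "(\<And>a. F a = sm M1 (\<lambda>m1. sm (M2 m1) (\<lambda>m2. sm (M3 m1 m2) (\<lambda>m3. sm (M4 m1 m2 m3) (\<lambda>m4. sm (M5 m1
  m2 m3 m4) (\<lambda>m5. sm (M6 m1 m2 m3 m4 m5) (\<lambda>m6. sm (M7 m1 m2 m3 m4 m5 m6) (\<lambda>m7. sm (M8 m1 m2 m3 m4 m5 m6 m7)
    (\<lambda>m8. sm (M9 m1 m2 m3 m4 m5 m6 m7 m8) (\<lambda>m9. sm (M10 m1 m2 m3 m4 m5 m6 m7 m8 m9) (\<lambda>m10. sm (M11 m1 m2 m3 m4
      m5 m6 m7 m8 m9 m10) (\<lambda>m11. sm (M12 m1 m2 m3 m4 m5 m6 m7 m8 m9 m10 m11) (\<lambda>m12. G m1 m2 m3 m4 m5 m6 m7 m8 m9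
        m10 m11 m12 a))))))))))))) \<Longrightarrow>
    sm L F = sm M1 (\<lambda>m1. sm (M2 m1) (\<lambda>m2. sm (M3 m1 m2) (\<lambda>m3. sm (M4 m1 m2 m3) (\<lambda>m4. sm (M5 m1 m2 m3 m4) (\<lambda>m5.
      sm (M6 m1 m2 m3 m4 m5) (\<lambda>m6. sm (M7 m1 m2 m3 m4 m5 m6) (\<lambda>m7. sm (M8 m1 m2 m3 m4 m5 m6 m7) (\<lambda>m8. sm (M9 m1
        m2 m3 m4 m5 m6 m7 m8) (\<lambda>m9. sm (M10 m1 m2 m3 m4 m5 m6 m7 m8 m9) (\<lambda>m10. sm (M11 m1 m2 m3 m4 m5 m6 m7 m8
          m9 m10) (\<lambda>m11. sm (M12 m1 m2 m3 m4 m5 m6 m7 m8 m9 m10 m11) (\<lambda>m12. sm L (\<lambda>a. G m1 m2 m3 m4 m5 m6 m7 m8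
            m9 m10 m11 m12 a)))))))))))))"
  by (subst sm_cong[where F = F], assumption) (simp add: sm_swap[of L])

text \<open>Each of the rules after \<open>refl\<close> strips the outermost sum of the left side,
  which on the right side stands behind a block of further sums; \<open>sm_cong\<close> is the case
  of an empty block. The ranges in the block may depend on one another, but not on the stripped
  variable.\<close>

lemmas sm_perm = refl sm_cong sm_bring1 sm_bring2 sm_bring3 sm_bring4 sm_bring5 sm_bring6 sm_bring7 sm_bring8
  sm_bring9 sm_bring10 sm_bring11 sm_bring12

text \<open>For a law whose two sides agree with those of the goal up to the order of
  summation.\<close>

lemma eq_via: "A = B \<Longrightarrow> A' = A \<Longrightarrow> B = B' \<Longrightarrow> A' = B'"
  by simp

section \<open>Linearity in one variable\<close>

definition lin :: "('k::field \<Rightarrow> 'v::ab_group_add \<Rightarrow> 'v) \<Rightarrow> ('v \<Rightarrow> 'k) \<Rightarrow> bool" where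
  "lin s F \<longleftrightarrow> (\<forall>x y. F (x + y) = F x + F y) \<and> (\<forall>c x. F (s c x) = c * F x)"

text \<open>As in \<open>lin\<close>, additivity and homogeneity alone, without the vector space
  axioms that \<open>Vector_Spaces.linear\<close> carries, so that conditional rewriting has fewer
  premises to discharge.\<close>

definition lmap :: "('k::field \<Rightarrow> 'v::ab_group_add \<Rightarrow> 'v) \<Rightarrow> ('k \<Rightarrow> 'w::ab_group_add \<Rightarrow> 'w) \<Rightarrow>
    ('v \<Rightarrow> 'w) \<Rightarrow> bool" where
  "lmap s s' g \<longleftrightarrow> (\<forall>x y. g (x + y) = g x + g y) \<and> (\<forall>c x. g (s c x) = s' c (g x))"

lemma lin_add: "lin s F \<Longrightarrow> F (x + y) = F x + F y" and lin_scale: "lin s F \<Longrightarrow> F (s c x) = c * F x"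
  by (auto simp: lin_def)

lemma lin_0: "lin s F \<Longrightarrow> F 0 = 0"
  using lin_add[of s F 0 0] by (metis add.right_neutral add_left_cancel)

lemma lin_sum_list: "lin s F \<Longrightarrow> F (\<Sum>x\<leftarrow>xs. g x) = sm xs (\<lambda>x. F (g x))"
  by (induction xs) (auto simp: lin_add lin_0)

lemma lin_comp: "lin s' F \<Longrightarrow> lmap s s' g \<Longrightarrow> lin s (\<lambda>x. F (g x))"
  by (auto simp: lin_def lmap_def)

lemma lmap_id [simp]: "lmap s s (\<lambda>x. x)"
  by (auto simp: lmap_def)

lemma lmap_comp: "lmap s' s'' f \<Longrightarrow> lmap s s' g \<Longrightarrow> lmap s s'' (\<lambda>x. f (g x))"
  by (auto simp: lmap_def)

lemma lin_sm [simp]: "(\<And>y. lin s (\<lambda>x. G x y)) \<Longrightarrow> lin s (\<lambda>x. sm ys (G x))"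
proof -
  assume G: "\<And>y. lin s (\<lambda>x. G x y)"
  have "G (x + y) = (\<lambda>z. G x z + G y z)" "G (s c x) = (\<lambda>z. c * G x z)" for x y c
    using lin_add[OF G] lin_scale[OF G] by auto
  then show ?thesis by (simp add: lin_def sm_add sm_scale)
qed

lemma lin_mult_left [simp]: "lin s F \<Longrightarrow> lin s (\<lambda>x. c * F x)"
  and lin_mult_right [simp]: "lin s F \<Longrightarrow> lin s (\<lambda>x. F x * c)"
  by (auto simp: lin_def algebra_simps)

text \<open>Curried sums with one variable per tensor factor. Linearity in a single factor becomes a
  premise about one bound variable, which the simplifier can discharge; \<open>smn_defs\<close>
  leads back to \<open>sm\<close> when sums have to be reordered.\<close>

definition sm2 :: "('a \<times> 'b) list \<Rightarrow> ('a \<Rightarrow> 'b \<Rightarrow> 'k::field) \<Rightarrow> 'k" where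
  "sm2 xs F = sm xs (\<lambda>p. F (fst p) (snd p))"

definition sm3 :: "('a \<times> 'b \<times> 'c) list \<Rightarrow> ('a \<Rightarrow> 'b \<Rightarrow> 'c \<Rightarrow> 'k::field) \<Rightarrow> 'k" where
  "sm3 xs F = sm xs (\<lambda>p. F (fst p) (fst (snd p)) (snd (snd p)))"

definition sm4 :: "('a \<times> 'b \<times> 'c \<times> 'd) list \<Rightarrow> ('a \<Rightarrow> 'b \<Rightarrow> 'c \<Rightarrow> 'd \<Rightarrow> 'k::field) \<Rightarrow> 'k" where
  "sm4 xs F = sm xs (\<lambda>p. F (fst p) (fst (snd p)) (fst (snd (snd p))) (snd (snd (snd p))))"

definition sm5 :: "('a \<times> 'b \<times> 'c \<times> 'd \<times> 'e) list \<Rightarrow> ('a \<Rightarrow> 'b \<Rightarrow> 'c \<Rightarrow> 'd \<Rightarrow> 'e \<Rightarrow> 'k::field) \<Rightarrow> 'k" where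
  "sm5 xs F = sm xs (\<lambda>p. F (fst p) (fst (snd p)) (fst (snd (snd p))) (fst (snd (snd (snd p)))) (snd (snd (snd
    (snd p)))))"

lemmas smn_defs = sm2_def sm3_def sm4_def sm5_def

lemma sm_uncurry:
  "sm xs2 F2 = sm2 xs2 (\<lambda>a b. F2 (a, b))" "sm xs3 F3 = sm3 xs3 (\<lambda>a b c. F3 (a, b, c))"
  "sm xs4 F4 = sm4 xs4 (\<lambda>a b c d. F4 (a, b, c, d))" "sm xs5 F5 = sm5 xs5 (\<lambda>a b c d e. F5 (a, b, c, d, e))"
  by (simp_all add: smn_defs)

lemma lin_smn [simp]:
  "(\<And>a b. lin s (\<lambda>x. G2 x a b)) \<Longrightarrow> lin s (\<lambda>x. sm2 xs2 (G2 x))"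
  "(\<And>a b c. lin s (\<lambda>x. G3 x a b c)) \<Longrightarrow> lin s (\<lambda>x. sm3 xs3 (G3 x))"
  "(\<And>a b c d. lin s (\<lambda>x. G4 x a b c d)) \<Longrightarrow> lin s (\<lambda>x. sm4 xs4 (G4 x))"
  "(\<And>a b c d e. lin s (\<lambda>x. G5 x a b c d e)) \<Longrightarrow> lin s (\<lambda>x. sm5 xs5 (G5 x))"
  unfolding smn_defs by (auto intro!: lin_sm)

lemma smn_scale:
  "sm2 xs2 (\<lambda>a b. c * F2 a b) = c * sm2 xs2 F2" "sm2 xs2 (\<lambda>a b. F2 a b * c) = sm2 xs2 F2 * c"
  "sm3 xs3 (\<lambda>x y z. c * F3 x y z) = c * sm3 xs3 F3" "sm3 xs3 (\<lambda>x y z. F3 x y z * c) = sm3 xs3 F3 * c"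
  "sm4 xs4 (\<lambda>x y z w. c * F4 x y z w) = c * sm4 xs4 F4" "sm5 xs5 (\<lambda>x y z w v. c * F5 x y z w v) = c * sm5 xs5 F5"
  unfolding smn_defs by (simp_all add: sm_scale sm_scale_right)

lemmas sm_pull = sm_scale sm_scale_right smn_scale

section \<open>Forms on a presented space\<close>

text \<open>These are the functions on generators that descend to the space presented by R. By
  \<open>resp_vrel\<close> and \<open>resp_trel\<close> they are the multilinear forms when R
  presents a tensor product of vector spaces.\<close>

definition resp :: "('x \<Rightarrow>\<^sub>0 'k::field) set \<Rightarrow> ('x \<Rightarrow> 'k) \<Rightarrow> bool" where
  "resp R F \<longleftrightarrow> (\<forall>r\<in>R. (\<Sum>x\<in>Poly_Mapping.keys r. Poly_Mapping.lookup r x * F x) = 0)"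

definition leval :: "('x \<Rightarrow> 'k) \<Rightarrow> ('x \<Rightarrow>\<^sub>0 'k::field) \<Rightarrow> 'k" where
  "leval F p = (\<Sum>x\<in>Poly_Mapping.keys p. Poly_Mapping.lookup p x * F x)"

lemma leval_superset:
  "finite S \<Longrightarrow> Poly_Mapping.keys p \<subseteq> S \<Longrightarrow> leval F p = (\<Sum>x\<in>S. Poly_Mapping.lookup p x * F x)"
  unfolding leval_def by (rule sum.mono_neutral_left) (auto simp: in_keys_iff)

lemma leval_add [simp]: "leval F (p + q) = leval F p + leval F q"
proof -
  let ?S = "Poly_Mapping.keys p \<union> Poly_Mapping.keys q"
  have "leval F r = (\<Sum>x\<in>?S. Poly_Mapping.lookup r x * F x)" if "r \<in> {p, q, p + q}" for r
    using that keys_add[of p q] by (intro leval_superset) auto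
  then show ?thesis
    by (simp add: lookup_add algebra_simps sum.distrib)
qed

lemma lookup_fscale [simp]: "Poly_Mapping.lookup (fscale c p) x = c * Poly_Mapping.lookup p x"
  by (simp add: fscale_def map.rep_eq when_def)

lemma leval_fscale [simp]: "leval F (fscale c p) = c * leval F p"
proof -
  have "leval F (fscale c p) = (\<Sum>x\<in>Poly_Mapping.keys p. Poly_Mapping.lookup (fscale c p) x * F x)"
    by (rule leval_superset) (auto simp: in_keys_iff)
  then show ?thesis by (simp add: leval_def sum_distrib_left algebra_simps)
qed

lemma leval_zero [simp]: "leval F 0 = 0"
  by (simp add: leval_def)

lemma leval_single [simp]: "leval F (Poly_Mapping.single x c) = c * F x"
  by (simp add: leval_def)

lemma leval_uminus [simp]: "leval F (- p) = - leval F p"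
  using leval_add[of F "- p" p] by (simp add: eq_neg_iff_add_eq_0 del: leval_add)

lemma leval_diff [simp]: "leval F (p - q) = leval F p - leval F q"
  using leval_add[of F p "- q"] by simp

lemma leval_sum [simp]: "leval F (\<Sum>x\<in>S. g x) = (\<Sum>x\<in>S. leval F (g x))"
  by (induction S rule: infinite_finite_induct) auto

lemma leval_formal_sum [simp]: "leval F (formal_sum xs) = sm xs F"
  by (induction xs) (auto simp: formal_sum_def)

lemma leval_push [simp]: "leval F (push g p) = leval (\<lambda>x. F (g x)) p"
  by (simp add: push_def leval_def[of "\<lambda>x. F (g x)"])

lemma resp_leval: "resp R F \<longleftrightarrow> (\<forall>r\<in>R. leval F r = 0)"
  by (simp add: resp_def leval_def)

lemma resp_vrel [simp]: "resp (vrel s) F \<longleftrightarrow> lin s F"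
proof -
  have "resp (vrel s) F \<longleftrightarrow>
      (\<forall>x y. leval F (Poly_Mapping.single (x + y) 1 - Poly_Mapping.single x 1 - Poly_Mapping.single y 1) = 0) \<and>
      (\<forall>c x. leval F (Poly_Mapping.single (s c x) 1 - Poly_Mapping.single x c) = 0)"
    unfolding resp_leval vrel_def by blast
  then show ?thesis by (simp add: lin_def algebra_simps)
qed

lemma resp_trel [simp]:
  "resp (R \<boxtimes> Q) F \<longleftrightarrow> (\<forall>y. resp R (\<lambda>x. F (x, y))) \<and> (\<forall>x. resp Q (\<lambda>y. F (x, y)))"
proof -
  have "resp (R \<boxtimes> Q) F \<longleftrightarrow> (\<forall>y. \<forall>r\<in>R. leval F (push (\<lambda>x. (x, y)) r) = 0) \<and>
      (\<forall>x. \<forall>q\<in>Q. leval F (push (\<lambda>y. (x, y)) q) = 0)"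
    unfolding resp_leval trel_def by blast
  then show ?thesis by (simp add: resp_leval)
qed

text \<open>The linear maps inside the arguments are free, so these rules prove linearity in a
  variable that is buried under products, antipodes or actions. The analogues for more factors serve
  the same purpose.\<close>

lemma resp2_lin:
  assumes "resp (vrel s1 \<boxtimes> vrel s2) F"
  shows "lmap t1 s1 i1 \<Longrightarrow> lin t1 (\<lambda>x. F (i1 x, b))"
    "lmap t2 s2 i2 \<Longrightarrow> lin t2 (\<lambda>x. F (a, i2 x))"
  using assms by (auto intro: lin_comp[of s1 "\<lambda>x. F (x, _)"]
    lin_comp[of s2 "\<lambda>x. F (_, x)"])

lemma resp3_lin:
  assumes "resp (vrel s1 \<boxtimes> vrel s2 \<boxtimes> vrel s3) F"
  shows "lmap t1 s1 i1 \<Longrightarrow> lin t1 (\<lambda>x. F (i1 x, b, c))"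
    "lmap t2 s2 i2 \<Longrightarrow> lin t2 (\<lambda>x. F (a, i2 x, c))"
    "lmap t3 s3 i3 \<Longrightarrow> lin t3 (\<lambda>x. F (a, b, i3 x))"
  using assms by (auto intro: lin_comp[of s1 "\<lambda>x. F (x, _, _)"]
    lin_comp[of s2 "\<lambda>x. F (_, x, _)"]
    lin_comp[of s3 "\<lambda>x. F (_, _, x)"])

lemma resp4_lin:
  assumes "resp (vrel s1 \<boxtimes> vrel s2 \<boxtimes> vrel s3 \<boxtimes> vrel s4) F"
  shows "lmap t1 s1 i1 \<Longrightarrow> lin t1 (\<lambda>x. F (i1 x, b, c, d))"
    "lmap t2 s2 i2 \<Longrightarrow> lin t2 (\<lambda>x. F (a, i2 x, c, d))"
    "lmap t3 s3 i3 \<Longrightarrow> lin t3 (\<lambda>x. F (a, b, i3 x, d))"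
    "lmap t4 s4 i4 \<Longrightarrow> lin t4 (\<lambda>x. F (a, b, c, i4 x))"
  using assms by (auto intro: lin_comp[of s1 "\<lambda>x. F (x, _, _, _)"]
    lin_comp[of s2 "\<lambda>x. F (_, x, _, _)"]
    lin_comp[of s3 "\<lambda>x. F (_, _, x, _)"]
    lin_comp[of s4 "\<lambda>x. F (_, _, _, x)"])

lemma resp5_lin:
  assumes "resp (vrel s1 \<boxtimes> vrel s2 \<boxtimes> vrel s3 \<boxtimes> vrel s4 \<boxtimes> vrel s5) F"
  shows "lmap t1 s1 i1 \<Longrightarrow> lin t1 (\<lambda>x. F (i1 x, b, c, d, e))"
    "lmap t2 s2 i2 \<Longrightarrow> lin t2 (\<lambda>x. F (a, i2 x, c, d, e))"
    "lmap t3 s3 i3 \<Longrightarrow> lin t3 (\<lambda>x. F (a, b, i3 x, d, e))"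
    "lmap t4 s4 i4 \<Longrightarrow> lin t4 (\<lambda>x. F (a, b, c, i4 x, e))"
    "lmap t5 s5 i5 \<Longrightarrow> lin t5 (\<lambda>x. F (a, b, c, d, i5 x))"
  using assms by (auto intro: lin_comp[of s1 "\<lambda>x. F (x, _, _, _, _)"]
    lin_comp[of s2 "\<lambda>x. F (_, x, _, _, _)"]
    lin_comp[of s3 "\<lambda>x. F (_, _, x, _, _)"]
    lin_comp[of s4 "\<lambda>x. F (_, _, _, x, _)"]
    lin_comp[of s5 "\<lambda>x. F (_, _, _, _, x)"])

lemma resp6_lin:
  assumes "resp (vrel s1 \<boxtimes> vrel s2 \<boxtimes> vrel s3 \<boxtimes> vrel s4 \<boxtimes> vrel s5 \<boxtimes> vrel s6) F"
  shows "lmap t1 s1 i1 \<Longrightarrow> lin t1 (\<lambda>x. F (i1 x, b, c, d, e, f))"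
    "lmap t2 s2 i2 \<Longrightarrow> lin t2 (\<lambda>x. F (a, i2 x, c, d, e, f))"
    "lmap t3 s3 i3 \<Longrightarrow> lin t3 (\<lambda>x. F (a, b, i3 x, d, e, f))"
    "lmap t4 s4 i4 \<Longrightarrow> lin t4 (\<lambda>x. F (a, b, c, i4 x, e, f))"
    "lmap t5 s5 i5 \<Longrightarrow> lin t5 (\<lambda>x. F (a, b, c, d, i5 x, f))"
    "lmap t6 s6 i6 \<Longrightarrow> lin t6 (\<lambda>x. F (a, b, c, d, e, i6 x))"
  using assms by (auto intro: lin_comp[of s1 "\<lambda>x. F (x, _, _, _, _, _)"]
    lin_comp[of s2 "\<lambda>x. F (_, x, _, _, _, _)"]
    lin_comp[of s3 "\<lambda>x. F (_, _, x, _, _, _)"]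
    lin_comp[of s4 "\<lambda>x. F (_, _, _, x, _, _)"]
    lin_comp[of s5 "\<lambda>x. F (_, _, _, _, x, _)"]
    lin_comp[of s6 "\<lambda>x. F (_, _, _, _, _, x)"])

lemma resp7_lin:
  assumes "resp (vrel s1 \<boxtimes> vrel s2 \<boxtimes> vrel s3 \<boxtimes> vrel s4 \<boxtimes> vrel s5 \<boxtimes> vrel s6 \<boxtimes> vrel s7) F"
  shows "lmap t1 s1 i1 \<Longrightarrow> lin t1 (\<lambda>x. F (i1 x, b, c, d, e, f, g))"
    "lmap t2 s2 i2 \<Longrightarrow> lin t2 (\<lambda>x. F (a, i2 x, c, d, e, f, g))"
    "lmap t3 s3 i3 \<Longrightarrow> lin t3 (\<lambda>x. F (a, b, i3 x, d, e, f, g))"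
    "lmap t4 s4 i4 \<Longrightarrow> lin t4 (\<lambda>x. F (a, b, c, i4 x, e, f, g))"
    "lmap t5 s5 i5 \<Longrightarrow> lin t5 (\<lambda>x. F (a, b, c, d, i5 x, f, g))"
    "lmap t6 s6 i6 \<Longrightarrow> lin t6 (\<lambda>x. F (a, b, c, d, e, i6 x, g))"
    "lmap t7 s7 i7 \<Longrightarrow> lin t7 (\<lambda>x. F (a, b, c, d, e, f, i7 x))"
  using assms by (auto intro: lin_comp[of s1 "\<lambda>x. F (x, _, _, _, _, _, _)"]
    lin_comp[of s2 "\<lambda>x. F (_, x, _, _, _, _, _)"]
    lin_comp[of s3 "\<lambda>x. F (_, _, x, _, _, _, _)"]
    lin_comp[of s4 "\<lambda>x. F (_, _, _, x, _, _, _)"]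
    lin_comp[of s5 "\<lambda>x. F (_, _, _, _, x, _, _)"]
    lin_comp[of s6 "\<lambda>x. F (_, _, _, _, _, x, _)"]
    lin_comp[of s7 "\<lambda>x. F (_, _, _, _, _, _, x)"])

section \<open>Separation of tensors by forms\<close>

interpretation fs: vector_space "fscale :: 'k::field \<Rightarrow> ('x \<Rightarrow>\<^sub>0 'k) \<Rightarrow> _"
  by standard (auto intro!: poly_mapping_eqI simp: lookup_add algebra_simps)

text \<open>A basis of the span of R stays independent when p is joined to it. The functional with
  value 1 at p and 0 on the basis vanishes on R, and its values on the generators give F.\<close>

lemma separation:
  fixes R :: "('x \<Rightarrow>\<^sub>0 'k::field) set"
  assumes "p \<notin> fs.span R"
  obtains F where "resp R F" "leval F p \<noteq> 0"
proof -
  obtain B where B: "B \<subseteq> R" "fs.independent B" "R \<subseteq> fs.span B"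
    using fs.maximal_independent_subset by blast
  have span: "fs.span B = fs.span R"
    using B by (metis fs.span_mono fs.span_span subset_antisym)
  interpret vector_space_pair fscale "(*) :: 'k \<Rightarrow> 'k \<Rightarrow> 'k"
    by standard (auto simp: algebra_simps)
  have "fs.independent (insert p B)"
    using B assms span by (simp add: fs.independent_insertI)
  then obtain g where g: "Vector_Spaces.linear fscale (*) g" "\<forall>x\<in>insert p B. g x = (if x = p then 1 else 0)"
    using linear_independent_extend[of "insert p B" "\<lambda>x. if x = p then 1 else 0"] by blast
  interpret g: Vector_Spaces.linear fscale "(*)" g by (rule g)
  define F where "F = (\<lambda>x. g (Poly_Mapping.single x 1))"
  have gF: "g q = leval F q" for q
  proof -
    have "q = (\<Sum>x\<in>Poly_Mapping.keys q. fscale (Poly_Mapping.lookup q x) (Poly_Mapping.single x 1))"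
      by (rule poly_mapping_eqI)
        (simp add: lookup_sum lookup_single when_def in_keys_iff if_distrib [of "(*) _"] sum.delta cong: if_cong)
    then have "g q = (\<Sum>x\<in>Poly_Mapping.keys q. Poly_Mapping.lookup q x * F x)"
      by (smt (verit) F_def g.scale g.sum sum.cong)
    then show ?thesis by (simp add: leval_def)
  qed
  have "p \<notin> B" using assms B span fs.span_base by blast
  then have "g r = 0" if "r \<in> B" for r using g that by auto
  then have "g r = 0" if "r \<in> R" for r
    using g.eq_0_on_span[of B r] B that by blast
  moreover have "g p = 1" using g by simp
  ultimately show thesis using that[of F] by (simp add: gF resp_leval)
qed

lemma leval_span: "resp R F \<Longrightarrow> p \<in> fs.span R \<Longrightarrow> leval F p = 0"
  by (erule fs.span_induct_alt) (auto simp: resp_leval)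

lemma span_iff: "p \<in> fs.span R \<longleftrightarrow> (\<forall>F. resp R F \<longrightarrow> leval F p = 0)"
  using leval_span separation by metis

lemma mem_tens: "p \<in> tens R xs \<longleftrightarrow> (\<forall>F. resp R F \<longrightarrow> leval F p = sm xs F)"
  by (simp add: tens_def span_iff)

lemma tens_eq_iff: "tens R xs = tens R ys \<longleftrightarrow> (\<forall>F. resp R F \<longrightarrow> sm xs F = sm ys F)" (is "?l = ?r")
proof
  assume ?l
  moreover have "formal_sum xs \<in> tens R xs" by (simp add: mem_tens)
  ultimately have "formal_sum xs \<in> tens R ys" by simp
  then show ?r by (simp add: mem_tens)
qed (auto simp: mem_tens)

lemma tens_eqI: "(\<And>F. resp R F \<Longrightarrow> sm xs F = sm ys F) \<Longrightarrow> tens R xs = tens R ys"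
  by (simp add: tens_eq_iff)

lemma tens_eqD: "tens R xs = tens R ys \<Longrightarrow> resp R F \<Longrightarrow> sm xs F = sm ys F"
  by (simp add: tens_eq_iff)

text \<open>The list chosen by \<open>terms\<close> represents the coset it was chosen from, so
  every form that respects R has the same value on it as on any other representation.\<close>

lemma tens_terms_tens [simp]: "tens R (terms (tens R xs)) = tens R xs"
proof -
  have "formal_sum xs \<in> tens R xs" by (simp add: mem_tens)
  then have "formal_sum (terms (tens R xs)) \<in> tens R xs"
    unfolding terms_def by (rule someI)
  then show ?thesis by (simp add: mem_tens tens_eq_iff)
qed

lemma tens_terms: "t \<in> range (tens R) \<Longrightarrow> tens R (terms t) = t"
  by auto

lemma sm_terms_tens [simp]: "resp R F \<Longrightarrow> sm (terms (tens R xs)) F = sm xs F"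
  using tens_terms_tens tens_eqD by blast

section \<open>Tensor products of algebras\<close>

text \<open>The dual way to say that the span of R is a two-sided ideal of the free space with the
  multiplication of generators, hence that products of cosets are well defined.\<close>

definition mult_ideal :: "('x::times \<Rightarrow>\<^sub>0 'k::field) set \<Rightarrow> bool" where
  "mult_ideal R \<longleftrightarrow> (\<forall>F. resp R F \<longrightarrow> (\<forall>y. resp R (\<lambda>x. F (x * y)) \<and> resp R (\<lambda>x. F (y * x))))"

lemma mult_ideal_trel [simp]:
  fixes R :: "('x::monoid_mult \<Rightarrow>\<^sub>0 'k::field) set" and Q :: "('y::monoid_mult \<Rightarrow>\<^sub>0 'k::field) set"
  assumes "mult_ideal R" "mult_ideal Q"
  shows "mult_ideal (R \<boxtimes> Q)"
  unfolding mult_ideal_def using assms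
  apply (auto simp: times_prod_def)
  subgoal for F a b c using assms(1)[unfolded mult_ideal_def, rule_format, of "\<lambda>x. F (x, c * b)" a] by simp
  subgoal for F a b c using assms(2)[unfolded mult_ideal_def, rule_format, of "\<lambda>x. F (c * a, x)" b] by simp
  subgoal for F a b c using assms(1)[unfolded mult_ideal_def, rule_format, of "\<lambda>x. F (x, b * c)" a] by simp
  subgoal for F a b c using assms(2)[unfolded mult_ideal_def, rule_format, of "\<lambda>x. F (a * c, x)" b] by simp
  done

definition lmul :: "'x::times list \<Rightarrow> 'x list \<Rightarrow> 'x list" (infixr \<open>\<star>\<close> 70) where
  "xs \<star> ys = [x * y. x \<leftarrow> xs, y \<leftarrow> ys]"

lemma sm_lmul [simp]: "sm (xs \<star> ys) F = sm xs (\<lambda>x. sm ys (\<lambda>y. F (x * y)))"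
  by (simp add: lmul_def)

lemma mult_ideal_left: "mult_ideal R \<Longrightarrow> resp R F \<Longrightarrow> resp R (\<lambda>x. F (x * y))"
  and mult_ideal_right: "mult_ideal R \<Longrightarrow> resp R F \<Longrightarrow> resp R (\<lambda>x. F (y * x))"
  by (auto simp: mult_ideal_def)

lemma resp_sm: "(\<And>y. resp R (\<lambda>x. G x y)) \<Longrightarrow> resp R (\<lambda>x. sm ys (G x))"
  by (simp add: resp_leval leval_def sm_def)
    (induction ys; simp add: algebra_simps sum.distrib sum_subtractf sum.neutral)

lemma tens_lmul_cong:
  assumes "mult_ideal R" "tens R xs = tens R xs'" "tens R ys = tens R ys'"
  shows "tens R (xs \<star> ys) = tens R (xs' \<star> ys')"
proof (rule tens_eqI)
  fix F assume F: "resp R F"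
  have "sm (xs \<star> ys) F = sm xs' (\<lambda>x. sm ys (\<lambda>y. F (x * y)))"
    using F assms by (auto intro!: tens_eqD[OF assms(2)] resp_sm mult_ideal_left)
  also have "\<dots> = sm xs' (\<lambda>x. sm ys' (\<lambda>y. F (x * y)))"
  proof -
    have "sm ys (\<lambda>y. F (x * y)) = sm ys' (\<lambda>y. F (x * y))" for x
      using F assms by (auto intro!: tens_eqD[OF assms(3)] mult_ideal_right)
    then show ?thesis by simp
  qed
  finally show "sm (xs \<star> ys) F = sm (xs' \<star> ys') F" by simp
qed

lemma talg_simps [simp]:
  "carrier (talg R) = range (tens R)" "\<one>\<^bsub>talg R\<^esub> = tens R [1]"
  by (simp_all add: talg_def tspace_def)

lemma talg_mult: "t \<otimes>\<^bsub>talg R\<^esub> t' = tens R (terms t \<star> terms t')"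
  by (simp add: talg_def tspace_def lmul_def)

lemma talg_mult_tens [simp]:
  "mult_ideal R \<Longrightarrow> tens R xs \<otimes>\<^bsub>talg R\<^esub> tens R ys = tens R (xs \<star> ys)"
  unfolding talg_mult by (intro tens_lmul_cong) auto

lemma lmul_Nil: "[] \<star> ys = []" and lmul_Cons: "(x # xs) \<star> ys = map ((*) x) ys @ (xs \<star> ys)"
  by (simp_all add: lmul_def)

lemma lmul_append: "(xs @ xs') \<star> ys = (xs \<star> ys) @ (xs' \<star> ys)"
  by (simp add: lmul_def)

lemma lmul_map: "map ((*) (a :: 'x::monoid_mult)) ys \<star> zs = map ((*) a) (ys \<star> zs)"
  by (induction ys) (simp_all add: lmul_Nil lmul_Cons mult.assoc)

lemma lmul_assoc: "(xs \<star> ys) \<star> (zs :: 'x::monoid_mult list) = xs \<star> ys \<star> zs"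
  by (induction xs) (simp_all add: lmul_Nil lmul_Cons lmul_append lmul_map)

lemma lmul_one [simp]: "[1] \<star> xs = xs" "xs \<star> [1 :: 'x::monoid_mult] = xs"
  by (simp_all add: lmul_def) (induction xs; simp)

text \<open>Makes the library theory of monoids available for tensors: identities between
  associators and their inverses are proved for arbitrary monoid elements and then
  instantiated.\<close>

lemma monoid_talg: "mult_ideal (R :: ('x::monoid_mult \<Rightarrow>\<^sub>0 'k::field) set) \<Longrightarrow> monoid (talg R)"
  by (rule monoidI) (auto simp: lmul_assoc)

text \<open>Turns a naturality square of an associator into the square of its inverse.\<close>

lemma (in monoid) commute_inverse:
  assumes "a \<in> carrier G" "a' \<in> carrier G" "x \<in> carrier G" "y \<in> carrier G"
    and "a \<otimes> a' = \<one>" "a' \<otimes> a = \<one>" "a \<otimes> x = y \<otimes> a"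
  shows "x \<otimes> a' = a' \<otimes> y"
proof -
  have "x \<otimes> a' = (a' \<otimes> a) \<otimes> (x \<otimes> a')" using assms by simp
  also have "\<dots> = a' \<otimes> ((a \<otimes> x) \<otimes> a')" using assms(1-4) by (simp only: m_assoc m_closed)
  also have "\<dots> = (a' \<otimes> y) \<otimes> (a \<otimes> a')" unfolding assms(7) using assms(1-4) by (simp only: m_assoc m_closed)
  also have "\<dots> = a' \<otimes> y" using assms by simp
  finally show ?thesis .
qed

section \<open>Quasi-bialgebras\<close>

lemma k_algebra_alg_ofD:
  fixes s :: "'k::field \<Rightarrow> 'v::{ring,monoid_mult} \<Rightarrow> 'v"
  assumes "k_algebra (alg_of s)"
  shows "vector_space s" "s c x * y = s c (x * y)" "x * s c y = s c (x * y)"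
proof -
  have m: "module (alg_of ((*) :: 'k \<Rightarrow> 'k \<Rightarrow> 'k)) (alg_of s)"
    and a: "s c x * y = s c (x * y) \<and> x * s c y = s c (x * y)" for c x y
    using assms by (auto simp: k_algebra_def alg_of_def)
  interpret module "alg_of ((*) :: 'k \<Rightarrow> 'k \<Rightarrow> 'k)" "alg_of s" by (rule m)
  show "vector_space s"
    using smult_l_distr smult_r_distr smult_assoc1 smult_one
    by unfold_locales (auto simp: alg_of_def)
  show "s c x * y = s c (x * y)" "x * s c y = s c (x * y)"
    using a by auto
qed

lemma mult_ideal_vrel: "k_algebra (alg_of s) \<Longrightarrow> mult_ideal (vrel s)"
  by (auto simp: mult_ideal_def lin_def algebra_simps k_algebra_alg_ofD)

lemma lmap_mult:
  assumes "k_algebra (alg_of s)" "lmap s' s g"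
  shows "lmap s' s (\<lambda>x. g x * y)" "lmap s' s (\<lambda>x. y * g x)"
  using assms by (auto simp: lmap_def algebra_simps k_algebra_alg_ofD)

lemma tspace_add:
  "tens R xs \<oplus>\<^bsub>tspace R m e\<^esub> tens R ys = tens R (xs @ ys)"
proof -
  have "r \<in> tens R (xs @ ys)" if "r = p + q" "p \<in> tens R xs" "q \<in> tens R ys" for p q r
    using that by (simp add: mem_tens)
  moreover have "\<exists>p q. r = p + q \<and> p \<in> tens R xs \<and> q \<in> tens R ys" if "r \<in> tens R (xs @ ys)" for r
    using that by (intro exI[of _ "formal_sum xs"] exI[of _ "r - formal_sum xs"]) (simp add: mem_tens)
  ultimately show ?thesis by (auto simp: tspace_def)
qed

lemma mem_tspace_smult:
  "p \<in> c \<odot>\<^bsub>tspace R m e\<^esub> tens R xs \<longleftrightarrow> (\<forall>F. resp R F \<longrightarrow> leval F p = c * sm xs F)"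
proof
  assume "p \<in> c \<odot>\<^bsub>tspace R m e\<^esub> tens R xs"
  then show "\<forall>F. resp R F \<longrightarrow> leval F p = c * sm xs F"
    by (auto simp: tspace_def mem_tens span_iff)
next
  assume *: "\<forall>F. resp R F \<longrightarrow> leval F p = c * sm xs F"
  have "p = fscale c (formal_sum xs) + (p - fscale c (formal_sum xs))" by simp
  moreover have "formal_sum xs \<in> tens R xs" by (simp add: mem_tens)
  moreover have "p - fscale c (formal_sum xs) \<in> fs.span R" using * by (simp add: span_iff)
  ultimately have "p \<in> {fscale c p' + q | p' q. p' \<in> tens R xs \<and> q \<in> fs.span R}"
    by blast
  then show "p \<in> c \<odot>\<^bsub>tspace R m e\<^esub> tens R xs" by (simp add: tspace_def)
qed

lemma tspace_smult_eqD:
  assumes "t = c \<odot>\<^bsub>tspace R m e\<^esub> tens R xs" "t = tens R ys" "resp R F"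
  shows "sm ys F = c * sm xs F"
proof -
  have "formal_sum ys \<in> t" using assms(2) by (simp add: mem_tens)
  then show ?thesis using assms(1,3) by (simp add: mem_tspace_smult)
qed

text \<open>An algebra map into a tensor algebra, seen through a form: the unspecified lists
  \<open>terms (g x)\<close> behave like a linear and multiplicative family.\<close>

lemma alg_hom_terms:
  fixes R :: "('x::monoid_mult \<Rightarrow>\<^sub>0 'k::field) set"
  assumes g: "g \<in> alg_hom (alg_of s) (talg R)" and m: "mult_ideal R" and F: "resp R F"
  shows "sm (terms (g 1)) F = F 1" "sm (terms (g (x * y))) F = sm (terms (g x)) (\<lambda>a. sm (terms (g y)) (\<lambda>b. F (a * b)))"
    "lin s (\<lambda>x. sm (terms (g x)) F)"
proof -
  have t: "tens R (terms (g x)) = g x" for x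
    using g by (intro tens_terms) (auto simp: alg_hom_def ring_hom_def alg_of_def)
  have h: "g (x * y) = g x \<otimes>\<^bsub>talg R\<^esub> g y" "g 1 = \<one>\<^bsub>talg R\<^esub>" "g (x + y) = g x \<oplus>\<^bsub>talg R\<^esub> g y" "g (s c x) = c
    \<odot>\<^bsub>talg R\<^esub> g x" for x y c
    using g by (auto simp: alg_hom_def ring_hom_def alg_of_def)
  show "sm (terms (g 1)) F = F 1" using F by (simp add: h)
  have "tens R (terms (g (x * y))) = tens R (terms (g x) \<star> terms (g y))"
    by (simp only: h(1) talg_mult tens_terms_tens)
  from tens_eqD[OF this F] show "sm (terms (g (x * y))) F = sm (terms (g x)) (\<lambda>a. sm (terms (g y)) (\<lambda>b. F (a *
    b)))" by simp
  have "tens R (terms (g (x + y))) = tens R (terms (g x) @ terms (g y))" for x y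
  proof -
    have "tens R (terms (g x)) \<oplus>\<^bsub>talg R\<^esub> tens R (terms (g y)) = tens R (terms (g x) @ terms (g y))"
      by (simp only: talg_def tspace_add)
    then show ?thesis by (metis t h(3))
  qed
  from tens_eqD[OF this F] have "sm (terms (g (x + y))) F = sm (terms (g x)) F + sm (terms (g y)) F" for x y by simp
  moreover have "sm (terms (g (s c x))) F = c * sm (terms (g x)) F" for c x
  proof -
    have "g (s c x) = c \<odot>\<^bsub>talg R\<^esub> tens R (terms (g x))" by (simp only: t h(4))
    then show ?thesis using F unfolding talg_def by (rule tspace_smult_eqD[OF _ t[symmetric]])
  qed
  ultimately show "lin s (\<lambda>x. sm (terms (g x)) F)" by (simp add: lin_def)
qed

lemma Units_terms:
  fixes R :: "('x::monoid_mult \<Rightarrow>\<^sub>0 'k::field) set"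
  assumes t: "t \<in> Units (talg R)" and m: "mult_ideal R"
  shows "tens R (terms t) = t" "tens R (terms (inv\<^bsub>talg R\<^esub> t)) = inv\<^bsub>talg R\<^esub> t"
    "tens R (terms t \<star> terms (inv\<^bsub>talg R\<^esub> t)) = tens R [1]" "tens R (terms (inv\<^bsub>talg R\<^esub> t) \<star> terms t) = tens R [1]"
proof -
  interpret monoid "talg R" by (rule monoid_talg[OF m])
  have u: "t \<in> carrier (talg R)" "inv\<^bsub>talg R\<^esub> t \<in> carrier (talg R)"
    using t Units_inv_closed[OF t] by (auto simp: Units_def)
  show 1: "tens R (terms t) = t" by (rule tens_terms) (use u(1) in simp)
  show 2: "tens R (terms (inv\<^bsub>talg R\<^esub> t)) = inv\<^bsub>talg R\<^esub> t" by (rule tens_terms) (use u(2) in simp)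
  have "tens R (terms t) \<otimes>\<^bsub>talg R\<^esub> tens R (terms (inv\<^bsub>talg R\<^esub> t)) = tens R [1]"
    unfolding 1 2 using Units_r_inv[OF t] by simp
  then show "tens R (terms t \<star> terms (inv\<^bsub>talg R\<^esub> t)) = tens R [1]" unfolding talg_mult_tens[OF m] .
  have "tens R (terms (inv\<^bsub>talg R\<^esub> t)) \<otimes>\<^bsub>talg R\<^esub> tens R (terms t) = tens R [1]"
    unfolding 1 2 using Units_l_inv[OF t] by simp
  then show "tens R (terms (inv\<^bsub>talg R\<^esub> t) \<star> terms t) = tens R [1]" unfolding talg_mult_tens[OF m] .
qed

context quasi_bialgebra
begin

abbreviation "hs \<equiv> hscale H"
abbreviation "D h \<equiv> terms (comul H h)"
abbreviation "\<epsilon> \<equiv> counit H"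
abbreviation "P \<equiv> terms (reassoc H)"
abbreviation "Q \<equiv> terms (reassoc_inv H)"

lemma mult_ideal_H [simp]: "mult_ideal (H1 H)"
  by (rule mult_ideal_vrel[OF algebra])

lemmas lmap_multH [simp] = lmap_mult[OF algebra]

lemma hs_mult [simp]: "hs c x * y = hs c (x * y)" "x * hs c y = hs c (x * y)"
  by (simp_all add: k_algebra_alg_ofD[OF algebra])

lemma counit_simps [simp]: "\<epsilon> (x * y) = \<epsilon> x * \<epsilon> y" "\<epsilon> 1 = 1"
  using counit_hom by (auto simp: alg_hom_def ring_hom_def alg_of_def)

lemma counit_lin: "lin hs \<epsilon>"
  using counit_hom by (auto simp: alg_hom_def ring_hom_def alg_of_def lin_def)

lemma counit_lin_comp [simp]: "lmap s hs g \<Longrightarrow> lin s (\<lambda>x. \<epsilon> (g x))"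
  by (rule lin_comp[OF counit_lin])

lemma uncurry_D [simp]: "sm (D h) F = sm2 (D h) (\<lambda>x y. F (x, y))"
  and uncurry_P [simp]: "sm P G = sm3 P (\<lambda>x y z. G (x, y, z))"
  and uncurry_Q [simp]: "sm Q G = sm3 Q (\<lambda>x y z. G (x, y, z))"
  by (rule sm_uncurry)+

lemma D_hom [simp]:
  assumes "\<And>y. lin hs (\<lambda>x. F x y)" "\<And>x. lin hs (F x)"
  shows "sm2 (D 1) F = F 1 1" "sm2 (D (h * k)) F = sm2 (D h) (\<lambda>a b. sm2 (D k) (\<lambda>c d. F (a * c) (b * d)))"
    "lmap s hs g \<Longrightarrow> lin s (\<lambda>x. sm2 (D (g x)) F)"
proof -
  have F: "resp (HH H) (case_prod F)" using assms by simp
  note hom = alg_hom_terms[OF comul_hom _ F]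
  show "sm2 (D 1) F = F 1 1" "sm2 (D (h * k)) F = sm2 (D h) (\<lambda>a b. sm2 (D k) (\<lambda>c d. F (a * c) (b * d)))"
    using hom(1,2) by (simp_all add: one_prod_def)
  show "lmap s hs g \<Longrightarrow> lin s (\<lambda>x. sm2 (D (g x)) F)"
    using lin_comp[OF hom(3), of s g] by simp
qed

lemma D_counit [simp]:
  assumes "lin hs F"
  shows "sm2 (D h) (\<lambda>x y. \<epsilon> y * F x) = F h" "sm2 (D h) (\<lambda>x y. \<epsilon> x * F y) = F h"
    "sm2 (D h) (\<lambda>x y. F x * \<epsilon> y) = F h" "sm2 (D h) (\<lambda>x y. F y * \<epsilon> x) = F h"
  using arg_cong[OF counit_right[of h], of F] arg_cong[OF counit_left[of h], of F]
  by (simp_all add: lin_sum_list[OF assms] lin_scale[OF assms] case_prod_beta mult.commute)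

lemma P_tens: "tens (HHH H) P = reassoc H" and Q_tens: "tens (HHH H) Q = reassoc_inv H"
  and PQ_tens: "tens (HHH H) (P \<star> Q) = tens (HHH H) [1]" and QP_tens: "tens (HHH H) (Q \<star> P) = tens (HHH H) [1]"
  using Units_terms[OF reassoc_unit] by (simp_all del: sm_lmul)

lemma PQ:
  assumes "\<And>y z. lin hs (\<lambda>x. F x y z)" "\<And>x z. lin hs (\<lambda>y. F x y z)" "\<And>x y. lin hs (\<lambda>z. F x y z)"
  shows "sm3 P (\<lambda>x y z. sm3 Q (\<lambda>x' y' z'. F (x * x') (y * y') (z * z'))) = F 1 1 1"
    "sm3 Q (\<lambda>x y z. sm3 P (\<lambda>x' y' z'. F (x * x') (y * y') (z * z'))) = F 1 1 1"
  using tens_eqD[OF PQ_tens, of "\<lambda>(x, y, z). F x y z"] tens_eqD[OF QP_tens, of "\<lambda>(x, y, z). F x y z"] assms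
  by (simp_all add: one_prod_def)

text \<open>The axiom is a conjugation by \<Phi>. Cancelling either of the two outer factors gives
  the naturality squares of \<Phi> and of \<Phi>^{-1}.\<close>

lemma coassoc_P_tens:
  "tens (HHH H) (concat (map (\<lambda>(a, b). map (\<lambda>(b1, b2). (a, b1, b2)) (D b)) (D h)) \<star> P) =
   tens (HHH H) (P \<star> concat (map (\<lambda>(a, b). map (\<lambda>(a1, a2). (a1, a2, b)) (D a)) (D h)))" (is ?thesis1)
  and coassoc_Q_tens:
  "tens (HHH H) (Q \<star> concat (map (\<lambda>(a, b). map (\<lambda>(b1, b2). (a, b1, b2)) (D b)) (D h))) =
   tens (HHH H) (concat (map (\<lambda>(a, b). map (\<lambda>(a1, a2). (a1, a2, b)) (D a)) (D h)) \<star> Q)" (is ?thesis2)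
proof -
  let ?T = "talg (HHH H)"
  interpret monoid "talg (HHH H)" by (rule monoid_talg) simp
  define X Y where "X = concat (map (\<lambda>(a, b). map (\<lambda>(b1, b2). (a, b1, b2)) (D b)) (D h))"
    and "Y = concat (map (\<lambda>(a, b). map (\<lambda>(a1, a2). (a1, a2, b)) (D a)) (D h))"
  have *: "tens (HHH H) X = tens (HHH H) P \<otimes>\<^bsub>?T\<^esub> tens (HHH H) Y \<otimes>\<^bsub>?T\<^esub> tens (HHH H) Q"
    using quasi_coassoc[of h] by (simp only: P_tens Q_tens X_def Y_def)
  have C: "tens (HHH H) xs \<in> carrier ?T" for xs by simp
  have 1: "tens (HHH H) P \<otimes>\<^bsub>?T\<^esub> tens (HHH H) Q = \<one>\<^bsub>?T\<^esub>" "tens (HHH H) Q \<otimes>\<^bsub>?T\<^esub> tens (HHH H) P = \<one>\<^bsub>?T\<^esub>"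
    by (simp_all add: PQ_tens QP_tens del: sm_lmul)
  have "tens (HHH H) X \<otimes>\<^bsub>?T\<^esub> tens (HHH H) P = tens (HHH H) P \<otimes>\<^bsub>?T\<^esub> tens (HHH H) Y"
    by (simp only: * m_assoc 1 r_one m_closed C)
  moreover have "tens (HHH H) Q \<otimes>\<^bsub>?T\<^esub> tens (HHH H) X = tens (HHH H) Y \<otimes>\<^bsub>?T\<^esub> tens (HHH H) Q"
    by (simp only: * m_assoc[symmetric] 1 l_one m_closed C)
  ultimately show ?thesis1 ?thesis2 by (simp_all add: X_def Y_def)
qed

lemma coassoc:
  assumes "\<And>y z. lin hs (\<lambda>x. F x y z)" "\<And>x z. lin hs (\<lambda>y. F x y z)" "\<And>x y. lin hs (\<lambda>z. F x y z)"
  shows "sm2 (D h) (\<lambda>a b. sm2 (D b) (\<lambda>b1 b2. sm3 P (\<lambda>x y z. F (a * x) (b1 * y) (b2 * z)))) =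
      sm3 P (\<lambda>x y z. sm2 (D h) (\<lambda>a b. sm2 (D a) (\<lambda>a1 a2. F (x * a1) (y * a2) (z * b))))"
    "sm3 Q (\<lambda>x y z. sm2 (D h) (\<lambda>a b. sm2 (D b) (\<lambda>b1 b2. F (x * a) (y * b1) (z * b2)))) =
      sm2 (D h) (\<lambda>a b. sm2 (D a) (\<lambda>a1 a2. sm3 Q (\<lambda>x y z. F (a1 * x) (a2 * y) (b * z))))"
  using tens_eqD[OF coassoc_P_tens, of "\<lambda>(x, y, z). F x y z"] tens_eqD[OF coassoc_Q_tens, of "\<lambda>(x, y, z). F x y
    z"] assms
  by (simp_all add: one_prod_def)

lemma pentagon':
  assumes "\<And>y z w. lin hs (\<lambda>x. F x y z w)" "\<And>x z w. lin hs (\<lambda>y. F x y z w)"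
    "\<And>x y w. lin hs (\<lambda>z. F x y z w)" "\<And>x y z. lin hs (\<lambda>w. F x y z w)"
  shows "sm3 P (\<lambda>x y z. sm3 P (\<lambda>x' y' z'. sm2 (D y') (\<lambda>y1 y2. sm3 P (\<lambda>x'' y'' z''.
      F (x' * x'') (x * (y1 * y'')) (y * (y2 * z'')) (z * z'))))) =
    sm3 P (\<lambda>x y z. sm2 (D z) (\<lambda>z1 z2. sm3 P (\<lambda>x' y' z'. sm2 (D x') (\<lambda>x1 x2.
      F (x * x1) (y * x2) (z1 * y') (z2 * z')))))"
proof -
  have "mult_ideal (HHHH H)" by simp
  note pentagon[unfolded talg_mult_tens[OF this] lmul_assoc]
  from tens_eqD[OF this, of "\<lambda>(x, y, z, w). F x y z w"] assms show ?thesis by (simp add: mult.assoc)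
qed

lemma reassoc_counit_mid:
  assumes "\<And>y. lin hs (\<lambda>x. F x y)" "\<And>x. lin hs (\<lambda>y. F x y)"
  shows "sm3 P (\<lambda>x y z. \<epsilon> y * F x z) = F 1 1"
  using tens_eqD[OF reassoc_counit, of "case_prod F"] assms
  by (simp add: lin_scale[where s=hs and F="\<lambda>x. F x _"])

end

section \<open>Rearrangements of the pentagon\<close>

text \<open>The letters a, ..., e stand for the five invertible faces of the pentagon and the primed
  letters for their inverses. Which faces have to be inverted depends on where \<Phi> and
  \<Phi>^{-1} occur in the later sums.\<close>

lemma (in monoid) pentagon_variants:
  assumes C: "a \<in> carrier G" "b \<in> carrier G" "c \<in> carrier G" "d \<in> carrier G" "e \<in> carrier G"
      "a' \<in> carrier G" "b' \<in> carrier G" "c' \<in> carrier G" "d' \<in> carrier G" "e' \<in> carrier G"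
    and I: "a \<otimes> a' = \<one>" "b \<otimes> b' = \<one>" "c \<otimes> c' = \<one>" "d \<otimes> d' = \<one>" "e \<otimes> e' = \<one>"
      "a' \<otimes> a = \<one>" "b' \<otimes> b = \<one>" "c' \<otimes> c = \<one>" "d' \<otimes> d = \<one>" "e' \<otimes> e = \<one>"
    and p: "a \<otimes> (b \<otimes> c) = d \<otimes> e"
  shows "c \<otimes> (e' \<otimes> d') = b' \<otimes> a'" "b \<otimes> c = a' \<otimes> (d \<otimes> e)" "c' \<otimes> b' = e' \<otimes> (d' \<otimes> a)"
    "d \<otimes> (e \<otimes> c') = a \<otimes> b" "e' \<otimes> d' = c' \<otimes> (b' \<otimes> a')" "b \<otimes> (c \<otimes> e') = a' \<otimes> d"
    "e \<otimes> c' = d' \<otimes> (a \<otimes> b)" "c \<otimes> e' = b' \<otimes> (a' \<otimes> d)" "d' \<otimes> a = e \<otimes> (c' \<otimes> b')"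
proof -
  have I': "x \<in> carrier G \<Longrightarrow> a \<otimes> (a' \<otimes> x) = x" "x \<in> carrier G \<Longrightarrow> b \<otimes> (b' \<otimes> x) = x"
    "x \<in> carrier G \<Longrightarrow> c \<otimes> (c' \<otimes> x) = x" "x \<in> carrier G \<Longrightarrow> d \<otimes> (d' \<otimes> x) = x"
    "x \<in> carrier G \<Longrightarrow> e \<otimes> (e' \<otimes> x) = x" "x \<in> carrier G \<Longrightarrow> a' \<otimes> (a \<otimes> x) = x"
    "x \<in> carrier G \<Longrightarrow> b' \<otimes> (b \<otimes> x) = x" "x \<in> carrier G \<Longrightarrow> c' \<otimes> (c \<otimes> x) = x"
    "x \<in> carrier G \<Longrightarrow> d' \<otimes> (d \<otimes> x) = x" "x \<in> carrier G \<Longrightarrow> e' \<otimes> (e \<otimes> x) = x" for x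
    by (simp_all add: C I flip: m_assoc)
  show bc: "b \<otimes> c = a' \<otimes> (d \<otimes> e)" using arg_cong[OF p, of "\<lambda>x. a' \<otimes> x"] by (simp add: C I')
  have c: "c = b' \<otimes> (a' \<otimes> (d \<otimes> e))" using arg_cong[OF bc, of "\<lambda>x. b' \<otimes> x"] by (simp add: C I')
  show "c \<otimes> (e' \<otimes> d') = b' \<otimes> a'" "c \<otimes> e' = b' \<otimes> (a' \<otimes> d)"
    by (simp_all add: C I I' m_assoc c)
  show "b \<otimes> (c \<otimes> e') = a' \<otimes> d" by (simp add: C I I' m_assoc c)
  have e: "e = d' \<otimes> (a \<otimes> (b \<otimes> c))" using arg_cong[OF p, of "\<lambda>x. d' \<otimes> x"] by (simp add: C I')
  then show ec: "e \<otimes> c' = d' \<otimes> (a \<otimes> b)" by (simp add: C I I' m_assoc)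
  then show "d \<otimes> (e \<otimes> c') = a \<otimes> b" by (simp add: C I')
  have "d' \<otimes> a = (d' \<otimes> (a \<otimes> b)) \<otimes> b'" by (simp add: C I m_assoc)
  then show da: "d' \<otimes> a = e \<otimes> (c' \<otimes> b')" by (simp add: C m_assoc flip: ec)
  then show cb: "c' \<otimes> b' = e' \<otimes> (d' \<otimes> a)" by (simp add: C I')
  have "e' \<otimes> d' = (e' \<otimes> (d' \<otimes> a)) \<otimes> a'" by (simp add: C I m_assoc)
  then show "e' \<otimes> d' = c' \<otimes> (b' \<otimes> a')" by (simp add: C m_assoc flip: cb)
qed

context quasi_bialgebra
begin

text \<open>
  The names list the positions that are occupied by the three legs; a leg that is spread over
  several positions is comultiplied.
\<close>

definition "e123 X = [(x, y, z, 1). (x, y, z) \<leftarrow> X]" for X :: "('h \<times> 'h \<times> 'h) list"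
definition "e234 X = [(1, x, y, z). (x, y, z) \<leftarrow> X]" for X :: "('h \<times> 'h \<times> 'h) list"
definition "e12_3_4 X = [(x1, x2, y, z). (x, y, z) \<leftarrow> X, (x1, x2) \<leftarrow> D x]" for X :: "('h \<times> 'h \<times> 'h) list"
definition "e1_23_4 X = [(x, y1, y2, z). (x, y, z) \<leftarrow> X, (y1, y2) \<leftarrow> D y]" for X :: "('h \<times> 'h \<times> 'h) list"
definition "e1_2_34 X = [(x, y, z1, z2). (x, y, z) \<leftarrow> X, (z1, z2) \<leftarrow> D z]" for X :: "('h \<times> 'h \<times> 'h) list"

lemmas e4_defs = e123_def e234_def e12_3_4_def e1_23_4_def e1_2_34_def

lemma e4_inv:
  "tens (HHHH H) (e123 P \<star> e123 Q) = tens (HHHH H) [1]" "tens (HHHH H) (e123 Q \<star> e123 P) = tens (HHHH H) [1]"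
  "tens (HHHH H) (e234 P \<star> e234 Q) = tens (HHHH H) [1]" "tens (HHHH H) (e234 Q \<star> e234 P) = tens (HHHH H) [1]"
proof -
  have "sm (e123 P \<star> e123 Q) F = F 1" "sm (e123 Q \<star> e123 P) F = F 1"
    "sm (e234 P \<star> e234 Q) F = F 1" "sm (e234 Q \<star> e234 P) F = F 1" if F: "resp (HHHH H) F" for F
    using PQ[of "\<lambda>x y z. F (x, y, z, 1)"] PQ[of "\<lambda>x y z. F (1, x, y, z)"] F
    by (simp_all add: e4_defs one_prod_def)
  then show "tens (HHHH H) (e123 P \<star> e123 Q) = tens (HHHH H) [1]" "tens (HHHH H) (e123 Q \<star> e123 P) = tens (HHHH H) [1]"
  "tens (HHHH H) (e234 P \<star> e234 Q) = tens (HHHH H) [1]" "tens (HHHH H) (e234 Q \<star> e234 P) = tens (HHHH H) [1]"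
    by (simp_all add: tens_eq_iff del: sm_lmul resp_trel)
qed

text \<open>\<Delta> is multiplicative, so comultiplying one leg of mutually inverse tensors keeps
  them inverse: \<open>PQ\<close> is applied to a form that already contains \<Delta>.\<close>

lemma e4_inv_comul:
  "tens (HHHH H) (e12_3_4 P \<star> e12_3_4 Q) = tens (HHHH H) [1]" "tens (HHHH H) (e12_3_4 Q \<star> e12_3_4 P) = tens
    (HHHH H) [1]"
  "tens (HHHH H) (e1_23_4 P \<star> e1_23_4 Q) = tens (HHHH H) [1]" "tens (HHHH H) (e1_23_4 Q \<star> e1_23_4 P) = tens
    (HHHH H) [1]"
  "tens (HHHH H) (e1_2_34 P \<star> e1_2_34 Q) = tens (HHHH H) [1]" "tens (HHHH H) (e1_2_34 Q \<star> e1_2_34 P) = tens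
    (HHHH H) [1]"
proof -
  have "sm (e12_3_4 P \<star> e12_3_4 Q) F = F 1" "sm (e12_3_4 Q \<star> e12_3_4 P) F = F 1"
    "sm (e1_23_4 P \<star> e1_23_4 Q) F = F 1" "sm (e1_23_4 Q \<star> e1_23_4 P) F = F 1"
    "sm (e1_2_34 P \<star> e1_2_34 Q) F = F 1" "sm (e1_2_34 Q \<star> e1_2_34 P) F = F 1"
    if F: "resp (HHHH H) F" for F
  proof -
    note [simp] = resp4_lin[OF F]
    have 1: "sm2 (D 1) (\<lambda>x y. F (x, y, 1, 1)) = F 1" "sm2 (D 1) (\<lambda>x y. F (1, x, y, 1)) = F 1"
      "sm2 (D 1) (\<lambda>x y. F (1, 1, x, y)) = F 1" by (simp_all add: one_prod_def)
    note PQ[of "\<lambda>x y z. sm2 (D x) (\<lambda>x1 x2. F (x1, x2, y, z))"]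
      PQ[of "\<lambda>x y z. sm2 (D y) (\<lambda>x1 x2. F (x, x1, x2, z))"]
      PQ[of "\<lambda>x y z. sm2 (D z) (\<lambda>x1 x2. F (x, y, x1, x2))"]
    note L = this[unfolded 1]
    show "sm (e12_3_4 P \<star> e12_3_4 Q) F = F 1"
      using L(1) by (simp add: e4_defs) (erule trans[rotated], simp only: smn_defs, (rule sm_perm)+)
    show "sm (e12_3_4 Q \<star> e12_3_4 P) F = F 1"
      using L(2) by (simp add: e4_defs) (erule trans[rotated], simp only: smn_defs, (rule sm_perm)+)
    show "sm (e1_23_4 P \<star> e1_23_4 Q) F = F 1"
      using L(3) by (simp add: e4_defs) (erule trans[rotated], simp only: smn_defs, (rule sm_perm)+)
    show "sm (e1_23_4 Q \<star> e1_23_4 P) F = F 1"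
      using L(4) by (simp add: e4_defs) (erule trans[rotated], simp only: smn_defs, (rule sm_perm)+)
    show "sm (e1_2_34 P \<star> e1_2_34 Q) F = F 1"
      using L(5) by (simp add: e4_defs) (erule trans[rotated], simp only: smn_defs, (rule sm_perm)+)
    show "sm (e1_2_34 Q \<star> e1_2_34 P) F = F 1"
      using L(6) by (simp add: e4_defs) (erule trans[rotated], simp only: smn_defs, (rule sm_perm)+)
  qed
  then show
  "tens (HHHH H) (e12_3_4 P \<star> e12_3_4 Q) = tens (HHHH H) [1]" "tens (HHHH H) (e12_3_4 Q \<star> e12_3_4 P) = tens
    (HHHH H) [1]"
  "tens (HHHH H) (e1_23_4 P \<star> e1_23_4 Q) = tens (HHHH H) [1]" "tens (HHHH H) (e1_23_4 Q \<star> e1_23_4 P) = tens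
    (HHHH H) [1]"
  "tens (HHHH H) (e1_2_34 P \<star> e1_2_34 Q) = tens (HHHH H) [1]" "tens (HHHH H) (e1_2_34 Q \<star> e1_2_34 P) = tens
    (HHHH H) [1]"
    by (simp_all add: tens_eq_iff del: sm_lmul resp_trel)
qed

lemma pentagon_tens:
  "tens (HHHH H) (e234 P \<star> e1_23_4 P \<star> e123 P) = tens (HHHH H) (e1_2_34 P \<star> e12_3_4 P)"
proof -
  have "mult_ideal (HHHH H)" by simp
  from pentagon[unfolded talg_mult_tens[OF this] lmul_assoc] show ?thesis unfolding e4_defs .
qed

lemma pentagon_variants_tens:
  "tens (HHHH H) (e123 P \<star> e12_3_4 Q \<star> e1_2_34 Q) = tens (HHHH H) (e1_23_4 Q \<star> e234 Q)"
  "tens (HHHH H) (e1_23_4 P \<star> e123 P) = tens (HHHH H) (e234 Q \<star> e1_2_34 P \<star> e12_3_4 P)"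
  "tens (HHHH H) (e123 Q \<star> e1_23_4 Q) = tens (HHHH H) (e12_3_4 Q \<star> e1_2_34 Q \<star> e234 P)"
  "tens (HHHH H) (e1_2_34 P \<star> e12_3_4 P \<star> e123 Q) = tens (HHHH H) (e234 P \<star> e1_23_4 P)"
  "tens (HHHH H) (e12_3_4 Q \<star> e1_2_34 Q) = tens (HHHH H) (e123 Q \<star> e1_23_4 Q \<star> e234 Q)"
  "tens (HHHH H) (e1_23_4 P \<star> e123 P \<star> e12_3_4 Q) = tens (HHHH H) (e234 Q \<star> e1_2_34 P)"
  "tens (HHHH H) (e12_3_4 P \<star> e123 Q) = tens (HHHH H) (e1_2_34 Q \<star> e234 P \<star> e1_23_4 P)"
  "tens (HHHH H) (e123 P \<star> e12_3_4 Q) = tens (HHHH H) (e1_23_4 Q \<star> e234 Q \<star> e1_2_34 P)"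
  "tens (HHHH H) (e1_2_34 Q \<star> e234 P) = tens (HHHH H) (e12_3_4 P \<star> e123 Q \<star> e1_23_4 Q)"
proof -
  interpret monoid "talg (HHHH H)" by (rule monoid_talg) simp
  have m: "tens (HHHH H) xs \<otimes>\<^bsub>talg (HHHH H)\<^esub> tens (HHHH H) ys = tens (HHHH H) (xs \<star> ys)" for xs ys
    by (rule talg_mult_tens) simp
  have C: "tens (HHHH H) xs \<in> carrier (talg (HHHH H))" for xs by simp
  note * = pentagon_variants[where a = "tens (HHHH H) (e234 P)" and b = "tens (HHHH H) (e1_23_4 P)" and c =
    "tens (HHHH H) (e123 P)"
    and d = "tens (HHHH H) (e1_2_34 P)" and e = "tens (HHHH H) (e12_3_4 P)" and a' = "tens (HHHH H) (e234 Q)"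
    and b' = "tens (HHHH H) (e1_23_4 Q)" and c' = "tens (HHHH H) (e123 Q)"
    and d' = "tens (HHHH H) (e1_2_34 Q)" and e' = "tens (HHHH H) (e12_3_4 Q)",
    unfolded m talg_simps(2), OF C C C C C C C C C C e4_inv(3) e4_inv_comul(3) e4_inv(1) e4_inv_comul(5,1)
      e4_inv(4) e4_inv_comul(4) e4_inv(2) e4_inv_comul(6,2) pentagon_tens]
  show "tens (HHHH H) (e123 P \<star> e12_3_4 Q \<star> e1_2_34 Q) = tens (HHHH H) (e1_23_4 Q \<star> e234 Q)"
    by (rule *(1))
  show "tens (HHHH H) (e1_23_4 P \<star> e123 P) = tens (HHHH H) (e234 Q \<star> e1_2_34 P \<star> e12_3_4 P)"
    by (rule *(2))
  show "tens (HHHH H) (e123 Q \<star> e1_23_4 Q) = tens (HHHH H) (e12_3_4 Q \<star> e1_2_34 Q \<star> e234 P)"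
    by (rule *(3))
  show "tens (HHHH H) (e1_2_34 P \<star> e12_3_4 P \<star> e123 Q) = tens (HHHH H) (e234 P \<star> e1_23_4 P)"
    by (rule *(4))
  show "tens (HHHH H) (e12_3_4 Q \<star> e1_2_34 Q) = tens (HHHH H) (e123 Q \<star> e1_23_4 Q \<star> e234 Q)"
    by (rule *(5))
  show "tens (HHHH H) (e1_23_4 P \<star> e123 P \<star> e12_3_4 Q) = tens (HHHH H) (e234 Q \<star> e1_2_34 P)"
    by (rule *(6))
  show "tens (HHHH H) (e12_3_4 P \<star> e123 Q) = tens (HHHH H) (e1_2_34 Q \<star> e234 P \<star> e1_23_4 P)"
    by (rule *(7))
  show "tens (HHHH H) (e123 P \<star> e12_3_4 Q) = tens (HHHH H) (e1_23_4 Q \<star> e234 Q \<star> e1_2_34 P)"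
    by (rule *(8))
  show "tens (HHHH H) (e1_2_34 Q \<star> e234 P) = tens (HHHH H) (e12_3_4 P \<star> e123 Q \<star> e1_23_4 Q)"
    by (rule *(9))
qed

section \<open>Counits of the reassociator and its inverse\<close>

lemma counit_mid_Q:
  assumes "\<And>y. lin hs (\<lambda>x. F x y)" "\<And>x. lin hs (\<lambda>y. F x y)"
  shows "sm3 Q (\<lambda>x y z. \<epsilon> y * F x z) = F 1 1"
proof -
  have [simp]: "lmap s hs g \<Longrightarrow> lin s (\<lambda>x. F (g x) y)" "lmap s hs g \<Longrightarrow> lin s (\<lambda>y. F x (g y))" for s g x y
    using assms by (auto intro: lin_comp[where s'=hs and F="\<lambda>x. F x _"] lin_comp[where s'=hs and F="\<lambda>x. F _ x"])
  have "sm3 P (\<lambda>x y z. \<epsilon> y * F (x' * x) (z' * z)) = F x' z'" for x' z'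
    using reassoc_counit_mid[of "\<lambda>x z. F (x' * x) (z' * z)"] by simp
  then show ?thesis
    using PQ(2)[of "\<lambda>x y z. \<epsilon> y * F x z"] by (simp add: mult.assoc sm_pull)
qed

text \<open>Applying \<epsilon> to the second factor of the pentagon and using the counit axiom of
  the middle leg leaves (1 \<otimes> (\<epsilon> \<otimes> id \<otimes> id)(\<Phi>)) \<Phi> =
  \<Phi>, and \<Phi> cancels.\<close>

lemma counit_left_P:
  assumes "\<And>y. lin hs (\<lambda>x. F x y)" "\<And>x. lin hs (\<lambda>y. F x y)"
  shows "sm3 P (\<lambda>x y z. \<epsilon> x * F y z) = F 1 1"
proof -
  have [simp]: "lmap s hs g \<Longrightarrow> lin s (\<lambda>x. F (g x) y)" "lmap s hs g \<Longrightarrow> lin s (\<lambda>y. F x (g y))" for s g x y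
    using assms by (auto intro: lin_comp[where s'=hs and F="\<lambda>x. F x _"] lin_comp[where s'=hs and F="\<lambda>x. F _ x"])
  \<comment> \<open>\<open>G\<close> multiplies by \<Phi>^{-1} from the right and then evaluates
    \<epsilon> on the first factor and \<open>F\<close> on the other two; this performs the
    cancellation.\<close>
  define G where "G x y z = sm3 Q (\<lambda>a b c. \<epsilon> x * (\<epsilon> a * F (y * b) (z * c)))" for x y z
  have [simp]: "lmap s hs g \<Longrightarrow> lin s (\<lambda>x. G (g x) y z)" "lmap s hs g \<Longrightarrow> lin s (\<lambda>y. G x (g y) z)"
    "lmap s hs g \<Longrightarrow> lin s (\<lambda>z. G x y (g z))" for s g x y z
    unfolding G_def by simp_all
  have 1: "sm3 P (\<lambda>x y z. G x (a * y) (b * z)) = F a b" for a b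
    using PQ(1)[of "\<lambda>x y z. \<epsilon> x * F (a * y) (b * z)"] unfolding G_def by (simp add: mult.assoc)
  have 2: "sm3 P (\<lambda>x' y' z'. \<epsilon> y' * G (x * x') (y * (y'' * z')) z) = G x (y * y'') z" for x y z y''
    using reassoc_counit_mid[of "\<lambda>x' z'. G (x * x') (y * (y'' * z')) z"] by simp
  have 3: "sm2 (D y') (\<lambda>y1 y2. \<epsilon> y1 * G x (y * y2) z) = G x (y * y') z" for x y z y'
    by (rule D_counit(2)) simp
  have 5: "sm2 (D x') (\<lambda>x1 x2. \<epsilon> x2 * G x1 y z) = G x' y z" for x' y z
    by (rule D_counit(1)) simp
  show ?thesis
    using pentagon'[of "\<lambda>x y z w. \<epsilon> y * G x z w"] 1[of 1 1]
      reassoc_counit_mid[of "\<lambda>x z. sm2 (D z) (\<lambda>z1 z2. sm3 P (\<lambda>x' y' z'. G (x * x') (z1 * y') (z2 * z')))"]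
    by (simp add: 1 2 3 5 sm_pull mult.assoc mult.left_commute)
qed

text \<open>Here \<epsilon> is applied to the third factor of the pentagon, which leaves \<Phi> ((id
  \<otimes> id \<otimes> \<epsilon>)(\<Phi>) \<otimes> 1) = \<Phi>; accordingly \<open>G\<close> now
  multiplies by \<Phi>^{-1} from the left.\<close>

lemma counit_right_P:
  assumes "\<And>y. lin hs (\<lambda>x. F x y)" "\<And>x. lin hs (\<lambda>y. F x y)"
  shows "sm3 P (\<lambda>x y z. \<epsilon> z * F x y) = F 1 1"
proof -
  have [simp]: "lmap s hs g \<Longrightarrow> lin s (\<lambda>x. F (g x) y)" "lmap s hs g \<Longrightarrow> lin s (\<lambda>y. F x (g y))" for s g x y
    using assms by (auto intro: lin_comp[where s'=hs and F="\<lambda>x. F x _"] lin_comp[where s'=hs and F="\<lambda>x. F _ x"])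
  define G where "G x y z = sm3 Q (\<lambda>a b c. \<epsilon> z * (\<epsilon> c * F (a * x) (b * y)))" for x y z
  have [simp]: "lmap s hs g \<Longrightarrow> lin s (\<lambda>x. G (g x) y z)" "lmap s hs g \<Longrightarrow> lin s (\<lambda>y. G x (g y) z)"
    "lmap s hs g \<Longrightarrow> lin s (\<lambda>z. G x y (g z))" for s g x y z
    unfolding G_def by simp_all
  have 1: "sm3 P (\<lambda>x y z. G (x * a) (y * b) z) = F a b" for a b
  proof -
    have "sm3 P (\<lambda>x y z. G (x * a) (y * b) z) =
      sm3 Q (\<lambda>a' b' c'. sm3 P (\<lambda>x y z. \<epsilon> z * (\<epsilon> c' * F (a' * (x * a)) (b' * (y * b)))))"
      unfolding G_def smn_defs by (rule sm_swap)
    then show ?thesis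
      using PQ(2)[of "\<lambda>x y z. \<epsilon> z * F (x * a) (y * b)"] by (simp add: mult.assoc mult.left_commute)
  qed
  have 2: "sm3 P (\<lambda>x y z. \<epsilon> y * (\<epsilon> c * G (x' * a) (x * (y' * b)) (z * z'))) = \<epsilon> c * G (x' * a) (y' * b) z'" for
    x' y' z' a b c
    using reassoc_counit_mid[of "\<lambda>x z. \<epsilon> c * G (x' * a) (x * (y' * b)) (z * z')"] by simp
  have 3: "sm2 (D y') (\<lambda>y1 y2. \<epsilon> y2 * (\<epsilon> c * G x (y * (y1 * b)) z)) = \<epsilon> c * G x (y * (y' * b)) z" for x y z y' b c
    by (rule D_counit(1)) simp
  have 5: "sm2 (D z) (\<lambda>z1 z2. \<epsilon> z1 * G x y (z2 * z')) = G x y (z * z')" for x y z z'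
    by (rule D_counit(2)) simp
  have 6: "sm3 P (\<lambda>x' y' z'. \<epsilon> y' * sm2 (D x') (\<lambda>x1 x2. G (x * x1) (y * x2) (z * z'))) = G x y z" for x y z
    using reassoc_counit_mid[of "\<lambda>x' z'. sm2 (D x') (\<lambda>x1 x2. G (x * x1) (y * x2) (z * z'))"] by simp
  have "sm3 P (\<lambda>x y z. sm3 P (\<lambda>x' y' z'. sm2 (D y') (\<lambda>y1 y2. sm3 P (\<lambda>x'' y'' z''.
      \<epsilon> (y * (y2 * z'')) * G (x' * x'') (x * (y1 * y'')) (z * z'))))) =
    sm3 P (\<lambda>a b c. sm3 P (\<lambda>x' y' z'. sm3 P (\<lambda>x y z. \<epsilon> y * sm2 (D y') (\<lambda>y1 y2. \<epsilon> y2 * (\<epsilon> c * G (x' * a) (x * (y1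
      * b)) (z * z'))))))"
    by (simp add: mult.assoc del: D_counit flip: sm_pull) (simp only: smn_defs, iprover intro: sm_perm)
  also have "\<dots> = sm3 P (\<lambda>a b c. sm3 P (\<lambda>x' y' z'. \<epsilon> c * G (x' * a) (y' * b) z'))"
    by (simp only: 2 3)
  also have "\<dots> = sm3 P (\<lambda>a b c. \<epsilon> c * F a b)" by (simp add: sm_pull 1)
  finally show ?thesis
    using pentagon'[of "\<lambda>x y z w. \<epsilon> z * G x y w"] 1[of 1 1]
    by (simp add: sm_pull mult.assoc mult.left_commute 5 6)
qed

lemma counit_left_Q:
  assumes "\<And>y. lin hs (\<lambda>x. F x y)" "\<And>x. lin hs (\<lambda>y. F x y)"
  shows "sm3 Q (\<lambda>x y z. \<epsilon> x * F y z) = F 1 1"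
proof -
  have [simp]: "lmap s hs g \<Longrightarrow> lin s (\<lambda>x. F (g x) y)" "lmap s hs g \<Longrightarrow> lin s (\<lambda>y. F x (g y))" for s g x y
    using assms by (auto intro: lin_comp[where s'=hs and F="\<lambda>x. F x _"] lin_comp[where s'=hs and F="\<lambda>x. F _ x"])
  have "sm3 P (\<lambda>x y z. \<epsilon> x * F (y' * y) (z' * z)) = F y' z'" for y' z'
    using counit_left_P[of "\<lambda>y z. F (y' * y) (z' * z)"] by simp
  then show ?thesis
    using PQ(2)[of "\<lambda>x y z. \<epsilon> x * F y z"] by (simp add: mult.assoc sm_pull)
qed

lemma counit_right_Q:
  assumes "\<And>y. lin hs (\<lambda>x. F x y)" "\<And>x. lin hs (\<lambda>y. F x y)"
  shows "sm3 Q (\<lambda>x y z. \<epsilon> z * F x y) = F 1 1"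
proof -
  have [simp]: "lmap s hs g \<Longrightarrow> lin s (\<lambda>x. F (g x) y)" "lmap s hs g \<Longrightarrow> lin s (\<lambda>y. F x (g y))" for s g x y
    using assms by (auto intro: lin_comp[where s'=hs and F="\<lambda>x. F x _"] lin_comp[where s'=hs and F="\<lambda>x. F _ x"])
  have "sm3 P (\<lambda>x y z. \<epsilon> z * F (x' * x) (y' * y)) = F x' y'" for x' y'
    using counit_right_P[of "\<lambda>x y. F (x' * x) (y' * y)"] by simp
  then show ?thesis
    using PQ(2)[of "\<lambda>x y z. \<epsilon> z * F x y"] by (simp add: mult.assoc sm_pull)
qed

end

section \<open>Uniqueness of duals\<close>

lemma resp_smn [simp]:
  "(\<And>y. resp R (\<lambda>x. G x y)) \<Longrightarrow> resp R (\<lambda>x. sm ys (G x))"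
  "(\<And>a b. resp R (\<lambda>x. G2 x a b)) \<Longrightarrow> resp R (\<lambda>x. sm2 xs2 (G2 x))"
  "(\<And>a b c. resp R (\<lambda>x. G3 x a b c)) \<Longrightarrow> resp R (\<lambda>x. sm3 xs3 (G3 x))"
  unfolding smn_defs by (rule resp_sm, simp)+

text \<open>The class of left and right multiplications is closed under further multiplication. This
  lets the simplifier see that a form still respects R when its argument is a product with one
  variable factor.\<close>

definition transl :: "('x::monoid_mult \<Rightarrow> 'x) \<Rightarrow> bool" where
  "transl g \<longleftrightarrow> (\<exists>c d. \<forall>x. g x = c * (x * d))"

lemma transl_simps [simp]:
  "transl (\<lambda>x. x)" "transl g \<Longrightarrow> transl (\<lambda>x. c * g x)" "transl g \<Longrightarrow> transl (\<lambda>x. g x * c)"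
proof -
  show "transl (\<lambda>x. x)"
    unfolding transl_def by (rule exI[of _ 1], rule exI[of _ 1]) simp
  assume "transl g"
  then obtain a b where "\<forall>x. g x = a * (x * b)" by (auto simp: transl_def)
  then have "\<forall>x. c * g x = (c * a) * (x * b)" "\<forall>x. g x * c = a * (x * (b * c))"
    by (simp_all add: mult.assoc)
  then show "transl (\<lambda>x. c * g x)" "transl (\<lambda>x. g x * c)"
    unfolding transl_def by blast+
qed

lemma resp_transl:
  assumes "mult_ideal R" "resp R F" "transl g"
  shows "resp R (\<lambda>x. F (g x))"
  using assms(3) mult_ideal_left[OF assms(1) mult_ideal_right[OF assms(1,2)]]
  by (auto simp: transl_def mult.assoc)

context quasi_bialgebra
begin

text \<open>
  A family \<open>\<sigma>\<close> with \<open>ev_fam\<close>, \<open>coev_fam\<close> and the two zigzag identities is a left dual of \<open>\<pi>\<close>, with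
  evaluation and coevaluation given by the elements in the places of \<open>\<alpha>\<close> and \<open>\<beta>\<close>.
\<close>

definition hom_fam :: "('x::monoid_mult \<Rightarrow>\<^sub>0 'k) set \<Rightarrow> ('h \<Rightarrow> 'x list) \<Rightarrow> bool" where
  "hom_fam R \<pi> \<longleftrightarrow> (\<forall>F. resp R F \<longrightarrow> lin hs (\<lambda>h. sm (\<pi> h) F) \<and> sm (\<pi> 1) F = F 1 \<and>
     (\<forall>h k. sm (\<pi> (h * k)) F = sm (\<pi> h) (\<lambda>x. sm (\<pi> k) (\<lambda>y. F (x * y)))))"

definition anti_fam :: "('x::monoid_mult \<Rightarrow>\<^sub>0 'k) set \<Rightarrow> ('h \<Rightarrow> 'x list) \<Rightarrow> bool" where
  "anti_fam R \<sigma> \<longleftrightarrow> (\<forall>F. resp R F \<longrightarrow> lin hs (\<lambda>h. sm (\<sigma> h) F) \<and> sm (\<sigma> 1) F = F 1 \<and>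
     (\<forall>h k. sm (\<sigma> (h * k)) F = sm (\<sigma> k) (\<lambda>x. sm (\<sigma> h) (\<lambda>y. F (x * y)))))"

definition ev_fam where
  "ev_fam R \<pi> \<sigma> a \<longleftrightarrow> (\<forall>F h. resp R F \<longrightarrow>
     sm2 (D h) (\<lambda>h1 h2. sm (\<sigma> h1) (\<lambda>s. sm a (\<lambda>x. sm (\<pi> h2) (\<lambda>p. F (s * (x * p)))))) = \<epsilon> h * sm a F)"

definition coev_fam where
  "coev_fam R \<pi> b \<sigma> \<longleftrightarrow> (\<forall>F h. resp R F \<longrightarrow>
     sm2 (D h) (\<lambda>h1 h2. sm (\<pi> h1) (\<lambda>p. sm b (\<lambda>x. sm (\<sigma> h2) (\<lambda>s. F (p * (x * s)))))) = \<epsilon> h * sm b F)"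

definition zigzag_P where
  "zigzag_P R \<pi> b \<sigma> a \<longleftrightarrow> (\<forall>F. resp R F \<longrightarrow>
     sm3 P (\<lambda>x y z. sm (\<pi> x) (\<lambda>p. sm b (\<lambda>v. sm (\<sigma> y) (\<lambda>s. sm a (\<lambda>u. sm (\<pi> z) (\<lambda>q.
       F (p * (v * (s * (u * q)))))))))) = F 1)"

definition zigzag_Q where
  "zigzag_Q R \<sigma> a \<pi> b \<longleftrightarrow> (\<forall>F. resp R F \<longrightarrow>
     sm3 Q (\<lambda>x y z. sm (\<sigma> x) (\<lambda>s. sm a (\<lambda>u. sm (\<pi> y) (\<lambda>p. sm b (\<lambda>v. sm (\<sigma> z) (\<lambda>t.
       F (s * (u * (p * (v * t)))))))))) = F 1)"

text \<open>The canonical map from one left dual of \<pi> to another: coevaluation of \<sigma>,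
  reassociation by \<Phi>^{-1}, evaluation of \<sigma>'. For \<sigma>' = \<sigma> and a' = a it is
  the expression that \<open>zigzag_Q\<close> equates with 1.\<close>

definition comparison where
  "comparison \<sigma>' a' \<pi> b \<sigma> = [w. (x, y, z) \<leftarrow> Q, w \<leftarrow> \<sigma>' x \<star> a' \<star> \<pi> y \<star> b \<star> \<sigma> z]"

lemma fam_simps:
  fixes R :: "('x::monoid_mult \<Rightarrow>\<^sub>0 'k) set"
  assumes "hom_fam R \<pi> \<or> anti_fam R \<pi>" "resp R F"
  shows "lmap s hs g \<Longrightarrow> lin s (\<lambda>x. sm (\<pi> (g x)) F)" "sm (\<pi> 1) F = F 1"
  using assms by (auto simp: hom_fam_def anti_fam_def intro: lin_comp[where s'=hs and F="\<lambda>x. sm (\<pi> x) F"])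

lemma sm_comparison [simp]:
  "sm (comparison \<sigma>' a' \<pi> b \<sigma>) F = sm3 Q (\<lambda>x y z. sm (\<sigma>' x) (\<lambda>s. sm a' (\<lambda>u. sm (\<pi> y) (\<lambda>p. sm b (\<lambda>v. sm (\<sigma> z) (\<lambda>t.
       F (s * (u * (p * (v * t))))))))))"
  by (simp add: comparison_def)

text \<open>The element h is carried across \<Phi>^{-1} by quasi-coassociativity. On one side two of
  its three parts disappear by the evaluation of \<sigma>', on the other side two disappear by the
  coevaluation of \<sigma>.\<close>

lemma comparison_intertwines:
  fixes R :: "('x::monoid_mult \<Rightarrow>\<^sub>0 'k) set"
  assumes R: "mult_ideal R"
    and fam: "hom_fam R \<pi>" "anti_fam R \<sigma>" "anti_fam R \<sigma>'"
    and ev': "ev_fam R \<pi> \<sigma>' a'" and coev: "coev_fam R \<pi> b \<sigma>"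
  shows "tens R (comparison \<sigma>' a' \<pi> b \<sigma> \<star> \<sigma> h) = tens R (\<sigma>' h \<star> comparison \<sigma>' a' \<pi> b \<sigma>)"
proof (rule tens_eqI)
  fix F assume F: "resp R F"
  note [simp] = R F resp_transl[OF R F] fam
  have [simp]: "sm (\<pi> (k * l)) K = sm (\<pi> k) (\<lambda>x. sm (\<pi> l) (\<lambda>y. K (x * y)))"
    "sm (\<sigma> (k * l)) K = sm (\<sigma> l) (\<lambda>x. sm (\<sigma> k) (\<lambda>y. K (x * y)))"
    "sm (\<sigma>' (k * l)) K = sm (\<sigma>' l) (\<lambda>x. sm (\<sigma>' k) (\<lambda>y. K (x * y)))"
    if "resp R K" for K k l
    using fam that by (auto simp: hom_fam_def anti_fam_def)
  note [simp] = fam_simps[where R=R and \<pi>=\<pi>] fam_simps[where R=R and \<pi>=\<sigma>] fam_simps[where R=R and \<pi>=\<sigma>']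
  define G where "G x y z = sm (\<sigma>' x) (\<lambda>s. sm a' (\<lambda>u. sm (\<pi> y) (\<lambda>p. sm b (\<lambda>v. sm (\<sigma> z) (\<lambda>t.
       F (s * (u * (p * (v * t)))))))))" for x y z
  define K where "K x y z c = sm (\<sigma>' x) (\<lambda>s. sm a' (\<lambda>u. sm (\<pi> y) (\<lambda>p. sm b (\<lambda>v. sm (\<sigma> z) (\<lambda>t. sm (\<sigma> c) (\<lambda>r.
       F (s * (u * (p * (v * (t * r)))))))))))" for x y z c
  have 1: "sm2 (D k) (\<lambda>k1 k2. G w (y * k1) (z * k2)) = \<epsilon> k * G w y z" for w y z k
  proof -
    have "sm2 (D k) (\<lambda>k1 k2. G w (y * k1) (z * k2)) =
      sm (\<sigma>' w) (\<lambda>s. sm a' (\<lambda>u. sm (\<pi> y) (\<lambda>p. \<epsilon> k * sm b (\<lambda>v. sm (\<sigma> z) (\<lambda>t. F (s * (u * (p * (v * t)))))))))"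
      using coev[unfolded coev_fam_def, rule_format, symmetric]
      by (simp add: G_def mult.assoc) (simp only: smn_defs, iprover intro: sm_perm)
    then show ?thesis by (simp add: G_def sm_pull)
  qed
  have 2: "sm2 (D k) (\<lambda>k1 k2. G (k1 * x) (k2 * y) (c * z)) = \<epsilon> k * K x y z c" for x y z k c
  proof -
    have "sm2 (D k) (\<lambda>k1 k2. G (k1 * x) (k2 * y) (c * z)) =
      sm (\<sigma>' x) (\<lambda>s. \<epsilon> k * sm a' (\<lambda>u. sm (\<pi> y) (\<lambda>p. sm b (\<lambda>v. sm (\<sigma> z) (\<lambda>t. sm (\<sigma> c) (\<lambda>r. F (s * (u * (p * (v *
        (t * r)))))))))))"
      using ev'[unfolded ev_fam_def, rule_format, symmetric]
      by (simp add: G_def mult.assoc) (simp only: smn_defs, iprover intro: sm_perm)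
    then show ?thesis by (simp add: K_def sm_pull)
  qed
  have "sm (comparison \<sigma>' a' \<pi> b \<sigma> \<star> \<sigma> h) F = sm3 Q (\<lambda>x y z. K x y z h)"
    by (simp add: K_def mult.assoc)
  \<comment> \<open>h is written as \<epsilon>(h_1) h_2, so that \<epsilon>(h_1) can be expanded
    into an evaluation of \<sigma>'.\<close>
  also have "\<dots> = sm2 (D h) (\<lambda>a b. \<epsilon> a * sm3 Q (\<lambda>x y z. K x y z b))"
    by (rule D_counit(2)[symmetric]) (simp add: K_def)
  also have "\<dots> = sm2 (D h) (\<lambda>a b. sm3 Q (\<lambda>x y z. sm2 (D a) (\<lambda>a1 a2. G (a1 * x) (a2 * y) (b * z))))"
    by (simp only: 2 sm_pull)
  also have "\<dots> = sm2 (D h) (\<lambda>a b. sm2 (D a) (\<lambda>a1 a2. sm3 Q (\<lambda>x y z. G (a1 * x) (a2 * y) (b * z))))"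
    by (simp only: smn_defs, iprover intro: sm_perm)
  also have "\<dots> = sm3 Q (\<lambda>x y z. sm2 (D h) (\<lambda>a b. sm2 (D b) (\<lambda>b1 b2. G (x * a) (y * b1) (z * b2))))"
    by (rule coassoc(2)[symmetric]) (simp_all add: G_def)
  also have "\<dots> = sm3 Q (\<lambda>x y z. G (x * h) y z)"
    unfolding 1 by (subst D_counit(1)) (simp_all add: G_def)
  also have "\<dots> = sm (\<sigma>' h \<star> comparison \<sigma>' a' \<pi> b \<sigma>) F"
    by (simp add: G_def mult.assoc) (simp only: smn_defs, iprover intro: sm_perm)
  finally show "sm (comparison \<sigma>' a' \<pi> b \<sigma> \<star> \<sigma> h) F = sm (\<sigma>' h \<star> comparison \<sigma>' a' \<pi> b \<sigma>) F" .
qed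

text \<open>The product with \<open>a\<close> is a word in four legs, the last of them trivial. The
  pentagon for \<Phi>^{-1} relates it to a sum in which two evaluations can be carried out, and the
  zigzag identity reduces the rest to a'.\<close>

lemma comparison_ev:
  fixes R :: "('x::monoid_mult \<Rightarrow>\<^sub>0 'k) set"
  assumes R: "mult_ideal R"
    and fam: "hom_fam R \<pi>" "anti_fam R \<sigma>" "anti_fam R \<sigma>'"
    and ev': "ev_fam R \<pi> \<sigma>' a'" and ev: "ev_fam R \<pi> \<sigma> a" and coev: "coev_fam R \<pi> b \<sigma>"
    and zz: "zigzag_P R \<pi> b \<sigma> a"
  shows "tens R (comparison \<sigma>' a' \<pi> b \<sigma> \<star> a) = tens R a'"
proof (rule tens_eqI)
  fix F assume F: "resp R F"
  note [simp] = R F resp_transl[OF R F] fam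
  have [simp]: "sm (\<pi> (k * l)) K = sm (\<pi> k) (\<lambda>x. sm (\<pi> l) (\<lambda>y. K (x * y)))"
    "sm (\<sigma> (k * l)) K = sm (\<sigma> l) (\<lambda>x. sm (\<sigma> k) (\<lambda>y. K (x * y)))"
    "sm (\<sigma>' (k * l)) K = sm (\<sigma>' l) (\<lambda>x. sm (\<sigma>' k) (\<lambda>y. K (x * y)))"
    if "resp R K" for K k l
    using fam that by (auto simp: hom_fam_def anti_fam_def)
  note [simp] = fam_simps[where R=R and \<pi>=\<pi>] fam_simps[where R=R and \<pi>=\<sigma>] fam_simps[where R=R and \<pi>=\<sigma>']
  define G where "G x y z w = sm (\<sigma>' x) (\<lambda>s. sm a' (\<lambda>u. sm (\<pi> y) (\<lambda>p. sm b (\<lambda>v. sm (\<sigma> z) (\<lambda>t. sm a (\<lambda>u'. sm (\<pi> w) (\<lambda>q.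
       F (s * (u * (p * (v * (t * (u' * q)))))))))))))" for x y z w
  have lG [simp]: "lmap s hs g \<Longrightarrow> lin s (\<lambda>x. G (g x) y z w)" "lmap s hs g \<Longrightarrow> lin s (\<lambda>y. G x (g y) z w)"
    "lmap s hs g \<Longrightarrow> lin s (\<lambda>z. G x y (g z) w)" "lmap s hs g \<Longrightarrow> lin s (\<lambda>w. G x y z (g w))" for s g x y z w
    by (simp_all add: G_def)
  have 1: "sm2 (D k) (\<lambda>k1 k2. G x (y * k1) (z * k2) w) = \<epsilon> k * G x y z w" for x y z w k
  proof -
    have "sm2 (D k) (\<lambda>k1 k2. G x (y * k1) (z * k2) w) =
      sm (\<sigma>' x) (\<lambda>s. sm a' (\<lambda>u. sm (\<pi> y) (\<lambda>p. \<epsilon> k * sm b (\<lambda>v. sm (\<sigma> z) (\<lambda>t. sm a (\<lambda>u'. sm (\<pi> w) (\<lambda>q. F (s * (u *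
        (p * (v * (t * (u' * q)))))))))))))"
      using coev[unfolded coev_fam_def, rule_format, symmetric]
      by (simp add: G_def mult.assoc) (simp only: smn_defs, iprover intro: sm_perm)
    then show ?thesis by (simp add: G_def sm_pull)
  qed
  have 2: "sm2 (D k) (\<lambda>k1 k2. G (k1 * x) (k2 * y) z w) = \<epsilon> k * G x y z w" for x y z w k
  proof -
    have "sm2 (D k) (\<lambda>k1 k2. G (k1 * x) (k2 * y) z w) =
      sm (\<sigma>' x) (\<lambda>s. \<epsilon> k * sm a' (\<lambda>u. sm (\<pi> y) (\<lambda>p. sm b (\<lambda>v. sm (\<sigma> z) (\<lambda>t. sm a (\<lambda>u'. sm (\<pi> w) (\<lambda>q. F (s * (u *
        (p * (v * (t * (u' * q)))))))))))))"
      using ev'[unfolded ev_fam_def, rule_format, symmetric]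
      by (simp add: G_def mult.assoc) (simp only: smn_defs, iprover intro: sm_perm)
    then show ?thesis by (simp add: G_def sm_pull)
  qed
  have 3: "sm2 (D k) (\<lambda>k1 k2. G x y (k1 * z) (k2 * w)) = \<epsilon> k * G x y z w" for x y z w k
  proof -
    have "sm2 (D k) (\<lambda>k1 k2. G x y (k1 * z) (k2 * w)) =
      sm (\<sigma>' x) (\<lambda>s. sm a' (\<lambda>u. sm (\<pi> y) (\<lambda>p. sm b (\<lambda>v. sm (\<sigma> z) (\<lambda>t. \<epsilon> k * sm a (\<lambda>u'. sm (\<pi> w) (\<lambda>q. F (s * (u *
        (p * (v * (t * (u' * q)))))))))))))"
      using ev[unfolded ev_fam_def, rule_format, symmetric]
      by (simp add: G_def mult.assoc) (simp only: smn_defs, iprover intro: sm_perm)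
    then show ?thesis by (simp add: G_def sm_pull)
  qed
  have "sm3 Q (\<lambda>x y z. sm3 Q (\<lambda>x' y' z'. sm2 (D y') (\<lambda>y1 y2. G (x * x') (y * y1) (z * y2) z'))) =
    sm3 Q (\<lambda>x y z. sm2 (D x) (\<lambda>x1 x2. sm3 Q (\<lambda>x' y' z'. sm2 (D z') (\<lambda>z1 z2.
      sm3 P (\<lambda>u v w. G (x1 * x') (x2 * (y' * u)) (y * (z1 * v)) (z * (z2 * w)))))))"
    using tens_eqD[OF pentagon_variants_tens(3), of "\<lambda>(x, y, z, w). G x y z w"] by (simp add: e4_defs)
  also have "\<dots> = sm3 Q (\<lambda>x y z. sm3 Q (\<lambda>x' y' z'. sm2 (D z') (\<lambda>z1 z2.
      sm3 P (\<lambda>u v w. sm2 (D x) (\<lambda>x1 x2. G (x1 * x') (x2 * (y' * u)) (y * (z1 * v)) (z * (z2 * w)))))))"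
    by (simp only: smn_defs, iprover intro: sm_perm)
  also have "\<dots> = sm3 Q (\<lambda>x y z. \<epsilon> x * sm3 Q (\<lambda>x' y' z'. sm2 (D z') (\<lambda>z1 z2.
      sm3 P (\<lambda>u v w. G x' (y' * u) (y * (z1 * v)) (z * (z2 * w))))))"
    by (simp only: 2 sm_pull)
  also have "\<dots> = sm3 Q (\<lambda>x' y' z'. sm2 (D z') (\<lambda>z1 z2. sm3 P (\<lambda>u v w. G x' (y' * u) (z1 * v) (z2 * w))))"
    by (subst counit_left_Q) simp_all
  also have "\<dots> = sm3 Q (\<lambda>x' y' z'. sm3 P (\<lambda>u v w. sm2 (D z') (\<lambda>z1 z2. G x' (y' * u) (z1 * v) (z2 * w))))"
    by (simp only: smn_defs, iprover intro: sm_perm)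
  also have "\<dots> = sm3 Q (\<lambda>x' y' z'. \<epsilon> z' * sm3 P (\<lambda>u v w. G x' (y' * u) v w))"
    by (simp only: 3 sm_pull)
  also have "\<dots> = sm3 P (\<lambda>u v w. G 1 u v w)"
    by (subst counit_right_Q) simp_all
  also have "\<dots> = sm a' F"
  proof -
    have "sm3 P (\<lambda>u v w. G 1 u v w) = sm a' (\<lambda>x. sm3 P (\<lambda>u v w. sm (\<pi> u) (\<lambda>p. sm b (\<lambda>v'. sm (\<sigma> v) (\<lambda>t. sm a
      (\<lambda>u'. sm (\<pi> w) (\<lambda>q.
       F (x * (p * (v' * (t * (u' * q))))))))))))"
      by (simp add: G_def) (simp only: smn_defs, iprover intro: sm_perm)
    then show ?thesis
      using zz[unfolded zigzag_P_def, rule_format, of "\<lambda>z. F (_ * z)"] by simp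
  qed
  finally have "sm3 Q (\<lambda>x y z. sm3 Q (\<lambda>x' y' z'. \<epsilon> y' * G (x * x') y z z')) = sm a' F"
    by (simp only: 1)
  moreover have "sm3 Q (\<lambda>x' y' z'. \<epsilon> y' * G (x * x') y z z') = G x y z 1" for x y z
    by (subst counit_mid_Q) simp_all
  ultimately have "sm3 Q (\<lambda>x y z. G x y z 1) = sm a' F" by simp
  then show "sm (comparison \<sigma>' a' \<pi> b \<sigma> \<star> a) F = sm a' F"
    by (simp add: G_def mult.assoc)
qed

text \<open>Expand the unit to the right of V by the zigzag identity of \<sigma>. Then V passes
  \<sigma> by the intertwining property and turns a into a', which leaves the comparison element.
  Two elements with the same behaviour on \<sigma> and a are therefore equal.\<close>

lemma comparison_unique:
  fixes R :: "('x::monoid_mult \<Rightarrow>\<^sub>0 'k) set"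
  assumes R: "mult_ideal R" and zz: "zigzag_Q R \<sigma> a \<pi> b"
    and V: "\<And>h. tens R (V \<star> \<sigma> h) = tens R (\<sigma>' h \<star> V)" "tens R (V \<star> a) = tens R a'"
  shows "tens R V = tens R (comparison \<sigma>' a' \<pi> b \<sigma>)"
proof (rule tens_eqI)
  fix F assume F: "resp R F"
  note [simp] = R F resp_transl[OF R F]
  have 1: "sm V (\<lambda>v. sm (\<sigma> h) (\<lambda>s. K (v * s))) = sm (\<sigma>' h) (\<lambda>s. sm V (\<lambda>v. K (s * v)))" if "resp R K" for h K
    using tens_eqD[OF V(1) that] by simp
  have 2: "sm V (\<lambda>v. sm a (\<lambda>s. K (v * s))) = sm a' K" if "resp R K" for K
    using tens_eqD[OF V(2) that] by simp
  have "sm V F = sm V (\<lambda>v. sm3 Q (\<lambda>x y z. sm (\<sigma> x) (\<lambda>s. sm a (\<lambda>u. sm (\<pi> y) (\<lambda>p. sm b (\<lambda>w. sm (\<sigma> z) (\<lambda>t.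
       F (v * (s * (u * (p * (w * t))))))))))))"
    using zz[unfolded zigzag_Q_def, rule_format, of "\<lambda>z. F (_ * z)"] by simp
  also have "\<dots> = sm3 Q (\<lambda>x y z. sm V (\<lambda>v. sm (\<sigma> x) (\<lambda>s. sm a (\<lambda>u. sm (\<pi> y) (\<lambda>p. sm b (\<lambda>w. sm (\<sigma> z) (\<lambda>t.
       F ((v * s) * (u * (p * (w * t)))))))))))"
    unfolding mult.assoc by (simp only: smn_defs, iprover intro: sm_perm)
  also have "\<dots> = sm3 Q (\<lambda>x y z. sm (\<sigma>' x) (\<lambda>s. sm V (\<lambda>v. sm a (\<lambda>u. sm (\<pi> y) (\<lambda>p. sm b (\<lambda>w. sm (\<sigma> z) (\<lambda>t.
       F (s * ((v * u) * (p * (w * t)))))))))))"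
    by (subst 1) (simp_all add: mult.assoc)
  also have "\<dots> = sm3 Q (\<lambda>x y z. sm (\<sigma>' x) (\<lambda>s. sm a' (\<lambda>u. sm (\<pi> y) (\<lambda>p. sm b (\<lambda>w. sm (\<sigma> z) (\<lambda>t.
       F (s * (u * (p * (w * t))))))))))"
    by (subst 2) simp_all
  finally show "sm V F = sm (comparison \<sigma>' a' \<pi> b \<sigma>) F" by simp
qed

end

section \<open>The Drinfeld twist\<close>

context quasi_hopf_algebra
begin

abbreviation "S \<equiv> antipode H"
abbreviation "\<alpha> \<equiv> alpha H"
abbreviation "\<beta> \<equiv> beta H"

lemma lmap_S: "lmap hs hs S"
proof -
  interpret Vector_Spaces.linear hs hs S by (rule antipode_linear)
  show ?thesis by (simp add: lmap_def add scale)
qed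

lemma lmap_S_comp [simp]: "lmap s hs g \<Longrightarrow> lmap s hs (\<lambda>x. S (g x))"
  by (rule lmap_comp[OF lmap_S])

declare antipode_mult [simp] antipode_one [simp] counit_alpha [simp] counit_beta [simp] counit_antipode [simp]

lemma alpha_law: "lin hs F \<Longrightarrow> sm2 (D h) (\<lambda>x y. F (S x * (\<alpha> * y))) = \<epsilon> h * F \<alpha>"
  using arg_cong[OF antipode_alpha[of h], of F]
  by (simp add: lin_sum_list lin_scale case_prod_beta mult.assoc)

lemma beta_law: "lin hs F \<Longrightarrow> sm2 (D h) (\<lambda>x y. F (x * (\<beta> * S y))) = \<epsilon> h * F \<beta>"
  using arg_cong[OF antipode_beta[of h], of F]
  by (simp add: lin_sum_list lin_scale case_prod_beta mult.assoc)

lemma zigzag_P_law: "lin hs F \<Longrightarrow> sm3 P (\<lambda>x y z. F (x * (\<beta> * (S y * (\<alpha> * z))))) = F 1"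
  using arg_cong[OF antipode_reassoc, of F]
  by (simp add: lin_sum_list lin_scale case_prod_beta mult.assoc)

lemma zigzag_Q_law: "lin hs F \<Longrightarrow> sm3 Q (\<lambda>x y z. F (S x * (\<alpha> * (y * (\<beta> * S z))))) = F 1"
  using arg_cong[OF antipode_reassoc_inv, of F]
  by (simp add: lin_sum_list lin_scale case_prod_beta mult.assoc)

section \<open>Two duals of the comultiplication\<close>

text \<open>The element \<gamma>: evaluation of a product of two objects, with the inner pair at
  legs 2, 3 and the outer pair at legs 1, 4.\<close>

definition "gam = [(S a2 * (\<alpha> * a3), S a1 * (\<alpha> * a4)). (a1, a2, a3, a4) \<leftarrow> e123 P \<star> e12_3_4 Q]"
text \<open>Drinfeld's element \<delta>, the counterpart of \<gamma> for coevaluation; it occurs in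
  the formula for the inverse of the twist.\<close>

definition "del = [(b1 * (\<beta> * S b4), b2 * (\<beta> * S b3)). (b1, b2, b3, b4) \<leftarrow> e12_3_4 P \<star> e123 Q]"
definition "SS h = [(S h2, S h1). (h1, h2) \<leftarrow> D h]"

lemma sm_gam:
  "sm gam F = sm3 P (\<lambda>x y z. sm3 Q (\<lambda>x' y' z'. sm2 (D x') (\<lambda>u v.
      F (S (y * v) * (\<alpha> * (z * y')), S (x * u) * (\<alpha> * z')))))"
  by (simp add: gam_def e4_defs case_prod_beta mult.assoc)

lemma sm_del:
  "sm del F = sm3 P (\<lambda>x y z. sm2 (D x) (\<lambda>u v. sm3 Q (\<lambda>x' y' z'.
      F ((u * x') * (\<beta> * S z), (v * y') * (\<beta> * S (y * z'))))))"
  by (simp add: del_def e4_defs case_prod_beta mult.assoc)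

lemma sm_SS: "sm (SS h) F = sm2 (D h) (\<lambda>x y. F (S y, S x))"
  by (simp add: SS_def case_prod_beta)

lemma hom_fam_D: "hom_fam (HH H) D"
  using resp2_lin by (auto simp: hom_fam_def one_prod_def)

lemma anti_fam_SS: "anti_fam (HH H) SS"
proof -
  have "sm2 (D h) (\<lambda>a b. sm2 (D k) (\<lambda>c d. F (S d * S b, S c * S a))) =
    sm2 (D k) (\<lambda>x y. sm2 (D h) (\<lambda>xa ya. F (S y * S ya, S x * S xa)))" for F h k
    by (simp only: smn_defs, iprover intro: sm_perm)
  then have "sm2 (D (h * k)) (\<lambda>x y. F (S y, S x)) = sm2 (D k) (\<lambda>x y. sm2 (D h) (\<lambda>xa ya. F (S y * S ya, S x * S xa)))"
    if "resp (HH H) F" for F h k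
    by (simp add: resp2_lin[OF that])
  moreover have "lin hs (\<lambda>h. sm2 (D h) (\<lambda>x y. F (S y, S x)))" "sm2 (D 1) (\<lambda>x y. F (S y, S x)) = F (1, 1)"
    if "resp (HH H) F" for F
    by (simp_all add: resp2_lin[OF that])
  ultimately show ?thesis
    by (simp add: anti_fam_def sm_SS one_prod_def del: resp_trel)
qed

lemma anti_fam_DS: "anti_fam (HH H) (\<lambda>h. D (S h))"
  using resp2_lin by (auto simp: anti_fam_def one_prod_def)

text \<open>This law, the coevaluation law and both zigzag identities of h \<mapsto> \<Delta>(S(h))
  are the antipode axioms of H pushed through the algebra map \<Delta>.\<close>

lemma ev_DS: "ev_fam (HH H) D (\<lambda>h. D (S h)) (D \<alpha>)"
  unfolding ev_fam_def
proof (intro allI impI)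
  fix F h assume F: "resp (HH H) F"
  note [simp] = resp2_lin[OF F]
  show "sm2 (D h) (\<lambda>h1 h2. sm (D (S h1)) (\<lambda>s. sm (D \<alpha>) (\<lambda>x. sm (D h2) (\<lambda>p. F (s * (x * p)))))) = \<epsilon> h * sm (D \<alpha>) F"
    using alpha_law[of "\<lambda>z. sm (D z) F" h] by simp
qed

lemma coev_DS: "coev_fam (HH H) D (D \<beta>) (\<lambda>h. D (S h))"
  unfolding coev_fam_def
proof (intro allI impI)
  fix F h assume F: "resp (HH H) F"
  note [simp] = resp2_lin[OF F]
  show "sm2 (D h) (\<lambda>h1 h2. sm (D h1) (\<lambda>s. sm (D \<beta>) (\<lambda>x. sm (D (S h2)) (\<lambda>p. F (s * (x * p)))))) = \<epsilon> h * sm (D \<beta>) F"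
    using beta_law[of "\<lambda>z. sm (D z) F" h] by simp
qed

lemma zigzag_P_DS: "zigzag_P (HH H) D (D \<beta>) (\<lambda>h. D (S h)) (D \<alpha>)"
  unfolding zigzag_P_def
proof (intro allI impI)
  fix F assume F: "resp (HH H) F"
  note [simp] = resp2_lin[OF F]
  show "sm3 P (\<lambda>x y z. sm (D x) (\<lambda>p. sm (D \<beta>) (\<lambda>v. sm (D (S y)) (\<lambda>s. sm (D \<alpha>) (\<lambda>u. sm (D z) (\<lambda>q.
       F (p * (v * (s * (u * q)))))))))) = F 1"
    using zigzag_P_law[of "\<lambda>z. sm (D z) F"] by (simp add: one_prod_def)
qed

lemma zigzag_Q_DS: "zigzag_Q (HH H) (\<lambda>h. D (S h)) (D \<alpha>) D (D \<beta>)"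
  unfolding zigzag_Q_def
proof (intro allI impI)
  fix F assume F: "resp (HH H) F"
  note [simp] = resp2_lin[OF F]
  show "sm3 Q (\<lambda>x y z. sm (D (S x)) (\<lambda>s. sm (D \<alpha>) (\<lambda>u. sm (D y) (\<lambda>p. sm (D \<beta>) (\<lambda>v. sm (D (S z)) (\<lambda>t.
       F (s * (u * (p * (v * t)))))))))) = F 1"
    using zigzag_Q_law[of "\<lambda>z. sm (D z) F"] by (simp add: one_prod_def)
qed

text \<open>The arguments of \<open>E\<close> are the four legs of \<gamma>. Quasi-coassociativity
  carries h through both reassociators of \<gamma> until its parts stand in front of the legs; then
  \<alpha> contracts the inner pair 2, 3 and after it the outer pair 1, 4.\<close>

lemma ev_SS: "ev_fam (HH H) D SS gam"
  unfolding ev_fam_def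
proof (intro allI impI)
  fix F h assume F: "resp (HH H) F"
  note [simp] = resp2_lin[OF F]
  define E where "E p q r s = F (S q * (\<alpha> * r), S p * (\<alpha> * s))" for p q r s
  have [simp]: "lmap s hs g \<Longrightarrow> lin s (\<lambda>x. E (g x) q r t)" "lmap s hs g \<Longrightarrow> lin s (\<lambda>x. E p (g x) r t)"
    "lmap s hs g \<Longrightarrow> lin s (\<lambda>x. E p q (g x) t)" "lmap s hs g \<Longrightarrow> lin s (\<lambda>x. E p q r (g x))" for s g p q r t
    by (simp_all add: E_def)
  have 1: "sm2 (D k) (\<lambda>k1 k2. E p (k1 * q) (k2 * r) s) = \<epsilon> k * E p q r s" for p q r s k
    using alpha_law[of "\<lambda>z. F (S q * (z * r), S p * (\<alpha> * s))" k] by (simp add: E_def mult.assoc)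
  have 2: "sm2 (D k) (\<lambda>k1 k2. E (k1 * p) q r (k2 * s)) = \<epsilon> k * E p q r s" for p q r s k
    using alpha_law[of "\<lambda>z. F (S q * (\<alpha> * r), S p * (z * s))" k] by (simp add: E_def mult.assoc)
  have "sm2 (D h) (\<lambda>h1 h2. sm (SS h1) (\<lambda>s. sm gam (\<lambda>x. sm (D h2) (\<lambda>p. F (s * (x * p)))))) =
    sm3 P (\<lambda>x y z. sm3 Q (\<lambda>x' y' z'. sm2 (D h) (\<lambda>h1 h2. sm2 (D h2) (\<lambda>c d. sm2 (D (x' * h1)) (\<lambda>u v.
      E (x * u) (y * v) (z * (y' * c)) (z' * d))))))"
    by (simp add: sm_gam sm_SS mult.assoc E_def) (simp only: smn_defs, iprover intro: sm_perm)
  also have "\<dots> = sm3 P (\<lambda>x y z. sm2 (D h) (\<lambda>a b. sm2 (D a) (\<lambda>a1 a2. sm3 Q (\<lambda>x' y' z'.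
      sm2 (D (a1 * x')) (\<lambda>u v. E (x * u) (y * v) (z * (a2 * y')) (b * z'))))))"
    by (subst coassoc(2)) simp_all
  also have "\<dots> = sm3 Q (\<lambda>x' y' z'. sm2 (D x') (\<lambda>u v. sm2 (D h) (\<lambda>a b. sm3 P (\<lambda>x y z. sm2 (D a) (\<lambda>a1 a2. sm2 (D
    a1) (\<lambda>p q.
      E ((x * p) * u) ((y * q) * v) ((z * a2) * y') (b * z')))))))"
    by (simp add: mult.assoc) (simp only: smn_defs, iprover intro: sm_perm)
  also have "\<dots> = sm3 Q (\<lambda>x' y' z'. sm2 (D x') (\<lambda>u v. sm2 (D h) (\<lambda>a b. sm2 (D a) (\<lambda>a1 a2. sm2 (D a2) (\<lambda>p q. sm3 P
    (\<lambda>x y z.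
      E ((a1 * x) * u) ((p * y) * v) ((q * z) * y') (b * z')))))))"
    by (subst coassoc(1)) simp_all
  also have "\<dots> = sm3 Q (\<lambda>x' y' z'. sm2 (D x') (\<lambda>u v. sm3 P (\<lambda>x y z. sm2 (D h) (\<lambda>a b. sm2 (D a) (\<lambda>a1 a2. sm2 (D
    a2) (\<lambda>p q.
      E (a1 * (x * u)) (p * (y * v)) (q * (z * y')) (b * z')))))))"
    unfolding mult.assoc by (simp only: smn_defs, iprover intro: sm_perm)
  also have "\<dots> = sm3 Q (\<lambda>x' y' z'. sm2 (D x') (\<lambda>u v. sm3 P (\<lambda>x y z. \<epsilon> h * E (x * u) (y * v) (z * y') z')))"
    by (simp add: 1 2)
  also have "\<dots> = \<epsilon> h * sm gam F"
    by (simp add: sm_gam E_def sm_pull) (rule disjI2, simp only: smn_defs, iprover intro: sm_perm)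
  finally show "sm2 (D h) (\<lambda>h1 h2. sm (SS h1) (\<lambda>s. sm gam (\<lambda>x. sm (D h2) (\<lambda>p. F (s * (x * p)))))) = \<epsilon> h * sm gam F" .
qed

text \<open>Mirror image of \<open>ev_SS\<close>: h is carried through the reassociators of \<delta>
  to the right of the legs, and \<beta> contracts the inner and then the outer pair.\<close>

lemma coev_SS: "coev_fam (HH H) D del SS"
  unfolding coev_fam_def
proof (intro allI impI)
  fix F h assume F: "resp (HH H) F"
  note [simp] = resp2_lin[OF F]
  define E where "E p q r s = F (p * (\<beta> * S s), q * (\<beta> * S r))" for p q r s
  have [simp]: "lmap s hs g \<Longrightarrow> lin s (\<lambda>x. E (g x) q r t)" "lmap s hs g \<Longrightarrow> lin s (\<lambda>x. E p (g x) r t)"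
    "lmap s hs g \<Longrightarrow> lin s (\<lambda>x. E p q (g x) t)" "lmap s hs g \<Longrightarrow> lin s (\<lambda>x. E p q r (g x))" for s g p q r t
    by (simp_all add: E_def)
  have 1: "sm2 (D k) (\<lambda>k1 k2. E p (q * k1) (r * k2) s) = \<epsilon> k * E p q r s" for p q r s k
    using beta_law[of "\<lambda>z. F (p * (\<beta> * S s), q * (z * S r))" k] by (simp add: E_def mult.assoc)
  have 2: "sm2 (D k) (\<lambda>k1 k2. E (p * k1) q r (s * k2)) = \<epsilon> k * E p q r s" for p q r s k
    using beta_law[of "\<lambda>z. F (p * (z * S s), q * (\<beta> * S r))" k] by (simp add: E_def mult.assoc)
  have "sm2 (D h) (\<lambda>h1 h2. sm (D h1) (\<lambda>p. sm del (\<lambda>x. sm (SS h2) (\<lambda>s. F (p * (x * s)))))) =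
    sm3 Q (\<lambda>x' y' z'. sm2 (D h) (\<lambda>h1 h2. sm2 (D h2) (\<lambda>c d. sm3 P (\<lambda>x y z. sm2 (D (h1 * x)) (\<lambda>u v.
      E (u * x') (v * y') ((c * y) * z') (d * z))))))"
    by (simp add: sm_del sm_SS mult.assoc E_def) (simp only: smn_defs, iprover intro: sm_perm)
  also have "\<dots> = sm3 Q (\<lambda>x' y' z'. sm3 P (\<lambda>x y z. sm2 (D h) (\<lambda>a b. sm2 (D a) (\<lambda>a1 a2. sm2 (D (x * a1)) (\<lambda>u v.
      E (u * x') (v * y') ((y * a2) * z') (z * b))))))"
    by (subst coassoc(1)) simp_all
  also have "\<dots> = sm3 P (\<lambda>x y z. sm2 (D x) (\<lambda>u v. sm2 (D h) (\<lambda>a b. sm2 (D a) (\<lambda>a1 a2. sm2 (D a1) (\<lambda>p q. sm3 Q (\<lambda>x' y' z'.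
      E (u * (p * x')) (v * (q * y')) (y * (a2 * z')) (z * b)))))))"
    by (simp add: mult.assoc) (simp only: smn_defs, iprover intro: sm_perm)
  also have "\<dots> = sm3 P (\<lambda>x y z. sm2 (D x) (\<lambda>u v. sm2 (D h) (\<lambda>a b. sm3 Q (\<lambda>x' y' z'. sm2 (D a) (\<lambda>a1 a2. sm2 (D a2) (\<lambda>p q.
      E (u * (x' * a1)) (v * (y' * p)) (y * (z' * q)) (z * b)))))))"
    by (subst coassoc(2)) simp_all
  also have "\<dots> = sm3 P (\<lambda>x y z. sm2 (D x) (\<lambda>u v. sm3 Q (\<lambda>x' y' z'. sm2 (D h) (\<lambda>a b. sm2 (D a) (\<lambda>a1 a2. sm2 (D a2) (\<lambda>p q.
      E ((u * x') * a1) ((v * y') * p) ((y * z') * q) (z * b)))))))"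
    unfolding mult.assoc by (simp only: smn_defs, iprover intro: sm_perm)
  also have "\<dots> = sm3 P (\<lambda>x y z. sm2 (D x) (\<lambda>u v. sm3 Q (\<lambda>x' y' z'. \<epsilon> h * E (u * x') (v * y') (y * z') z)))"
    by (simp add: 1 2)
  also have "\<dots> = \<epsilon> h * sm del F"
    by (simp add: sm_del E_def sm_pull)
  finally show "sm2 (D h) (\<lambda>h1 h2. sm (D h1) (\<lambda>p. sm del (\<lambda>x. sm (SS h2) (\<lambda>s. F (p * (x * s)))))) = \<epsilon> h * sm del F" .
qed

end

section \<open>Reassociations of six tensor factors\<close>

text \<open>In the names p stands for \<Phi> and q for \<Phi>^{-1}, followed by the occupied
  positions. The equations \<open>a\<close> and \<open>c\<close> are pentagons, \<open>b\<close> and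
  \<open>d\<close> naturality squares, and \<open>e\<close> exchanges reassociators at disjoint
  positions; pasted together they fill the diagram.\<close>

lemma (in monoid) zigzag_coherence:
  assumes "p345 \<in> carrier G" "q34_5_6 \<in> carrier G" "p12_34_56 \<in> carrier G" "p12_3_4 \<in> carrier G"
    "q123 \<in> carrier G" "q3_4_56 \<in> carrier G" "p12_3_4'56 \<in> carrier G" "p12'3_4_56 \<in> carrier G"
    "p1'23_4_56 \<in> carrier G" "q3_45_6 \<in> carrier G" "q456 \<in> carrier G" "p12_3_45'6 \<in> carrier G"
    and a: "p12_34_56 \<otimes> p12_3_4 = q3_4_56 \<otimes> (p12_3_4'56 \<otimes> p12'3_4_56)"
    and b: "p12'3_4_56 \<otimes> q123 = q123 \<otimes> p1'23_4_56"
    and c: "p345 \<otimes> (q34_5_6 \<otimes> q3_4_56) = q3_45_6 \<otimes> q456"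
    and d: "q456 \<otimes> p12_3_4'56 = p12_3_45'6 \<otimes> q456"
    and e: "q456 \<otimes> q123 = q123 \<otimes> q456"
  shows "p345 \<otimes> (q34_5_6 \<otimes> (p12_34_56 \<otimes> (p12_3_4 \<otimes> q123))) =
    q3_45_6 \<otimes> (p12_3_45'6 \<otimes> (q123 \<otimes> (q456 \<otimes> p1'23_4_56)))"
proof -
  note C = assms(1-12)
  have "p345 \<otimes> (q34_5_6 \<otimes> (p12_34_56 \<otimes> (p12_3_4 \<otimes> q123))) = p345 \<otimes> (q34_5_6 \<otimes> ((p12_34_56 \<otimes> p12_3_4) \<otimes> q123))"
    by (simp add: C m_assoc)
  also have "\<dots> = (p345 \<otimes> (q34_5_6 \<otimes> q3_4_56)) \<otimes> (p12_3_4'56 \<otimes> (p12'3_4_56 \<otimes> q123))"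
    unfolding a by (simp add: C m_assoc)
  also have "\<dots> = q3_45_6 \<otimes> ((q456 \<otimes> p12_3_4'56) \<otimes> (q123 \<otimes> p1'23_4_56))"
    unfolding b c by (simp add: C m_assoc)
  also have "\<dots> = q3_45_6 \<otimes> (p12_3_45'6 \<otimes> ((q456 \<otimes> q123) \<otimes> p1'23_4_56))"
    unfolding d by (simp add: C m_assoc)
  also have "\<dots> = q3_45_6 \<otimes> (p12_3_45'6 \<otimes> (q123 \<otimes> (q456 \<otimes> p1'23_4_56)))"
    unfolding e by (simp add: C m_assoc)
  finally show ?thesis .
qed

text \<open>The inverse of the diagram in \<open>zigzag_coherence\<close>, filled by the inverse
  pentagons and squares.\<close>

lemma (in monoid) zigzag_coherence':
  assumes "p123 \<in> carrier G" "q12_3_4 \<in> carrier G" "q12_34_56 \<in> carrier G" "p34_5_6 \<in> carrier G"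
    "q345 \<in> carrier G" "q12'3_4_56 \<in> carrier G" "q12_3_4'56 \<in> carrier G" "p3_4_56 \<in> carrier G"
    "p456 \<in> carrier G" "p3_45_6 \<in> carrier G" "q1'23_4_56 \<in> carrier G" "q12_3_45'6 \<in> carrier G"
    and a: "q12_3_4 \<otimes> q12_34_56 = q12'3_4_56 \<otimes> (q12_3_4'56 \<otimes> p3_4_56)"
    and b: "p3_4_56 \<otimes> (p34_5_6 \<otimes> q345) = p456 \<otimes> p3_45_6"
    and c: "p123 \<otimes> q12'3_4_56 = q1'23_4_56 \<otimes> p123"
    and d: "q12_3_4'56 \<otimes> p456 = p456 \<otimes> q12_3_45'6"
    and e: "p123 \<otimes> p456 = p456 \<otimes> p123"
  shows "p123 \<otimes> (q12_3_4 \<otimes> (q12_34_56 \<otimes> (p34_5_6 \<otimes> q345))) =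
    q1'23_4_56 \<otimes> (p456 \<otimes> (p123 \<otimes> (q12_3_45'6 \<otimes> p3_45_6)))"
proof -
  note C = assms(1-12)
  have "p123 \<otimes> (q12_3_4 \<otimes> (q12_34_56 \<otimes> (p34_5_6 \<otimes> q345))) = p123 \<otimes> ((q12_3_4 \<otimes> q12_34_56) \<otimes> (p34_5_6 \<otimes> q345))"
    by (simp add: C m_assoc)
  also have "\<dots> = (p123 \<otimes> q12'3_4_56) \<otimes> (q12_3_4'56 \<otimes> (p3_4_56 \<otimes> (p34_5_6 \<otimes> q345)))"
    unfolding a by (simp add: C m_assoc)
  also have "\<dots> = q1'23_4_56 \<otimes> (p123 \<otimes> ((q12_3_4'56 \<otimes> p456) \<otimes> p3_45_6))"
    unfolding b c by (simp add: C m_assoc)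
  also have "\<dots> = q1'23_4_56 \<otimes> ((p123 \<otimes> p456) \<otimes> (q12_3_45'6 \<otimes> p3_45_6))"
    unfolding d by (simp add: C m_assoc)
  also have "\<dots> = q1'23_4_56 \<otimes> (p456 \<otimes> (p123 \<otimes> (q12_3_45'6 \<otimes> p3_45_6)))"
    unfolding e by (simp add: C m_assoc)
  finally show ?thesis .
qed

context quasi_bialgebra
begin

abbreviation "T6 \<equiv> H1 H \<boxtimes> H1 H \<boxtimes> H1 H \<boxtimes> H1 H \<boxtimes> H1 H \<boxtimes> H1 H"

context
  fixes X :: "('h \<times> 'h \<times> 'h) list"
begin

text \<open>Positions as in \<open>e123\<close>. An apostrophe inside a group separates the two
  parts that the first of its two comultiplications produces.\<close>

definition "s123 = [(x, y, z, 1::'h, 1::'h, 1::'h). (x, y, z) \<leftarrow> X]"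
definition "s345 = [(1::'h, 1::'h, x, y, z, 1::'h). (x, y, z) \<leftarrow> X]"
definition "s456 = [(1::'h, 1::'h, 1::'h, x, y, z). (x, y, z) \<leftarrow> X]"
definition "s12_3_4 = [(x1, x2, y, z, 1::'h, 1::'h). (x, y, z) \<leftarrow> X, (x1, x2) \<leftarrow> D x]"
definition "s34_5_6 = [(1::'h, 1::'h, x1, x2, y, z). (x, y, z) \<leftarrow> X, (x1, x2) \<leftarrow> D x]"
definition "s3_45_6 = [(1::'h, 1::'h, x, y1, y2, z). (x, y, z) \<leftarrow> X, (y1, y2) \<leftarrow> D y]"
definition "s3_4_56 = [(1::'h, 1::'h, x, y, z1, z2). (x, y, z) \<leftarrow> X, (z1, z2) \<leftarrow> D z]"
definition "s12_34_56 = [(x1, x2, y1, y2, z1, z2). (x, y, z) \<leftarrow> X, (x1, x2) \<leftarrow> D x, (y1, y2) \<leftarrow> D y, (z1, z2) \<leftarrow> D z]"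
definition "s12_3_4'56 = [(x1, x2, y, z1, z2, z3). (x, y, z) \<leftarrow> X, (x1, x2) \<leftarrow> D x, (z1, z') \<leftarrow> D z, (z2, z3) \<leftarrow> D z']"
definition "s12_3_45'6 = [(x1, x2, y, z1, z2, z3). (x, y, z) \<leftarrow> X, (x1, x2) \<leftarrow> D x, (z', z3) \<leftarrow> D z, (z1, z2) \<leftarrow> D z']"
definition "s12'3_4_56 = [(x1, x2, x3, y, z1, z2). (x, y, z) \<leftarrow> X, (x', x3) \<leftarrow> D x, (x1, x2) \<leftarrow> D x', (z1, z2) \<leftarrow> D z]"
definition "s1'23_4_56 = [(x1, x2, x3, y, z1, z2). (x, y, z) \<leftarrow> X, (x1, x') \<leftarrow> D x, (x2, x3) \<leftarrow> D x', (z1, z2) \<leftarrow> D z]"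

lemmas s6_defs = s123_def s345_def s456_def s12_3_4_def s34_5_6_def s3_45_6_def s3_4_56_def s12_34_56_def
  s12_3_4'56_def s12_3_45'6_def s12'3_4_56_def s1'23_4_56_def

end

text \<open>The pentagon on four factors, evaluated on a form that comultiplies the first and the
  last of them.\<close>

lemma pentagon_12_3_4_56:
  "tens T6 (s12_34_56 P \<star> s12_3_4 P) = tens T6 (s3_4_56 Q \<star> s12_3_4'56 P \<star> s12'3_4_56 P)"
  "tens T6 (s12_3_4 Q \<star> s12_34_56 Q) = tens T6 (s12'3_4_56 Q \<star> s12_3_4'56 Q \<star> s3_4_56 P)"
proof -
  have "sm (s12_34_56 P \<star> s12_3_4 P) F = sm (s3_4_56 Q \<star> s12_3_4'56 P \<star> s12'3_4_56 P) F"
    "sm (s12_3_4 Q \<star> s12_34_56 Q) F = sm (s12'3_4_56 Q \<star> s12_3_4'56 Q \<star> s3_4_56 P) F" if F: "resp T6 F" for F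
  proof -
    note [simp] = resp6_lin[OF F]
    note L = pentagon_variants_tens(2,3)[THEN tens_eqD, of "\<lambda>(x, y, z, w). sm2 (D x) (\<lambda>x1 x2. sm2 (D w) (\<lambda>w1 w2.
      F (x1, x2, y, z, w1, w2)))"]
    show "sm (s12_34_56 P \<star> s12_3_4 P) F = sm (s3_4_56 Q \<star> s12_3_4'56 P \<star> s12'3_4_56 P) F"
      using L(1) by (simp add: e4_defs s6_defs) (erule eq_via; simp only: smn_defs, iprover intro: sm_perm)
    show "sm (s12_3_4 Q \<star> s12_34_56 Q) F = sm (s12'3_4_56 Q \<star> s12_3_4'56 Q \<star> s3_4_56 P) F"
      using L(2) by (simp add: e4_defs s6_defs) (erule eq_via; simp only: smn_defs, iprover intro: sm_perm)
  qed
  then show "tens T6 (s12_34_56 P \<star> s12_3_4 P) = tens T6 (s3_4_56 Q \<star> s12_3_4'56 P \<star> s12'3_4_56 P)"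
    "tens T6 (s12_3_4 Q \<star> s12_34_56 Q) = tens T6 (s12'3_4_56 Q \<star> s12_3_4'56 Q \<star> s3_4_56 P)"
    by (simp_all add: tens_eq_iff del: sm_lmul resp_trel)
qed

lemma pentagon_3456:
  "tens T6 (s345 P \<star> s34_5_6 Q \<star> s3_4_56 Q) = tens T6 (s3_45_6 Q \<star> s456 Q)"
  "tens T6 (s3_4_56 P \<star> s34_5_6 P \<star> s345 Q) = tens T6 (s456 P \<star> s3_45_6 P)"
proof -
  have "sm (s345 P \<star> s34_5_6 Q \<star> s3_4_56 Q) F = sm (s3_45_6 Q \<star> s456 Q) F"
    "sm (s3_4_56 P \<star> s34_5_6 P \<star> s345 Q) F = sm (s456 P \<star> s3_45_6 P) F" if F: "resp T6 F" for F
  proof -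
    note [simp] = resp6_lin[OF F]
    note L = pentagon_variants_tens(1,4)[THEN tens_eqD, of "\<lambda>(x, y, z, w). F (1, 1, x, y, z, w)"]
    show "sm (s345 P \<star> s34_5_6 Q \<star> s3_4_56 Q) F = sm (s3_45_6 Q \<star> s456 Q) F"
      using L(1) by (simp add: e4_defs s6_defs)
    show "sm (s3_4_56 P \<star> s34_5_6 P \<star> s345 Q) F = sm (s456 P \<star> s3_45_6 P) F"
      using L(2) by (simp add: e4_defs s6_defs)
  qed
  then show "tens T6 (s345 P \<star> s34_5_6 Q \<star> s3_4_56 Q) = tens T6 (s3_45_6 Q \<star> s456 Q)"
    "tens T6 (s3_4_56 P \<star> s34_5_6 P \<star> s345 Q) = tens T6 (s456 P \<star> s3_45_6 P)"
    by (simp_all add: tens_eq_iff del: sm_lmul resp_trel)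
qed

text \<open>Quasi-coassociativity, applied to the first leg of the other reassociator.\<close>

lemma naturality_123:
  "tens T6 (s12'3_4_56 P \<star> s123 Q) = tens T6 (s123 Q \<star> s1'23_4_56 P)"
  "tens T6 (s123 P \<star> s12'3_4_56 Q) = tens T6 (s1'23_4_56 Q \<star> s123 P)"
proof -
  have "sm (s12'3_4_56 P \<star> s123 Q) F = sm (s123 Q \<star> s1'23_4_56 P) F"
    "sm (s123 P \<star> s12'3_4_56 Q) F = sm (s1'23_4_56 Q \<star> s123 P) F" if F: "resp T6 F" for F
  proof -
    note [simp] = resp6_lin[OF F]
    have "sm (s12'3_4_56 P \<star> s123 Q) F = sm3 P (\<lambda>x y z. sm2 (D x) (\<lambda>a b. sm2 (D a) (\<lambda>a1 a2. sm3 Q (\<lambda>x' y' z'.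
       sm2 (D z) (\<lambda>z1 z2. F (a1 * x', a2 * y', b * z', y, z1, z2))))))"
      by (simp add: s6_defs) (simp only: smn_defs, iprover intro: sm_perm)
    also have "\<dots> = sm (s123 Q \<star> s1'23_4_56 P) F"
      by (subst coassoc(2)[symmetric]) (simp_all add: s6_defs, simp only: smn_defs, iprover intro: sm_perm)
    finally show "sm (s12'3_4_56 P \<star> s123 Q) F = sm (s123 Q \<star> s1'23_4_56 P) F" .
    have "sm (s123 P \<star> s12'3_4_56 Q) F = sm3 Q (\<lambda>x y z. sm3 P (\<lambda>x' y' z'. sm2 (D x) (\<lambda>a b. sm2 (D a) (\<lambda>a1 a2.
       sm2 (D z) (\<lambda>z1 z2. F (x' * a1, y' * a2, z' * b, y, z1, z2))))))"
      by (simp add: s6_defs) (simp only: smn_defs, iprover intro: sm_perm)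
    also have "\<dots> = sm (s1'23_4_56 Q \<star> s123 P) F"
      by (subst coassoc(1)[symmetric]) (simp_all add: s6_defs, simp only: smn_defs, iprover intro: sm_perm)
    finally show "sm (s123 P \<star> s12'3_4_56 Q) F = sm (s1'23_4_56 Q \<star> s123 P) F" .
  qed
  then show "tens T6 (s12'3_4_56 P \<star> s123 Q) = tens T6 (s123 Q \<star> s1'23_4_56 P)"
    "tens T6 (s123 P \<star> s12'3_4_56 Q) = tens T6 (s1'23_4_56 Q \<star> s123 P)"
    by (simp_all add: tens_eq_iff del: sm_lmul resp_trel)
qed

lemma naturality_456:
  "tens T6 (s456 Q \<star> s12_3_4'56 P) = tens T6 (s12_3_45'6 P \<star> s456 Q)"
  "tens T6 (s12_3_4'56 Q \<star> s456 P) = tens T6 (s456 P \<star> s12_3_45'6 Q)"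
proof -
  have "sm (s456 Q \<star> s12_3_4'56 P) F = sm (s12_3_45'6 P \<star> s456 Q) F"
    "sm (s12_3_4'56 Q \<star> s456 P) F = sm (s456 P \<star> s12_3_45'6 Q) F" if F: "resp T6 F" for F
  proof -
    note [simp] = resp6_lin[OF F]
    have "sm (s456 Q \<star> s12_3_4'56 P) F = sm3 P (\<lambda>x y z. sm3 Q (\<lambda>x' y' z'. sm2 (D z) (\<lambda>a b. sm2 (D b) (\<lambda>b1 b2.
       sm2 (D x) (\<lambda>x1 x2. F (x1, x2, y, x' * a, y' * b1, z' * b2))))))"
      by (simp add: s6_defs) (simp only: smn_defs, iprover intro: sm_perm)
    also have "\<dots> = sm (s12_3_45'6 P \<star> s456 Q) F"
      by (subst coassoc(2)) (simp_all add: s6_defs, simp only: smn_defs, iprover intro: sm_perm)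
    finally show "sm (s456 Q \<star> s12_3_4'56 P) F = sm (s12_3_45'6 P \<star> s456 Q) F" .
    have "sm (s12_3_4'56 Q \<star> s456 P) F = sm3 Q (\<lambda>x y z. sm2 (D z) (\<lambda>a b. sm2 (D b) (\<lambda>b1 b2. sm3 P (\<lambda>x' y' z'.
       sm2 (D x) (\<lambda>x1 x2. F (x1, x2, y, a * x', b1 * y', b2 * z'))))))"
      by (simp add: s6_defs) (simp only: smn_defs, iprover intro: sm_perm)
    also have "\<dots> = sm (s456 P \<star> s12_3_45'6 Q) F"
      by (subst coassoc(1)) (simp_all add: s6_defs, simp only: smn_defs, iprover intro: sm_perm)
    finally show "sm (s12_3_4'56 Q \<star> s456 P) F = sm (s456 P \<star> s12_3_45'6 Q) F" .
  qed
  then show "tens T6 (s456 Q \<star> s12_3_4'56 P) = tens T6 (s12_3_45'6 P \<star> s456 Q)"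
    "tens T6 (s12_3_4'56 Q \<star> s456 P) = tens T6 (s456 P \<star> s12_3_45'6 Q)"
    by (simp_all add: tens_eq_iff del: sm_lmul resp_trel)
qed

lemma commute_123_456:
  "tens T6 (s456 Y \<star> s123 X) = tens T6 (s123 X \<star> s456 Y)"
proof -
  have "sm (s456 Y \<star> s123 X) F = sm (s123 X \<star> s456 Y) F" for F
    by (simp add: s6_defs case_prod_beta sm_swap[of Y] times_prod_def)
  then show ?thesis unfolding tens_eq_iff by blast
qed

lemma T6_mult: "tens T6 xs \<otimes>\<^bsub>talg T6\<^esub> tens T6 ys = tens T6 (xs \<star> ys)"
  by (rule talg_mult_tens) simp

lemma zigzag_coherence_P:
  "tens T6 (s345 P \<star> s34_5_6 Q \<star> s12_34_56 P \<star> s12_3_4 P \<star> s123 Q) =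
    tens T6 (s3_45_6 Q \<star> s12_3_45'6 P \<star> s123 Q \<star> s456 Q \<star> s1'23_4_56 P)"
proof -
  interpret monoid "talg T6" by (rule monoid_talg) simp
  show ?thesis
    using zigzag_coherence[OF _ _ _ _ _ _ _ _ _ _ _ _ pentagon_12_3_4_56(1)[folded T6_mult]
      naturality_123(1)[folded T6_mult]
      pentagon_3456(1)[folded T6_mult] naturality_456(1)[folded T6_mult] commute_123_456[folded T6_mult]]
    by (simp add: T6_mult)
qed

lemma zigzag_coherence_Q:
  "tens T6 (s123 P \<star> s12_3_4 Q \<star> s12_34_56 Q \<star> s34_5_6 P \<star> s345 Q) =
    tens T6 (s1'23_4_56 Q \<star> s456 P \<star> s123 P \<star> s12_3_45'6 Q \<star> s3_45_6 P)"
proof -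
  interpret monoid "talg T6" by (rule monoid_talg) simp
  show ?thesis
    using zigzag_coherence'[OF _ _ _ _ _ _ _ _ _ _ _ _ pentagon_12_3_4_56(2)[folded T6_mult]
      pentagon_3456(2)[folded T6_mult]
      naturality_123(2)[folded T6_mult] naturality_456(2)[folded T6_mult] commute_123_456[folded T6_mult, symmetric]]
    by (simp add: T6_mult)
qed

end

context quasi_hopf_algebra
begin

section \<open>Zigzag identities of the reversed family\<close>

text \<open>The word with \<delta> and \<gamma> consists of two nested zigzags, with five
  reassociators on six legs. The coherence diagram brings it to a form in which the inner pairs meet
  comultiplied legs and contract. What remains is one plain zigzag for each tensor factor; further
  pentagons split them off.\<close>

lemma zigzag_P_SS: "zigzag_P (HH H) D del SS gam"
  unfolding zigzag_P_def
proof (intro allI impI)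
  fix F assume F: "resp (HH H) F"
  note [simp] = resp2_lin[OF F]
  \<comment> \<open>The arguments are the six legs before \<alpha>, \<beta> and S are inserted:
    \<beta> joins legs 2, 3 and legs 1, 4, while \<alpha> joins legs 4, 5 and legs 3, 6.\<close>
  define E where "E a b c d e f = F (a * (\<beta> * (S d * (\<alpha> * e))), b * (\<beta> * (S c * (\<alpha> * f))))" for a b c d e f
  have [simp]: "lmap s hs g \<Longrightarrow> lin s (\<lambda>x. E (g x) b c d e f)" "lmap s hs g \<Longrightarrow> lin s (\<lambda>x. E a (g x) c d e f)"
    "lmap s hs g \<Longrightarrow> lin s (\<lambda>x. E a b (g x) d e f)" "lmap s hs g \<Longrightarrow> lin s (\<lambda>x. E a b c (g x) e f)"
    "lmap s hs g \<Longrightarrow> lin s (\<lambda>x. E a b c d (g x) f)" "lmap s hs g \<Longrightarrow> lin s (\<lambda>x. E a b c d e (g x))" for s g a b c d e f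
    by (simp_all add: E_def)
  have L45: "sm2 (D k) (\<lambda>x y. E a b c (x * d) (y * e) f) = \<epsilon> k * E a b c d e f" for a b c d e f k
    using alpha_law[of "\<lambda>z. F (a * (\<beta> * (S d * (z * e))), b * (\<beta> * (S c * (\<alpha> * f))))" k] by (simp add: E_def mult.assoc)
  have L36: "sm2 (D k) (\<lambda>x y. E a b (x * c) d e (y * f)) = \<epsilon> k * E a b c d e f" for a b c d e f k
    using alpha_law[of "\<lambda>z. F (a * (\<beta> * (S d * (\<alpha> * e))), b * (\<beta> * (S c * (z * f))))" k] by (simp add: E_def mult.assoc)
  have R23: "sm2 (D k) (\<lambda>x y. E a (b * x) (c * y) d e f) = \<epsilon> k * E a b c d e f" for a b c d e f k
    using beta_law[of "\<lambda>z. F (a * (\<beta> * (S d * (\<alpha> * e))), b * (z * (S c * (\<alpha> * f))))" k] by (simp add: E_def mult.assoc)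
  have "sm3 P (\<lambda>x y z. sm (D x) (\<lambda>p. sm del (\<lambda>v. sm (SS y) (\<lambda>s. sm gam (\<lambda>u. sm (D z) (\<lambda>q.
       F (p * (v * (s * (u * q)))))))))) =
    sm (s345 P \<star> s34_5_6 Q \<star> s12_34_56 P \<star> s12_3_4 P \<star> s123 Q) (\<lambda>(a, b, c, d, e, f). E a b c d e f)"
    by (simp add: s6_defs sm_del sm_gam sm_SS E_def mult.assoc) (simp only: smn_defs, iprover intro: sm_perm)
  also have "\<dots> = sm (s3_45_6 Q \<star> s12_3_45'6 P \<star> s123 Q \<star> s456 Q \<star> s1'23_4_56 P) (\<lambda>(a, b, c, d, e, f). E a b c d e f)"
    by (rule tens_eqD[OF zigzag_coherence_P]) simp
  also have "\<dots> = sm3 Q (\<lambda>x y z. sm3 P (\<lambda>a b c. sm3 Q (\<lambda>d e f. sm3 Q (\<lambda>g h i. sm3 P (\<lambda>l m n. sm2 (D a) (\<lambda>a1 a2.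
    sm2 (D n) (\<lambda>n1 n2.
    sm2 (D c) (\<lambda>c' c2. sm2 (D c') (\<lambda>c11 c12. sm2 (D y) (\<lambda>y1 y2. sm2 (D l) (\<lambda>l1 l'. sm2 (D l') (\<lambda>l21 l22.
    E (a1 * (d * l1)) ((a2 * e) * l21) ((x * (b * f)) * l22) (y1 * (c11 * (g * m))) (y2 * (c12 * (h * n1))) (z *
      (c2 * (i * n2)))))))))))))))"
    by (simp add: s6_defs mult.assoc) (simp only: smn_defs, iprover intro: sm_perm)
  \<comment> \<open>The legs that are spread over positions 2, 3 or over positions 4, 5 contract to
    their counits.\<close>
  also have "\<dots> = sm3 Q (\<lambda>x y z. \<epsilon> y * sm3 P (\<lambda>a b c. sm3 Q (\<lambda>d e f. sm3 Q (\<lambda>g h i. sm3 P (\<lambda>l m n. sm2 (D a) (\<lambda>a1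
    a2. sm2 (D n) (\<lambda>n1 n2.
    E (a1 * (d * l)) (a2 * e) (x * (b * f)) (g * m) (h * n1) (z * (c * (i * n2))))))))))"
    by (simp add: R23 L45 sm_pull)
  also have "\<dots> = sm3 P (\<lambda>a b c. sm3 Q (\<lambda>d e f. sm3 Q (\<lambda>g h i. sm3 P (\<lambda>l m n. sm2 (D a) (\<lambda>a1 a2. sm2 (D n) (\<lambda>n1 n2.
    E (a1 * (d * l)) (a2 * e) (b * f) (g * m) (h * n1) (c * (i * n2))))))))"
    by (subst counit_mid_Q) simp_all
  also have "\<dots> = sm3 Q (\<lambda>g h i. sm3 P (\<lambda>l m n. sm2 (D n) (\<lambda>n1 n2. sm3 P (\<lambda>a b c. sm2 (D a) (\<lambda>a1 a2. sm3 Q (\<lambda>d e f.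
    E ((a1 * d) * l) (a2 * e) (b * f) (g * m) (h * n1) (c * (i * n2))))))))"
    unfolding mult.assoc by (simp only: smn_defs, iprover intro: sm_perm)
  also have "\<dots> = sm3 Q (\<lambda>g h i. sm3 P (\<lambda>l m n. sm2 (D n) (\<lambda>n1 n2. F (l * (\<beta> * (S (g * m) * (\<alpha> * (h * n1)))), i * n2))))"
  proof -
    \<comment> \<open>The zigzag of the second tensor factor, through legs 2, 3 and 6, is pulled out
      by a pentagon; l, q, r belong to the first factor and stay passive.\<close>
    have "sm3 P (\<lambda>a b c. sm2 (D a) (\<lambda>a1 a2. sm3 Q (\<lambda>d e f. E ((a1 * d) * l) (a2 * e) (b * f) q r (c * s)))) =
       F (l * (\<beta> * (S q * (\<alpha> * r))), s)" for l q r s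
    proof -
      have "sm3 P (\<lambda>a b c. sm2 (D a) (\<lambda>a1 a2. sm3 Q (\<lambda>d e f. E ((a1 * d) * l) (a2 * e) (b * f) q r (c * s)))) =
        sm3 Q (\<lambda>x y z. sm2 (D z) (\<lambda>z1 z2. sm3 P (\<lambda>x' y' z'. sm3 P (\<lambda>x'' y'' z''. sm2 (D y'') (\<lambda>u v.
          E (x * (x'' * l)) ((y * x') * u) ((z1 * y') * v) q r (z2 * (z' * (z'' * s))))))))"
        using pentagon_variants_tens(7)[THEN tens_eqD, of "\<lambda>(x, y, z, w). E (x * l) y z q r (w * s)"]
        by (simp add: e4_defs mult.assoc)
      also have "\<dots> = sm3 Q (\<lambda>x y z. sm3 P (\<lambda>x' y' z'. sm3 P (\<lambda>x'' y'' z''. sm2 (D z) (\<lambda>z1 z2. \<epsilon> y'' *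
          E (x * (x'' * l)) (y * x') (z1 * y') q r (z2 * (z' * (z'' * s)))))))"
        unfolding R23 by (simp only: smn_defs, iprover intro: sm_perm)
      also have "\<dots> = sm3 Q (\<lambda>x y z. \<epsilon> z * sm3 P (\<lambda>x' y' z'. sm3 P (\<lambda>x'' y'' z''. \<epsilon> y'' *
          E (x * (x'' * l)) (y * x') y' q r (z' * (z'' * s)))))"
        by (simp add: sm_pull L36 mult.left_commute)
      also have "\<dots> = sm3 P (\<lambda>x' y' z'. sm3 P (\<lambda>x'' y'' z''. \<epsilon> y'' * E (x'' * l) x' y' q r (z' * (z'' * s))))"
        by (subst counit_right_Q) simp_all
      also have "\<dots> = sm3 P (\<lambda>x' y' z'. E l x' y' q r (z' * s))"
        by (subst reassoc_counit_mid) simp_all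
      also have "\<dots> = F (l * (\<beta> * (S q * (\<alpha> * r))), s)"
        using zigzag_P_law[of "\<lambda>z. F (l * (\<beta> * (S q * (\<alpha> * r))), z * s)"] by (simp add: E_def mult.assoc)
      finally show ?thesis .
    qed
    then show ?thesis by simp
  qed
  also have "\<dots> = F 1"
  proof -
    \<comment> \<open>What is left once the second tensor factor has shrunk to the leg w: a single
      zigzag through x, y and z.\<close>
    define K where "K x y z w = F (x * (\<beta> * (S y * (\<alpha> * z))), w)" for x y z w
    have [simp]: "lmap s hs g \<Longrightarrow> lin s (\<lambda>x. K (g x) b c d)" "lmap s hs g \<Longrightarrow> lin s (\<lambda>x. K a (g x) c d)"
      "lmap s hs g \<Longrightarrow> lin s (\<lambda>x. K a b (g x) d)" "lmap s hs g \<Longrightarrow> lin s (\<lambda>x. K a b c (g x))" for s g a b c d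
      by (simp_all add: K_def)
    have L: "sm2 (D k) (\<lambda>x y. K a (x * b) (y * c) d) = \<epsilon> k * K a b c d" for a b c d k
      using alpha_law[of "\<lambda>z. F (a * (\<beta> * (S b * (z * c))), d)" k] by (simp add: K_def mult.assoc)
    have R: "sm2 (D k) (\<lambda>x y. K (a * x) (b * y) c d) = \<epsilon> k * K a b c d" for a b c d k
      using beta_law[of "\<lambda>z. F (a * (z * (S b * (\<alpha> * c))), d)" k] by (simp add: K_def mult.assoc)
    have "sm3 Q (\<lambda>g h i. sm3 P (\<lambda>l m n. sm2 (D n) (\<lambda>n1 n2. F (l * (\<beta> * (S (g * m) * (\<alpha> * (h * n1)))), i * n2)))) =
      sm3 P (\<lambda>x y z. sm2 (D y) (\<lambda>y1 y2. sm3 P (\<lambda>x' y' z'. sm3 Q (\<lambda>x'' y'' z''. sm2 (D x'') (\<lambda>u v.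
        K ((x * x') * u) ((y1 * y') * v) (y2 * (z' * y'')) (z * z''))))))"
      using pentagon_variants_tens(6)[THEN tens_eqD, of "\<lambda>(x, y, z, w). K x y z w", symmetric]
      by (simp add: e4_defs mult.assoc) (simp add: K_def mult.assoc)
    also have "\<dots> = sm3 P (\<lambda>x y z. sm3 P (\<lambda>x' y' z'. sm3 Q (\<lambda>x'' y'' z''. sm2 (D y) (\<lambda>y1 y2. \<epsilon> x'' *
        K (x * x') (y1 * y') (y2 * (z' * y'')) (z * z'')))))"
      unfolding R by (simp only: smn_defs, iprover intro: sm_perm)
    also have "\<dots> = sm3 P (\<lambda>x y z. \<epsilon> y * sm3 P (\<lambda>x' y' z'. sm3 Q (\<lambda>x'' y'' z''. \<epsilon> x'' *
        K (x * x') y' (z' * y'') (z * z''))))"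
      by (simp add: sm_pull L mult.left_commute)
    also have "\<dots> = sm3 P (\<lambda>x' y' z'. sm3 Q (\<lambda>x'' y'' z''. \<epsilon> x'' * K x' y' (z' * y'') z''))"
      by (subst reassoc_counit_mid) simp_all
    also have "\<dots> = sm3 P (\<lambda>x' y' z'. K x' y' z' 1)"
      by (subst counit_left_Q) simp_all
    also have "\<dots> = F 1"
      using zigzag_P_law[of "\<lambda>z. F (z, 1)"] by (simp add: K_def one_prod_def)
    finally show ?thesis .
  qed
  finally show "sm3 P (\<lambda>x y z. sm (D x) (\<lambda>p. sm del (\<lambda>v. sm (SS y) (\<lambda>s. sm gam (\<lambda>u. sm (D z) (\<lambda>q.
       F (p * (v * (s * (u * q)))))))))) = F 1" .
qed

text \<open>Runs parallel to \<open>zigzag_P_SS\<close> along the inverse coherence diagram, now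
  with evaluations in front of coevaluations.\<close>

lemma zigzag_Q_SS: "zigzag_Q (HH H) SS gam D del"
  unfolding zigzag_Q_def
proof (intro allI impI)
  fix F assume F: "resp (HH H) F"
  note [simp] = resp2_lin[OF F]
  \<comment> \<open>Here \<alpha> joins legs 2, 3 and legs 1, 4, while \<beta> joins legs 4, 5 and
    legs 3, 6.\<close>
  define E where "E a b c d e f = F (S b * (\<alpha> * (c * (\<beta> * S f))), S a * (\<alpha> * (d * (\<beta> * S e))))" for a b c d e f
  have [simp]: "lmap s hs g \<Longrightarrow> lin s (\<lambda>x. E (g x) b c d e f)" "lmap s hs g \<Longrightarrow> lin s (\<lambda>x. E a (g x) c d e f)"
    "lmap s hs g \<Longrightarrow> lin s (\<lambda>x. E a b (g x) d e f)" "lmap s hs g \<Longrightarrow> lin s (\<lambda>x. E a b c (g x) e f)"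
    "lmap s hs g \<Longrightarrow> lin s (\<lambda>x. E a b c d (g x) f)" "lmap s hs g \<Longrightarrow> lin s (\<lambda>x. E a b c d e (g x))" for s g a b c d e f
    by (simp_all add: E_def)
  have L23: "sm2 (D k) (\<lambda>x y. E a (x * b) (y * c) d e f) = \<epsilon> k * E a b c d e f" for a b c d e f k
    using alpha_law[of "\<lambda>z. F (S b * (z * (c * (\<beta> * S f))), S a * (\<alpha> * (d * (\<beta> * S e))))" k] by (simp add: E_def
      mult.assoc)
  have R45: "sm2 (D k) (\<lambda>x y. E a b c (d * x) (e * y) f) = \<epsilon> k * E a b c d e f" for a b c d e f k
    using beta_law[of "\<lambda>z. F (S b * (\<alpha> * (c * (\<beta> * S f))), S a * (\<alpha> * (d * (z * S e))))" k] by (simp add: E_def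
      mult.assoc)
  \<comment> \<open>The contraction in the bracketing that simplification leaves when further
    factors stand in front of the comultiplied leg.\<close>
  have R45': "sm2 (D k) (\<lambda>x y. E a b c (d * (d' * x)) (e * (e' * y)) f) = \<epsilon> k * E a b c (d * d') (e * e') f" for
    a b c d e f k d' e'
    using R45[of k a b c "d * d'" "e * e'" f] by (simp add: mult.assoc)
  have R36: "sm2 (D k) (\<lambda>x y. E a b (c * x) d e (f * y)) = \<epsilon> k * E a b c d e f" for a b c d e f k
    using beta_law[of "\<lambda>z. F (S b * (\<alpha> * (c * (z * S f))), S a * (\<alpha> * (d * (\<beta> * S e))))" k] by (simp add: E_def
      mult.assoc)
  have "sm3 Q (\<lambda>x y z. sm (SS x) (\<lambda>s. sm gam (\<lambda>u. sm (D y) (\<lambda>p. sm del (\<lambda>v. sm (SS z) (\<lambda>t.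
       F (s * (u * (p * (v * t)))))))))) =
    sm (s123 P \<star> s12_3_4 Q \<star> s12_34_56 Q \<star> s34_5_6 P \<star> s345 Q) (\<lambda>(a, b, c, d, e, f). E a b c d e f)"
    by (simp add: s6_defs sm_del sm_gam sm_SS E_def mult.assoc) (simp only: smn_defs, iprover intro: sm_perm)
  also have "\<dots> = sm (s1'23_4_56 Q \<star> s456 P \<star> s123 P \<star> s12_3_45'6 Q \<star> s3_45_6 P) (\<lambda>(a, b, c, d, e, f). E a b c d e f)"
    by (rule tens_eqD[OF zigzag_coherence_Q]) simp
  also have "\<dots> = sm3 P (\<lambda>x y z. sm3 Q (\<lambda>a b c. sm3 P (\<lambda>d e f. sm3 P (\<lambda>g h i. sm3 Q (\<lambda>l m n. sm2 (D a) (\<lambda>a1 a2.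
    sm2 (D n) (\<lambda>n1 n2.
    sm2 (D c) (\<lambda>c' c2. sm2 (D c') (\<lambda>c11 c12. sm2 (D y) (\<lambda>y1 y2. sm2 (D l) (\<lambda>l1 l'. sm2 (D l') (\<lambda>l21 l22.
    E (l1 * (d * a1)) (l21 * (e * a2)) (l22 * (f * (b * x))) ((m * (g * c11)) * y1) ((n1 * (h * c12)) * y2) (n2
      * (i * (c2 * z)))))))))))))))"
    by (simp add: s6_defs mult.assoc) (simp only: smn_defs, iprover intro: sm_perm)
  also have "\<dots> = sm3 P (\<lambda>x y z. \<epsilon> y * sm3 Q (\<lambda>a b c. sm3 P (\<lambda>d e f. sm3 P (\<lambda>g h i. sm3 Q (\<lambda>l m n. sm2 (D a) (\<lambda>a1
    a2. sm2 (D n) (\<lambda>n1 n2.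
    sm2 (D c) (\<lambda>c' c2. sm2 (D c') (\<lambda>c11 c12. E (l * (d * a1)) (e * a2) (f * (b * x)) (m * (g * c11)) (n1 * (h *
      c12)) (n2 * (i * (c2 * z))))))))))))"
    by (simp add: L23 R45 sm_pull)
  also have "\<dots> = sm3 Q (\<lambda>a b c. sm3 P (\<lambda>d e f. sm3 P (\<lambda>g h i. sm3 Q (\<lambda>l m n. sm2 (D a) (\<lambda>a1 a2. sm2 (D n) (\<lambda>n1 n2.
    sm2 (D c) (\<lambda>c' c2. \<epsilon> c' * E (l * (d * a1)) (e * a2) (f * b) (m * g) (n1 * h) (n2 * (i * c2)))))))))"
    by (subst reassoc_counit_mid) (simp_all add: R45')
  also have "\<dots> = sm3 Q (\<lambda>l m n. sm2 (D n) (\<lambda>n1 n2. sm3 P (\<lambda>g h i. sm3 P (\<lambda>d e f. sm3 Q (\<lambda>a b c. sm2 (D a) (\<lambda>a1 a2.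
    E (l * (d * a1)) (e * a2) (f * b) (m * g) (n1 * h) ((n2 * i) * c)))))))"
    by (simp add: mult.assoc) (simp only: smn_defs, iprover intro: sm_perm)
  also have "\<dots> = sm3 Q (\<lambda>l m n. sm2 (D n) (\<lambda>n1 n2. sm3 P (\<lambda>g h i. F (S (n2 * i), S l * (\<alpha> * ((m * g) * (\<beta> * S
    (n1 * h))))))))"
  proof -
    \<comment> \<open>This time the zigzag through legs 2, 3 and 6 lies in the first tensor
      factor.\<close>
    have "sm3 P (\<lambda>d e f. sm3 Q (\<lambda>a b c. sm2 (D a) (\<lambda>a1 a2. E (l * (d * a1)) (e * a2) (f * b) q r (s * c)))) =
       F (S s, S l * (\<alpha> * (q * (\<beta> * S r))))" for l q r s
    proof -
      have "sm3 P (\<lambda>d e f. sm3 Q (\<lambda>a b c. sm2 (D a) (\<lambda>a1 a2. E (l * (d * a1)) (e * a2) (f * b) q r (s * c)))) =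
        sm3 Q (\<lambda>x y z. sm2 (D y) (\<lambda>y1 y2. sm3 Q (\<lambda>x' y' z'. sm3 P (\<lambda>x'' y'' z''. sm2 (D z'') (\<lambda>u v.
          E (l * (x * x'')) (y1 * (x' * y'')) ((y2 * y') * u) q r ((s * (z * z')) * v))))))"
        using pentagon_variants_tens(8)[THEN tens_eqD, of "\<lambda>(x, y, z, w). E (l * x) y z q r (s * w)"]
        by (simp add: e4_defs mult.assoc)
      also have "\<dots> = sm3 Q (\<lambda>x y z. sm3 Q (\<lambda>x' y' z'. sm3 P (\<lambda>x'' y'' z''. sm2 (D y) (\<lambda>y1 y2. \<epsilon> z'' *
          E (l * (x * x'')) (y1 * (x' * y'')) (y2 * y') q r (s * (z * z'))))))"
        unfolding R36 by (simp only: smn_defs, iprover intro: sm_perm)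
      also have "\<dots> = sm3 Q (\<lambda>x y z. \<epsilon> y * sm3 Q (\<lambda>x' y' z'. sm3 P (\<lambda>x'' y'' z''. \<epsilon> z'' *
          E (l * (x * x'')) (x' * y'') y' q r (s * (z * z')))))"
        by (simp add: sm_pull L23 mult.left_commute)
      also have "\<dots> = sm3 Q (\<lambda>x' y' z'. sm3 P (\<lambda>x'' y'' z''. \<epsilon> z'' * E (l * x'') (x' * y'') y' q r (s * z')))"
        by (subst counit_mid_Q) simp_all
      also have "\<dots> = sm3 Q (\<lambda>x' y' z'. E l x' y' q r (s * z'))"
        by (subst counit_right_P) simp_all
      also have "\<dots> = F (S s, S l * (\<alpha> * (q * (\<beta> * S r))))"
        using zigzag_Q_law[of "\<lambda>z. F (z * S s, S l * (\<alpha> * (q * (\<beta> * S r))))"] by (simp add: E_def mult.assoc)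
      finally show ?thesis .
    qed
    then show ?thesis by simp
  qed
  also have "\<dots> = F 1"
  proof -
    define K where "K x y z w = F (S w, S x * (\<alpha> * (y * (\<beta> * S z))))" for x y z w
    have [simp]: "lmap s hs g \<Longrightarrow> lin s (\<lambda>x. K (g x) b c d)" "lmap s hs g \<Longrightarrow> lin s (\<lambda>x. K a (g x) c d)"
      "lmap s hs g \<Longrightarrow> lin s (\<lambda>x. K a b (g x) d)" "lmap s hs g \<Longrightarrow> lin s (\<lambda>x. K a b c (g x))" for s g a b c d
      by (simp_all add: K_def)
    have L: "sm2 (D k) (\<lambda>x y. K (x * a) (y * b) c d) = \<epsilon> k * K a b c d" for a b c d k
      using alpha_law[of "\<lambda>z. F (S d, S a * (z * (b * (\<beta> * S c))))" k] by (simp add: K_def mult.assoc)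
    have R: "sm2 (D k) (\<lambda>x y. K a (b * x) (c * y) d) = \<epsilon> k * K a b c d" for a b c d k
      using beta_law[of "\<lambda>z. F (S d, S a * (\<alpha> * (b * (z * S c))))" k] by (simp add: K_def mult.assoc)
    have "sm3 Q (\<lambda>l m n. sm2 (D n) (\<lambda>n1 n2. sm3 P (\<lambda>g h i. F (S (n2 * i), S l * (\<alpha> * ((m * g) * (\<beta> * S (n1 * h)))))))) =
      sm3 P (\<lambda>x y z. sm2 (D x) (\<lambda>u v. sm3 Q (\<lambda>x' y' z'. sm3 Q (\<lambda>x'' y'' z''. sm2 (D y'') (\<lambda>y1 y2.
        K (u * (x' * x'')) ((v * y') * y1) ((y * z') * y2) (z * z''))))))"
      using pentagon_variants_tens(9)[THEN tens_eqD, of "\<lambda>(x, y, z, w). K x y z w", symmetric]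
      by (simp add: e4_defs mult.assoc) (simp add: K_def mult.assoc)
    also have "\<dots> = sm3 P (\<lambda>x y z. sm3 Q (\<lambda>x' y' z'. sm3 Q (\<lambda>x'' y'' z''. sm2 (D x) (\<lambda>u v. \<epsilon> y'' *
        K (u * (x' * x'')) (v * y') (y * z') (z * z'')))))"
      unfolding R by (simp only: smn_defs, iprover intro: sm_perm)
    also have "\<dots> = sm3 P (\<lambda>x y z. \<epsilon> x * sm3 Q (\<lambda>x' y' z'. sm3 Q (\<lambda>x'' y'' z''. \<epsilon> y'' *
        K (x' * x'') y' (y * z') (z * z''))))"
      by (simp add: sm_pull L mult.left_commute)
    also have "\<dots> = sm3 Q (\<lambda>x' y' z'. sm3 Q (\<lambda>x'' y'' z''. \<epsilon> y'' * K (x' * x'') y' z' z''))"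
      by (subst counit_left_P) simp_all
    also have "\<dots> = sm3 Q (\<lambda>x' y' z'. K x' y' z' 1)"
      by (subst counit_mid_Q) simp_all
    also have "\<dots> = F 1"
      using zigzag_Q_law[of "\<lambda>z. F (1, z)"] by (simp add: K_def one_prod_def)
    finally show ?thesis .
  qed
  finally show "sm3 Q (\<lambda>x y z. sm (SS x) (\<lambda>s. sm gam (\<lambda>u. sm (D y) (\<lambda>p. sm del (\<lambda>v. sm (SS z) (\<lambda>t.
       F (s * (u * (p * (v * t)))))))))) = F 1" .
qed

section \<open>The twist and its inverse\<close>

text \<open>The formula of the Drinfeld twist is the comparison element from h \<mapsto>
  \<Delta>(S(h)) to the reversed family: its last factor \<Delta>(x^2 \<beta> S(x^3)) is
  \<Delta>(x^2) \<Delta>(\<beta>) \<Delta>(S(x^3)).\<close>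

definition "twist = comparison SS gam D (D \<beta>) (\<lambda>h. D (S h))"
text \<open>The comparison element in the opposite direction, hence the candidate for
  f^{-1}.\<close>

definition "twist_inv = comparison (\<lambda>h. D (S h)) (D \<alpha>) D del SS"

lemma sm_twist:
  "sm twist F = sm3 Q (\<lambda>x y z. sm2 (D x) (\<lambda>x1 x2. sm gam (\<lambda>g. sm2 (D y) (\<lambda>y1 y2. sm2 (D \<beta>) (\<lambda>b1 b2. sm2 (D (S
    z)) (\<lambda>z1 z2.
    F ((S x2, S x1) * (g * ((y1, y2) * ((b1, b2) * (z1, z2)))))))))))"
  by (simp add: twist_def sm_SS del: times_Pair)

lemma twist_comul_antipode: "tens (HH H) (twist \<star> D (S h)) = tens (HH H) (SS h \<star> twist)"
  unfolding twist_def
  by (rule comparison_intertwines) (simp_all add: hom_fam_D anti_fam_DS anti_fam_SS ev_SS coev_DS)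

lemma twist_comul_alpha: "tens (HH H) (twist \<star> D \<alpha>) = tens (HH H) gam"
  unfolding twist_def
  by (rule comparison_ev) (simp_all add: hom_fam_D anti_fam_DS anti_fam_SS ev_SS ev_DS coev_DS zigzag_P_DS)

lemma twist_inv_SS: "tens (HH H) (twist_inv \<star> SS h) = tens (HH H) (D (S h) \<star> twist_inv)"
  unfolding twist_inv_def
  by (rule comparison_intertwines) (simp_all add: hom_fam_D anti_fam_DS anti_fam_SS ev_DS coev_SS)

lemma twist_inv_gam: "tens (HH H) (twist_inv \<star> gam) = tens (HH H) (D \<alpha>)"
  unfolding twist_inv_def
  by (rule comparison_ev) (simp_all add: hom_fam_D anti_fam_DS anti_fam_SS ev_SS ev_DS coev_SS zigzag_P_SS)

lemma tens_lmul_HH: "tens (HH H) X = tens (HH H) X' \<Longrightarrow> tens (HH H) Y = tens (HH H) Y' \<Longrightarrow>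
    tens (HH H) (X \<star> Y) = tens (HH H) (X' \<star> Y')"
  by (rule tens_lmul_cong) simp_all

text \<open>Each composite intertwines one of the two families with itself and fixes its evaluation.
  So does 1, and \<open>comparison_unique\<close> identifies them.\<close>

lemma twist_inverse:
  "tens (HH H) (twist_inv \<star> twist) = tens (HH H) [1]" "tens (HH H) (twist \<star> twist_inv) = tens (HH H) [1]"
proof -
  have 1: "tens (HH H) ((twist_inv \<star> twist) \<star> D (S h)) = tens (HH H) (D (S h) \<star> (twist_inv \<star> twist))" for h
    using tens_lmul_HH[OF refl twist_comul_antipode[of h], of twist_inv] tens_lmul_HH[OF twist_inv_SS[of h]
      refl, of twist]
    by (simp add: lmul_assoc)
  have 2: "tens (HH H) ((twist_inv \<star> twist) \<star> D \<alpha>) = tens (HH H) (D \<alpha>)"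
    using tens_lmul_HH[OF refl twist_comul_alpha, of twist_inv] twist_inv_gam
    by (simp add: lmul_assoc)
  show "tens (HH H) (twist_inv \<star> twist) = tens (HH H) [1]"
    using comparison_unique[OF _ zigzag_Q_DS 1 2] comparison_unique[OF _ zigzag_Q_DS, of "[1]" "\<lambda>h. D (S h)" "D
      \<alpha>"] by simp
  have 3: "tens (HH H) ((twist \<star> twist_inv) \<star> SS h) = tens (HH H) (SS h \<star> (twist \<star> twist_inv))" for h
    using tens_lmul_HH[OF refl twist_inv_SS[of h], of twist] tens_lmul_HH[OF twist_comul_antipode[of h] refl, of
      twist_inv]
    by (simp add: lmul_assoc)
  have 4: "tens (HH H) ((twist \<star> twist_inv) \<star> gam) = tens (HH H) gam"
    using tens_lmul_HH[OF refl twist_inv_gam, of twist] twist_comul_alpha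
    by (simp add: lmul_assoc)
  show "tens (HH H) (twist \<star> twist_inv) = tens (HH H) [1]"
    using comparison_unique[OF _ zigzag_Q_SS 3 4] comparison_unique[OF _ zigzag_Q_SS, of "[1]" SS gam] by simp
qed

lemma twist_gamma_eq: "twist_gamma H = tens (HH H) gam"
  unfolding twist_gamma_def
proof (rule tens_eqI)
  fix F assume F: "resp (HH H) F"
  note [simp] = resp2_lin[OF F]
  have m: "mult_ideal (HHHH H)" by simp
  have "twist_A H = tens (HHHH H) (e123 P \<star> e12_3_4 Q)"
    unfolding twist_A_def e4_defs by (rule talg_mult_tens[OF m])
  then have *: "tens (HHHH H) (terms (twist_A H)) = tens (HHHH H) (e123 P \<star> e12_3_4 Q)"
    by (simp only: tens_terms_tens)
  show "sm [(S a2 * \<alpha> * a3, S a1 * \<alpha> * a4). (a1, a2, a3, a4) \<leftarrow> terms (twist_A H)] F = sm gam F"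
    using tens_eqD[OF *, of "\<lambda>(a1, a2, a3, a4). F (S a2 * \<alpha> * a3, S a1 * \<alpha> * a4)"]
    by (simp add: gam_def case_prod_unfold mult.assoc del: sm_lmul)
qed

lemma drinfeld_twist_eq: "drinfeld_twist H = tens (HH H) twist"
  unfolding drinfeld_twist_def
proof (rule tens_eqI)
  fix F assume F: "resp (HH H) F"
  note [simp] = resp2_lin[OF F]
  have [simp]: "sm (terms (twist_gamma H)) K = sm gam K" if "resp (HH H) K" for K
    using that unfolding twist_gamma_eq by (rule sm_terms_tens)
  show "sm [(S x2 * c1 * d1, S x1 * c2 * d2). (x, y, z) \<leftarrow> Q, (x1, x2) \<leftarrow> D x, (c1, c2) \<leftarrow> terms (twist_gamma H),
      (d1, d2) \<leftarrow> D (y * \<beta> * S z)] F = sm twist F"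
    by (simp add: sm_twist case_prod_beta times_prod_def mult.assoc)
qed

lemma drinfeld_twist_inv: "inv\<^bsub>talg (HH H)\<^esub> (drinfeld_twist H) = tens (HH H) twist_inv"
proof -
  interpret monoid "talg (HH H)" by (rule monoid_talg) simp
  show ?thesis
    unfolding drinfeld_twist_eq by (rule inv_unique'[symmetric]) (use twist_inverse in simp_all)
qed

text \<open>With \<epsilon>(\<alpha>) = 1 and invariance of \<epsilon> under S one of the two pairs
  in \<gamma> disappears; the counit laws then remove both reassociators.\<close>

lemma gam_counit:
  assumes G: "lin hs G"
  shows "sm gam (\<lambda>p. \<epsilon> (fst p) * G (snd p)) = G \<alpha>" "sm gam (\<lambda>p. \<epsilon> (snd p) * G (fst p)) = G \<alpha>"
proof -
  note [simp] = G lin_comp[OF G]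
  have "sm gam (\<lambda>p. \<epsilon> (fst p) * G (snd p)) =
    sm3 P (\<lambda>x y z. \<epsilon> y * sm3 Q (\<lambda>x' y' z'. \<epsilon> y' * sm2 (D x') (\<lambda>u v. \<epsilon> v * (\<epsilon> z * G (S (x * u) * (\<alpha> * z'))))))"
    by (simp add: sm_gam mult.assoc mult.left_commute del: D_counit flip: sm_pull)
  also have "\<dots> = sm3 P (\<lambda>x y z. \<epsilon> y * (\<epsilon> z * sm3 Q (\<lambda>x' y' z'. \<epsilon> y' * G (S (x * x') * (\<alpha> * z')))))"
    by (simp add: sm_pull mult.left_commute)
  also have "\<dots> = sm3 P (\<lambda>x y z. \<epsilon> y * (\<epsilon> z * G (S x * \<alpha>)))"
    by (subst counit_mid_Q) simp_all
  also have "\<dots> = G \<alpha>"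
    by (subst reassoc_counit_mid) simp_all
  finally show "sm gam (\<lambda>p. \<epsilon> (fst p) * G (snd p)) = G \<alpha>" .
  have "sm gam (\<lambda>p. \<epsilon> (snd p) * G (fst p)) =
    sm3 P (\<lambda>x y z. \<epsilon> x * sm3 Q (\<lambda>x' y' z'. \<epsilon> z' * sm2 (D x') (\<lambda>u v. \<epsilon> u * (G (S (y * v) * (\<alpha> * (z * y')))))))"
    by (simp add: sm_gam mult.assoc mult.left_commute del: D_counit flip: sm_pull)
  also have "\<dots> = sm3 P (\<lambda>x y z. \<epsilon> x * sm3 Q (\<lambda>x' y' z'. \<epsilon> z' * G (S (y * x') * (\<alpha> * (z * y')))))"
    by simp
  also have "\<dots> = sm3 P (\<lambda>x y z. \<epsilon> x * G (S y * (\<alpha> * z)))"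
    by (subst counit_right_Q) simp_all
  also have "\<dots> = G \<alpha>"
    by (subst counit_left_P) simp_all
  finally show "sm gam (\<lambda>p. \<epsilon> (snd p) * G (fst p)) = G \<alpha>" .
qed

text \<open>Once \<epsilon> is applied to one tensor factor, every \<Delta> collapses and \<gamma>
  becomes \<alpha>; the formula of f turns into the zigzag identity of S.\<close>

lemma twist_counit:
  assumes G: "lin hs G"
  shows "sm twist (\<lambda>p. \<epsilon> (fst p) * G (snd p)) = G 1" "sm twist (\<lambda>p. \<epsilon> (snd p) * G (fst p)) = G 1"
proof -
  note [simp] = G lin_comp[OF G]
  have [simp]: "sm gam (\<lambda>p. \<epsilon> (fst p) * G (a * (snd p * b))) = G (a * (\<alpha> * b))"
    "sm gam (\<lambda>p. \<epsilon> (snd p) * G (a * (fst p * b))) = G (a * (\<alpha> * b))" for a b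
    using gam_counit[of "\<lambda>g. G (a * (g * b))"] by simp_all
  have "sm twist (\<lambda>p. \<epsilon> (fst p) * G (snd p)) = sm3 Q (\<lambda>x y z. sm2 (D x) (\<lambda>x1 x2. \<epsilon> x2 * sm gam (\<lambda>g. \<epsilon> (fst g) *
      sm2 (D y) (\<lambda>y1 y2. \<epsilon> y1 * sm2 (D \<beta>) (\<lambda>b1 b2. \<epsilon> b1 * sm2 (D (S z)) (\<lambda>z1 z2. \<epsilon> z1 * G (S x1 * (snd g * (y2 *
        (b2 * z2))))))))))"
    by (simp add: sm_twist mult.assoc mult.left_commute del: D_counit flip: sm_pull)
  also have "\<dots> = G 1"
    using zigzag_Q_law[of G] by simp
  finally show "sm twist (\<lambda>p. \<epsilon> (fst p) * G (snd p)) = G 1" .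
  have "sm twist (\<lambda>p. \<epsilon> (snd p) * G (fst p)) = sm3 Q (\<lambda>x y z. sm2 (D x) (\<lambda>x1 x2. \<epsilon> x1 * sm gam (\<lambda>g. \<epsilon> (snd g) *
      sm2 (D y) (\<lambda>y1 y2. \<epsilon> y2 * sm2 (D \<beta>) (\<lambda>b1 b2. \<epsilon> b2 * sm2 (D (S z)) (\<lambda>z1 z2. \<epsilon> z2 * G (S x2 * (fst g * (y1 *
        (b1 * z1))))))))))"
    by (simp add: sm_twist mult.assoc mult.left_commute del: D_counit flip: sm_pull)
  also have "\<dots> = G 1"
    using zigzag_Q_law[of G] by simp
  finally show "sm twist (\<lambda>p. \<epsilon> (snd p) * G (fst p)) = G 1" .
qed

end

section \<open>Coherence behind the compatibility of twist and reassociator\<close>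

text \<open>\<open>p1\<close>, \<open>p2\<close>, \<open>p3\<close> are pentagons, \<open>n1\<close>
  to \<open>n4\<close> naturality squares, \<open>c\<close> exchanges disjoint reassociators and
  \<open>i\<close> cancels one of them. The six factors come from the evaluation of a triple
  product, in which three pairs are nested.\<close>

lemma (in monoid) reversal_coherence:
  assumes C: "r1 \<in> carrier G" "r2 \<in> carrier G" "r3 \<in> carrier G" "r4 \<in> carrier G" "r5 \<in> carrier G"
    "l1 \<in> carrier G" "l2 \<in> carrier G" "l3 \<in> carrier G" "l4 \<in> carrier G" "m \<in> carrier G" "n1 \<in> carrier G"
    "r1' \<in> carrier G" "r2' \<in> carrier G" "r2'' \<in> carrier G" "r5' \<in> carrier G"
    "p123 \<in> carrier G" "p456 \<in> carrier G" "q456 \<in> carrier G"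
    and p1: "r3 \<otimes> r4 = l1 \<otimes> (m \<otimes> p123)" and n1: "p123 \<otimes> r5 = r5' \<otimes> p123"
    and n2: "r2 \<otimes> l1 = l1 \<otimes> r2'" and n3: "r2' \<otimes> m = m \<otimes> r2''" and n4: "r1 \<otimes> l1 = l1 \<otimes> r1'"
    and p2: "r2'' \<otimes> r5' = n1 \<otimes> (l4 \<otimes> q456)" and p3: "r1' \<otimes> (m \<otimes> n1) = l2 \<otimes> l3"
    and c: "p123 \<otimes> p456 = p456 \<otimes> p123" and i: "q456 \<otimes> p456 = \<one>"
  shows "r1 \<otimes> (r2 \<otimes> (r3 \<otimes> (r4 \<otimes> (r5 \<otimes> p456)))) = l1 \<otimes> (l2 \<otimes> (l3 \<otimes> (l4 \<otimes> p123)))"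
proof -
  have "r1 \<otimes> (r2 \<otimes> (r3 \<otimes> (r4 \<otimes> (r5 \<otimes> p456)))) = r1 \<otimes> (r2 \<otimes> ((r3 \<otimes> r4) \<otimes> (r5 \<otimes> p456)))"
    by (simp add: C m_assoc)
  also have "\<dots> = r1 \<otimes> ((r2 \<otimes> l1) \<otimes> (m \<otimes> ((p123 \<otimes> r5) \<otimes> p456)))"
    unfolding p1 by (simp add: C m_assoc)
  also have "\<dots> = (r1 \<otimes> l1) \<otimes> ((r2' \<otimes> m) \<otimes> (r5' \<otimes> (p123 \<otimes> p456)))"
    unfolding n1 n2 by (simp add: C m_assoc)
  also have "\<dots> = l1 \<otimes> (r1' \<otimes> (m \<otimes> ((r2'' \<otimes> r5') \<otimes> (p456 \<otimes> p123))))"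
    unfolding n3 n4 c by (simp add: C m_assoc)
  also have "\<dots> = l1 \<otimes> ((r1' \<otimes> (m \<otimes> n1)) \<otimes> (l4 \<otimes> ((q456 \<otimes> p456) \<otimes> p123)))"
    unfolding p2 by (simp add: C m_assoc)
  also have "\<dots> = l1 \<otimes> (l2 \<otimes> (l3 \<otimes> (l4 \<otimes> p123)))"
    unfolding p3 i by (simp add: C m_assoc)
  finally show ?thesis .
qed

context quasi_bialgebra
begin

context
  fixes X :: "('h \<times> 'h \<times> 'h) list"
begin

text \<open>For a leg spread over four positions the apostrophes indicate the bracketing:
  \<open>s1_2'34_5_6\<close>, \<open>s1'23'4_5_6\<close> and \<open>s'1'23''4_5_6\<close> use
  1(2(34)), 1((23)4) and (1(23))4.\<close>

definition "s1_2'34_5 = [(x, y, y1, y2, z, 1::'h). (x, y', z) \<leftarrow> X, (y, y'') \<leftarrow> D y', (y1, y2) \<leftarrow> D y'']"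
definition "s1_2'34_5_6 = [(x1, x2, x3, x4, y, z). (x, y, z) \<leftarrow> X, (x1, x') \<leftarrow> D x, (x2, x'') \<leftarrow> D x', (x3, x4) \<leftarrow> D x'']"
definition "s1_2_34 = [(x, y, z1, z2, 1::'h, 1::'h). (x, y, z) \<leftarrow> X, (z1, z2) \<leftarrow> D z]"
definition "s234 = [(1::'h, x, y, z, 1::'h, 1::'h). (x, y, z) \<leftarrow> X]"
definition "s23_4_5 = [(1::'h, x1, x2, y, z, 1::'h). (x, y, z) \<leftarrow> X, (x1, x2) \<leftarrow> D x]"
definition "s1_23_45 = [(x, y1, y2, z1, z2, 1::'h). (x, y, z) \<leftarrow> X, (y1, y2) \<leftarrow> D y, (z1, z2) \<leftarrow> D z]"
definition "s1'23_45_6 = [(x1, x2, x3, y1, y2, z). (x, y, z) \<leftarrow> X, (x1, x') \<leftarrow> D x, (x2, x3) \<leftarrow> D x', (y1, y2) \<leftarrow> D y]"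
definition "s1_23_4 = [(x, y1, y2, z, 1::'h, 1::'h). (x, y, z) \<leftarrow> X, (y1, y2) \<leftarrow> D y]"
definition "s1_'23'4_5 = [(x, y1, y2, y3, z, 1::'h). (x, y, z) \<leftarrow> X, (y', y3) \<leftarrow> D y, (y1, y2) \<leftarrow> D y']"
definition "s1'23'4_5_6 = [(x1, x2, x3, x4, y, z). (x, y, z) \<leftarrow> X, (x1, x') \<leftarrow> D x, (x'', x4) \<leftarrow> D x', (x2, x3) \<leftarrow> D x'']"
definition "s'1'23''4_5_6 = [(x1, x2, x3, x4, y, z). (x, y, z) \<leftarrow> X, (x', x4) \<leftarrow> D x, (x1, x'') \<leftarrow> D x', (x2, x3) \<leftarrow> D x'']"
definition "s1'23'_4_5 = [(x1, x2, x3, y, z, 1::'h). (x, y, z) \<leftarrow> X, (x1, x') \<leftarrow> D x, (x2, x3) \<leftarrow> D x']"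

lemmas s6_defs' = s1_2'34_5_def s1_2'34_5_6_def s1_2_34_def s234_def s23_4_5_def s1_23_45_def s1'23_45_6_def
  s1_23_4_def s1_'23'4_5_def s1'23'4_5_6_def s'1'23''4_5_6_def s1'23'_4_5_def

end

lemma pentagon_1234:
  "tens T6 (s1_2_34 P \<star> s12_3_4 P) = tens T6 (s234 P \<star> s1_23_4 P \<star> s123 P)"
proof (rule tens_eqI)
  fix F assume F: "resp T6 F"
  note [simp] = resp6_lin[OF F]
  show "sm (s1_2_34 P \<star> s12_3_4 P) F = sm (s234 P \<star> s1_23_4 P \<star> s123 P) F"
    using pentagon_tens[THEN tens_eqD, of "\<lambda>(x, y, z, w). F (x, y, z, w, 1, 1)"]
    by (simp add: e4_defs s6_defs s6_defs')
qed

lemma pentagon_1'23_4_5_6: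
  "tens T6 (s'1'23''4_5_6 Q \<star> s1'23_4_56 Q) = tens T6 (s1'23'_4_5 Q \<star> s1'23_45_6 Q \<star> s456 Q)"
proof (rule tens_eqI)
  fix F assume F: "resp T6 F"
  note [simp] = resp6_lin[OF F]
  have "tens (HHHH H) (e12_3_4 Q \<star> e1_2_34 Q) = tens (HHHH H) (e123 Q \<star> e1_23_4 Q \<star> e234 Q)"
    by (rule pentagon_variants_tens(5))
  from tens_eqD[OF this, of "\<lambda>(x, y, z, w). sm2 (D x) (\<lambda>x1 x'. sm2 (D x') (\<lambda>x2 x3. F (x1, x2, x3, y, z, w)))"]
  show "sm (s'1'23''4_5_6 Q \<star> s1'23_4_56 Q) F = sm (s1'23'_4_5 Q \<star> s1'23_45_6 Q \<star> s456 Q) F"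
    by (simp add: e4_defs s6_defs s6_defs') (erule eq_via; simp only: smn_defs, iprover intro: sm_perm)
qed

lemma pentagon_1_23_4_5:
  "tens T6 (s1_'23'4_5 P \<star> s1_23_4 P \<star> s1'23'_4_5 Q) = tens T6 (s23_4_5 Q \<star> s1_23_45 P)"
proof (rule tens_eqI)
  fix F assume F: "resp T6 F"
  note [simp] = resp6_lin[OF F]
  from pentagon_variants_tens(6)[THEN tens_eqD, of "\<lambda>(x, y, z, w). sm2 (D y) (\<lambda>y1 y2. F (x, y1, y2, z, w, 1))"]
  show "sm (s1_'23'4_5 P \<star> s1_23_4 P \<star> s1'23'_4_5 Q) F = sm (s23_4_5 Q \<star> s1_23_45 P) F"
    by (simp add: e4_defs s6_defs s6_defs') (erule eq_via; simp only: smn_defs, iprover intro: sm_perm)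
qed

lemma naturality_234:
  "tens T6 (s1_2'34_5_6 Q \<star> s234 P) = tens T6 (s234 P \<star> s1'23'4_5_6 Q)"
  "tens T6 (s1_2'34_5 P \<star> s234 P) = tens T6 (s234 P \<star> s1_'23'4_5 P)"
proof -
  have "sm (s1_2'34_5_6 Q \<star> s234 P) F = sm (s234 P \<star> s1'23'4_5_6 Q) F"
    "sm (s1_2'34_5 P \<star> s234 P) F = sm (s234 P \<star> s1_'23'4_5 P) F" if F: "resp T6 F" for F
  proof -
    note [simp] = resp6_lin[OF F]
    have "sm (s1_2'34_5_6 Q \<star> s234 P) F = sm3 Q (\<lambda>x y z. sm2 (D x) (\<lambda>x1 x'. sm2 (D x') (\<lambda>a b. sm2 (D b) (\<lambda>b1 b2.
      sm3 P (\<lambda>u v w.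
        F (x1, a * u, b1 * v, b2 * w, y, z))))))"
      by (simp add: s6_defs s6_defs')
    also have "\<dots> = sm (s234 P \<star> s1'23'4_5_6 Q) F"
      by (subst coassoc(1)) (simp_all add: s6_defs s6_defs', simp only: smn_defs, iprover intro: sm_perm)
    finally show "sm (s1_2'34_5_6 Q \<star> s234 P) F = sm (s234 P \<star> s1'23'4_5_6 Q) F" .
    have "sm (s1_2'34_5 P \<star> s234 P) F = sm3 P (\<lambda>x y z. sm2 (D y) (\<lambda>a b. sm2 (D b) (\<lambda>b1 b2. sm3 P (\<lambda>u v w.
        F (x, a * u, b1 * v, b2 * w, z, 1)))))"
      by (simp add: s6_defs s6_defs')
    also have "\<dots> = sm (s234 P \<star> s1_'23'4_5 P) F"
      by (subst coassoc(1)) (simp_all add: s6_defs s6_defs', simp only: smn_defs, iprover intro: sm_perm)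
    finally show "sm (s1_2'34_5 P \<star> s234 P) F = sm (s234 P \<star> s1_'23'4_5 P) F" .
  qed
  then show "tens T6 (s1_2'34_5_6 Q \<star> s234 P) = tens T6 (s234 P \<star> s1'23'4_5_6 Q)"
    "tens T6 (s1_2'34_5 P \<star> s234 P) = tens T6 (s234 P \<star> s1_'23'4_5 P)"
    by (simp_all add: tens_eq_iff del: sm_lmul resp_trel)
qed

lemma naturality_1_23_4:
  "tens T6 (s1'23'4_5_6 Q \<star> s1_23_4 P) = tens T6 (s1_23_4 P \<star> s'1'23''4_5_6 Q)"
proof (rule tens_eqI)
  fix F assume F: "resp T6 F"
  note [simp] = resp6_lin[OF F]
  have "sm (s1'23'4_5_6 Q \<star> s1_23_4 P) F = sm3 Q (\<lambda>x y z. sm2 (D x) (\<lambda>a b. sm2 (D b) (\<lambda>b1 b2. sm3 P (\<lambda>u v w. sm2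
    (D (b1 * v)) (\<lambda>c d.
      F (a * u, c, d, b2 * w, y, z))))))"
    by (simp add: s6_defs s6_defs') (simp only: smn_defs, iprover intro: sm_perm)
  also have "\<dots> = sm (s1_23_4 P \<star> s'1'23''4_5_6 Q) F"
    by (subst coassoc(1)) (simp_all add: s6_defs s6_defs', simp only: smn_defs, iprover intro: sm_perm)
  finally show "sm (s1'23'4_5_6 Q \<star> s1_23_4 P) F = sm (s1_23_4 P \<star> s'1'23''4_5_6 Q) F" .
qed

lemma inverse_456: "tens T6 (s456 Q \<star> s456 P) = tens T6 [1]"
proof (rule tens_eqI)
  fix F assume F: "resp T6 F"
  note [simp] = resp6_lin[OF F]
  show "sm (s456 Q \<star> s456 P) F = sm [1] F"
    using PQ(2)[of "\<lambda>x y z. F (1, 1, 1, x, y, z)"] by (simp add: s6_defs one_prod_def)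
qed

lemma reversal_coherence_P:
  "tens T6 (s1_2'34_5 P \<star> s1_2'34_5_6 Q \<star> s1_2_34 P \<star> s12_3_4 P \<star> s12'3_4_56 Q \<star> s456 P) =
    tens T6 (s234 P \<star> s23_4_5 Q \<star> s1_23_45 P \<star> s1'23_45_6 Q \<star> s123 P)"
proof -
  interpret monoid "talg T6" by (rule monoid_talg) simp
  have i: "tens T6 (s456 Q) \<otimes>\<^bsub>talg T6\<^esub> tens T6 (s456 P) = \<one>\<^bsub>talg T6\<^esub>"
    by (simp only: T6_mult inverse_456 talg_simps)
  show ?thesis
    using reversal_coherence[OF _ _ _ _ _ _ _ _ _ _ _ _ _ _ _ _ _ _ pentagon_1234[folded T6_mult]
      naturality_123(2)[folded T6_mult] naturality_234(1)[folded T6_mult] naturality_1_23_4[folded T6_mult]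
      naturality_234(2)[folded T6_mult] pentagon_1'23_4_5_6[folded T6_mult] pentagon_1_23_4_5[folded T6_mult]
      commute_123_456[folded T6_mult, symmetric] i]
    by (simp add: T6_mult)
qed

end

context quasi_hopf_algebra
begin

section \<open>The cocycle property of the twist\<close>

text \<open>The left bracketing serves as reference for both sides of the cocycle identity; the
  right bracketing is reached through \<Phi>.\<close>

definition "DL h = [(a1, a2, b). (a, b) \<leftarrow> D h, (a1, a2) \<leftarrow> D a]"
definition "SR h = [(S b, S a2, S a1). (a, b) \<leftarrow> D h, (a1, a2) \<leftarrow> D a]"
definition "P_rev = [(S z, S y, S x). (x, y, z) \<leftarrow> P]"
text \<open>This is (1 \<otimes> f)(id \<otimes> \<Delta>)(f), one of the two ways to extend f to
  three factors; \<open>twist_left\<close> is the other one.\<close>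

definition "twist_right = [(1, a, b). (a, b) \<leftarrow> twist] \<star> [(a, b1, b2). (a, b) \<leftarrow> twist, (b1, b2) \<leftarrow> D b]"
definition "twist_left = [(a, b, 1). (a, b) \<leftarrow> twist] \<star> [(a1, a2, b). (a, b) \<leftarrow> twist, (a1, a2) \<leftarrow> D a]"

lemma uncurry_twist: "sm twist F = sm2 twist (\<lambda>a b. F (a, b))"
  by (rule sm_uncurry)

lemma twist_comul_antipode_law:
  assumes "\<And>y. lin hs (\<lambda>x. F x y)" "\<And>x. lin hs (\<lambda>y. F x y)"
  shows "sm2 twist (\<lambda>a b. sm2 (D (S h)) (\<lambda>c d. F (a * c) (b * d))) = sm2 (D h) (\<lambda>x y. sm2 twist (\<lambda>a b. F (S y *
    a) (S x * b)))"
  using tens_eqD[OF twist_comul_antipode, of "\<lambda>(x, y). F x y" h] assms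
  by (simp add: sm_SS uncurry_twist)

lemma twist_comul_alpha_law:
  assumes "\<And>y. lin hs (\<lambda>x. F x y)" "\<And>x. lin hs (\<lambda>y. F x y)"
  shows "sm2 twist (\<lambda>a b. sm2 (D \<alpha>) (\<lambda>c d. F (a * c) (b * d))) = sm gam (\<lambda>p. F (fst p) (snd p))"
  using tens_eqD[OF twist_comul_alpha, of "\<lambda>(x, y). F x y"] assms
  by (simp add: uncurry_twist case_prod_unfold)

text \<open>The zigzag identity of S pushed through the algebra map (\<Delta> \<otimes> id)\<Delta>;
  it makes \<open>comparison_unique\<close> applicable on three factors.\<close>

lemma zigzag_Q_DL: "zigzag_Q (HHH H) (\<lambda>h. DL (S h)) (DL \<alpha>) DL (DL \<beta>)"
  unfolding zigzag_Q_def
proof (intro allI impI)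
  fix F assume F: "resp (HHH H) F"
  note [simp] = resp3_lin[OF F]
  have DL_mult: "sm (DL (h * k)) K = sm (DL h) (\<lambda>x. sm (DL k) (\<lambda>y. K (x * y)))" if K: "resp (HHH H) K" for h k K
  proof -
    note [simp] = resp3_lin[OF K]
    show ?thesis by (simp add: DL_def) (simp only: smn_defs, iprover intro: sm_perm)
  qed
  have DL_one: "sm (DL 1) K = K 1" if K: "resp (HHH H) K" for K
    by (simp add: DL_def one_prod_def resp3_lin[OF K])
  have DL_lin: "lin hs (\<lambda>z. sm (DL z) F)"
    by (simp add: DL_def)
  have m: "mult_ideal (HHH H)" by simp
  note [simp] = F resp_transl[OF m F] DL_mult DL_one
  show "sm3 Q (\<lambda>x y z. sm (DL (S x)) (\<lambda>s. sm (DL \<alpha>) (\<lambda>u. sm (DL y) (\<lambda>p. sm (DL \<beta>) (\<lambda>v. sm (DL (S z)) (\<lambda>t.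
       F (s * (u * (p * (v * t)))))))))) = F 1"
    using zigzag_Q_law[OF DL_lin] by (simp del: resp_trel)
qed

text \<open>\<Phi> changes the bracketing of the iterated comultiplication from left to right; then
  each of the two copies of f exchanges one \<Delta> with S.\<close>

lemma twist_right_P_antipode:
  "tens (HHH H) ((twist_right \<star> P) \<star> DL (S h)) = tens (HHH H) (SR h \<star> (twist_right \<star> P))"
proof (rule tens_eqI)
  fix F assume F: "resp (HHH H) F"
  note [simp] = resp3_lin[OF F]
  have "sm ((twist_right \<star> P) \<star> DL (S h)) F = sm2 twist (\<lambda>a b. sm2 twist (\<lambda>a' b'. sm2 (D b') (\<lambda>b1 b2. sm3 P (\<lambda>x y z.
    sm2 (D (S h)) (\<lambda>c d. sm2 (D c) (\<lambda>c1 c2. F (a' * (x * c1), a * (b1 * (y * c2)), b * (b2 * (z * d)))))))))"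
    by (simp add: twist_right_def DL_def uncurry_twist mult.assoc)
  also have "\<dots> = sm2 twist (\<lambda>a b. sm2 twist (\<lambda>a' b'. sm2 (D b') (\<lambda>b1 b2.
    sm2 (D (S h)) (\<lambda>c d. sm2 (D d) (\<lambda>d1 d2. sm3 P (\<lambda>x y z. F (a' * (c * x), a * (b1 * (d1 * y)), b * (b2 * (d2 *
      z)))))))))"
    by (subst coassoc(1)[symmetric]) simp_all
  also have "\<dots> = sm3 P (\<lambda>x y z. sm2 twist (\<lambda>a b. sm2 twist (\<lambda>a' b'. sm2 (D (S h)) (\<lambda>c d. sm2 (D (b' * d)) (\<lambda>d1 d2.
     F ((a' * c) * x, a * (d1 * y), b * (d2 * z)))))))"
    by (simp add: mult.assoc) (simp only: smn_defs, iprover intro: sm_perm)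
  also have "\<dots> = sm3 P (\<lambda>x y z. sm2 twist (\<lambda>a b. sm2 (D h) (\<lambda>h1 h2. sm2 twist (\<lambda>a' b'. sm2 (D (S h1 * b')) (\<lambda>d1 d2.
     F ((S h2 * a') * x, a * (d1 * y), b * (d2 * z)))))))"
    by (subst twist_comul_antipode_law) simp_all
  also have "\<dots> = sm3 P (\<lambda>x y z. sm2 (D h) (\<lambda>h1 h2. sm2 twist (\<lambda>a' b'. sm2 (D b') (\<lambda>e1 e2. sm2 twist (\<lambda>a b. sm2
    (D (S h1)) (\<lambda>d1 d2.
     F (S h2 * (a' * x), (a * d1) * (e1 * y), (b * d2) * (e2 * z))))))))"
    by (simp add: mult.assoc) (simp only: smn_defs, iprover intro: sm_perm)
  also have "\<dots> = sm3 P (\<lambda>x y z. sm2 (D h) (\<lambda>h1 h2. sm2 twist (\<lambda>a' b'. sm2 (D b') (\<lambda>e1 e2. sm2 (D h1) (\<lambda>d1 d2.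
    sm2 twist (\<lambda>a b.
     F (S h2 * (a' * x), (S d2 * a) * (e1 * y), (S d1 * b) * (e2 * z))))))))"
    by (subst twist_comul_antipode_law) simp_all
  also have "\<dots> = sm (SR h \<star> (twist_right \<star> P)) F"
    by (simp add: twist_right_def SR_def uncurry_twist mult.assoc) (simp only: smn_defs, iprover intro: sm_perm)
  finally show "sm ((twist_right \<star> P) \<star> DL (S h)) F = sm (SR h \<star> (twist_right \<star> P)) F" .
qed

text \<open>Here the copies of f exchange S with the left-bracketed comultiplication directly, and
  the reversed \<Phi> corrects the bracketing of the outcome.\<close>

lemma P_rev_twist_left_antipode:
  "tens (HHH H) ((P_rev \<star> twist_left) \<star> DL (S h)) = tens (HHH H) (SR h \<star> (P_rev \<star> twist_left))"
proof (rule tens_eqI)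
  fix F assume F: "resp (HHH H) F"
  note [simp] = resp3_lin[OF F]
  have "sm ((P_rev \<star> twist_left) \<star> DL (S h)) F = sm3 P (\<lambda>x y z. sm2 twist (\<lambda>a b. sm2 twist (\<lambda>a' b'. sm2 (D (S h)) (\<lambda>c d.
    sm2 (D (a' * c)) (\<lambda>c1 c2. F (S z * (a * c1), S y * (b * c2), S x * (b' * d)))))))"
    by (simp add: twist_left_def DL_def P_rev_def uncurry_twist mult.assoc) (simp only: smn_defs, iprover intro:
      sm_perm)
  also have "\<dots> = sm3 P (\<lambda>x y z. sm2 twist (\<lambda>a b. sm2 (D h) (\<lambda>h1 h2. sm2 twist (\<lambda>a' b'.
    sm2 (D (S h2 * a')) (\<lambda>c1 c2. F (S z * (a * c1), S y * (b * c2), S x * (S h1 * b')))))))"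
    by (subst twist_comul_antipode_law) simp_all
  also have "\<dots> = sm3 P (\<lambda>x y z. sm2 (D h) (\<lambda>h1 h2. sm2 twist (\<lambda>a' b'. sm2 (D a') (\<lambda>e1 e2. sm2 twist (\<lambda>a b. sm2
    (D (S h2)) (\<lambda>c1 c2.
    F (S z * ((a * c1) * e1), S y * ((b * c2) * e2), S x * (S h1 * b'))))))))"
    by (simp add: mult.assoc) (simp only: smn_defs, iprover intro: sm_perm)
  also have "\<dots> = sm3 P (\<lambda>x y z. sm2 (D h) (\<lambda>h1 h2. sm2 twist (\<lambda>a' b'. sm2 (D a') (\<lambda>e1 e2. sm2 (D h2) (\<lambda>c1 c2.
    sm2 twist (\<lambda>a b.
    F (S z * ((S c2 * a) * e1), S y * ((S c1 * b) * e2), S x * (S h1 * b'))))))))"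
    by (subst twist_comul_antipode_law) simp_all
  also have "\<dots> = sm2 twist (\<lambda>a' b'. sm2 (D a') (\<lambda>e1 e2. sm2 twist (\<lambda>a b. sm2 (D h) (\<lambda>h1 h2. sm2 (D h2) (\<lambda>c1 c2.
    sm3 P (\<lambda>x y z.
    F (S (c2 * z) * (a * e1), S (c1 * y) * (b * e2), S (h1 * x) * b')))))))"
    by (simp add: mult.assoc) (simp only: smn_defs, iprover intro: sm_perm)
  also have "\<dots> = sm2 twist (\<lambda>a' b'. sm2 (D a') (\<lambda>e1 e2. sm2 twist (\<lambda>a b. sm3 P (\<lambda>x y z. sm2 (D h) (\<lambda>h1 h2. sm2
    (D h1) (\<lambda>c1 c2.
    F (S (z * h2) * (a * e1), S (y * c2) * (b * e2), S (x * c1) * b')))))))"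
    by (subst coassoc(1)) (simp_all add: mult.assoc del: antipode_mult)
  also have "\<dots> = sm (SR h \<star> (P_rev \<star> twist_left)) F"
    by (simp add: twist_left_def SR_def P_rev_def uncurry_twist mult.assoc) (simp only: smn_defs, iprover intro:
      sm_perm)
  finally show "sm ((P_rev \<star> twist_left) \<star> DL (S h)) F = sm (SR h \<star> (P_rev \<star> twist_left)) F" .
qed

text \<open>f \<Delta>(S(h) \<alpha> k) = (S \<otimes> S)(\<Delta>^cop(h)) \<gamma> \<Delta>(k). The
  components of \<gamma> are themselves of the form S(h) \<alpha> k, so this resolves a twist in
  front of a comultiplied component of \<gamma>.\<close>

lemma twist_alpha_law:
  assumes F: "\<And>y. lin hs (\<lambda>x. F x y)" "\<And>x. lin hs (\<lambda>y. F x y)"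
  shows "sm2 twist (\<lambda>a b. sm2 (D (S h * (\<alpha> * k))) (\<lambda>c d. F (a * c) (b * d))) =
    sm2 (D h) (\<lambda>x y. sm gam (\<lambda>g. sm2 (D k) (\<lambda>c d. F (S y * (fst g * c)) (S x * (snd g * d)))))"
proof -
  note [simp] = lin_comp[OF F(1)] lin_comp[OF F(2)]
  have "sm2 twist (\<lambda>a b. sm2 (D (S h * (\<alpha> * k))) (\<lambda>c d. F (a * c) (b * d))) =
    sm2 (D k) (\<lambda>k1 k2. sm2 (D \<alpha>) (\<lambda>e1 e2. sm2 twist (\<lambda>a b. sm2 (D (S h)) (\<lambda>c d. F ((a * c) * (e1 * k1)) ((b * d)
      * (e2 * k2))))))"
    by (simp add: mult.assoc) (simp only: smn_defs, iprover intro: sm_perm)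
  also have "\<dots> = sm2 (D k) (\<lambda>k1 k2. sm2 (D \<alpha>) (\<lambda>e1 e2. sm2 (D h) (\<lambda>x y. sm2 twist (\<lambda>a b. F ((S y * a) * (e1 *
    k1)) ((S x * b) * (e2 * k2))))))"
    by (subst twist_comul_antipode_law) simp_all
  also have "\<dots> = sm2 (D k) (\<lambda>k1 k2. sm2 (D h) (\<lambda>x y. sm2 twist (\<lambda>a b. sm2 (D \<alpha>) (\<lambda>e1 e2. F (S y * ((a * e1) *
    k1)) (S x * ((b * e2) * k2))))))"
    by (simp only: mult.assoc smn_defs, iprover intro: sm_perm)
  also have "\<dots> = sm2 (D k) (\<lambda>k1 k2. sm2 (D h) (\<lambda>x y. sm gam (\<lambda>g. F (S y * (fst g * k1)) (S x * (snd g * k2)))))"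
    by (subst twist_comul_alpha_law) simp_all
  also have "\<dots> = sm2 (D h) (\<lambda>x y. sm gam (\<lambda>g. sm2 (D k) (\<lambda>c d. F (S y * (fst g * c)) (S x * (snd g * d)))))"
    by (simp only: smn_defs, iprover intro: sm_perm)
  finally show ?thesis .
qed

text \<open>Repeated use of f \<Delta>(\<alpha>) = \<gamma> removes the twists and leaves a product
  of reassociators on six legs, evaluated by the nested pairs 3, 4 and 2, 5 and 1, 6.\<close>

lemma ev_twist_right:
  assumes F: "resp (HHH H) F"
  shows "sm ((twist_right \<star> P) \<star> DL \<alpha>) F =
    sm ((([(x, y, 1, 1, z, 1). (x, y, z) \<leftarrow> P] \<star> [(x1, x2, 1, 1, y, z). (x, y, z) \<leftarrow> Q, (x1, x2) \<leftarrow> D x]) \<star>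
      s12_3_4 P \<star> s12'3_4_56 Q) \<star> s456 P)
      (\<lambda>(a, b, c, d, e, f). F (S c * (\<alpha> * d), S b * (\<alpha> * e), S a * (\<alpha> * f)))"
proof -
  note [simp] = resp3_lin[OF F]
  have "sm ((twist_right \<star> P) \<star> DL \<alpha>) F = sm2 twist (\<lambda>a b. sm2 twist (\<lambda>a' b'. sm2 (D b') (\<lambda>b1 b2. sm3 P (\<lambda>x y z.
    sm2 (D \<alpha>) (\<lambda>c d. sm2 (D c) (\<lambda>c1 c2. F (a' * (x * c1), a * (b1 * (y * c2)), b * (b2 * (z * d)))))))))"
    by (simp add: twist_right_def DL_def uncurry_twist mult.assoc)
  also have "\<dots> = sm2 twist (\<lambda>a b. sm2 twist (\<lambda>a' b'. sm2 (D b') (\<lambda>b1 b2.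
    sm2 (D \<alpha>) (\<lambda>c d. sm2 (D d) (\<lambda>d1 d2. sm3 P (\<lambda>x y z. F (a' * (c * x), a * (b1 * (d1 * y)), b * (b2 * (d2 * z)))))))))"
    by (subst coassoc(1)[symmetric]) simp_all
  also have "\<dots> = sm3 P (\<lambda>x y z. sm2 twist (\<lambda>a b. sm2 twist (\<lambda>a' b'. sm2 (D \<alpha>) (\<lambda>c d. sm2 (D (b' * d)) (\<lambda>d1 d2.
     F ((a' * c) * x, a * (d1 * y), b * (d2 * z)))))))"
    by (simp add: mult.assoc) (simp only: smn_defs, iprover intro: sm_perm)
  also have "\<dots> = sm3 P (\<lambda>x y z. sm2 twist (\<lambda>a b. sm gam (\<lambda>g. sm2 (D (snd g)) (\<lambda>d1 d2.
     F (fst g * x, a * (d1 * y), b * (d2 * z))))))"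
    by (subst twist_comul_alpha_law) simp_all
  also have "\<dots> = sm3 P (\<lambda>x y z. sm gam (\<lambda>g. sm2 twist (\<lambda>a b. sm2 (D (snd g)) (\<lambda>d1 d2.
     F (fst g * x, (a * d1) * y, (b * d2) * z)))))"
    by (simp only: mult.assoc smn_defs, iprover intro: sm_perm)
  also have "\<dots> = sm3 P (\<lambda>x y z. sm3 P (\<lambda>x' y' z'. sm3 Q (\<lambda>u v w. sm2 (D u) (\<lambda>u1 u2.
     sm2 twist (\<lambda>a b. sm2 (D (S (x' * u1) * (\<alpha> * w))) (\<lambda>d1 d2. F (S (y' * u2) * (\<alpha> * (z' * v)) * x, (a * d1) *
       y, (b * d2) * z)))))))"
    by (subst sm_gam) (simp del: D_hom(2) antipode_mult)
  also have "\<dots> = sm3 P (\<lambda>x y z. sm3 P (\<lambda>x' y' z'. sm3 Q (\<lambda>u v w. sm2 (D u) (\<lambda>u1 u2.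
     sm2 (D (x' * u1)) (\<lambda>h1 h2. sm gam (\<lambda>g. sm2 (D w) (\<lambda>w1 w2. F (S (y' * u2) * (\<alpha> * (z' * v)) * x, (S h2 * (fst
       g * w1)) * y, (S h1 * (snd g * w2)) * z))))))))"
    by (subst twist_alpha_law) simp_all
  also have "\<dots> = sm ((([(x, y, 1, 1, z, 1). (x, y, z) \<leftarrow> P] \<star> [(x1, x2, 1, 1, y, z). (x, y, z) \<leftarrow> Q, (x1, x2) \<leftarrow> D x]) \<star>
      s12_3_4 P \<star> s12'3_4_56 Q) \<star> s456 P)
      (\<lambda>(a, b, c, d, e, f). F (S c * (\<alpha> * d), S b * (\<alpha> * e), S a * (\<alpha> * f)))"
    by (simp add: s6_defs sm_gam mult.assoc) (simp only: smn_defs, iprover intro: sm_perm)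
  finally show ?thesis .
qed

text \<open>As for \<open>ev_twist_right\<close>; here the outcome is already one side of
  \<open>reversal_coherence_P\<close>.\<close>

lemma ev_twist_left:
  assumes F: "resp (HHH H) F"
  shows "sm ((P_rev \<star> twist_left) \<star> DL \<alpha>) F =
    sm (s234 P \<star> s23_4_5 Q \<star> s1_23_45 P \<star> s1'23_45_6 Q \<star> s123 P)
      (\<lambda>(a, b, c, d, e, f). F (S c * (\<alpha> * d), S b * (\<alpha> * e), S a * (\<alpha> * f)))"
proof -
  note [simp] = resp3_lin[OF F]
  have "sm ((P_rev \<star> twist_left) \<star> DL \<alpha>) F = sm3 P (\<lambda>x y z. sm2 twist (\<lambda>a b. sm2 twist (\<lambda>a' b'. sm2 (D \<alpha>) (\<lambda>c d.
    sm2 (D (a' * c)) (\<lambda>c1 c2. F (S z * (a * c1), S y * (b * c2), S x * (b' * d)))))))"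
    by (simp add: twist_left_def DL_def P_rev_def uncurry_twist mult.assoc) (simp only: smn_defs, iprover intro:
      sm_perm)
  also have "\<dots> = sm3 P (\<lambda>x y z. sm2 twist (\<lambda>a b. sm gam (\<lambda>g.
    sm2 (D (fst g)) (\<lambda>c1 c2. F (S z * (a * c1), S y * (b * c2), S x * snd g)))))"
    by (subst twist_comul_alpha_law) simp_all
  also have "\<dots> = sm3 P (\<lambda>x y z. sm gam (\<lambda>g. sm2 twist (\<lambda>a b.
    sm2 (D (fst g)) (\<lambda>c1 c2. F (S z * (a * c1), S y * (b * c2), S x * snd g)))))"
    by (simp only: smn_defs, iprover intro: sm_perm)
  also have "\<dots> = sm3 P (\<lambda>x y z. sm3 P (\<lambda>x' y' z'. sm3 Q (\<lambda>u v w. sm2 (D u) (\<lambda>u1 u2. sm2 twist (\<lambda>a b.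
    sm2 (D (S (y' * u2) * (\<alpha> * (z' * v)))) (\<lambda>c1 c2. F (S z * (a * c1), S y * (b * c2), S x * (S (x' * u1) * (\<alpha> *
      w)))))))))"
    by (subst sm_gam) (simp del: D_hom(2) antipode_mult)
  also have "\<dots> = sm3 P (\<lambda>x y z. sm3 P (\<lambda>x' y' z'. sm3 Q (\<lambda>u v w. sm2 (D u) (\<lambda>u1 u2.
     sm2 (D (y' * u2)) (\<lambda>h1 h2. sm gam (\<lambda>g. sm2 (D (z' * v)) (\<lambda>w1 w2.
       F (S z * (S h2 * (fst g * w1)), S y * (S h1 * (snd g * w2)), S x * (S (x' * u1) * (\<alpha> * w))))))))))"
    by (subst twist_alpha_law) simp_all
  also have "\<dots> = sm (s234 P \<star> s23_4_5 Q \<star> s1_23_45 P \<star> s1'23_45_6 Q \<star> s123 P)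
      (\<lambda>(a, b, c, d, e, f). F (S c * (\<alpha> * d), S b * (\<alpha> * e), S a * (\<alpha> * f)))"
    by (simp add: s6_defs s6_defs' sm_gam mult.assoc) (simp only: smn_defs, iprover intro: sm_perm)
  finally show ?thesis .
qed

text \<open>A leg spread over positions 3 and 4 is contracted by \<alpha> to its counit. The units
  at these positions may therefore be replaced by comultiplied legs, and the factor
  \<open>s1_2_34 P\<close> may be inserted, without changing the value. This produces the other side
  of \<open>reversal_coherence_P\<close>.\<close>

lemma twist_ev_coherence:
  assumes F: "resp (HHH H) F"
  shows "sm ((([(x, y, 1, 1, z, 1). (x, y, z) \<leftarrow> P] \<star> [(x1, x2, 1, 1, y, z). (x, y, z) \<leftarrow> Q, (x1, x2) \<leftarrow> D x]) \<star>
      s12_3_4 P \<star> s12'3_4_56 Q) \<star> s456 P)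
      (\<lambda>(a, b, c, d, e, f). F (S c * (\<alpha> * d), S b * (\<alpha> * e), S a * (\<alpha> * f))) =
    sm (s1_2'34_5 P \<star> s1_2'34_5_6 Q \<star> s1_2_34 P \<star> s12_3_4 P \<star> s12'3_4_56 Q \<star> s456 P)
      (\<lambda>(a, b, c, d, e, f). F (S c * (\<alpha> * d), S b * (\<alpha> * e), S a * (\<alpha> * f)))"
proof -
  note [simp] = resp3_lin[OF F]
  define E where "E a b c d e f = F (S c * (\<alpha> * d), S b * (\<alpha> * e), S a * (\<alpha> * f))" for a b c d e f
  have [simp]: "lmap s hs g \<Longrightarrow> lin s (\<lambda>x. E (g x) b c d e f)" "lmap s hs g \<Longrightarrow> lin s (\<lambda>x. E a (g x) c d e f)"
    "lmap s hs g \<Longrightarrow> lin s (\<lambda>x. E a b (g x) d e f)" "lmap s hs g \<Longrightarrow> lin s (\<lambda>x. E a b c (g x) e f)"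
    "lmap s hs g \<Longrightarrow> lin s (\<lambda>x. E a b c d (g x) f)" "lmap s hs g \<Longrightarrow> lin s (\<lambda>x. E a b c d e (g x))" for s g a b c d e f
    by (simp_all add: E_def)
  have L34: "sm2 (D k) (\<lambda>x y. E a b (x * c) (y * d) e f) = \<epsilon> k * E a b c d e f" for a b c d e f k
    using alpha_law[of "\<lambda>z. F (S c * (z * d), S b * (\<alpha> * e), S a * (\<alpha> * f))" k] by (simp add: E_def mult.assoc)
  \<comment> \<open>The remaining factors are kept as a variable \<open>Z\<close>, because only the
    components of their product matter.\<close>
  have "sm (s1_2'34_5 P \<star> s1_2'34_5_6 Q \<star> s1_2_34 P \<star> Z) (\<lambda>(a, b, c, d, e, f). E a b c d e f) =
    sm (([(x, y, 1, 1, z, 1). (x, y, z) \<leftarrow> P] \<star> [(x1, x2, 1, 1, y, z). (x, y, z) \<leftarrow> Q, (x1, x2) \<leftarrow> D x]) \<star> Z)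
      (\<lambda>(a, b, c, d, e, f). E a b c d e f)" for Z :: "('h \<times> 'h \<times> 'h \<times> 'h \<times> 'h \<times> 'h) list"
  proof -
    define p q r s t u where "p = (fst :: 'h \<times> 'h \<times> 'h \<times> 'h \<times> 'h \<times> 'h \<Rightarrow> 'h)" and "q = (\<lambda>z :: 'h \<times> 'h \<times> 'h \<times> 'h \<times>
      'h \<times> 'h. fst (snd z))"
      and "r = (\<lambda>z :: 'h \<times> 'h \<times> 'h \<times> 'h \<times> 'h \<times> 'h. fst (snd (snd z)))" and "s = (\<lambda>z :: 'h \<times> 'h \<times> 'h \<times> 'h \<times> 'h \<times>
        'h. fst (snd (snd (snd z))))"
      and "t = (\<lambda>z :: 'h \<times> 'h \<times> 'h \<times> 'h \<times> 'h \<times> 'h. fst (snd (snd (snd (snd z)))))" and "u = (\<lambda>z :: 'h \<times> 'h \<times> 'h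
        \<times> 'h \<times> 'h \<times> 'h. snd (snd (snd (snd (snd z)))))"
    note defs = this
    have "sm (s1_2'34_5 P \<star> s1_2'34_5_6 Q \<star> s1_2_34 P \<star> Z) (\<lambda>(a, b, c, d, e, f). E a b c d e f) =
      sm3 P (\<lambda>x y z. sm3 Q (\<lambda>x' y' z'. sm2 (D x') (\<lambda>x1' x2'. sm3 P (\<lambda>a b c. sm Z (\<lambda>m.
      sm2 (D c) (\<lambda>c1 c2. sm2 (D x2') (\<lambda>x21 x22. sm2 (D x22) (\<lambda>x221 x222. sm2 (D y) (\<lambda>y1 y2. sm2 (D y2) (\<lambda>y21 y22.
      E (x * (x1' * (a * p m))) (y1 * (x21 * (b * q m))) (y21 * (x221 * (c1 * r m))) (y22 * (x222 * (c2 * s m)))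
        (z * (y' * t m)) (z' * u m)))))))))))"
      by (simp add: s6_defs' times_prod_def case_prod_unfold defs mult.assoc) (simp only: smn_defs, iprover
        intro: sm_perm)
    also have "\<dots> = sm3 P (\<lambda>x y z. sm3 Q (\<lambda>x' y' z'. sm2 (D x') (\<lambda>x1' x2'. sm3 P (\<lambda>a b c. \<epsilon> c * sm Z (\<lambda>m.
        E (x * (x1' * (a * p m))) (y * (x2' * (b * q m))) (r m) (s m) (z * (y' * t m)) (z' * u m))))))"
      by (simp add: L34 sm_pull)
    also have "\<dots> = sm3 P (\<lambda>x y z. sm3 Q (\<lambda>x' y' z'. sm2 (D x') (\<lambda>x1' x2'. sm Z (\<lambda>m.
        E (x * (x1' * p m)) (y * (x2' * q m)) (r m) (s m) (z * (y' * t m)) (z' * u m)))))"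
      by (subst counit_right_P) simp_all
    also have "\<dots> = sm (([(x, y, 1, 1, z, 1). (x, y, z) \<leftarrow> P] \<star> [(x1, x2, 1, 1, y, z). (x, y, z) \<leftarrow> Q, (x1, x2) \<leftarrow> D
      x]) \<star> Z)
        (\<lambda>(a, b, c, d, e, f). E a b c d e f)"
      by (simp add: times_prod_def case_prod_unfold defs mult.assoc)
    finally show ?thesis .
  qed
  from this[of "s12_3_4 P \<star> s12'3_4_56 Q \<star> s456 P"] show ?thesis
    by (simp only: lmul_assoc E_def)
qed

text \<open>Both sides intertwine h \<mapsto> (\<Delta> \<otimes> id)\<Delta>(S(h)) with
  \<open>SR\<close> and have the same product with (\<Delta> \<otimes> id)\<Delta>(\<alpha>), so
  \<open>comparison_unique\<close> equates both with one comparison element.\<close>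

lemma twist_cocycle: "tens (HHH H) (twist_right \<star> P) = tens (HHH H) (P_rev \<star> twist_left)"
proof -
  have "sm ((P_rev \<star> twist_left) \<star> DL \<alpha>) F = sm ((twist_right \<star> P) \<star> DL \<alpha>) F" if F: "resp (HHH H) F" for F
    unfolding ev_twist_left[OF F] ev_twist_right[OF F] twist_ev_coherence[OF F]
    by (rule tens_eqD[OF reversal_coherence_P, symmetric]) (simp add: resp3_lin[OF F])
  then have 1: "tens (HHH H) ((P_rev \<star> twist_left) \<star> DL \<alpha>) = tens (HHH H) ((twist_right \<star> P) \<star> DL \<alpha>)"
    by (simp add: tens_eq_iff del: sm_lmul resp_trel)
  have m: "mult_ideal (HHH H)" by simp
  show ?thesis
    using comparison_unique[OF m zigzag_Q_DL P_rev_twist_left_antipode 1]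
      comparison_unique[OF m zigzag_Q_DL twist_right_P_antipode refl] by simp
qed

end

section \<open>Two-sided coactions\<close>

text \<open>Solves the pentagon for the inverses of its first two faces; needed because \<Omega>
  contains \<Psi>^{-1}.\<close>

lemma (in monoid) inverse_pentagon:
  assumes C: "a \<in> carrier G" "b \<in> carrier G" "c \<in> carrier G" "d \<in> carrier G" "e \<in> carrier G"
      "a' \<in> carrier G" "b' \<in> carrier G" "c' \<in> carrier G" "d' \<in> carrier G" "e' \<in> carrier G"
    and I: "a' \<otimes> a = \<one>" "b' \<otimes> b = \<one>" "c \<otimes> c' = \<one>" "d \<otimes> d' = \<one>" "e \<otimes> e' = \<one>"
    and p: "a \<otimes> (b \<otimes> c) = d \<otimes> e"
  shows "b' \<otimes> a' = c \<otimes> (e' \<otimes> d')"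
proof -
  have I': "x \<in> carrier G \<Longrightarrow> a' \<otimes> (a \<otimes> x) = x" "x \<in> carrier G \<Longrightarrow> b' \<otimes> (b \<otimes> x) = x"
    "x \<in> carrier G \<Longrightarrow> e \<otimes> (e' \<otimes> x) = x" for x
    by (simp_all add: C I flip: m_assoc)
  have "b' \<otimes> a' = b' \<otimes> (a' \<otimes> ((d \<otimes> e) \<otimes> (e' \<otimes> d')))" by (simp add: C m_assoc I I')
  also have "\<dots> = c \<otimes> (e' \<otimes> d')" by (simp add: C m_assoc I' flip: p)
  finally show ?thesis .
qed

locale quasi_hopf_coaction = quasi_hopf_algebra H + coaction: two_sided_coaction H s \<delta> \<Psi>
  for H :: "('k::field, 'h::{ring,monoid_mult}) quasi_hopf" and s :: "'k \<Rightarrow> 'u::{ring,monoid_mult} \<Rightarrow> 'u"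
    and \<delta> :: "'u \<Rightarrow> ('h \<times> 'u \<times> 'h \<Rightarrow>\<^sub>0 'k) set" and \<Psi> :: "('h \<times> 'h \<times> 'u \<times> 'h \<times> 'h \<Rightarrow>\<^sub>0 'k) set"
begin

abbreviation "dl u \<equiv> terms (\<delta> u)"
abbreviation "W \<equiv> terms \<Psi>"
abbreviation "V \<equiv> terms (inv\<^bsub>talg (HHUHH H s)\<^esub> \<Psi>)"

lemma mult_ideal_U [simp]: "mult_ideal (vrel s)"
  by (rule mult_ideal_vrel[OF coaction.algebra])

lemmas lmap_multU [simp] = lmap_mult[OF coaction.algebra]

lemma uncurry_dl [simp]: "sm (dl u) F = sm3 (dl u) (\<lambda>x y z. F (x, y, z))"
  and uncurry_W [simp]: "sm W G = sm5 W (\<lambda>a b c d e. G (a, b, c, d, e))"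
  and uncurry_V [simp]: "sm V G = sm5 V (\<lambda>a b c d e. G (a, b, c, d, e))"
  by (rule sm_uncurry)+

lemma dl_hom [simp]:
  assumes "\<And>y z. lin hs (\<lambda>x. F x y z)" "\<And>x z. lin s (\<lambda>y. F x y z)" "\<And>x y. lin hs (\<lambda>z. F x y z)"
  shows "sm3 (dl 1) F = F 1 1 1"
    "sm3 (dl (u * v)) F = sm3 (dl u) (\<lambda>x y z. sm3 (dl v) (\<lambda>x' y' z'. F (x * x') (y * y') (z * z')))"
    "lmap s' s g \<Longrightarrow> lin s' (\<lambda>x. sm3 (dl (g x)) F)"
proof -
  have F: "resp (HUH H s) (\<lambda>(x, y, z). F x y z)" using assms by simp
  note hom = alg_hom_terms[OF coaction.coact_hom _ F]
  show "sm3 (dl 1) F = F 1 1 1"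
    "sm3 (dl (u * v)) F = sm3 (dl u) (\<lambda>x y z. sm3 (dl v) (\<lambda>x' y' z'. F (x * x') (y * y') (z * z')))"
    using hom(1,2) by (simp_all add: one_prod_def)
  show "lmap s' s g \<Longrightarrow> lin s' (\<lambda>x. sm3 (dl (g x)) F)"
    using lin_comp[OF hom(3), of s' g] by simp
qed

lemma dl_counit:
  assumes "lin s F"
  shows "sm3 (dl u) (\<lambda>a v d. \<epsilon> a * (\<epsilon> d * F v)) = F u"
  using arg_cong[OF coaction.coact_counit[of u], of F] assms
  by (simp add: lin_sum_list lin_scale case_prod_unfold mult.assoc)

lemma W_tens: "tens (HHUHH H s) W = \<Psi>"
  and WV_tens: "tens (HHUHH H s) (W \<star> V) = tens (HHUHH H s) [1]"
  and VW_tens: "tens (HHUHH H s) (V \<star> W) = tens (HHUHH H s) [1]"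
  using Units_terms[OF coaction.psi_unit] by (simp_all del: sm_lmul)

text \<open>Multilinearity in five arguments as a single premise for the laws of \<Psi>.\<close>

definition "lin5 F \<longleftrightarrow> (\<forall>b c d e. lin hs (\<lambda>x. F x b c d e)) \<and> (\<forall>a c d e. lin hs (\<lambda>x. F a x c d e)) \<and>
  (\<forall>a b d e. lin s (\<lambda>x. F a b x d e)) \<and> (\<forall>a b c e. lin hs (\<lambda>x. F a b c x e)) \<and> (\<forall>a b c d. lin hs (\<lambda>x. F a b c d x))"

lemma WV:
  assumes "lin5 F"
  shows "sm5 W (\<lambda>a b c d e. sm5 V (\<lambda>a' b' c' d' e'. F (a * a') (b * b') (c * c') (d * d') (e * e'))) = F 1 1 1 1 1"
    "sm5 V (\<lambda>a b c d e. sm5 W (\<lambda>a' b' c' d' e'. F (a * a') (b * b') (c * c') (d * d') (e * e'))) = F 1 1 1 1 1"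
  using tens_eqD[OF WV_tens, of "\<lambda>(a, b, c, d, e). F a b c d e"] tens_eqD[OF VW_tens, of "\<lambda>(a, b, c, d, e). F a
    b c d e"]
    assms by (simp_all add: one_prod_def lin5_def)

lemma coassoc_W_tens:
  "tens (HHUHH H s) ([(a, b, v, c, d). (a, w, d) \<leftarrow> dl u, (b, v, c) \<leftarrow> dl w] \<star> W) =
   tens (HHUHH H s) (W \<star> [(a1, a2, v, d1, d2). (a, v, d) \<leftarrow> dl u, (a1, a2) \<leftarrow> D a, (d1, d2) \<leftarrow> D d])"
proof -
  have m: "mult_ideal (HHUHH H s)" by simp
  show ?thesis
    using coaction.coact_coassoc[of u] by (simp only: W_tens flip: talg_mult_tens[OF m])
qed

lemma coassoc_V_tens:
  "tens (HHUHH H s) (V \<star> [(a, b, v, c, d). (a, w, d) \<leftarrow> dl u, (b, v, c) \<leftarrow> dl w]) =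
   tens (HHUHH H s) ([(a1, a2, v, d1, d2). (a, v, d) \<leftarrow> dl u, (a1, a2) \<leftarrow> D a, (d1, d2) \<leftarrow> D d] \<star> V)"
proof -
  let ?T = "talg (HHUHH H s)" and ?t = "tens (HHUHH H s)"
  define X Y where "X = [(a, b, v, c, d). (a, w, d) \<leftarrow> dl u, (b, v, c) \<leftarrow> dl w]"
    and "Y = [(a1, a2, v, d1, d2). (a, v, d) \<leftarrow> dl u, (a1, a2) \<leftarrow> D a, (d1, d2) \<leftarrow> D d]"
  interpret monoid ?T by (rule monoid_talg) simp
  have C: "?t xs \<in> carrier ?T" for xs by simp
  have m: "?t xs \<otimes>\<^bsub>?T\<^esub> ?t ys = ?t (xs \<star> ys)" for xs ys by (rule talg_mult_tens) simp
  have 1: "?t W \<otimes>\<^bsub>?T\<^esub> ?t V = \<one>\<^bsub>?T\<^esub>" "?t V \<otimes>\<^bsub>?T\<^esub> ?t W = \<one>\<^bsub>?T\<^esub>"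
    by (simp_all only: m WV_tens VW_tens talg_simps)
  have 2: "?t X \<otimes>\<^bsub>?T\<^esub> ?t W = ?t W \<otimes>\<^bsub>?T\<^esub> ?t Y"
    unfolding m X_def Y_def by (rule coassoc_W_tens)
  show ?thesis
    using commute_inverse[OF C C C C 1 2[symmetric]] unfolding m X_def Y_def by simp
qed

lemma coact_coassoc_V:
  assumes "lin5 F"
  shows "sm5 V (\<lambda>p q r t w. sm3 (dl u) (\<lambda>a x d. sm3 (dl x) (\<lambda>b v c. F (p * a) (q * b) (r * v) (t * c) (w * d)))) =
    sm3 (dl u) (\<lambda>a v d. sm2 (D a) (\<lambda>a1 a2. sm2 (D d) (\<lambda>d1 d2. sm5 V (\<lambda>p q r t w.
      F (a1 * p) (a2 * q) (v * r) (d1 * t) (d2 * w)))))"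
  using tens_eqD[OF coassoc_V_tens, of "\<lambda>(a, b, c, d, e). F a b c d e" u] assms by (simp add: lin5_def)

lemma coact_coassoc_W:
  assumes "lin5 F"
  shows "sm3 (dl u) (\<lambda>a x d. sm3 (dl x) (\<lambda>b v c. sm5 W (\<lambda>p q r t w. F (a * p) (b * q) (v * r) (c * t) (d * w)))) =
    sm5 W (\<lambda>p q r t w. sm3 (dl u) (\<lambda>a v d. sm2 (D a) (\<lambda>a1 a2. sm2 (D d) (\<lambda>d1 d2.
      F (p * a1) (q * a2) (r * v) (t * d1) (w * d2)))))"
  using tens_eqD[OF coassoc_W_tens, of "\<lambda>(a, b, c, d, e). F a b c d e" u] assms by (simp add: lin5_def)

section \<open>The pentagon of \<Psi> and of its inverse\<close>

abbreviation "T7 \<equiv> HHHUHHH H s"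

context
  fixes X :: "('h \<times> 'h \<times> 'u \<times> 'h \<times> 'h) list"
begin
definition "t_inner = [(1 :: 'h, a, b, v, c, d, 1 :: 'h). (a, b, v, c, d) \<leftarrow> X]"
definition "t_mid = [(a, b1, b2, v, c1, c2, d). (a, b, v, c, d) \<leftarrow> X, (b1, b2) \<leftarrow> D b, (c1, c2) \<leftarrow> D c]"
definition "t_coact = [(a, b, v1, v, v2, c, d). (a, b, w, c, d) \<leftarrow> X, (v1, v, v2) \<leftarrow> dl w]"
definition "t_outer = [(a1, a2, b, v, c, d1, d2). (a, b, v, c, d) \<leftarrow> X, (a1, a2) \<leftarrow> D a, (d1, d2) \<leftarrow> D d]"
end

definition "t_assoc X Y = [(a, b, c, 1 :: 'u, x, y, z). (a, b, c) \<leftarrow> X, (x, y, z) \<leftarrow> Y]"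

lemmas t7_defs = t_inner_def t_mid_def t_coact_def t_outer_def t_assoc_def

lemma psi_pentagon_tens:
  "tens T7 (t_inner W \<star> t_mid W \<star> t_assoc P Q) = tens T7 (t_coact W \<star> t_outer W)"
proof -
  have m: "mult_ideal T7" by simp
  from coaction.psi_pentagon[unfolded talg_mult_tens[OF m] lmul_assoc] show ?thesis unfolding t7_defs .
qed

lemma t7_inverse:
  "tens T7 (t_inner V \<star> t_inner W) = tens T7 [1]" "tens T7 (t_mid V \<star> t_mid W) = tens T7 [1]"
  "tens T7 (t_coact W \<star> t_coact V) = tens T7 [1]" "tens T7 (t_outer W \<star> t_outer V) = tens T7 [1]"
  "tens T7 (t_assoc P Q \<star> t_assoc Q P) = tens T7 [1]"
proof -
  have "sm (t_inner V \<star> t_inner W) F = F 1 \<and> sm (t_mid V \<star> t_mid W) F = F 1 \<and> sm (t_coact W \<star> t_coact V) F = F 1 \<and>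
    sm (t_outer W \<star> t_outer V) F = F 1 \<and> sm (t_assoc P Q \<star> t_assoc Q P) F = F 1" if F: "resp T7 F" for F
  proof (intro conjI)
    note [simp] = resp7_lin[OF F]
    show "sm (t_inner V \<star> t_inner W) F = F 1"
      using WV(2)[of "\<lambda>a b c d e. F (1, a, b, c, d, e, 1)"] by (simp add: t7_defs lin5_def one_prod_def)
    show "sm (t_mid V \<star> t_mid W) F = F 1"
      using WV(2)[of "\<lambda>a b c d e. sm2 (D b) (\<lambda>b1 b2. sm2 (D d) (\<lambda>d1 d2. F (a, b1, b2, c, d1, d2, e)))"]
      by (simp add: t7_defs lin5_def one_prod_def) (erule trans[rotated], simp only: smn_defs, iprover intro: sm_perm)
    show "sm (t_coact W \<star> t_coact V) F = F 1"
      using WV(1)[of "\<lambda>a b c d e. sm3 (dl c) (\<lambda>x y z. F (a, b, x, y, z, d, e))"]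
      by (simp add: t7_defs lin5_def one_prod_def) (erule trans[rotated], simp only: smn_defs, iprover intro: sm_perm)
    show "sm (t_outer W \<star> t_outer V) F = F 1"
      using WV(1)[of "\<lambda>a b c d e. sm2 (D a) (\<lambda>b1 b2. sm2 (D e) (\<lambda>d1 d2. F (b1, b2, b, c, d, d1, d2)))"]
      by (simp add: t7_defs lin5_def one_prod_def) (erule trans[rotated], simp only: smn_defs, iprover intro: sm_perm)
    have "sm (t_assoc P Q \<star> t_assoc Q P) F = sm3 P (\<lambda>x y z. sm3 Q (\<lambda>x' y' z'.
      sm3 Q (\<lambda>a b c. sm3 P (\<lambda>a' b' c'. F (x * x', y * y', z * z', 1, a * a', b * b', c * c')))))"
      by (simp add: t7_defs) (simp only: smn_defs, iprover intro: sm_perm)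
    also have "\<dots> = F 1"
      using PQ(2)[of "\<lambda>a b c. F (_, _, _, 1, a, b, c)"] PQ(1)[of "\<lambda>a b c. F (a, b, c, 1, 1, 1, 1)"] by (simp
        add: one_prod_def)
    finally show "sm (t_assoc P Q \<star> t_assoc Q P) F = F 1" .
  qed
  then show "tens T7 (t_inner V \<star> t_inner W) = tens T7 [1]" "tens T7 (t_mid V \<star> t_mid W) = tens T7 [1]"
  "tens T7 (t_coact W \<star> t_coact V) = tens T7 [1]" "tens T7 (t_outer W \<star> t_outer V) = tens T7 [1]"
  "tens T7 (t_assoc P Q \<star> t_assoc Q P) = tens T7 [1]"
    by (simp_all add: tens_eq_iff del: sm_lmul resp_trel)
qed

text \<open>The form used for the first crossed product, whose \<Omega> is built from
  \<Psi>^{-1}.\<close>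

lemma psi_inv_pentagon_tens:
  "tens T7 (t_mid V \<star> t_inner V) = tens T7 (t_assoc P Q \<star> t_outer V \<star> t_coact V)"
proof -
  interpret monoid "talg T7" by (rule monoid_talg) simp
  have m: "tens T7 xs \<otimes>\<^bsub>talg T7\<^esub> tens T7 ys = tens T7 (xs \<star> ys)" for xs ys
    by (rule talg_mult_tens) simp
  have C: "tens T7 xs \<in> carrier (talg T7)" for xs by simp
  show ?thesis
    by (rule inverse_pentagon[where a = "tens T7 (t_inner W)" and b = "tens T7 (t_mid W)" and c = "tens T7
      (t_assoc P Q)"
     and d = "tens T7 (t_coact W)" and e = "tens T7 (t_outer W)" and a' = "tens T7 (t_inner V)" and b' = "tens
       T7 (t_mid V)"
     and c' = "tens T7 (t_assoc Q P)" and d' = "tens T7 (t_coact V)" and e' = "tens T7 (t_outer V)",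
      unfolded m talg_simps(2), OF C C C C C C C C C C t7_inverse(1,2,5,3,4) psi_pentagon_tens])
qed

text \<open>The form used for the second crossed product, whose \<Omega>' contains \<Psi> itself;
  only the reassociator changes sides.\<close>

lemma psi_pentagon_tens':
  "tens T7 (t_inner W \<star> t_mid W) = tens T7 (t_coact W \<star> t_outer W \<star> t_assoc Q P)"
proof -
  interpret monoid "talg T7" by (rule monoid_talg) simp
  have m: "tens T7 xs \<otimes>\<^bsub>talg T7\<^esub> tens T7 ys = tens T7 (xs \<star> ys)" for xs ys
    by (rule talg_mult_tens) simp
  have C: "tens T7 xs \<in> carrier (talg T7)" for xs by simp
  have 1: "tens T7 (t_assoc P Q) \<otimes>\<^bsub>talg T7\<^esub> tens T7 (t_assoc Q P) = \<one>\<^bsub>talg T7\<^esub>"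
    by (simp only: m t7_inverse talg_simps)
  have "tens T7 (t_inner W \<star> t_mid W) = (tens T7 (t_inner W) \<otimes>\<^bsub>talg T7\<^esub> tens T7 (t_mid W)) \<otimes>\<^bsub>talg T7\<^esub>
    (tens T7 (t_assoc P Q) \<otimes>\<^bsub>talg T7\<^esub> tens T7 (t_assoc Q P))"
    by (simp only: 1 r_one C m_closed) (simp only: m)
  also have "\<dots> = tens T7 ((t_inner W \<star> t_mid W \<star> t_assoc P Q) \<star> t_assoc Q P)"
    by (simp only: m lmul_assoc)
  also have "\<dots> = tens T7 ((t_coact W \<star> t_outer W) \<star> t_assoc Q P)"
    by (simp only: m[symmetric] psi_pentagon_tens[unfolded m[symmetric]])
  finally show ?thesis by (simp only: lmul_assoc)
qed

context
  fixes F :: "'h \<Rightarrow> 'u \<Rightarrow> 'h \<Rightarrow> 'k"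
  assumes F: "\<And>y z. lin hs (\<lambda>x. F x y z)" "\<And>x z. lin s (\<lambda>y. F x y z)" "\<And>x y. lin hs (\<lambda>z. F x y z)"
begin

private lemma F_lin: "lmap s' hs g \<Longrightarrow> lin s' (\<lambda>x. F (g x) y z)" "lmap s' s f \<Longrightarrow> lin s' (\<lambda>y. F x (f y) z)"
    "lmap s' hs g \<Longrightarrow> lin s' (\<lambda>z. F x y (g z))"
  using F by (auto intro: lin_comp[where s'=hs and F="\<lambda>x. F x _ _"] lin_comp[where s'=s and F="\<lambda>x. F _ x _"]
    lin_comp[where s'=hs and F="\<lambda>x. F _ _ x"])

lemma psi_counit_outer: "sm5 W (\<lambda>a b v c d. \<epsilon> a * (\<epsilon> d * F b v c)) = F 1 1 1"
  using tens_eqD[OF coaction.psi_counit_outer, of "\<lambda>(x, y, z). F x y z"] F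
  by (simp add: lin_scale[OF F(2)] mult.assoc)

lemma psi_counit_inner: "sm5 W (\<lambda>a b v c d. \<epsilon> b * (\<epsilon> c * F a v d)) = F 1 1 1"
  using tens_eqD[OF coaction.psi_counit_inner, of "\<lambda>(x, y, z). F x y z"] F
  by (simp add: lin_scale[OF F(2)] mult.assoc)

end

text \<open>Apply the counits to \<Psi>^{-1} \<Psi> = 1; the factor \<Psi> collapses by its own
  counit laws.\<close>

lemma psi_inv_counit:
  assumes F: "\<And>y z. lin hs (\<lambda>x. F x y z)" "\<And>x z. lin s (\<lambda>y. F x y z)" "\<And>x y. lin hs (\<lambda>z. F x y z)"
  shows "sm5 V (\<lambda>a b v c d. \<epsilon> a * (\<epsilon> d * F b v c)) = F 1 1 1" "sm5 V (\<lambda>a b v c d. \<epsilon> b * (\<epsilon> c * F a v d)) = F 1 1 1"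
proof -
  have [simp]: "lmap s' hs g \<Longrightarrow> lin s' (\<lambda>x. F (g x) y z)" "lmap s' s f \<Longrightarrow> lin s' (\<lambda>y. F x (f y) z)"
    "lmap s' hs g \<Longrightarrow> lin s' (\<lambda>z. F x y (g z))" for s' f g x y z
    using F by (auto intro: lin_comp[where s'=hs and F="\<lambda>x. F x _ _"] lin_comp[where s'=s and F="\<lambda>x. F _ x _"]
      lin_comp[where s'=hs and F="\<lambda>x. F _ _ x"])
  have *: "sm5 W (\<lambda>a b v c d. \<epsilon> a * (\<epsilon> d * F (b' * b) (v' * v) (c' * c))) = F b' v' c'"
    "sm5 W (\<lambda>a b v c d. \<epsilon> b * (\<epsilon> c * F (b' * a) (v' * v) (c' * d))) = F b' v' c'" for b' v' c'
    using psi_counit_outer[of "\<lambda>b v c. F (b' * b) (v' * v) (c' * c)"] psi_counit_inner[of "\<lambda>b v c. F (b' * b)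
      (v' * v) (c' * c)"]
    by simp_all
  have "sm5 V (\<lambda>a b v c d. sm5 W (\<lambda>a' b' v' c' d'. \<epsilon> (a * a') * (\<epsilon> (d * d') * F (b * b') (v * v') (c * c')))) =
    sm5 V (\<lambda>a b v c d. \<epsilon> a * (\<epsilon> d * F b v c))"
  proof -
    have "sm5 W (\<lambda>a' b' v' c' d'. \<epsilon> (a * a') * (\<epsilon> (d * d') * F (b * b') (v * v') (c * c'))) =
      \<epsilon> a * (\<epsilon> d * sm5 W (\<lambda>a' b' v' c' d'. \<epsilon> a' * (\<epsilon> d' * F (b * b') (v * v') (c * c'))))" for a b v c d
      by (simp add: mult.left_commute mult.assoc flip: sm_pull)
    then show ?thesis by (simp only: *)
  qed
  then show "sm5 V (\<lambda>a b v c d. \<epsilon> a * (\<epsilon> d * F b v c)) = F 1 1 1"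
    using WV(2)[of "\<lambda>a b v c d. \<epsilon> a * (\<epsilon> d * F b v c)"] by (simp add: lin5_def)
  have "sm5 V (\<lambda>a b v c d. sm5 W (\<lambda>a' b' v' c' d'. \<epsilon> (b * b') * (\<epsilon> (c * c') * F (a * a') (v * v') (d * d')))) =
    sm5 V (\<lambda>a b v c d. \<epsilon> b * (\<epsilon> c * F a v d))"
  proof -
    have "sm5 W (\<lambda>a' b' v' c' d'. \<epsilon> (b * b') * (\<epsilon> (c * c') * F (a * a') (v * v') (d * d'))) =
      \<epsilon> b * (\<epsilon> c * sm5 W (\<lambda>a' b' v' c' d'. \<epsilon> b' * (\<epsilon> c' * F (a * a') (v * v') (d * d'))))" for a b v c d
      by (simp add: mult.left_commute mult.assoc flip: sm_pull)
    then show ?thesis by (simp only: *)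
  qed
  then show "sm5 V (\<lambda>a b v c d. \<epsilon> b * (\<epsilon> c * F a v d)) = F 1 1 1"
    using WV(2)[of "\<lambda>a b v c d. \<epsilon> b * (\<epsilon> c * F a v d)"] by (simp add: lin5_def)
qed

end

section \<open>Algebras on tensor spaces\<close>

lemma cring_alg_of_field: "cring (alg_of ((*) :: 'k::field \<Rightarrow> 'k \<Rightarrow> 'k))"
proof (rule cringI)
  show "abelian_group (alg_of ((*) :: 'k \<Rightarrow> 'k \<Rightarrow> 'k))"
  proof (rule abelian_groupI)
    show "\<exists>y\<in>carrier (alg_of (*)). y \<oplus>\<^bsub>alg_of (*)\<^esub> x = \<zero>\<^bsub>alg_of (*)\<^esub>" for x :: 'k
      by (rule bexI[of _ "- x"]) (simp_all add: alg_of_def)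
  qed (simp_all add: alg_of_def algebra_simps)
  show "comm_monoid (alg_of ((*) :: 'k \<Rightarrow> 'k \<Rightarrow> 'k))"
    by (rule comm_monoidI) (simp_all add: alg_of_def algebra_simps)
qed (simp add: alg_of_def algebra_simps)

lemma sm_minus: "sm xs (\<lambda>x. - F x) = - sm xs F"
  using sm_diff[of xs "\<lambda>x. 0" F] by simp

text \<open>Common frame of the two crossed products. The product of two generators is a list, and
  all laws are required only under forms, so that they pass to cosets. The map \<open>sc\<close>
  realizes a scalar multiple of a pure tensor as a pure tensor.\<close>

locale tensor_product_structure =
  fixes R :: "('x \<Rightarrow>\<^sub>0 'k::field) set" and sc :: "'k \<Rightarrow> 'x \<Rightarrow> 'x" and pr :: "'x \<Rightarrow> 'x \<Rightarrow> 'x list" and e :: 'x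
  assumes sc: "resp R F \<Longrightarrow> F (sc c x) = c * F x"
    and pr_left: "resp R F \<Longrightarrow> resp R (\<lambda>x. sm (pr x y) F)"
    and pr_right: "resp R F \<Longrightarrow> resp R (\<lambda>y. sm (pr x y) F)"
    and pr_assoc: "resp R F \<Longrightarrow> sm (pr x y) (\<lambda>w. sm (pr w z) F) = sm (pr y z) (\<lambda>w. sm (pr x w) F)"
    and pr_unit_left: "resp R F \<Longrightarrow> sm (pr e x) F = F x"
    and pr_unit_right: "resp R F \<Longrightarrow> sm (pr x e) F = F x"
begin

definition "T = tspace R (\<lambda>t t'. tens R [z. x \<leftarrow> terms t, y \<leftarrow> terms t', z \<leftarrow> pr x y]) (tens R [e])"

lemma T_simps [simp]: "carrier T = range (tens R)" "\<one>\<^bsub>T\<^esub> = tens R [e]" "\<zero>\<^bsub>T\<^esub> = tens R []"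
  by (simp_all add: T_def tspace_def)

lemma T_add [simp]: "tens R xs \<oplus>\<^bsub>T\<^esub> tens R ys = tens R (xs @ ys)"
  unfolding T_def by (rule tspace_add)

lemma T_smult [simp]: "c \<odot>\<^bsub>T\<^esub> tens R xs = tens R (map (sc c) xs)"
proof -
  have "p \<in> c \<odot>\<^bsub>T\<^esub> tens R xs \<longleftrightarrow> p \<in> tens R (map (sc c) xs)" for p
    unfolding T_def mem_tspace_smult mem_tens by (simp add: sc sm_scale)
  then show ?thesis by blast
qed

lemma T_mult [simp]: "tens R xs \<otimes>\<^bsub>T\<^esub> tens R ys = tens R [z. x \<leftarrow> xs, y \<leftarrow> ys, z \<leftarrow> pr x y]"
proof -
  have "tens R [z. x \<leftarrow> terms (tens R xs), y \<leftarrow> terms (tens R ys), z \<leftarrow> pr x y] = tens R [z. x \<leftarrow> xs, y \<leftarrow> ys, z \<leftarrow> pr x y]"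
  proof (rule tens_eqI)
    fix F assume F: "resp R F"
    have 1: "sm (terms (tens R xs)) (\<lambda>x. sm (pr x y) F) = sm xs (\<lambda>x. sm (pr x y) F)" for y
      by (rule sm_terms_tens) (rule pr_left[OF F])
    have 2: "sm (terms (tens R ys)) (\<lambda>y. sm (pr x y) F) = sm ys (\<lambda>y. sm (pr x y) F)" for x
      by (rule sm_terms_tens) (rule pr_right[OF F])
    show "sm [z. x \<leftarrow> terms (tens R xs), y \<leftarrow> terms (tens R ys), z \<leftarrow> pr x y] F = sm [z. x \<leftarrow> xs, y \<leftarrow> ys, z \<leftarrow> pr x y] F"
      by (simp add: 2) (simp add: sm_swap[of _ ys] 1)
  qed
  then show ?thesis by (simp add: T_def tspace_def)
qed

lemma ring_T: "ring T"
proof (rule ringI)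
  show "abelian_group T"
  proof (rule abelian_groupI)
    fix t assume "t \<in> carrier T"
    then obtain xs where t: "t = tens R xs" by auto
    show "\<exists>y\<in>carrier T. y \<oplus>\<^bsub>T\<^esub> t = \<zero>\<^bsub>T\<^esub>"
      by (rule bexI[of _ "tens R (map (sc (- 1)) xs)"]) (auto simp: t sc sm_minus intro!: tens_eqI)
  qed (clarsimp simp: add.commute intro!: tens_eqI | force intro!: tens_eqI)+
  show "monoid T"
  proof (rule monoidI)
    fix x y z assume "x \<in> carrier T" "y \<in> carrier T" "z \<in> carrier T"
    then obtain xs ys zs where *: "x = tens R xs" "y = tens R ys" "z = tens R zs" by auto
    show "x \<otimes>\<^bsub>T\<^esub> y \<otimes>\<^bsub>T\<^esub> z = x \<otimes>\<^bsub>T\<^esub> (y \<otimes>\<^bsub>T\<^esub> z)"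
    proof -
      have "sm xs (\<lambda>x. sm ys (\<lambda>y. sm (pr x y) (\<lambda>w. sm zs (\<lambda>z. sm (pr w z) F)))) =
        sm xs (\<lambda>x. sm ys (\<lambda>y. sm zs (\<lambda>z. sm (pr y z) (\<lambda>w. sm (pr x w) F))))" if "resp R F" for F
        by (simp add: sm_swap[of _ zs] pr_assoc[OF that])
      then show ?thesis by (auto simp: * intro!: tens_eqI)
    qed
  qed (clarsimp, (rule tens_eqI, simp add: pr_unit_left pr_unit_right)?)+
next
  fix x y z assume "x \<in> carrier T" "y \<in> carrier T" "z \<in> carrier T"
  then obtain xs ys zs where *: "x = tens R xs" "y = tens R ys" "z = tens R zs" by auto
  show "(x \<oplus>\<^bsub>T\<^esub> y) \<otimes>\<^bsub>T\<^esub> z = x \<otimes>\<^bsub>T\<^esub> z \<oplus>\<^bsub>T\<^esub> y \<otimes>\<^bsub>T\<^esub> z" "z \<otimes>\<^bsub>T\<^esub> (x \<oplus>\<^bsub>T\<^esub> y) = z \<otimes>\<^bsub>T\<^esub> x \<oplus>\<^bsub>T\<^esub> z \<otimes>\<^bsub>T\<^esub> y"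
    unfolding * T_mult T_add by (rule tens_eqI, simp add: sm_add)+
qed

lemma k_algebra_T: "k_algebra T"
proof -
  interpret ring T by (rule ring_T)
  have "Module.module (alg_of ((*) :: 'k \<Rightarrow> 'k \<Rightarrow> 'k)) T"
  proof (rule moduleI[OF cring_alg_of_field])
    show "abelian_group T" by (rule is_abelian_group)
  qed (clarsimp simp: alg_of_def sc sm_scale sm_add algebra_simps, (rule tens_eqI)?, (simp add: sc sm_scale
    sm_add algebra_simps)?)+
  moreover have "(c \<odot>\<^bsub>T\<^esub> t) \<otimes>\<^bsub>T\<^esub> t' = c \<odot>\<^bsub>T\<^esub> (t \<otimes>\<^bsub>T\<^esub> t') \<and> t \<otimes>\<^bsub>T\<^esub> (c \<odot>\<^bsub>T\<^esub> t') = c \<odot>\<^bsub>T\<^esub> (t \<otimes>\<^bsub>T\<^esub> t')"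
    if tt: "t \<in> carrier T" "t' \<in> carrier T" for c t t'
  proof -
    obtain xs ys where *: "t = tens R xs" "t' = tens R ys" using tt by auto
    have "sm (pr (sc c x) y) F = c * sm (pr x y) F" "sm (pr x (sc c y)) F = c * sm (pr x y) F" if "resp R F" for F x y
      using sc[OF pr_left[OF that, of y]] sc[OF pr_right[OF that, of x]] by simp_all
    then show ?thesis by (auto simp: * sc sm_scale intro!: tens_eqI)
  qed
  ultimately show ?thesis unfolding k_algebra_def using ring_T by blast
qed

lemma alg_hom_T:
  assumes "\<And>F u v. resp R F \<Longrightarrow> F (i (u + v)) = F (i u) + F (i v)" "\<And>F c u. resp R F \<Longrightarrow> F (i (s c u)) = c * F (i u)"
    and "\<And>F u v. resp R F \<Longrightarrow> sm (pr (i u) (i v)) F = F (i (u * v))" "i 1 = e"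
  shows "(\<lambda>u. tens R [i u]) \<in> alg_hom (alg_of s) T"
  using assms by (auto simp: alg_hom_def alg_of_def ring_hom_def sc intro!: tens_eqI)

end

section \<open>Smash products\<close>

text \<open>
  \<open>RK\<close> presents a quasi-bialgebra that acts on \<open>'a\<close> and coacts on \<open>'u\<close>; \<open>KD\<close> and \<open>KP\<close> are
  its comultiplication and reassociator, and the coaction \<open>lam\<close> is coassociative up to \<open>Om\<close>.
\<close>

locale smash_product_data =
  fixes sA :: "'k::field \<Rightarrow> 'a::ab_group_add \<Rightarrow> 'a" and sU :: "'k \<Rightarrow> 'u::ab_group_add \<Rightarrow> 'u" and RK :: "('x \<Rightarrow>\<^sub>0 'k) set"
    and mA :: "'a \<Rightarrow> 'a \<Rightarrow> 'a" and mU :: "'u \<Rightarrow> 'u \<Rightarrow> 'u" and act :: "'x \<Rightarrow> 'a \<Rightarrow> 'a" and kmul :: "'x \<Rightarrow> 'x \<Rightarrow> 'x"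
    and KD :: "'x \<Rightarrow> ('x \<times> 'x) list" and KP :: "('x \<times> 'x \<times> 'x) list" and lam :: "'u \<Rightarrow> ('x \<times> 'u) list" and Om ::
      "('x \<times> 'x \<times> 'u) list"
  assumes act_kmul: "act (kmul x y) p = act x (act y p)"
    and kmul_assoc: "kmul (kmul x y) z = kmul x (kmul y z)"
    and mU_assoc: "mU (mU u v) w = mU u (mU v w)"
    and act_resp: "lin sA g \<Longrightarrow> resp RK (\<lambda>x. g (act x p))"
    and act_lin: "lin sA g \<Longrightarrow> lin sA (\<lambda>p. g (act x p))"
    and mA_lin: "lin sA g \<Longrightarrow> lin sA (\<lambda>p. g (mA p q))" "lin sA g \<Longrightarrow> lin sA (\<lambda>q. g (mA p q))"
    and mU_lin: "lin sU f \<Longrightarrow> lin sU (\<lambda>u. f (mU u v))" "lin sU f \<Longrightarrow> lin sU (\<lambda>v. f (mU u v))"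
    and kmul_resp: "resp RK F \<Longrightarrow> resp RK (\<lambda>x. F (kmul x y))" "resp RK F \<Longrightarrow> resp RK (\<lambda>y. F (kmul x y))"
    and mA_assoc: "lin sA g \<Longrightarrow> g (mA (mA p q) r) = sm3 KP (\<lambda>x y z. g (mA (act x p) (mA (act y q) (act z r))))"
    and act_mA: "lin sA g \<Longrightarrow> g (act x (mA p q)) = sm2 (KD x) (\<lambda>y z. g (mA (act y p) (act z q)))"
    and KD_kmul: "\<lbrakk>\<And>z. resp RK (\<lambda>y. F2 y z); \<And>y. resp RK (F2 y)\<rbrakk> \<Longrightarrow>
       sm2 (KD (kmul x x')) F2 = sm2 (KD x) (\<lambda>y z. sm2 (KD x') (\<lambda>y' z'. F2 (kmul y y') (kmul z z')))"
    and lam_mU: "\<lbrakk>\<And>v. resp RK (\<lambda>x. L x v); \<And>x. lin sU (L x)\<rbrakk> \<Longrightarrow>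
       sm2 (lam (mU u u')) L = sm2 (lam u) (\<lambda>x v. sm2 (lam u') (\<lambda>x' v'. L (kmul x x') (mU v v')))"
    and lam_lin: "\<lbrakk>\<And>v. resp RK (\<lambda>x. L x v); \<And>x. lin sU (L x)\<rbrakk> \<Longrightarrow> lin sU (\<lambda>u. sm2 (lam u) L)"
    and lam_Om: "\<lbrakk>\<And>y u. resp RK (\<lambda>x. F3 x y u); \<And>x u. resp RK (\<lambda>y. F3 x y u); \<And>x y. lin sU (F3 x y)\<rbrakk> \<Longrightarrow>
       sm3 Om (\<lambda>x y w. sm2 (lam u) (\<lambda>a v. sm2 (lam v) (\<lambda>b v'. F3 (kmul x a) (kmul y b) (mU w v')))) =
       sm2 (lam u) (\<lambda>a v. sm2 (KD a) (\<lambda>a1 a2. sm3 Om (\<lambda>x y w. F3 (kmul a1 x) (kmul a2 y) (mU v w))))"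
    and Om_pentagon: "\<lbrakk>\<And>y z u. resp RK (\<lambda>x. F4 x y z u); \<And>x z u. resp RK (\<lambda>y. F4 x y z u);
         \<And>x y u. resp RK (\<lambda>z. F4 x y z u); \<And>x y z. lin sU (F4 x y z)\<rbrakk> \<Longrightarrow>
       sm3 KP (\<lambda>X Y Z. sm3 Om (\<lambda>x y w. sm2 (KD x) (\<lambda>x1 x2. sm3 Om (\<lambda>x' y' w'. sm2 (lam w') (\<lambda>a v.
         F4 (kmul X (kmul x1 x')) (kmul Y (kmul x2 y')) (kmul Z (kmul y a)) (mU w v)))))) =
       sm3 Om (\<lambda>x y w. sm2 (KD y) (\<lambda>y1 y2. sm3 Om (\<lambda>x' y' w'. F4 x (kmul y1 x') (kmul y2 y') (mU w w'))))"
begin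

text \<open>In Sweedler notation, the value of G on (\<Omega>^1 p)(\<Omega>^2 u_(-1) q) \<otimes>
  \<Omega>^3 u_(0) v, the product of p \<otimes> u and q \<otimes> v.\<close>

definition "prodform p u q v G =
  sm3 Om (\<lambda>x y w. sm2 (lam u) (\<lambda>a b. G (mA (act x p) (act (kmul y a) q)) (mU w (mU b v))))"

text \<open>In the left-bracketed product an outer leg of \<open>Om\<close> acts on a product, which
  costs a comultiplication, and rebracketing costs the reassociator \<open>KP\<close>. The pentagon
  of \<open>Om\<close> trades them for a comultiplication of the second leg, and coassociativity of
  \<open>lam\<close> up to \<open>Om\<close> reassembles the right-bracketed product.\<close>

lemma prodform_assoc:
  assumes G: "\<And>u. lin sA (\<lambda>p. G p u)" "\<And>p. lin sU (G p)"
  shows "prodform p u q v (\<lambda>p' u'. prodform p' u' r t G) = prodform q v r t (\<lambda>p' u'. prodform p u p' u' G)"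
proof -
  have l1: "lin sA (\<lambda>m. G (mA m n) u)" for n u by (rule mA_lin(1)) (rule G)
  have l2: "lin sA (\<lambda>m. G (mA n (mA m n')) u)" for n n' u
    using mA_lin(1)[OF mA_lin(2)[OF G(1)]] .
  have l3: "lin sA (\<lambda>m. G (mA n (mA n' m)) u)" for n n' u
    using mA_lin(2)[OF mA_lin(2)[OF G(1)]] .
  have [simp]: "resp RK (\<lambda>x. G (mA (act x p) n) u)" for p n u by (rule act_resp[OF l1])
  have r2: "resp RK (\<lambda>x. G (mA n (mA (act x q) n')) u)" for n n' u q by (rule act_resp[OF l2])
  have r3: "resp RK (\<lambda>x. G (mA n (mA n' (act x q))) u)" for n n' u q by (rule act_resp[OF l3])
  have [simp]: "resp RK (\<lambda>x. G (mA n (mA (act (kmul x y) q) n')) u)" "resp RK (\<lambda>x. G (mA n (mA (act (kmul y x)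
    q) n')) u)"
    "resp RK (\<lambda>x. G (mA n (mA (act (kmul y (kmul x z)) q) n')) u)" for n n' u q y z
    using kmul_resp(1)[OF r2] kmul_resp(2)[OF r2] kmul_resp(1)[OF kmul_resp(2)[OF r2]] by simp_all
  have [simp]: "resp RK (\<lambda>x. G (mA n (mA n' (act (kmul x y) q))) u)" "resp RK (\<lambda>x. G (mA n (mA n' (act (kmul y
    x) q))) u)"
    "resp RK (\<lambda>x. G (mA n (mA n' (act (kmul y (kmul x z)) q))) u)" for n n' u q y z
    using kmul_resp(1)[OF r3] kmul_resp(2)[OF r3] kmul_resp(1)[OF kmul_resp(2)[OF r3]] by simp_all
  have l4: "lin sA (\<lambda>m. G (mA n m) u)" for n u by (rule mA_lin(2)) (rule G)
  have r4: "resp RK (\<lambda>x. G (mA n (act x q)) u)" for n u q by (rule act_resp[OF l4])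
  have [simp]: "resp RK (\<lambda>x. G (mA n (act (kmul y x) q)) u)" "resp RK (\<lambda>x. G (mA n (act (kmul y (kmul x z)) q)) u)"
    "resp RK (\<lambda>x. G (mA n (act (kmul y (kmul z (kmul x z'))) q)) u)"
    "resp RK (\<lambda>x. G (mA n (act (kmul y (kmul z x)) q)) u)" "resp RK (\<lambda>x. G (mA n (act (kmul y (kmul z (kmul z'
      x))) q)) u)" for n u q y z z'
    using kmul_resp(2)[OF kmul_resp(2)[OF r4]] kmul_resp(2)[OF kmul_resp(2)[OF kmul_resp(2)[OF r4]]]
      kmul_resp(2)[OF r4] kmul_resp(1)[OF kmul_resp(2)[OF r4]] kmul_resp(1)[OF kmul_resp(2)[OF kmul_resp(2)[OF
        r4]]] by simp_all
  have [simp]: "lin sU (\<lambda>u. G p (mU u w))" "lin sU (\<lambda>u. G p (mU w u))" "lin sU (\<lambda>u. G p (mU w (mU u w')))"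
    "lin sU (\<lambda>u. G p (mU w (mU w' u)))" "lin sU (\<lambda>u. G p (mU w (mU w' (mU u w''))))" for p w w' w''
    using mU_lin(1)[OF G(2)] mU_lin(2)[OF G(2)] mU_lin(1)[OF mU_lin(2)[OF G(2)]] mU_lin(2)[OF mU_lin(2)[OF G(2)]]
      mU_lin(1)[OF mU_lin(2)[OF mU_lin(2)[OF G(2)]]] by simp_all
  note [simp] = kmul_assoc mU_assoc
  \<comment> \<open>Collects what the pentagon does not touch: the two successive coactions on u and
    the coaction on v.\<close>
  define K where "K \<alpha> \<beta> \<gamma> \<omega> = sm2 (lam u) (\<lambda>a b. sm2 (lam b) (\<lambda>c2 d2. sm2 (lam v) (\<lambda>c3 d3.
    G (mA (act \<alpha> p) (mA (act (kmul \<beta> a) q) (act (kmul \<gamma> (kmul c2 c3)) r))) (mU \<omega> (mU d2 (mU d3 t))))))" for \<alpha> \<beta> \<gamma> \<omega>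
  have "prodform p u q v (\<lambda>p' u'. prodform p' u' r t G) =
    sm3 Om (\<lambda>x y w. sm2 (lam u) (\<lambda>a b. sm3 Om (\<lambda>x' y' w'. sm2 (lam w) (\<lambda>c1 d1. sm2 (lam b) (\<lambda>c2 d2. sm2 (lam v) (\<lambda>c3 d3.
      G (mA (act x' (mA (act x p) (act (kmul y a) q))) (act (kmul y' (kmul c1 (kmul c2 c3))) r)) (mU w' (mU d1
        (mU d2 (mU d3 t))))))))))"
    by (simp add: prodform_def lam_mU)
  also have "\<dots> = sm3 Om (\<lambda>x y w. sm2 (lam u) (\<lambda>a b. sm3 Om (\<lambda>x' y' w'. sm2 (lam w) (\<lambda>c1 d1. sm2 (lam b) (\<lambda>c2 d2.
    sm2 (lam v) (\<lambda>c3 d3.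
      sm2 (KD x') (\<lambda>x1 x2. sm3 KP (\<lambda>X Y Z.
      G (mA (act (kmul X (kmul x1 x)) p) (mA (act (kmul Y (kmul x2 (kmul y a))) q) (act (kmul Z (kmul y' (kmul
        c1 (kmul c2 c3)))) r))) (mU w' (mU d1 (mU d2 (mU d3 t))))))))))))"
    by (subst act_mA[OF l1]) (subst mA_assoc[OF G(1)], simp add: act_kmul)
  also have "\<dots> = sm3 KP (\<lambda>X Y Z. sm3 Om (\<lambda>x y w. sm2 (KD x) (\<lambda>x1 x2. sm3 Om (\<lambda>x' y' w'. sm2 (lam w') (\<lambda>a v.
         K (kmul X (kmul x1 x')) (kmul Y (kmul x2 y')) (kmul Z (kmul y a)) (mU w v))))))"
    by (simp add: K_def) (simp only: smn_defs, iprover intro: sm_perm)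
  also have "\<dots> = sm3 Om (\<lambda>x y w. sm2 (KD y) (\<lambda>y1 y2. sm3 Om (\<lambda>x' y' w'. K x (kmul y1 x') (kmul y2 y') (mU w w'))))"
    by (rule Om_pentagon) (simp_all add: K_def)
  also have "\<dots> = sm3 Om (\<lambda>x y w. sm2 (KD y) (\<lambda>y1 y2. sm2 (lam v) (\<lambda>c3 d3. sm3 Om (\<lambda>x' y' w'. sm2 (lam u) (\<lambda>a b.
    sm2 (lam b) (\<lambda>c2 d2.
    G (mA (act x p) (mA (act (kmul y1 (kmul x' a)) q) (act (kmul y2 (kmul (kmul y' c2) c3)) r))) (mU w (mU (mU
      w' d2) (mU d3 t)))))))))"
    by (simp add: K_def) (simp only: smn_defs, iprover intro: sm_perm)
  \<comment> \<open>The inner copy of \<open>Om\<close> passes the two coactions on u and replaces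
    them by one coaction followed by \<open>KD\<close>.\<close>
  also have "\<dots> = sm3 Om (\<lambda>x y w. sm2 (KD y) (\<lambda>y1 y2. sm2 (lam v) (\<lambda>c3 d3. sm2 (lam u) (\<lambda>a b. sm2 (KD a) (\<lambda>a1 a2.
    sm3 Om (\<lambda>x' y' w'.
    G (mA (act x p) (mA (act (kmul y1 (kmul a1 x')) q) (act (kmul y2 (kmul (kmul a2 y') c3)) r))) (mU w (mU (mU
      b w') (mU d3 t)))))))))"
    by (subst lam_Om) simp_all
  \<comment> \<open>The comultiplications of y and a combine to that of their product, which is what
    acts on the product of the last two factors.\<close>
  also have "\<dots> = sm3 Om (\<lambda>x y w. sm2 (lam v) (\<lambda>c3 d3. sm2 (lam u) (\<lambda>a b. sm3 Om (\<lambda>x' y' w'. sm2 (KD (kmul y a)) (\<lambda>k1 k2.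
    G (mA (act x p) (mA (act k1 (act x' q)) (act k2 (act (kmul y' c3) r)))) (mU w (mU b (mU w' (mU d3 t)))))))))"
    by (simp add: KD_kmul r2 r3) (simp add: act_kmul, simp only: smn_defs, iprover intro: sm_perm)
  also have "\<dots> = prodform q v r t (\<lambda>p' u'. prodform p u p' u' G)"
    by (simp add: prodform_def act_mA[OF l4]) (simp only: smn_defs, iprover intro: sm_perm)
  finally show ?thesis .
qed

lemma prodform_lin:
  assumes G: "\<And>u. lin sA (\<lambda>p. G p u)" "\<And>p. lin sU (G p)"
  shows "lin sA (\<lambda>p. prodform p u q v G)" "lin sU (\<lambda>u. prodform p u q v G)"
    "lin sA (\<lambda>q. prodform p u q v G)" "lin sU (\<lambda>v. prodform p u q v G)"
proof -
  have 1: "lin sA (\<lambda>m. G (mA m n) u)" "lin sA (\<lambda>m. G (mA n m) u)" for n u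
    by (rule mA_lin(1), rule G, rule mA_lin(2), rule G)
  have 2: "lin sU (\<lambda>v. G n (mU w (mU b v)))" "lin sU (\<lambda>b. G n (mU w (mU b v)))" for n w b v
    using mU_lin(2)[OF mU_lin(2)[OF G(2)]] mU_lin(1)[OF mU_lin(2)[OF G(2)]] .
  show "lin sA (\<lambda>p. prodform p u q v G)" "lin sA (\<lambda>q. prodform p u q v G)" "lin sU (\<lambda>v. prodform p u q v G)"
    using act_lin[OF 1(1)] act_lin[OF 1(2)] by (simp_all add: prodform_def 2)
  have "resp RK (\<lambda>a. G (mA n (act (kmul y a) q)) u)" for n y u
    using kmul_resp(2)[OF act_resp[OF 1(2)]] .
  then show "lin sU (\<lambda>u. prodform p u q v G)"
    unfolding prodform_def by (intro lin_smn lam_lin 2)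
qed

end

locale unital_smash_product_data = smash_product_data sA sU RK mA mU act kmul KD KP lam Om
  for sA :: "'k::field \<Rightarrow> 'a::ab_group_add \<Rightarrow> 'a" and sU :: "'k \<Rightarrow> 'u::ab_group_add \<Rightarrow> 'u" and RK :: "('x \<Rightarrow>\<^sub>0 'k) set"
    and mA mU act kmul KD KP lam Om +
  fixes eA :: 'a and eU :: 'u and kone :: 'x and cK :: "'x \<Rightarrow> 'k"
  assumes mA_one: "mA eA p = p" "mA p eA = p" and mU_one: "mU eU u = u"
    and act_eA: "act x eA = sA (cK x) eA" and act_kone: "act kone p = p" and kmul_kone: "kmul x kone = x"
    and cK_kmul: "cK (kmul x y) = cK x * cK y"
    and Om_counit: "\<lbrakk>\<And>u. resp RK (\<lambda>x. F x u); \<And>x. lin sU (F x)\<rbrakk> \<Longrightarrow> sm3 Om (\<lambda>x y w. cK x * F y w) = F kone eU"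
      "\<lbrakk>\<And>u. resp RK (\<lambda>x. F x u); \<And>x. lin sU (F x)\<rbrakk> \<Longrightarrow> sm3 Om (\<lambda>x y w. cK y * F x w) = F kone eU"
    and lam_counit: "lin sU f \<Longrightarrow> sm2 (lam u) (\<lambda>a v. cK a * f v) = f u"
    and lam_one: "\<lbrakk>\<And>u. resp RK (\<lambda>x. F x u); \<And>x. lin sU (F x)\<rbrakk> \<Longrightarrow> sm2 (lam eU) F = F kone eU"
begin

lemma prodform_unit_left:
  assumes G: "\<And>u. lin sA (\<lambda>p. G p u)" "\<And>p. lin sU (G p)"
  shows "prodform eA eU q v G = G q v"
proof -
  have r: "resp RK (\<lambda>x. G (act x q) u)" for u by (rule act_resp[OF G(1)])
  have l: "lin sU (\<lambda>u. G p (mU u v))" for p by (rule mU_lin(1)[OF G(2)])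
  have l2: "lin sU (\<lambda>u. G p (mU w (mU u v)))" for p w by (rule mU_lin(1)[OF mU_lin(2)[OF G(2)]])
  have "G (mA (act x eA) p) u = cK x * G p u" for x p u
    using lin_scale[OF mA_lin(1)[OF G(1)[of u]], of "cK x" eA p] by (simp add: act_eA mA_one)
  then have "prodform eA eU q v G = sm3 Om (\<lambda>x y w. cK x * sm2 (lam eU) (\<lambda>a b. G (act (kmul y a) q) (mU w (mU b v))))"
    by (simp add: prodform_def sm_pull)
  also have "\<dots> = sm3 Om (\<lambda>x y w. cK x * G (act y q) (mU w v))"
    by (subst lam_one) (simp_all add: kmul_resp(2)[OF r] l2 kmul_kone mU_one)
  also have "\<dots> = G q v"
    by (subst Om_counit) (simp_all add: r l act_kone mU_one)
  finally show ?thesis .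
qed

text \<open>Since v is arbitrary, this yields the right unit law and also the multiplicativity of u
  \<mapsto> 1 \<otimes> u.\<close>

lemma prodform_unit_right:
  assumes G: "\<And>u. lin sA (\<lambda>p. G p u)" "\<And>p. lin sU (G p)"
  shows "prodform p u eA v G = G p (mU u v)"
proof -
  have r: "resp RK (\<lambda>x. G (act x q) u)" for u q by (rule act_resp[OF G(1)])
  have l: "lin sU (\<lambda>u. G p (mU u v))" for p v by (rule mU_lin(1)[OF G(2)])
  have l2: "lin sU (\<lambda>u. G p (mU w (mU u v)))" for p w by (rule mU_lin(1)[OF mU_lin(2)[OF G(2)]])
  have "G (mA p (act x eA)) u = cK x * G p u" for x p u
    using lin_scale[OF mA_lin(2)[OF G(1)[of u]], of p "cK x" eA] by (simp add: act_eA mA_one)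
  then have "prodform p u eA v G = sm3 Om (\<lambda>x y w. cK y * sm2 (lam u) (\<lambda>a b. cK a * G (act x p) (mU w (mU b v))))"
    by (simp add: prodform_def cK_kmul mult.assoc sm_pull)
  also have "\<dots> = sm3 Om (\<lambda>x y w. cK y * G (act x p) (mU w (mU u v)))"
    by (subst lam_counit) (simp_all add: l2)
  also have "\<dots> = G p (mU u v)"
    by (subst Om_counit) (simp_all add: r l act_kone mU_one)
  finally show ?thesis .
qed

end

section \<open>Twist identities at the inverse antipode\<close>

context quasi_hopf_algebra
begin

abbreviation "Si \<equiv> antipode_inv H"

lemma S_Si [simp]: "S (Si x) = x" and Si_S [simp]: "Si (S x) = x"
  using antipode_bij by (simp_all add: bij_is_surj surj_f_inv_f bij_is_inj inv_f_f)

lemma Si_mult: "Si (x * y) = Si y * Si x"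
  using Si_S[of "Si y * Si x"] by (simp add: antipode_mult)

lemma Si_one [simp]: "Si 1 = 1"
  using Si_S[of 1] by (simp add: antipode_one)

lemma counit_Si [simp]: "\<epsilon> (Si x) = \<epsilon> x"
  using counit_antipode[of "Si x"] by simp

lemma lmap_Si [simp]: "lmap s hs g \<Longrightarrow> lmap s hs (\<lambda>x. Si (g x))"
proof -
  have "S (Si x + Si y) = x + y" "S (hs c (Si x)) = hs c x" for x y c
    using lmap_S by (simp_all add: lmap_def)
  then have "Si (x + y) = Si x + Si y" "Si (hs c x) = hs c (Si x)" for x y c
    by (metis Si_S)+
  then show "lmap s hs g \<Longrightarrow> lmap s hs (\<lambda>x. Si (g x))" by (simp add: lmap_def)
qed

lemma uncurry_twist_inv: "sm twist_inv F = sm2 twist_inv (\<lambda>a b. F (a, b))"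
  by (rule sm_uncurry)

text \<open>The relation between f, \<Delta> and S at the element S^{-1}(h), read under S^{-1}
  \<otimes> S^{-1}. It lets \<Delta> pass the S^{-1} in \<Omega> and in the coaction; the factors c
  and d leave room for the surrounding products.\<close>

lemma twist_Si:
  assumes "\<And>y. lin hs (\<lambda>x. F x y)" "\<And>x. lin hs (\<lambda>y. F x y)"
  shows "sm2 (D (Si h)) (\<lambda>x y. sm2 twist (\<lambda>a b. F (Si (a * c) * y) (Si (b * d) * x))) =
    sm2 twist (\<lambda>a b. sm2 (D h) (\<lambda>x y. F (Si (a * (x * c))) (Si (b * (y * d)))))"
proof -
  note [simp] = lin_comp[OF assms(1)] lin_comp[OF assms(2)]
  show ?thesis
    using twist_comul_antipode_law[of "\<lambda>p q. F (Si (p * c)) (Si (q * d))" "Si h"] by (simp add: Si_mult mult.assoc)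
qed

text \<open>The same for f^{-1}. The free factors stand on the left because \<Omega>' multiplies by
  f^{-1} from the right.\<close>

lemma twist_inv_Si:
  assumes "\<And>y. lin hs (\<lambda>x. F x y)" "\<And>x. lin hs (\<lambda>y. F x y)"
  shows "sm2 (D (Si h)) (\<lambda>x y. sm2 twist_inv (\<lambda>a b. F (y * Si (c * a)) (x * Si (d * b)))) =
    sm2 (D h) (\<lambda>x y. sm2 twist_inv (\<lambda>a b. F (Si (c * (x * a))) (Si (d * (y * b)))))"
proof -
  note [simp] = lin_comp[OF assms(1)] lin_comp[OF assms(2)]
  have "sm (twist_inv \<star> SS (Si h)) (\<lambda>(p, q). F (Si (c * p)) (Si (d * q))) =
    sm (D (S (Si h)) \<star> twist_inv) (\<lambda>(p, q). F (Si (c * p)) (Si (d * q)))"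
    by (rule tens_eqD[OF twist_inv_SS]) simp
  then show ?thesis
    by (simp add: sm_SS uncurry_twist_inv Si_mult mult.assoc) (erule trans[rotated], simp only: smn_defs,
      iprover intro: sm_perm)
qed

text \<open>Apply a counit to f^{-1} f = 1 and collapse f by \<open>twist_counit\<close>.\<close>

lemma twist_inv_counit:
  assumes G: "lin hs G"
  shows "sm2 twist_inv (\<lambda>a b. \<epsilon> a * G b) = G 1" "sm2 twist_inv (\<lambda>a b. \<epsilon> b * G a) = G 1"
proof -
  note [simp] = G lin_comp[OF G]
  have "sm (twist_inv \<star> twist) (\<lambda>(p, q). \<epsilon> p * G q) = G 1"
    using tens_eqD[OF twist_inverse(1), of "\<lambda>(p, q). \<epsilon> p * G q"] by (simp add: one_prod_def)
  moreover have "sm (twist_inv \<star> twist) (\<lambda>(p, q). \<epsilon> p * G q) = sm2 twist_inv (\<lambda>a b. \<epsilon> a * sm twist (\<lambda>p. \<epsilon> (fst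
    p) * G (b * snd p)))"
    by (simp add: uncurry_twist_inv case_prod_unfold mult.assoc sm_pull)
  ultimately show "sm2 twist_inv (\<lambda>a b. \<epsilon> a * G b) = G 1"
    using twist_counit(1)[of "\<lambda>x. G (_ * x)"] by simp
  have "sm (twist_inv \<star> twist) (\<lambda>(p, q). \<epsilon> q * G p) = G 1"
    using tens_eqD[OF twist_inverse(1), of "\<lambda>(p, q). \<epsilon> q * G p"] by (simp add: one_prod_def)
  moreover have "sm (twist_inv \<star> twist) (\<lambda>(p, q). \<epsilon> q * G p) = sm2 twist_inv (\<lambda>a b. \<epsilon> b * sm twist (\<lambda>p. \<epsilon> (snd
    p) * G (a * fst p)))"
    by (simp add: uncurry_twist_inv case_prod_unfold mult.assoc sm_pull)
  ultimately show "sm2 twist_inv (\<lambda>a b. \<epsilon> b * G a) = G 1"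
    using twist_counit(2)[of "\<lambda>x. G (_ * x)"] by simp
qed

definition "Q_rev = [(S z, S y, S x). (x, y, z) \<leftarrow> Q]"
definition "twist_inv_left = [(a1, a2, b). (a, b) \<leftarrow> twist_inv, (a1, a2) \<leftarrow> D a] \<star> [(a, b, 1). (a, b) \<leftarrow> twist_inv]"
definition "twist_inv_right = [(a, b1, b2). (a, b) \<leftarrow> twist_inv, (b1, b2) \<leftarrow> D b] \<star> [(1, a, b). (a, b) \<leftarrow> twist_inv]"

lemma twist_inverse_law:
  assumes "\<And>y. lin hs (\<lambda>x. F x y)" "\<And>x. lin hs (\<lambda>y. F x y)"
  shows "sm2 twist_inv (\<lambda>a b. sm2 twist (\<lambda>c d. F (a * c) (b * d))) = F 1 1"
    "sm2 twist (\<lambda>a b. sm2 twist_inv (\<lambda>c d. F (a * c) (b * d))) = F 1 1"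
  using tens_eqD[OF twist_inverse(1), of "\<lambda>(x, y). F x y"] tens_eqD[OF twist_inverse(2), of "\<lambda>(x, y). F x y"] assms
  by (simp_all add: uncurry_twist uncurry_twist_inv one_prod_def)

lemma twist_left_inverse:
  "tens (HHH H) (twist_left \<star> twist_inv_left) = tens (HHH H) [1]" "tens (HHH H) (twist_inv_left \<star> twist_left) =
    tens (HHH H) [1]"
  "tens (HHH H) (twist_right \<star> twist_inv_right) = tens (HHH H) [1]" "tens (HHH H) (twist_inv_right \<star>
    twist_right) = tens (HHH H) [1]"
  "tens (HHH H) (P_rev \<star> Q_rev) = tens (HHH H) [1]" "tens (HHH H) (Q_rev \<star> P_rev) = tens (HHH H) [1]"
proof -
  have *: "tens (HHH H) ((a \<star> b) \<star> (b' \<star> a')) = tens (HHH H) [1]"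
    if "tens (HHH H) (a \<star> a') = tens (HHH H) [1]" "tens (HHH H) (b \<star> b') = tens (HHH H) [1]" for a b a' b'
  proof -
    have m: "mult_ideal (HHH H)" by simp
    have "tens (HHH H) (a \<star> (b \<star> b') \<star> a') = tens (HHH H) (a \<star> [1] \<star> a')"
      using that by (intro tens_lmul_cong[OF m] refl)
    then show ?thesis using that by (simp add: lmul_assoc)
  qed
  let ?f1 = "[(a, b, 1). (a, b) \<leftarrow> twist]" and ?f2 = "[(a1, a2, b). (a, b) \<leftarrow> twist, (a1, a2) \<leftarrow> D a]"
    and ?g1 = "[(1, a, b). (a, b) \<leftarrow> twist]" and ?g2 = "[(a, b1, b2). (a, b) \<leftarrow> twist, (b1, b2) \<leftarrow> D b]"
    and ?f1' = "[(a, b, 1). (a, b) \<leftarrow> twist_inv]" and ?f2' = "[(a1, a2, b). (a, b) \<leftarrow> twist_inv, (a1, a2) \<leftarrow> D a]"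
    and ?g1' = "[(1, a, b). (a, b) \<leftarrow> twist_inv]" and ?g2' = "[(a, b1, b2). (a, b) \<leftarrow> twist_inv, (b1, b2) \<leftarrow> D b]"
  have "sm (?f1 \<star> ?f1') F = F 1 \<and> sm (?f1' \<star> ?f1) F = F 1 \<and> sm (?g1 \<star> ?g1') F = F 1 \<and> sm (?g1' \<star> ?g1) F = F 1 \<and>
    sm (?f2 \<star> ?f2') F = F 1 \<and> sm (?f2' \<star> ?f2) F = F 1 \<and> sm (?g2 \<star> ?g2') F = F 1 \<and> sm (?g2' \<star> ?g2) F = F 1 \<and>
    sm (P_rev \<star> Q_rev) F = F 1 \<and> sm (Q_rev \<star> P_rev) F = F 1" if F: "resp (HHH H) F" for F
  proof -
    note [simp] = resp3_lin[OF F] uncurry_twist uncurry_twist_inv one_prod_def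
    have "sm (?f1 \<star> ?f1') F = F 1 \<and> sm (?f1' \<star> ?f1) F = F 1 \<and> sm (?g1 \<star> ?g1') F = F 1 \<and> sm (?g1' \<star> ?g1) F = F 1"
      using twist_inverse_law[of "\<lambda>a b. F (a, b, 1)"] twist_inverse_law[of "\<lambda>a b. F (1, a, b)"] by simp
    moreover have "sm (?f2 \<star> ?f2') F = F 1"
      using twist_inverse_law(2)[of "\<lambda>a b. sm2 (D a) (\<lambda>a1 a2. F (a1, a2, b))"]
      by simp (erule trans[rotated], simp only: smn_defs, iprover intro: sm_perm)
    moreover have "sm (?f2' \<star> ?f2) F = F 1"
      using twist_inverse_law(1)[of "\<lambda>a b. sm2 (D a) (\<lambda>a1 a2. F (a1, a2, b))"]
      by simp (erule trans[rotated], simp only: smn_defs, iprover intro: sm_perm)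
    moreover have "sm (?g2 \<star> ?g2') F = F 1"
      using twist_inverse_law(2)[of "\<lambda>a b. sm2 (D b) (\<lambda>a1 a2. F (a, a1, a2))"]
      by simp (erule trans[rotated], simp only: smn_defs, iprover intro: sm_perm)
    moreover have "sm (?g2' \<star> ?g2) F = F 1"
      using twist_inverse_law(1)[of "\<lambda>a b. sm2 (D b) (\<lambda>a1 a2. F (a, a1, a2))"]
      by simp (erule trans[rotated], simp only: smn_defs, iprover intro: sm_perm)
    moreover have "sm (P_rev \<star> Q_rev) F = F 1"
      using PQ(2)[of "\<lambda>a b c. F (S c, S b, S a)"]
      by (simp add: P_rev_def Q_rev_def antipode_mult antipode_one)
         (erule trans[rotated], simp only: smn_defs, iprover intro: sm_perm)
    moreover have "sm (Q_rev \<star> P_rev) F = F 1"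
      using PQ(1)[of "\<lambda>a b c. F (S c, S b, S a)"]
      by (simp add: P_rev_def Q_rev_def antipode_mult antipode_one)
         (erule trans[rotated], simp only: smn_defs, iprover intro: sm_perm)
    ultimately show ?thesis by blast
  qed
  note ** = this
  show "tens (HHH H) (twist_left \<star> twist_inv_left) = tens (HHH H) [1]" "tens (HHH H) (twist_inv_left \<star>
    twist_left) = tens (HHH H) [1]"
    "tens (HHH H) (twist_right \<star> twist_inv_right) = tens (HHH H) [1]" "tens (HHH H) (twist_inv_right \<star>
      twist_right) = tens (HHH H) [1]"
    unfolding twist_left_def twist_inv_left_def twist_right_def twist_inv_right_def
    by (rule *; rule tens_eqI; simp only: ** sm_Cons sm_Nil add_0_right)+
  show "tens (HHH H) (P_rev \<star> Q_rev) = tens (HHH H) [1]" "tens (HHH H) (Q_rev \<star> P_rev) = tens (HHH H) [1]"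
    by (rule tens_eqI; simp only: ** sm_Cons sm_Nil add_0_right)+
qed

text \<open>The cocycle identity solved for \<Phi>^{-1}: the version with f serves \<Omega>, the
  version with f^{-1} serves \<Omega>'.\<close>

lemma twist_cocycle_variants:
  "tens (HHH H) (Q_rev \<star> twist_right) = tens (HHH H) (twist_left \<star> Q)"
  "tens (HHH H) (twist_inv_left \<star> Q_rev) = tens (HHH H) (Q \<star> twist_inv_right)"
proof -
  interpret monoid "talg (HHH H)" by (rule monoid_talg) simp
  have m: "tens (HHH H) xs \<otimes>\<^bsub>talg (HHH H)\<^esub> tens (HHH H) ys = tens (HHH H) (xs \<star> ys)" for xs ys
    by (rule talg_mult_tens) simp
  let ?t = "tens (HHH H)" and ?m = "\<lambda>x y. x \<otimes>\<^bsub>talg (HHH H)\<^esub> y"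
  have C: "?t xs \<in> carrier (talg (HHH H))" for xs by simp
  have PQ': "?t (P \<star> Q) = ?t [1]" "?t (Q \<star> P) = ?t [1]"
  proof -
    have "sm (P \<star> Q) F = F 1 \<and> sm (Q \<star> P) F = F 1" if F: "resp (HHH H) F" for F
      using PQ[of "\<lambda>a b c. F (a, b, c)"] F by (simp add: one_prod_def)
    then show "?t (P \<star> Q) = ?t [1]" "?t (Q \<star> P) = ?t [1]" by (simp_all add: tens_eq_iff del: sm_lmul resp_trel)
  qed
  note inv = twist_left_inverse[folded m] PQ'[folded m]
  have 1: "?t [1] = \<one>\<^bsub>talg (HHH H)\<^esub>" by simp
  have c: "?m (?t twist_right) (?t P) = ?m (?t P_rev) (?t twist_left)"
    unfolding m by (rule twist_cocycle)
  have "?m (?t Q_rev) (?t twist_right) = ?m (?t Q_rev) (?m (?m (?t twist_right) (?t P)) (?t Q))"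
    by (simp only: m_assoc C m_closed inv 1 r_one)
  also have "\<dots> = ?m (?m (?t Q_rev) (?t P_rev)) (?m (?t twist_left) (?t Q))"
    unfolding c by (simp only: m_assoc C m_closed)
  finally have A: "?m (?t Q_rev) (?t twist_right) = ?m (?t twist_left) (?t Q)"
    by (simp only: inv 1 l_one C m_closed)
  then show "tens (HHH H) (Q_rev \<star> twist_right) = tens (HHH H) (twist_left \<star> Q)" unfolding m .
  have "?m (?t twist_inv_left) (?t Q_rev) = ?m (?t twist_inv_left) (?m (?m (?t Q_rev) (?t twist_right)) (?t
    twist_inv_right))"
    by (simp only: m_assoc C m_closed inv 1 r_one)
  also have "\<dots> = ?m (?m (?t twist_inv_left) (?t twist_left)) (?m (?t Q) (?t twist_inv_right))"
    unfolding A by (simp only: m_assoc C m_closed)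
  finally show "tens (HHH H) (twist_inv_left \<star> Q_rev) = tens (HHH H) (Q \<star> twist_inv_right)"
    by (simp only: inv 1 l_one C m_closed) (simp only: m)
qed

end

section \<open>Diagonal crossed products\<close>

lemma bilin_lmap:
  assumes "bilin s1 s2 s3 g"
  shows "lmap s s2 f \<Longrightarrow> lmap s s3 (\<lambda>x. g a (f x))" "lmap t s1 f' \<Longrightarrow> lmap t s3 (\<lambda>x. g (f' x) b)"
  using assms by (simp_all add: bilin_def lmap_def Vector_Spaces.linear_def module_hom_def module_hom_axioms_def)

locale crossed_product_data = quasi_hopf_coaction H s \<delta> \<Psi> + bimod: bimodule_algebra H A
  for H :: "('k::field, 'h::{ring,monoid_mult}) quasi_hopf" and s :: "'k \<Rightarrow> 'u::{ring,monoid_mult} \<Rightarrow> 'u"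
    and \<delta> \<Psi> and A :: "('k, 'h, 'a::ab_group_add) bimodule_alg"
begin

lemmas uncurry = uncurry_D uncurry_P uncurry_Q uncurry_dl uncurry_V uncurry_W

abbreviation "bs \<equiv> bscale A"
abbreviation mulA (infixr \<open>\<diamond>\<close> 70) where "p \<diamond> q \<equiv> bmult A p q"

definition biact where "biact x p = lact A (fst x) (ract A p (snd x))"
text \<open>The multiplication of H \<otimes> H^op. The type class product on pairs is that of H
  \<otimes> H and would compose right actions in the wrong order.\<close>

definition opmul :: "'h \<times> 'h \<Rightarrow> 'h \<times> 'h \<Rightarrow> 'h \<times> 'h" where "opmul x y = (fst x * fst y, snd y * snd x)"

lemma opmul_Pair [simp]: "opmul (a, b) (c, d) = (a * c, d * b)"
  by (simp add: opmul_def)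

lemma ract_lact: "ract A (lact A h p) h' = biact (h, h') p"
  by (simp add: biact_def bimod.lact_ract)

lemma biact_biact [simp]: "biact x (biact y p) = biact (opmul x y) p"
  by (simp add: biact_def opmul_def bimod.lact_mult bimod.ract_mult bimod.lact_ract)

lemma biact_one [simp]: "biact (1, 1) p = p"
  by (simp add: biact_def bimod.lact_one bimod.ract_one)

lemma lmap_biact [simp]: "lmap t bs f \<Longrightarrow> lmap t bs (\<lambda>x. biact y (f x))"
    "lmap t hs g \<Longrightarrow> lmap t bs (\<lambda>x. biact (g x, b) p)" "lmap t hs g \<Longrightarrow> lmap t bs (\<lambda>x. biact (a, g x) p)"
    "lmap t bs f \<Longrightarrow> lmap t bs (\<lambda>x. f x \<diamond> p)" "lmap t bs f \<Longrightarrow> lmap t bs (\<lambda>x. p \<diamond> f x)"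
  by (auto simp: biact_def intro!: bilin_lmap[OF bimod.lact_bilin] bilin_lmap[OF bimod.ract_bilin] bilin_lmap[OF
    bimod.bmult_bilin])

text \<open>Quasi-associativity of the bimodule algebra, read for one action of H \<otimes> H^op
  with reassociator built from \<Phi> and \<Phi>^{-1}.\<close>

lemma mulA_assoc:
  assumes g: "lin bs g"
  shows "g ((p \<diamond> q) \<diamond> r) = sm3 P (\<lambda>X Y Z. sm3 Q (\<lambda>x y z. g (biact (X, x) p \<diamond> biact (Y, y) q \<diamond> biact (Z, z) r)))"
  by (subst bimod.quasi_assoc) (simp add: lin_sum_list[OF g] ract_lact case_prod_unfold smn_defs del: uncurry)

text \<open>Substituting \<open>mulA_assoc\<close> leaves \<Phi> \<Phi>^{-1} acting from each side,
  and both cancel. The reversed multiplication of the second crossed product needs this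
  direction.\<close>

lemma mulA_assoc_inv:
  assumes g: "lin bs g"
  shows "g (p \<diamond> q \<diamond> r) = sm3 Q (\<lambda>x y z. sm3 P (\<lambda>X Y Z. g ((biact (x, X) p \<diamond> biact (y, Y) q) \<diamond> biact (z, Z) r)))"
proof -
  note [simp] = lin_comp[OF g]
  have "sm3 Q (\<lambda>x y z. sm3 P (\<lambda>X Y Z. g ((biact (x, X) p \<diamond> biact (y, Y) q) \<diamond> biact (z, Z) r))) =
    sm3 Q (\<lambda>x y z. sm3 P (\<lambda>X Y Z. sm3 P (\<lambda>X' Y' Z'. sm3 Q (\<lambda>x' y' z'.
      g (biact (X' * x, X * x') p \<diamond> biact (Y' * y, Y * y') q \<diamond> biact (Z' * z, Z * z') r)))))"
    by (simp add: mulA_assoc[OF g])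
  also have "\<dots> = sm3 P (\<lambda>X' Y' Z'. sm3 Q (\<lambda>x y z. sm3 P (\<lambda>X Y Z. sm3 Q (\<lambda>x' y' z'.
      g (biact (X' * x, X * x') p \<diamond> biact (Y' * y, Y * y') q \<diamond> biact (Z' * z, Z * z') r)))))"
    by (simp only: smn_defs, iprover intro: sm_perm)
  also have "\<dots> = sm3 P (\<lambda>X' Y' Z'. sm3 Q (\<lambda>x y z.
      g (biact (X' * x, 1) p \<diamond> biact (Y' * y, 1) q \<diamond> biact (Z' * z, 1) r)))"
    using PQ(1)[of "\<lambda>a b c. g (biact (_, a) p \<diamond> biact (_, b) q \<diamond> biact (_, c) r)"] by simp
  also have "\<dots> = g (p \<diamond> q \<diamond> r)"
    using PQ(1)[of "\<lambda>a b c. g (biact (a, 1) p \<diamond> biact (b, 1) q \<diamond> biact (c, 1) r)"] by simp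
  finally show ?thesis ..
qed

lemma biact_mulA:
  assumes g: "lin bs g"
  shows "g (biact (h, h') (p \<diamond> q)) = sm2 (D h) (\<lambda>a b. sm2 (D h') (\<lambda>a' b'. g (biact (a, a') p \<diamond> biact (b, b') q)))"
proof -
  note [simp] = lin_comp[OF g]
  have 1: "lin bs g' \<Longrightarrow> g' (lact A h (p \<diamond> q)) = sm2 (D h) (\<lambda>a b. g' (lact A a p \<diamond> lact A b q))" for g' p q
    by (subst bimod.lact_bmult) (simp add: lin_sum_list case_prod_unfold smn_defs del: uncurry)
  have 2: "lin bs g' \<Longrightarrow> g' (ract A (p \<diamond> q) h') = sm2 (D h') (\<lambda>a b. g' (ract A p a \<diamond> ract A q b))" for g' p q
    by (subst bimod.ract_bmult) (simp add: lin_sum_list case_prod_unfold smn_defs del: uncurry)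
  have "lin bs (\<lambda>p. g (lact A h p))"
    by (rule lin_comp[OF g]) (auto intro!: bilin_lmap[OF bimod.lact_bilin])
  from 2[OF this] have "g (biact (h, h') (p \<diamond> q)) = sm2 (D h') (\<lambda>a' b'. sm2 (D h) (\<lambda>a b. g (biact (a, a') p \<diamond>
    biact (b, b') q)))"
    by (simp add: biact_def 1[OF g])
  also have "\<dots> = sm2 (D h) (\<lambda>a b. sm2 (D h') (\<lambda>a' b'. g (biact (a, a') p \<diamond> biact (b, b') q)))"
    by (simp only: smn_defs, iprover intro: sm_perm)
  finally show ?thesis .
qed

definition "opcounit x = \<epsilon> (fst x) * \<epsilon> (snd x)"

lemma biact_unit: "biact x (bunit A) = bs (opcounit x) (bunit A)"
proof -
  interpret vector_space bs by (rule bimod.space)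
  have "lmap bs bs (\<lambda>p. lact A (fst x) p)"
    by (auto intro!: bilin_lmap[OF bimod.lact_bilin])
  then show ?thesis
    by (simp add: biact_def opcounit_def bimod.lact_bunit bimod.ract_bunit lmap_def mult.commute)
qed

section \<open>The first crossed product as a smash product\<close>

text \<open>With the next abbreviation, the quasi-bialgebra H \<otimes> H^op. Its reassociator has
  \<Phi>^{-1} in the second component because multiplication is reversed there; for the same reason
  the coaction carries S^{-1} on its right leg.\<close>

abbreviation "op_comul x \<equiv> [((a, a'), (b, b')). (a, b) \<leftarrow> D (fst x), (a', b') \<leftarrow> D (snd x)]"
abbreviation "op_reassoc \<equiv> [((X, x), (Y, y), (Z, z)). (X, Y, Z) \<leftarrow> P, (x, y, z) \<leftarrow> Q]"
abbreviation "lcoact u \<equiv> [((a, Si d), v). (a, v, d) \<leftarrow> dl u]"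
text \<open>Legs 1 and 5 act on the first factor of a product and legs 2 and 4 on the second, hence
  this pairing.\<close>

abbreviation "lomega \<equiv> [((a, d), (b, c), v). (a, b, v, c, d) \<leftarrow> terms (Omega H s \<Psi>)]"

lemma sm_left:
  "sm2 (op_comul x) F2 = sm2 (D (fst x)) (\<lambda>a b. sm2 (D (snd x)) (\<lambda>a' b'. F2 (a, a') (b, b')))"
  "sm3 op_reassoc F3 = sm3 P (\<lambda>X Y Z. sm3 Q (\<lambda>x y z. F3 (X, x) (Y, y) (Z, z)))"
  "sm2 (lcoact u) L = sm3 (dl u) (\<lambda>a v d. L (a, Si d) v)"
  by (simp_all add: smn_defs case_prod_unfold del: uncurry)

lemma sm_lomega:
  assumes F: "\<And>y u. resp (HH H) (\<lambda>x. F x y u)" "\<And>x u. resp (HH H) (\<lambda>y. F x y u)" "\<And>x y. lin s (F x y)"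
  shows "sm3 lomega F = sm5 V (\<lambda>a b v c d. sm2 twist (\<lambda>f g. F (a, Si (g * d)) (b, Si (f * c)) v))"
proof -
  note [simp] = resp2_lin[OF F(1)] resp2_lin[OF F(2)] lin_comp[OF F(3)]
  have 1: "sm (terms (drinfeld_twist H)) K = sm twist K" if "resp (HH H) K" for K
    using that unfolding drinfeld_twist_eq by (rule sm_terms_tens)
  have "sm3 lomega F = sm (terms (Omega H s \<Psi>)) (\<lambda>(a, b, v, c, d). F (a, d) (b, c) v)"
    by (simp add: smn_defs case_prod_unfold del: uncurry)
  also have "\<dots> = sm5 V (\<lambda>a b v c d. sm (terms (drinfeld_twist H)) (\<lambda>p. F (a, Si (snd p * d)) (b, Si (fst p * c)) v))"
    unfolding Omega_def by (subst sm_terms_tens) (simp_all add: case_prod_unfold smn_defs del: uncurry)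
  also have "\<dots> = sm5 V (\<lambda>a b v c d. sm2 twist (\<lambda>f g. F (a, Si (g * d)) (b, Si (f * c)) v))"
    by (subst 1) (simp_all add: sm2_def)
  finally show ?thesis .
qed

text \<open>Coassociativity of \<delta> up to \<Psi>^{-1} comultiplies both outer legs. On the right
  leg the comultiplication stands under S^{-1}, and the f inside \<Omega> is what exchanges the
  two.\<close>

lemma lcoact_omega:
  assumes F: "\<And>y u. resp (HH H) (\<lambda>x. F x y u)" "\<And>x u. resp (HH H) (\<lambda>y. F x y u)" "\<And>x y. lin s (F x y)"
  shows "sm3 lomega (\<lambda>x y w. sm2 (lcoact u) (\<lambda>a v. sm2 (lcoact v) (\<lambda>b v'. F (opmul x a) (opmul y b) (w * v')))) =
    sm2 (lcoact u) (\<lambda>a v. sm2 (op_comul a) (\<lambda>a1 a2. sm3 lomega (\<lambda>x y w. F (opmul a1 x) (opmul a2 y) (v * w))))"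
proof -
  note [simp] = resp2_lin[OF F(1)] resp2_lin[OF F(2)] lin_comp[OF F(3)]
  have *: "sm2 twist (\<lambda>f g. sm2 (D d) (\<lambda>d1 d2. F (x, Si (g * (d2 * w))) (y, Si (f * (d1 * t))) z)) =
    sm2 (D (Si d)) (\<lambda>d1 d2. sm2 twist (\<lambda>f g. F (x, Si (g * w) * d1) (y, Si (f * t) * d2) z))" for x y z w d t
    by (rule twist_Si[of "\<lambda>a b. F (x, b) (y, a) z", symmetric]) simp_all
  have "sm3 lomega (\<lambda>x y w. sm2 (lcoact u) (\<lambda>a v. sm2 (lcoact v) (\<lambda>b v'. F (opmul x a) (opmul y b) (w * v')))) =
    sm2 twist (\<lambda>f g. sm5 V (\<lambda>p q r t w. sm3 (dl u) (\<lambda>a x d. sm3 (dl x) (\<lambda>b v c.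
      F (p * a, Si (g * (w * d))) (q * b, Si (f * (t * c))) (r * v)))))"
    by (simp add: sm_left sm_lomega opmul_def) (simp only: Si_mult mult.assoc smn_defs, iprover intro: sm_perm)
  also have "\<dots> = sm2 twist (\<lambda>f g. sm3 (dl u) (\<lambda>a v d. sm2 (D a) (\<lambda>a1 a2. sm2 (D d) (\<lambda>d1 d2. sm5 V (\<lambda>p q r t w.
      F (a1 * p, Si (g * (d2 * w))) (a2 * q, Si (f * (d1 * t))) (v * r))))))"
    by (subst coact_coassoc_V) (simp_all add: lin5_def)
  also have "\<dots> = sm3 (dl u) (\<lambda>a v d. sm2 (D a) (\<lambda>a1 a2. sm5 V (\<lambda>p q r t w. sm2 twist (\<lambda>f g. sm2 (D d) (\<lambda>d1 d2.
      F (a1 * p, Si (g * (d2 * w))) (a2 * q, Si (f * (d1 * t))) (v * r))))))"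
    by (simp only: smn_defs, iprover intro: sm_perm)
  also have "\<dots> = sm2 (lcoact u) (\<lambda>a v. sm2 (op_comul a) (\<lambda>a1 a2. sm3 lomega (\<lambda>x y w. F (opmul a1 x) (opmul a2 y)
    (v * w))))"
    unfolding * by (simp add: sm_left sm_lomega opmul_def) (simp only: smn_defs, iprover intro: sm_perm)
  finally show ?thesis .
qed

text \<open>Both sides become products of twists, reassociators and copies of \<Psi>^{-1}. The
  cocycle identity turns the twists of one side into those of the other and releases \<Phi>^{-1}
  next to the copies of \<Psi>^{-1}; what remains is the pentagon of \<Psi>^{-1}.\<close>

lemma lomega_pentagon:
  assumes F: "\<And>y z u. resp (HH H) (\<lambda>x. F x y z u)" "\<And>x z u. resp (HH H) (\<lambda>y. F x y z u)"
    "\<And>x y u. resp (HH H) (\<lambda>z. F x y z u)" "\<And>x y z. lin s (F x y z)"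
  shows "sm3 op_reassoc (\<lambda>X Y Z. sm3 lomega (\<lambda>x y w. sm2 (op_comul x) (\<lambda>x1 x2. sm3 lomega (\<lambda>x' y' w'. sm2
    (lcoact w') (\<lambda>a v.
         F (opmul X (opmul x1 x')) (opmul Y (opmul x2 y')) (opmul Z (opmul y a)) (w * v)))))) =
    sm3 lomega (\<lambda>x y w. sm2 (op_comul y) (\<lambda>y1 y2. sm3 lomega (\<lambda>x' y' w'. F x (opmul y1 x') (opmul y2 y') (w * w'))))"
    (is "?lhs = ?rhs")
proof -
  note [simp] = resp2_lin[OF F(1)] resp2_lin[OF F(2)] resp2_lin[OF F(3)] lin_comp[OF F(4)]
  have *: "sm2 (D (Si e)) (\<lambda>k1 k2. sm2 twist (\<lambda>f g. F (x, (Si (g * w) * k1) * x') (y, (Si (f * t) * k2) * y') z v)) =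
    sm2 twist (\<lambda>f g. sm2 (D e) (\<lambda>d1 d2. F (x, Si (g * (d2 * w)) * x') (y, Si (f * (d1 * t)) * y') z v))" for e x
      y x' y' z v w t
    using twist_Si[of "\<lambda>a b. F (x, b * x') (y, a * y') z v"] by simp
  have **: "sm2 (D (Si e)) (\<lambda>k1 k2. sm2 twist (\<lambda>f g. F x (y, Si (g * w) * k1) (z, Si (f * t) * k2) v)) =
    sm2 twist (\<lambda>f g. sm2 (D e) (\<lambda>d1 d2. F x (y, Si (g * (d2 * w))) (z, Si (f * (d1 * t))) v))" for e x y z v w t
    using twist_Si[of "\<lambda>a b. F x (y, b) (z, a) v"] by simp
  have "?lhs = sm3 P (\<lambda>X Y Z. sm3 Q (\<lambda>x y z. sm5 V (\<lambda>a b v c d. sm2 twist (\<lambda>f g. sm2 (D a) (\<lambda>a1 a2.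
      sm5 V (\<lambda>a' b' v' c' d'. sm3 (dl v') (\<lambda>e v0 e'. sm2 (D (Si (g * d))) (\<lambda>k1 k2. sm2 twist (\<lambda>f' g'.
      F (X * (a1 * a'), (Si (g' * d') * k1) * x) (Y * (a2 * b'), (Si (f' * c') * k2) * y) (Z * (b * e), (Si e' *
        Si (f * c)) * z) (v * v0))))))))))"
    by (simp add: sm_left sm_lomega opmul_def) (simp only: smn_defs, iprover intro: sm_perm)
  \<comment> \<open>\<open>twist_Si\<close> moves the comultiplication of the right leg inside
    S^{-1}.\<close>
  also have "\<dots> = sm3 P (\<lambda>X Y Z. sm3 Q (\<lambda>x y z. sm5 V (\<lambda>a b v c d. sm2 twist (\<lambda>f g. sm2 (D a) (\<lambda>a1 a2.
      sm5 V (\<lambda>a' b' v' c' d'. sm3 (dl v') (\<lambda>e v0 e'. sm2 twist (\<lambda>f' g'. sm2 (D (g * d)) (\<lambda>d1 d2.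
      F (X * (a1 * a'), Si (g' * (d2 * d')) * x) (Y * (a2 * b'), Si (f' * (d1 * c')) * y) (Z * (b * e), (Si e' *
        Si (f * c)) * z) (v * v0))))))))))"
    unfolding * ..
  \<comment> \<open>The legs of \<Phi>^{-1} coming from the right action enter S^{-1} as images
    under S and in reversed order, hence \<open>Q_rev\<close>.\<close>
  also have "\<dots> = sm (Q_rev \<star> twist_right) (\<lambda>(r1, r2, r3). sm3 P (\<lambda>X Y Z. sm (t_outer V \<star> t_coact V) (\<lambda>(l1, l2,
    l3, v, m1, m2, m3).
      F (X * l1, Si (r3 * m3)) (Y * l2, Si (r2 * m2)) (Z * l3, Si (r1 * m1)) v)))"
    by (simp add: Q_rev_def twist_right_def uncurry_twist t7_defs Si_mult mult.assoc)
      (simp only: smn_defs, iprover intro: sm_perm)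
  also have "\<dots> = sm (twist_left \<star> Q) (\<lambda>(r1, r2, r3). sm3 P (\<lambda>X Y Z. sm (t_outer V \<star> t_coact V) (\<lambda>(l1, l2, l3, v,
    m1, m2, m3).
      F (X * l1, Si (r3 * m3)) (Y * l2, Si (r2 * m2)) (Z * l3, Si (r1 * m1)) v)))"
    by (rule tens_eqD[OF twist_cocycle_variants(1)]) (simp add: case_prod_unfold)
  also have "\<dots> = sm twist_left (\<lambda>(r1, r2, r3). sm (t_assoc P Q \<star> t_outer V \<star> t_coact V) (\<lambda>(l1, l2, l3, v, m1, m2, m3).
      F (l1, Si (r3 * m3)) (l2, Si (r2 * m2)) (l3, Si (r1 * m1)) v))"
    by (simp add: twist_left_def uncurry_twist t7_defs mult.assoc) (simp only: smn_defs, iprover intro: sm_perm)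
  also have "\<dots> = sm twist_left (\<lambda>(r1, r2, r3). sm (t_mid V \<star> t_inner V) (\<lambda>(l1, l2, l3, v, m1, m2, m3).
      F (l1, Si (r3 * m3)) (l2, Si (r2 * m2)) (l3, Si (r1 * m1)) v))"
  proof -
    have "sm (t_assoc P Q \<star> t_outer V \<star> t_coact V) (\<lambda>(l1, l2, l3, v, m1, m2, m3).
      F (l1, Si (r3 * m3)) (l2, Si (r2 * m2)) (l3, Si (r1 * m1)) v) = sm (t_mid V \<star> t_inner V) (\<lambda>(l1, l2, l3, v,
        m1, m2, m3).
      F (l1, Si (r3 * m3)) (l2, Si (r2 * m2)) (l3, Si (r1 * m1)) v)" for r1 r2 r3
      by (rule tens_eqD[OF psi_inv_pentagon_tens, symmetric]) simp
    then show ?thesis by (simp only:)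
  qed
  also have "\<dots> = sm5 V (\<lambda>a b v c d. sm2 twist (\<lambda>f g. sm2 (D b) (\<lambda>b1 b2. sm5 V (\<lambda>a' b' v' c' d'. sm2 twist (\<lambda>f' g'.
      sm2 (D (f * c)) (\<lambda>d1 d2. F (a, Si (g * d)) (b1 * a', Si (g' * (d2 * d'))) (b2 * b', Si (f' * (d1 * c')))
        (v * v')))))))"
    by (simp add: twist_left_def uncurry_twist t7_defs mult.assoc) (simp only: smn_defs, iprover intro: sm_perm)
  also have "\<dots> = ?rhs"
    unfolding **[symmetric] by (simp add: sm_left sm_lomega opmul_def) (simp only: smn_defs, iprover intro: sm_perm)
  finally show ?thesis .
qed

end

lemma vector_space_functional:
  fixes sc :: "'k::field \<Rightarrow> 'v::ab_group_add \<Rightarrow> 'v"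
  assumes "vector_space sc" "x \<noteq> 0"
  obtains F where "lin sc F" "F x \<noteq> 0"
proof -
  interpret v: vector_space sc by fact
  interpret vector_space_pair sc "(*) :: 'k \<Rightarrow> 'k \<Rightarrow> 'k"
    by (intro vector_space_pair.intro assms) (standard, auto simp: algebra_simps)
  have "v.independent {x}" using assms by simp
  then obtain g where g: "Vector_Spaces.linear sc (*) g" "\<forall>y\<in>{x}. g y = 1"
    using linear_independent_extend[of "{x}" "\<lambda>_. 1"] by blast
  interpret g: Vector_Spaces.linear sc "(*)" g by (rule g)
  show thesis using that[of g] g by (simp add: lin_def g.add g.scale)
qed

text \<open>The product forms of a fixed F with F(a) \<noteq> 0 and an arbitrary G separate the
  tensors a \<otimes> u.\<close>

lemma inj_pure_tensor:
  assumes v: "vector_space sa" "vector_space su" "a \<noteq> 0"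
  shows "inj (\<lambda>u. tens (vrel sa \<boxtimes> vrel su) [(a, u)])" "inj (\<lambda>u. tens (vrel su \<boxtimes> vrel sa) [(u, a)])"
proof -
  obtain F where F: "lin sa F" "F a \<noteq> 0" using vector_space_functional[OF v(1,3)] .
  have *: "u = u'" if "\<And>G. lin su G \<Longrightarrow> F a * G u = F a * G u'" for u u'
  proof (rule ccontr)
    assume "u \<noteq> u'"
    then obtain G where G: "lin su G" "G (u - u') \<noteq> 0" using vector_space_functional[OF v(2), of "u - u'"] by auto
    have "G (u - u') + G u' = G u" using lin_add[OF G(1), of "u - u'" u'] by simp
    then show False using that[OF G(1)] F(2) G(2) by simp
  qed
  show "inj (\<lambda>u. tens (vrel sa \<boxtimes> vrel su) [(a, u)])"
  proof (rule injI, rule *)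
    fix u u' G assume "tens (vrel sa \<boxtimes> vrel su) [(a, u)] = tens (vrel sa \<boxtimes> vrel su) [(a, u')]" "lin su G"
    then show "F a * G u = F a * G u'" using F(1) by (auto dest: tens_eqD[where F = "\<lambda>(x, y). F x * G y"])
  qed
  show "inj (\<lambda>u. tens (vrel su \<boxtimes> vrel sa) [(u, a)])"
  proof (rule injI, rule *)
    fix u u' G assume "tens (vrel su \<boxtimes> vrel sa) [(u, a)] = tens (vrel su \<boxtimes> vrel sa) [(u', a)]" "lin su G"
    then show "F a * G u = F a * G u'" using F(1) by (auto dest: tens_eqD[where F = "\<lambda>(y, x). F x * G y"])
  qed
qed

context crossed_product_data
begin

lemma smash_linearity:
  "lin bs g \<Longrightarrow> resp (HH H) (\<lambda>x. g (biact x p))" "lin bs g \<Longrightarrow> lin bs (\<lambda>p. g (biact x p))"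
  "lin bs g \<Longrightarrow> lin bs (\<lambda>p. g (p \<diamond> q))" "lin bs g \<Longrightarrow> lin bs (\<lambda>q. g (p \<diamond> q))"
  "lin s f \<Longrightarrow> lin s (\<lambda>u. f (u * v))" "lin s f \<Longrightarrow> lin s (\<lambda>v. f (u * v))"
  "resp (HH H) F \<Longrightarrow> resp (HH H) (\<lambda>x. F (opmul x y))" "resp (HH H) F \<Longrightarrow> resp (HH H) (\<lambda>y. F (opmul x y))"
proof -
  assume g: "lin bs g"
  note [simp] = lin_comp[OF g]
  show "resp (HH H) (\<lambda>x. g (biact x p))" "lin bs (\<lambda>p. g (biact x p))" "lin bs (\<lambda>p. g (p \<diamond> q))" "lin bs (\<lambda>q. g (p \<diamond> q))"
    by simp_all
next
  assume f: "lin s f"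
  note [simp] = lin_comp[OF f]
  show "lin s (\<lambda>u. f (u * v))" "lin s (\<lambda>v. f (u * v))" by simp_all
next
  assume F: "resp (HH H) F"
  note [simp] = resp2_lin[OF F]
  show "resp (HH H) (\<lambda>x. F (opmul x y))" "resp (HH H) (\<lambda>y. F (opmul x y))"
    by (simp_all add: opmul_def)
qed

lemma opcounit_opmul: "opcounit (opmul x y) = opcounit x * opcounit y"
  by (simp add: opcounit_def opmul_def mult_ac)

lemmas smash_simps = bimod.bunit_left bimod.bunit_right biact_unit

text \<open>The substance lies in \<open>lcoact_omega\<close>, \<open>lomega_pentagon\<close> and,
  for the unit, in the normalizations of f and \<Psi>^{-1}; the other axioms are
  translations.\<close>

lemma left_smash_product:
  "unital_smash_product_data bs s (HH H) (\<diamond>) (*) biact opmul (\<lambda>x. op_comul x) op_reassoc (\<lambda>u. lcoact u) lomega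
     (bunit A) 1 (1, 1) opcounit"
proof (intro unital_smash_product_data.intro smash_product_data.intro unital_smash_product_data_axioms.intro)
  show "g ((p \<diamond> q) \<diamond> r) = sm3 op_reassoc (\<lambda>x y z. g (biact x p \<diamond> biact y q \<diamond> biact z r))" if "lin bs g" for g p q r
    unfolding sm_left by (rule mulA_assoc[OF that])
  show "g (biact x (p \<diamond> q)) = sm2 (op_comul x) (\<lambda>y z. g (biact y p \<diamond> biact z q))" if "lin bs g" for g x p q
    unfolding sm_left using biact_mulA[OF that, of "fst x" "snd x"] by simp
  show "sm2 (op_comul (opmul x x')) F = sm2 (op_comul x) (\<lambda>y z. sm2 (op_comul x') (\<lambda>y' z'. F (opmul y y') (opmul
    z z')))"
    if F: "\<And>z. resp (HH H) (\<lambda>y. F y z)" "\<And>y. resp (HH H) (F y)" for x x' F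
  proof -
    note [simp] = resp2_lin[OF F(1)] resp2_lin[OF F(2)]
    show ?thesis by (simp only: sm_left) (simp add: opmul_def, simp only: smn_defs, iprover intro: sm_perm)
  qed
  show "sm2 (lcoact (u * u')) L = sm2 (lcoact u) (\<lambda>x v. sm2 (lcoact u') (\<lambda>x' v'. L (opmul x x') (v * v')))"
    "lin s (\<lambda>u. sm2 (lcoact u) L)" "sm2 (lcoact 1) L = L (1, 1) 1"
    if L: "\<And>v. resp (HH H) (\<lambda>x. L x v)" "\<And>x. lin s (L x)" for L u u'
  proof -
    note [simp] = resp2_lin[OF L(1)] lin_comp[OF L(2)]
    show "sm2 (lcoact (u * u')) L = sm2 (lcoact u) (\<lambda>x v. sm2 (lcoact u') (\<lambda>x' v'. L (opmul x x') (v * v')))"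
      "lin s (\<lambda>u. sm2 (lcoact u) L)" "sm2 (lcoact 1) L = L (1, 1) 1"
      by (simp_all add: sm_left Si_mult)
  qed
  show "sm3 lomega (\<lambda>x y w. opcounit x * F y w) = F (1, 1) 1" "sm3 lomega (\<lambda>x y w. opcounit y * F x w) = F (1, 1) 1"
    if F: "\<And>v. resp (HH H) (\<lambda>x. F x v)" "\<And>x. lin s (F x)" for F
  proof -
    note [simp] = resp2_lin[OF F(1)] lin_comp[OF F(2)]
    \<comment> \<open>An \<epsilon> on one leg of f removes the twist from \<Omega>.\<close>
    have tw: "sm2 twist (\<lambda>f g. \<epsilon> g * F (a, Si (f * c)) v) = F (a, Si c) v"
      "sm2 twist (\<lambda>f g. \<epsilon> f * F (a, Si (g * c)) v) = F (a, Si c) v" for a c v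
      using twist_counit[of "\<lambda>x. F (a, Si (x * c)) v"] by (simp_all add: sm2_def)
    have "sm3 lomega (\<lambda>x y w. opcounit x * F y w) = sm5 V (\<lambda>a b v c d. \<epsilon> a * (\<epsilon> d * sm2 twist (\<lambda>f g. \<epsilon> g * F (b,
      Si (f * c)) v)))"
      by (simp add: sm_lomega opcounit_def mult.assoc mult.left_commute flip: sm_pull)
    also have "\<dots> = F (1, 1) 1"
      using psi_inv_counit(1)[of "\<lambda>b v c. F (b, Si c) v"] by (simp add: tw)
    finally show "sm3 lomega (\<lambda>x y w. opcounit x * F y w) = F (1, 1) 1" .
    have "sm3 lomega (\<lambda>x y w. opcounit y * F x w) = sm5 V (\<lambda>a b v c d. \<epsilon> b * (\<epsilon> c * sm2 twist (\<lambda>f g. \<epsilon> f * F (a,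
      Si (g * d)) v)))"
      by (simp add: sm_lomega opcounit_def mult.assoc mult.left_commute flip: sm_pull)
    also have "\<dots> = F (1, 1) 1"
      using psi_inv_counit(2)[of "\<lambda>b v c. F (b, Si c) v"] by (simp add: tw)
    finally show "sm3 lomega (\<lambda>x y w. opcounit y * F x w) = F (1, 1) 1" .
  qed
  show "sm2 (lcoact u) (\<lambda>a v. opcounit a * f v) = f u" if "lin s f" for f u
    using that by (simp add: sm_left opcounit_def mult.assoc dl_counit)
qed ((erule smash_linearity | rule opcounit_opmul | rule lcoact_omega lomega_pentagon; simp; fail | simp add:
  smash_simps opmul_def mult.assoc; fail)+)

lemma vector_space_s: "vector_space s"
  by (rule k_algebra_alg_ofD[OF coaction.algebra])

lemma left_crossed_product:
  "(\<forall>x y. tens (AU A s) [x] \<otimes>\<^bsub>lcross H A s \<delta> \<Psi>\<^esub> tens (AU A s) [y] = tens (AU A s) (lprod H A s \<delta> \<Psi> x y)) \<and>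
   k_algebra (lcross H A s \<delta> \<Psi>) \<and> \<one>\<^bsub>lcross H A s \<delta> \<Psi>\<^esub> = tens (AU A s) [(bunit A, 1)] \<and>
   lincl A s \<in> alg_hom (alg_of s) (lcross H A s \<delta> \<Psi>) \<and> (bunit A \<noteq> 0 \<longrightarrow> inj (lincl A s))"
proof -
  interpret smash: unital_smash_product_data bs s "HH H" "(\<diamond>)" "(*)" biact opmul "\<lambda>x. op_comul x" op_reassoc
    "\<lambda>u. lcoact u" lomega
     "bunit A" 1 "(1, 1)" opcounit by (rule left_smash_product)
  \<comment> \<open>Merging the left and right actions into one action of H \<otimes> H^op turns the
    defining formula into the smash product.\<close>
  have pr: "sm (lprod H A s \<delta> \<Psi> x y) F = smash.prodform (fst x) (snd x) (fst y) (snd y) (\<lambda>p u. F (p, u))" for F x y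
    unfolding smash.prodform_def by (simp add: lprod_def ract_lact case_prod_unfold smn_defs mult.assoc del: uncurry)
  interpret L: tensor_product_structure "AU A s" "\<lambda>c x. (bs c (fst x), snd x)" "lprod H A s \<delta> \<Psi>" "(bunit A, 1)"
  proof
    fix F :: "'a \<times> 'u \<Rightarrow> 'k" and x y z c assume F: "resp (AU A s) F"
    then have G: "lin bs (\<lambda>p. F (p, u))" "lin s (\<lambda>u. F (p, u))" for p u by simp_all
    show "F (bs c (fst x), snd x) = c * F x" using lin_scale[OF G(1)] by simp
    show "resp (AU A s) (\<lambda>x. sm (lprod H A s \<delta> \<Psi> x y) F)" "resp (AU A s) (\<lambda>y. sm (lprod H A s \<delta> \<Psi> x y) F)"
      by (simp_all add: pr smash.prodform_lin G)
    show "sm (lprod H A s \<delta> \<Psi> x y) (\<lambda>w. sm (lprod H A s \<delta> \<Psi> w z) F) = sm (lprod H A s \<delta> \<Psi> y z) (\<lambda>w. sm (lprod H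
      A s \<delta> \<Psi> x w) F)"
      by (simp add: pr smash.prodform_assoc G)
    show "sm (lprod H A s \<delta> \<Psi> (bunit A, 1) x) F = F x" "sm (lprod H A s \<delta> \<Psi> x (bunit A, 1)) F = F x"
      by (simp_all add: pr smash.prodform_unit_left smash.prodform_unit_right G)
  qed
  have eq: "lcross H A s \<delta> \<Psi> = L.T" by (simp add: lcross_def L.T_def)
  have incl: "lincl A s = (\<lambda>u. tens (AU A s) [(bunit A, u)])" by (simp add: lincl_def fun_eq_iff)
  have "(\<lambda>u. tens (AU A s) [(bunit A, u)]) \<in> alg_hom (alg_of s) L.T"
    by (rule L.alg_hom_T) (simp_all add: pr smash.prodform_unit_right lin_add[of s "\<lambda>u. _ (bunit A, u)"]
      lin_scale[of s "\<lambda>u. _ (bunit A, u)"])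
  moreover have "bunit A \<noteq> 0 \<longrightarrow> inj (lincl A s)"
    using inj_pure_tensor[OF bimod.space vector_space_s] by (simp add: incl)
  ultimately show ?thesis
    by (simp add: eq incl L.k_algebra_T)
qed

text \<open>
  In the second crossed product the factors appear in reverse order, so that comultiplication and
  reassociator of \<open>H \<otimes> H\<^sup>o\<^sup>p\<close> are reversed, too.
\<close>

abbreviation "op_comul_rev x \<equiv> [((b, b'), (a, a')). (a, b) \<leftarrow> D (fst x), (a', b') \<leftarrow> D (snd x)]"
abbreviation "op_reassoc_rev \<equiv> [((z, Z), (y, Y), (x, X)). (x, y, z) \<leftarrow> Q, (X, Y, Z) \<leftarrow> P]"
text \<open>For the opposite multiplication of the algebra it is the left leg that has to be
  reversed, so S^{-1} moves there.\<close>

abbreviation "rcoact u \<equiv> [((Si a, d), v). (a, v, d) \<leftarrow> dl u]"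
abbreviation "romega \<equiv> [((a, d), (b, c), v). (a, b, v, c, d) \<leftarrow> terms (Omega' H s \<Psi>)]"

lemma sm_right:
  "sm2 (op_comul_rev x) F2 = sm2 (D (fst x)) (\<lambda>a b. sm2 (D (snd x)) (\<lambda>a' b'. F2 (b, b') (a, a')))"
  "sm3 op_reassoc_rev F3 = sm3 Q (\<lambda>x y z. sm3 P (\<lambda>X Y Z. F3 (z, Z) (y, Y) (x, X)))"
  "sm2 (rcoact u) L = sm3 (dl u) (\<lambda>a v d. L (Si a, d) v)"
  by (simp_all add: smn_defs case_prod_unfold del: uncurry)

lemma sm_romega:
  assumes F: "\<And>y u. resp (HH H) (\<lambda>x. F x y u)" "\<And>x u. resp (HH H) (\<lambda>y. F x y u)" "\<And>x y. lin s (F x y)"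
  shows "sm3 romega F = sm5 W (\<lambda>a b v c d. sm2 twist_inv (\<lambda>f g. F (Si (a * f), d) (Si (b * g), c) v))"
proof -
  note [simp] = resp2_lin[OF F(1)] resp2_lin[OF F(2)] lin_comp[OF F(3)]
  have 1: "sm (terms (inv\<^bsub>talg (HH H)\<^esub> (drinfeld_twist H))) K = sm twist_inv K" if "resp (HH H) K" for K
    using that unfolding drinfeld_twist_inv by (rule sm_terms_tens)
  have "sm3 romega F = sm (terms (Omega' H s \<Psi>)) (\<lambda>(a, b, v, c, d). F (a, d) (b, c) v)"
    by (simp add: smn_defs case_prod_unfold del: uncurry)
  also have "\<dots> = sm5 W (\<lambda>a b v c d. sm (terms (inv\<^bsub>talg (HH H)\<^esub> (drinfeld_twist H))) (\<lambda>p. F (Si (a * fst p), d)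
    (Si (b * snd p), c) v))"
    unfolding Omega'_def by (subst sm_terms_tens) (simp_all add: case_prod_unfold smn_defs del: uncurry)
  also have "\<dots> = sm5 W (\<lambda>a b v c d. sm2 twist_inv (\<lambda>f g. F (Si (a * f), d) (Si (b * g), c) v))"
    by (subst 1) (simp_all add: sm2_def)
  finally show ?thesis .
qed

text \<open>As \<open>lcoact_omega\<close>, with \<Psi> and f^{-1} in place of \<Psi>^{-1} and f,
  and with the left leg under S^{-1}.\<close>

lemma rcoact_omega:
  assumes F: "\<And>y u. resp (HH H) (\<lambda>x. F x y u)" "\<And>x u. resp (HH H) (\<lambda>y. F x y u)" "\<And>x y. lin s (F x y)"
  shows "sm3 romega (\<lambda>x y w. sm2 (rcoact u) (\<lambda>a v. sm2 (rcoact v) (\<lambda>b v'. F (opmul x a) (opmul y b) (v' * w)))) =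
    sm2 (rcoact u) (\<lambda>a v. sm2 (op_comul_rev a) (\<lambda>a1 a2. sm3 romega (\<lambda>x y w. F (opmul a1 x) (opmul a2 y) (w * v))))"
proof -
  note [simp] = resp2_lin[OF F(1)] resp2_lin[OF F(2)] lin_comp[OF F(3)]
  have *: "sm2 (D a) (\<lambda>a1 a2. sm2 twist_inv (\<lambda>f g. F (Si (p * (a1 * f)), x) (Si (q * (a2 * g)), y) z)) =
    sm2 (D (Si a)) (\<lambda>a1 a2. sm2 twist_inv (\<lambda>f g. F (a2 * Si (p * f), x) (a1 * Si (q * g), y) z))" for x y z a p q
    by (rule twist_inv_Si[of "\<lambda>a b. F (a, x) (b, y) z", symmetric]) simp_all
  have "sm3 romega (\<lambda>x y w. sm2 (rcoact u) (\<lambda>a v. sm2 (rcoact v) (\<lambda>b v'. F (opmul x a) (opmul y b) (v' * w)))) =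
    sm2 twist_inv (\<lambda>f g. sm3 (dl u) (\<lambda>a x d. sm3 (dl x) (\<lambda>b v c. sm5 W (\<lambda>p q r t w.
      F (Si ((a * p) * f), d * w) (Si ((b * q) * g), c * t) (v * r)))))"
    by (simp add: sm_right sm_romega opmul_def) (simp only: Si_mult mult.assoc smn_defs, iprover intro: sm_perm)
  also have "\<dots> = sm2 twist_inv (\<lambda>f g. sm5 W (\<lambda>p q r t w. sm3 (dl u) (\<lambda>a v d. sm2 (D a) (\<lambda>a1 a2. sm2 (D d) (\<lambda>d1 d2.
      F (Si ((p * a1) * f), w * d2) (Si ((q * a2) * g), t * d1) (r * v))))))"
    by (subst coact_coassoc_W) (simp_all add: lin5_def)
  also have "\<dots> = sm5 W (\<lambda>p q r t w. sm3 (dl u) (\<lambda>a v d. sm2 (D d) (\<lambda>d1 d2. sm2 (D a) (\<lambda>a1 a2. sm2 twist_inv (\<lambda>f g.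
      F (Si (p * (a1 * f)), w * d2) (Si (q * (a2 * g)), t * d1) (r * v))))))"
    by (simp only: smn_defs mult.assoc, iprover intro: sm_perm)
  also have "\<dots> = sm2 (rcoact u) (\<lambda>a v. sm2 (op_comul_rev a) (\<lambda>a1 a2. sm3 romega (\<lambda>x y w. F (opmul a1 x) (opmul
    a2 y) (w * v))))"
    unfolding * by (simp add: sm_right sm_romega opmul_def) (simp only: smn_defs, iprover intro: sm_perm)
  finally show ?thesis .
qed

text \<open>Here \<open>Q_rev\<close> stands behind the inverse twists. The cocycle identity turns
  it into \<Phi>^{-1} in front of them, where, together with \<Phi> on the right legs, it completes
  the pentagon of \<Psi>.\<close>

lemma romega_pentagon:
  assumes F: "\<And>y z u. resp (HH H) (\<lambda>x. F x y z u)" "\<And>x z u. resp (HH H) (\<lambda>y. F x y z u)"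
    "\<And>x y u. resp (HH H) (\<lambda>z. F x y z u)" "\<And>x y z. lin s (F x y z)"
  shows "sm3 op_reassoc_rev (\<lambda>X Y Z. sm3 romega (\<lambda>x y w. sm2 (op_comul_rev x) (\<lambda>x1 x2. sm3 romega (\<lambda>x' y' w'.
    sm2 (rcoact w') (\<lambda>a v.
         F (opmul X (opmul x1 x')) (opmul Y (opmul x2 y')) (opmul Z (opmul y a)) (v * w)))))) =
    sm3 romega (\<lambda>x y w. sm2 (op_comul_rev y) (\<lambda>y1 y2. sm3 romega (\<lambda>x' y' w'. F x (opmul y1 x') (opmul y2 y') (w'
      * w))))"
    (is "?lhs = ?rhs")
proof -
  note [simp] = resp2_lin[OF F(1)] resp2_lin[OF F(2)] resp2_lin[OF F(3)] lin_comp[OF F(4)]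
  have *: "sm2 (D (Si e)) (\<lambda>k1 k2. sm2 twist_inv (\<lambda>f g. F (x * (k2 * Si (p * f)), x') (y * (k1 * Si (q * g)),
    y') z v)) =
    sm2 (D e) (\<lambda>d1 d2. sm2 twist_inv (\<lambda>f g. F (x * Si (p * (d1 * f)), x') (y * Si (q * (d2 * g)), y') z v))" for
      e x y x' y' z v p q
    using twist_inv_Si[of "\<lambda>a b. F (x * a, x') (y * b, y') z v"] by simp
  have **: "sm2 (D (Si e)) (\<lambda>k1 k2. sm2 twist_inv (\<lambda>f g. F x (k2 * Si (p * f), y) (k1 * Si (q * g), z) v)) =
    sm2 (D e) (\<lambda>d1 d2. sm2 twist_inv (\<lambda>f g. F x (Si (p * (d1 * f)), y) (Si (q * (d2 * g)), z) v))" for e x y z v p q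
    using twist_inv_Si[of "\<lambda>a b. F x (a, y) (b, z) v"] by simp
  have "?lhs = sm3 Q (\<lambda>x y z. sm3 P (\<lambda>X Y Z. sm5 W (\<lambda>a b v c d. sm2 twist_inv (\<lambda>f g. sm2 (D d) (\<lambda>d1 d2.
      sm5 W (\<lambda>a' b' v' c' d'. sm3 (dl v') (\<lambda>e v0 e'. sm2 (D (Si (a * f))) (\<lambda>k1 k2. sm2 twist_inv (\<lambda>f' g'.
      F (z * (k2 * Si (a' * f')), (d' * d2) * Z) (y * (k1 * Si (b' * g')), (c' * d1) * Y) (x * (Si (b * g) * Si
        e), (e' * c) * X) (v0 * v))))))))))"
    by (simp add: sm_right sm_romega opmul_def mult.assoc) (simp only: smn_defs, iprover intro: sm_perm)
  also have "\<dots> = sm3 Q (\<lambda>x y z. sm3 P (\<lambda>X Y Z. sm5 W (\<lambda>a b v c d. sm2 twist_inv (\<lambda>f g. sm2 (D d) (\<lambda>d1 d2.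
      sm5 W (\<lambda>a' b' v' c' d'. sm3 (dl v') (\<lambda>e v0 e'. sm2 (D (a * f)) (\<lambda>k1 k2. sm2 twist_inv (\<lambda>f' g'.
      F (z * Si (a' * (k1 * f')), (d' * d2) * Z) (y * Si (b' * (k2 * g')), (c' * d1) * Y) (x * (Si (b * g) * Si
        e), (e' * c) * X) (v0 * v))))))))))"
    unfolding * ..
  also have "\<dots> = sm (twist_inv_left \<star> Q_rev) (\<lambda>(r1, r2, r3). sm3 P (\<lambda>X Y Z. sm (t_coact W \<star> t_outer W) (\<lambda>(l1,
    l2, l3, v, m1, m2, m3).
      F (Si (l1 * r1), m3 * Z) (Si (l2 * r2), m2 * Y) (Si (l3 * r3), m1 * X) v)))"
    by (simp add: Q_rev_def twist_inv_left_def uncurry_twist_inv t7_defs Si_mult mult.assoc)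
      (simp only: smn_defs, iprover intro: sm_perm)
  also have "\<dots> = sm (Q \<star> twist_inv_right) (\<lambda>(r1, r2, r3). sm3 P (\<lambda>X Y Z. sm (t_coact W \<star> t_outer W) (\<lambda>(l1, l2,
    l3, v, m1, m2, m3).
      F (Si (l1 * r1), m3 * Z) (Si (l2 * r2), m2 * Y) (Si (l3 * r3), m1 * X) v)))"
    by (rule tens_eqD[OF twist_cocycle_variants(2)]) (simp add: case_prod_unfold)
  also have "\<dots> = sm twist_inv_right (\<lambda>(r1, r2, r3). sm (t_coact W \<star> t_outer W \<star> t_assoc Q P) (\<lambda>(l1, l2, l3, v,
    m1, m2, m3).
      F (Si (l1 * r1), m3) (Si (l2 * r2), m2) (Si (l3 * r3), m1) v))"
    by (simp add: twist_inv_right_def uncurry_twist_inv t7_defs mult.assoc) (simp only: smn_defs, iprover intro: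
      sm_perm)
  also have "\<dots> = sm twist_inv_right (\<lambda>(r1, r2, r3). sm (t_inner W \<star> t_mid W) (\<lambda>(l1, l2, l3, v, m1, m2, m3).
      F (Si (l1 * r1), m3) (Si (l2 * r2), m2) (Si (l3 * r3), m1) v))"
  proof -
    have "sm (t_coact W \<star> t_outer W \<star> t_assoc Q P) (\<lambda>(l1, l2, l3, v, m1, m2, m3).
      F (Si (l1 * r1), m3) (Si (l2 * r2), m2) (Si (l3 * r3), m1) v) = sm (t_inner W \<star> t_mid W) (\<lambda>(l1, l2, l3, v,
        m1, m2, m3).
      F (Si (l1 * r1), m3) (Si (l2 * r2), m2) (Si (l3 * r3), m1) v)" for r1 r2 r3
      by (rule tens_eqD[OF psi_pentagon_tens', symmetric]) simp
    then show ?thesis by (simp only:)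
  qed
  also have "\<dots> = sm5 W (\<lambda>a b v c d. sm2 twist_inv (\<lambda>f g. sm2 (D c) (\<lambda>c1 c2. sm5 W (\<lambda>a' b' v' c' d'.
      sm2 (D (b * g)) (\<lambda>d1 d2. sm2 twist_inv (\<lambda>f' g'. F (Si (a * f), d) (Si (a' * (d1 * f')), d' * c2) (Si (b' *
        (d2 * g')), c' * c1) (v' * v)))))))"
    by (simp add: twist_inv_right_def uncurry_twist_inv t7_defs mult.assoc) (simp only: smn_defs, iprover intro:
      sm_perm)
  also have "\<dots> = ?rhs"
    unfolding **[symmetric] by (simp add: sm_right sm_romega opmul_def) (simp only: smn_defs, iprover intro: sm_perm)
  finally show ?thesis .
qed

text \<open>Both multiplications are taken opposite. This mirrors the bracketing of triple products,
  so \<Phi> and \<Phi>^{-1} exchange roles and \<open>mulA_assoc_inv\<close> supplies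
  associativity.\<close>

lemma right_smash_product:
  "unital_smash_product_data bs s (HH H) (\<lambda>p q. q \<diamond> p) (\<lambda>u v. v * u) biact opmul (\<lambda>x. op_comul_rev x)
    op_reassoc_rev (\<lambda>u. rcoact u) romega
     (bunit A) 1 (1, 1) opcounit"
proof (intro unital_smash_product_data.intro smash_product_data.intro unital_smash_product_data_axioms.intro)
  show "g (r \<diamond> q \<diamond> p) = sm3 op_reassoc_rev (\<lambda>x y z. g ((biact z r \<diamond> biact y q) \<diamond> biact x p))" if "lin bs g" for g p q r
    unfolding sm_right by (rule mulA_assoc_inv[OF that])
  show "g (biact x (q \<diamond> p)) = sm2 (op_comul_rev x) (\<lambda>y z. g (biact z q \<diamond> biact y p))" if "lin bs g" for g x p q
    unfolding sm_right using biact_mulA[OF that, of "fst x" "snd x"] by simp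
  show "sm2 (op_comul_rev (opmul x x')) F = sm2 (op_comul_rev x) (\<lambda>y z. sm2 (op_comul_rev x') (\<lambda>y' z'. F (opmul
    y y') (opmul z z')))"
    if F: "\<And>z. resp (HH H) (\<lambda>y. F y z)" "\<And>y. resp (HH H) (F y)" for x x' F
  proof -
    note [simp] = resp2_lin[OF F(1)] resp2_lin[OF F(2)]
    show ?thesis by (simp only: sm_right) (simp add: opmul_def, simp only: smn_defs, iprover intro: sm_perm)
  qed
  show "sm2 (rcoact (u' * u)) L = sm2 (rcoact u) (\<lambda>x v. sm2 (rcoact u') (\<lambda>x' v'. L (opmul x x') (v' * v)))"
    "lin s (\<lambda>u. sm2 (rcoact u) L)" "sm2 (rcoact 1) L = L (1, 1) 1"
    if L: "\<And>v. resp (HH H) (\<lambda>x. L x v)" "\<And>x. lin s (L x)" for L u u'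
  proof -
    note [simp] = resp2_lin[OF L(1)] lin_comp[OF L(2)]
    show "sm2 (rcoact (u' * u)) L = sm2 (rcoact u) (\<lambda>x v. sm2 (rcoact u') (\<lambda>x' v'. L (opmul x x') (v' * v)))"
      by (simp add: sm_right Si_mult) (simp only: smn_defs, iprover intro: sm_perm)
    show "lin s (\<lambda>u. sm2 (rcoact u) L)" "sm2 (rcoact 1) L = L (1, 1) 1"
      by (simp_all add: sm_right)
  qed
  show "sm3 romega (\<lambda>x y w. opcounit x * F y w) = F (1, 1) 1" "sm3 romega (\<lambda>x y w. opcounit y * F x w) = F (1, 1) 1"
    if F: "\<And>v. resp (HH H) (\<lambda>x. F x v)" "\<And>x. lin s (F x)" for F
  proof -
    note [simp] = resp2_lin[OF F(1)] lin_comp[OF F(2)]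
    have tw: "sm2 twist_inv (\<lambda>f g. \<epsilon> f * F (Si (c * g), a) v) = F (Si c, a) v"
      "sm2 twist_inv (\<lambda>f g. \<epsilon> g * F (Si (c * f), a) v) = F (Si c, a) v" for a c v
      using twist_inv_counit[of "\<lambda>x. F (Si (c * x), a) v"] by simp_all
    have "sm3 romega (\<lambda>x y w. opcounit x * F y w) = sm5 W (\<lambda>a b v c d. \<epsilon> a * (\<epsilon> d * sm2 twist_inv (\<lambda>f g. \<epsilon> f * F
      (Si (b * g), c) v)))"
      by (simp add: sm_romega opcounit_def mult.assoc mult.left_commute flip: sm_pull)
    also have "\<dots> = F (1, 1) 1"
      using psi_counit_outer[of "\<lambda>b v c. F (Si b, c) v"] by (simp add: tw)
    finally show "sm3 romega (\<lambda>x y w. opcounit x * F y w) = F (1, 1) 1" .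
    have "sm3 romega (\<lambda>x y w. opcounit y * F x w) = sm5 W (\<lambda>a b v c d. \<epsilon> b * (\<epsilon> c * sm2 twist_inv (\<lambda>f g. \<epsilon> g * F
      (Si (a * f), d) v)))"
      by (simp add: sm_romega opcounit_def mult.assoc mult.left_commute flip: sm_pull)
    also have "\<dots> = F (1, 1) 1"
      using psi_counit_inner[of "\<lambda>b v c. F (Si b, c) v"] by (simp add: tw)
    finally show "sm3 romega (\<lambda>x y w. opcounit y * F x w) = F (1, 1) 1" .
  qed
  show "sm2 (rcoact u) (\<lambda>a v. opcounit a * f v) = f u" if "lin s f" for f u
    using that by (simp add: sm_right opcounit_def mult.assoc dl_counit)
qed ((erule smash_linearity | rule opcounit_opmul | rule rcoact_omega romega_pentagon; simp; fail | simp add: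
  smash_simps opmul_def mult.assoc; fail)+)

lemma right_crossed_product:
  "(\<forall>x y. tens (UA s A) [x] \<otimes>\<^bsub>rcross H A s \<delta> \<Psi>\<^esub> tens (UA s A) [y] = tens (UA s A) (rprod H A s \<delta> \<Psi> x y)) \<and>
   k_algebra (rcross H A s \<delta> \<Psi>) \<and> \<one>\<^bsub>rcross H A s \<delta> \<Psi>\<^esub> = tens (UA s A) [(1, bunit A)] \<and>
   rincl A s \<in> alg_hom (alg_of s) (rcross H A s \<delta> \<Psi>) \<and> (bunit A \<noteq> 0 \<longrightarrow> inj (rincl A s))"
proof -
  interpret smash: unital_smash_product_data bs s "HH H" "\<lambda>p q. q \<diamond> p" "\<lambda>u v. v * u" biact opmul "\<lambda>x.
    op_comul_rev x" op_reassoc_rev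
    "\<lambda>u. rcoact u" romega "bunit A" 1 "(1, 1)" opcounit by (rule right_smash_product)
  \<comment> \<open>The two arguments swap places: the product of x and y is the smash product of y
    and x for the opposite multiplications.\<close>
  have pr: "sm (rprod H A s \<delta> \<Psi> x y) F = smash.prodform (snd y) (fst y) (snd x) (fst x) (\<lambda>p u. F (u, p))" for F x y
    unfolding smash.prodform_def by (simp add: rprod_def ract_lact case_prod_unfold smn_defs mult.assoc del: uncurry)
  interpret L: tensor_product_structure "UA s A" "\<lambda>c x. (s c (fst x), snd x)" "rprod H A s \<delta> \<Psi>" "(1, bunit A)"
  proof
    fix F :: "'u \<times> 'a \<Rightarrow> 'k" and x y z c assume F: "resp (UA s A) F"
    then have G: "lin bs (\<lambda>p. F (u, p))" "lin s (\<lambda>u. F (u, p))" for p u by simp_all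
    show "F (s c (fst x), snd x) = c * F x" using lin_scale[OF G(2)] by simp
    show "resp (UA s A) (\<lambda>x. sm (rprod H A s \<delta> \<Psi> x y) F)" "resp (UA s A) (\<lambda>y. sm (rprod H A s \<delta> \<Psi> x y) F)"
      by (simp_all add: pr smash.prodform_lin G)
    show "sm (rprod H A s \<delta> \<Psi> x y) (\<lambda>w. sm (rprod H A s \<delta> \<Psi> w z) F) = sm (rprod H A s \<delta> \<Psi> y z) (\<lambda>w. sm (rprod H
      A s \<delta> \<Psi> x w) F)"
      by (simp add: pr smash.prodform_assoc G)
    show "sm (rprod H A s \<delta> \<Psi> (1, bunit A) x) F = F x" "sm (rprod H A s \<delta> \<Psi> x (1, bunit A)) F = F x"
      by (simp_all add: pr smash.prodform_unit_left smash.prodform_unit_right G)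
  qed
  have eq: "rcross H A s \<delta> \<Psi> = L.T" by (simp add: rcross_def L.T_def)
  have incl: "rincl A s = (\<lambda>u. tens (UA s A) [(u, bunit A)])" by (simp add: rincl_def fun_eq_iff)
  have "(\<lambda>u. tens (UA s A) [(u, bunit A)]) \<in> alg_hom (alg_of s) L.T"
    by (rule L.alg_hom_T) (simp_all add: pr smash.prodform_unit_right lin_add[of s "\<lambda>u. _ (u, bunit A)"]
      lin_scale[of s "\<lambda>u. _ (u, bunit A)"])
  moreover have "bunit A \<noteq> 0 \<longrightarrow> inj (rincl A s)"
    using inj_pure_tensor[OF bimod.space vector_space_s] by (simp add: incl)
  ultimately show ?thesis
    by (simp add: eq incl L.k_algebra_T)
qed

end

section \<open>Bicomodule algebras\<close>

text \<open>The assumptions \<open>N1\<close> to \<open>N7\<close> stand for naturality squares, \<open>P1\<close> to \<open>P4\<close> for pentagons.\<close>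

lemma (in monoid) two_sided_pentagon:
  assumes C: "i1 \<in> carrier G" "i2 \<in> carrier G" "i3 \<in> carrier G" "m1 \<in> carrier G" "m2 \<in> carrier G" "m3 \<in> carrier G"
      "p \<in> carrier G" "q \<in> carrier G" "n1 \<in> carrier G" "n2 \<in> carrier G" "k1 \<in> carrier G" "o1 \<in> carrier G" "o2 \<in>
        carrier G"
      "o3 \<in> carrier G" "c1 \<in> carrier G" "c2 \<in> carrier G" "c3 \<in> carrier G" "d1 \<in> carrier G" "d2 \<in> carrier G"
      "d3 \<in> carrier G" "d4 \<in> carrier G" "j1 \<in> carrier G" "o4 \<in> carrier G" "e1 \<in> carrier G"
    and N1: "i3 \<otimes> m1 = n1 \<otimes> i3" and N2: "i3 \<otimes> m2 = n2 \<otimes> i3" and N3: "c2 \<otimes> c3 = c3 \<otimes> d2"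
    and N4: "d2 \<otimes> o1 = o1 \<otimes> d3" and N5: "c1 \<otimes> i1 = i1 \<otimes> d1" and N6: "k1 \<otimes> d3 = d4 \<otimes> k1"
    and N7: "k1 \<otimes> o2 = o4 \<otimes> k1" and P1: "i3 \<otimes> (m3 \<otimes> p) = k1 \<otimes> o3" and P2: "c3 \<otimes> o1 = i1 \<otimes> (j1 \<otimes> k1)"
    and P3: "d4 \<otimes> o4 = e1 \<otimes> (n2 \<otimes> q)" and P4: "d1 \<otimes> (j1 \<otimes> e1) = i2 \<otimes> n1" and K: "k1 \<otimes> (o3 \<otimes> q) = q \<otimes> (k1 \<otimes> o3)"
  shows "(i1 \<otimes> (i2 \<otimes> i3)) \<otimes> ((m1 \<otimes> (m2 \<otimes> m3)) \<otimes> (p \<otimes> q)) = (c1 \<otimes> (c2 \<otimes> c3)) \<otimes> (o1 \<otimes> (o2 \<otimes> o3))"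
proof -
  have ext: "a \<otimes> b = c \<Longrightarrow> a \<otimes> (b \<otimes> z) = c \<otimes> z"
    if "a \<in> carrier G" "b \<in> carrier G" "z \<in> carrier G" for a b c z
    using that by (simp flip: m_assoc)
  note E = ext[OF _ _ _ N1] ext[OF _ _ _ N2] ext[OF _ _ _ N5] ext[OF _ _ _ N6] ext[OF _ _ _ N7] ext[OF _ _ _ P2]
    ext[OF _ _ _ P3]
  have P1': "i3 \<otimes> (m3 \<otimes> (p \<otimes> z)) = k1 \<otimes> (o3 \<otimes> z)" if "z \<in> carrier G" for z
    using arg_cong[OF P1, of "\<lambda>x. x \<otimes> z"] that by (simp add: C m_assoc)
  have P4': "d1 \<otimes> (j1 \<otimes> (e1 \<otimes> z)) = i2 \<otimes> (n1 \<otimes> z)" if "z \<in> carrier G" for z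
    using arg_cong[OF P4, of "\<lambda>x. x \<otimes> z"] that by (simp add: C m_assoc)
  \<comment> \<open>The right side here is the common path to which both sides of the pentagon are
    rewritten.\<close>
  have "(i1 \<otimes> (i2 \<otimes> i3)) \<otimes> ((m1 \<otimes> (m2 \<otimes> m3)) \<otimes> (p \<otimes> q)) = i1 \<otimes> (i2 \<otimes> (n1 \<otimes> (n2 \<otimes> (q \<otimes> (k1 \<otimes> o3)))))"
    by (simp only: m_assoc m_closed C E P1' K)
  moreover have "(c1 \<otimes> (c2 \<otimes> c3)) \<otimes> (o1 \<otimes> (o2 \<otimes> o3)) = c1 \<otimes> (c3 \<otimes> (o1 \<otimes> (d3 \<otimes> (o2 \<otimes> o3))))"
    by (simp only: m_assoc m_closed C ext[OF _ _ _ N3] ext[OF _ _ _ N4])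
  moreover have "c1 \<otimes> (c3 \<otimes> (o1 \<otimes> (d3 \<otimes> (o2 \<otimes> o3)))) = i1 \<otimes> (i2 \<otimes> (n1 \<otimes> (n2 \<otimes> (q \<otimes> (k1 \<otimes> o3)))))"
    by (simp only: m_assoc m_closed C E P4')
  ultimately show ?thesis by simp
qed

text \<open>
  One side of a bicomodule algebra. The right side takes this form when all its legs are
  reversed and its reassociators are inverted; the leg next to the algebra is always the last one.
\<close>

locale side_coaction =
  fixes hs :: "'k::field \<Rightarrow> 'h::{ring,monoid_mult} \<Rightarrow> 'h" and s :: "'k \<Rightarrow> 'u::{ring,monoid_mult} \<Rightarrow> 'u"
    and \<epsilon> :: "'h \<Rightarrow> 'k" and D :: "'h \<Rightarrow> ('h \<times> 'h) list" and P :: "('h \<times> 'h \<times> 'h) list"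
    and lam :: "'u \<Rightarrow> ('h \<times> 'u) list" and A A' :: "('h \<times> 'h \<times> 'u) list"
  assumes alg_hs: "k_algebra (alg_of hs)" and alg_s: "k_algebra (alg_of s)"
    and eps: "lin hs \<epsilon>" "\<epsilon> (x * y) = \<epsilon> x * \<epsilon> y" "\<epsilon> 1 = 1"
    and side_D: "\<lbrakk>\<And>y. lin hs (\<lambda>x. F x y); \<And>x. lin hs (F x)\<rbrakk> \<Longrightarrow>
      sm2 (D 1) F = F 1 1 \<and> sm2 (D (h * k)) F = sm2 (D h) (\<lambda>a b. sm2 (D k) (\<lambda>c d. F (a * c) (b * d))) \<and> lin hs
        (\<lambda>h. sm2 (D h) F)"
    and side_D_counit: "lin hs f \<Longrightarrow> sm2 (D h) (\<lambda>x y. \<epsilon> x * f y) = f h" "lin hs f \<Longrightarrow> sm2 (D h) (\<lambda>x y. \<epsilon> y * f x) = f h"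
    and side_lam: "\<lbrakk>\<And>y. lin hs (\<lambda>x. L x y); \<And>x. lin s (L x)\<rbrakk> \<Longrightarrow>
      sm2 (lam 1) L = L 1 1 \<and> sm2 (lam (u * v)) L = sm2 (lam u) (\<lambda>a b. sm2 (lam v) (\<lambda>c d. L (a * c) (b * d))) \<and>
        lin s (\<lambda>u. sm2 (lam u) L)"
    and lam_counit: "lin s g \<Longrightarrow> sm2 (lam u) (\<lambda>a v. \<epsilon> a * g v) = g u"
    and A_counit: "\<lbrakk>\<And>y. lin hs (\<lambda>x. L x y); \<And>x. lin s (L x)\<rbrakk> \<Longrightarrow>
      sm3 A (\<lambda>a b v. \<epsilon> b * L a v) = L 1 1 \<and> sm3 A (\<lambda>a b v. \<epsilon> a * L b v) = L 1 1"
    and A_inv: "\<lbrakk>\<And>b v. lin hs (\<lambda>a. K a b v); \<And>a v. lin hs (\<lambda>b. K a b v); \<And>a b. lin s (K a b)\<rbrakk> \<Longrightarrow>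
      sm3 A (\<lambda>a b v. sm3 A' (\<lambda>a' b' v'. K (a * a') (b * b') (v * v'))) = K 1 1 1 \<and>
      sm3 A' (\<lambda>a b v. sm3 A (\<lambda>a' b' v'. K (a * a') (b * b') (v * v'))) = K 1 1 1"
    and A_coassoc: "\<lbrakk>\<And>b v. lin hs (\<lambda>a. K a b v); \<And>a v. lin hs (\<lambda>b. K a b v); \<And>a b. lin s (K a b)\<rbrakk> \<Longrightarrow>
      sm2 (lam u) (\<lambda>a v. sm2 (lam v) (\<lambda>b w. sm3 A (\<lambda>p q r. K (a * p) (b * q) (w * r)))) =
      sm3 A (\<lambda>p q r. sm2 (lam u) (\<lambda>a v. sm2 (D a) (\<lambda>s t. K (p * s) (q * t) (r * v))))"
    and A_pentagon: "\<lbrakk>\<And>b c v. lin hs (\<lambda>a. M a b c v); \<And>a c v. lin hs (\<lambda>b. M a b c v); \<And>a b v. lin hs (\<lambda>c. M a b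
      c v); \<And>a b c. lin s (M a b c)\<rbrakk> \<Longrightarrow>
      sm3 A (\<lambda>a b v. sm3 A (\<lambda>d e w. sm2 (D e) (\<lambda>s t. sm3 P (\<lambda>x y z. M (d * x) (a * (s * y)) (b * (t * z)) (v * w))))) =
      sm3 A (\<lambda>a b v. sm2 (lam v) (\<lambda>c w. sm3 A (\<lambda>d e u. sm2 (D d) (\<lambda>s t. M (a * s) (b * t) (c * e) (w * u)))))"
begin

lemmas side_lmap [simp] = lmap_mult[OF alg_hs] lmap_mult[OF alg_s]

lemma side_comul [simp]:
  assumes "\<And>y. lin hs (\<lambda>x. F x y)" "\<And>x. lin hs (F x)"
  shows "sm2 (D 1) F = F 1 1" "sm2 (D (h * k)) F = sm2 (D h) (\<lambda>a b. sm2 (D k) (\<lambda>c d. F (a * c) (b * d)))"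
    "lmap t hs g \<Longrightarrow> lin t (\<lambda>h. sm2 (D (g h)) F)"
  using side_D[OF assms] lin_comp by blast+

lemma side_coact [simp]:
  assumes "\<And>y. lin hs (\<lambda>x. L x y)" "\<And>x. lin s (L x)"
  shows "sm2 (lam 1) L = L 1 1" "sm2 (lam (u * v)) L = sm2 (lam u) (\<lambda>a b. sm2 (lam v) (\<lambda>c d. L (a * c) (b * d)))"
    "lmap t s g \<Longrightarrow> lin t (\<lambda>u. sm2 (lam (g u)) L)"
  using side_lam[OF assms] lin_comp by blast+

lemma side_uncurry [simp]: "sm (D h) F2 = sm2 (D h) (\<lambda>a b. F2 (a, b))" "sm (lam u) G2 = sm2 (lam u) (\<lambda>a b. G2 (a, b))"
  "sm A F3 = sm3 A (\<lambda>a b c. F3 (a, b, c))" "sm P G3 = sm3 P (\<lambda>a b c. G3 (a, b, c))" "sm A' F3 = sm3 A' (\<lambda>a b c.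
    F3 (a, b, c))"
  by (rule sm_uncurry)+

end

text \<open>\<open>B\<close> is the mixed associator. The right side enters in the reversed form of
  \<open>side_coaction\<close>, so \<open>C\<close> plays the role of the reversed inverse of
  \<Phi>_\<rho>, and the right pentagon is stated in the arrangement in which only this inverse
  occurs.\<close>

locale bicoaction = L: side_coaction hs s \<epsilon> D1 P1 lam A A' + R: side_coaction hs s \<epsilon> D2 P2 rho C C'
  for hs :: "'k::field \<Rightarrow> 'h::{ring,monoid_mult} \<Rightarrow> 'h" and s :: "'k \<Rightarrow> 'u::{ring,monoid_mult} \<Rightarrow> 'u"
    and \<epsilon> D1 D2 P1 P2 lam rho A A' C C' +
  fixes B B' :: "('h \<times> 'u \<times> 'h) list"
  assumes B_inv: "\<lbrakk>\<And>v b. lin hs (\<lambda>a. K a v b); \<And>a b. lin s (\<lambda>v. K a v b); \<And>a v. lin hs (K a v)\<rbrakk> \<Longrightarrow>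
      sm3 B (\<lambda>a v b. sm3 B' (\<lambda>a' v' b'. K (a * a') (v * v') (b * b'))) = K 1 1 1 \<and>
      sm3 B' (\<lambda>a v b. sm3 B (\<lambda>a' v' b'. K (a * a') (v * v') (b * b'))) = K 1 1 1"
    and B_nat: "\<lbrakk>\<And>v b. lin hs (\<lambda>a. K a v b); \<And>a b. lin s (\<lambda>v. K a v b); \<And>a v. lin hs (K a v)\<rbrakk> \<Longrightarrow>
      sm2 (lam u) (\<lambda>a v. sm2 (rho v) (\<lambda>b w. sm3 B (\<lambda>p r q. K (a * p) (w * r) (b * q)))) =
      sm3 B (\<lambda>p r q. sm2 (rho u) (\<lambda>b v. sm2 (lam v) (\<lambda>a w. K (p * a) (r * w) (q * b))))"
    and left_pentagon: "\<lbrakk>\<And>b v x. lin hs (\<lambda>a. M a b v x); \<And>a v x. lin hs (\<lambda>b. M a b v x); \<And>a b x. lin s (\<lambda>v. M a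
      b v x); \<And>a b v. lin hs (M a b v)\<rbrakk> \<Longrightarrow>
      sm3 B (\<lambda>b v x. sm3 B (\<lambda>a u y. sm2 (lam u) (\<lambda>c w. sm3 A (\<lambda>p q r. M (a * p) (b * (c * q)) (v * (w * r)) (x *
        y))))) =
      sm3 A (\<lambda>p q r. sm2 (rho r) (\<lambda>x w. sm3 B (\<lambda>a v y. sm2 (D1 a) (\<lambda>s t. M (p * s) (q * t) (w * v) (x * y)))))"
    and right_pentagon: "\<lbrakk>\<And>v x y. lin hs (\<lambda>a. N a v x y); \<And>a x y. lin s (\<lambda>v. N a v x y); \<And>a v y. lin hs (\<lambda>x. N a
      v x y); \<And>a v x. lin hs (N a v x)\<rbrakk> \<Longrightarrow>
      sm3 B (\<lambda>a v y. sm2 (rho v) (\<lambda>x w. sm3 B (\<lambda>b u z. sm3 C (\<lambda>q p r. sm2 (lam r) (\<lambda>c s. N (a * (b * c)) (w * (u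
        * s)) (x * (z * p)) (y * q)))))) =
      sm3 C (\<lambda>q p r. sm3 B (\<lambda>a v y. sm2 (D2 y) (\<lambda>s t. N a (r * v) (p * t) (q * s))))"
begin

lemma uncurry_B [simp]: "sm B F = sm3 B (\<lambda>a b c. F (a, b, c))" "sm B' F = sm3 B' (\<lambda>a b c. F (a, b, c))"
  by (rule sm_uncurry)+

abbreviation "h1 \<equiv> vrel hs"
abbreviation "T5 \<equiv> h1 \<boxtimes> h1 \<boxtimes> vrel s \<boxtimes> h1 \<boxtimes> h1"
abbreviation "T7 \<equiv> h1 \<boxtimes> h1 \<boxtimes> h1 \<boxtimes> vrel s \<boxtimes> h1 \<boxtimes> h1 \<boxtimes> h1"

lemma mult_ideal_T [simp]: "mult_ideal T5" "mult_ideal T7"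
  by (intro mult_ideal_trel mult_ideal_vrel L.alg_hs L.alg_s)+

section \<open>The coaction and associator of index l\<close>

definition "dlt u = [(a, w, b). (b, v) \<leftarrow> rho u, (a, w) \<leftarrow> lam v]"
text \<open>\<open>psi1\<close>, \<open>psi2\<close> and \<open>psi3\<close> are the factors of
  \<Psi>_l that contain \<Phi>_{\<lambda>,\<rho>}, \<Phi>_\<rho>^{-1} and \<Phi>_\<lambda>. Kept
  apart, they turn the pentagon into a pasting of small diagrams.\<close>

definition "psi1 = [(a, c, w, b, 1 :: 'h). (a, v, b) \<leftarrow> B, (c, w) \<leftarrow> lam v]"
definition "psi2 = [(a, c, w, y, z). (z, y, v) \<leftarrow> C, (a, v') \<leftarrow> lam v, (c, w) \<leftarrow> lam v']"
definition "psi3 = [(a, b, v, 1 :: 'h, 1 :: 'h). (a, b, v) \<leftarrow> A]"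
definition "psi = psi1 \<star> psi2 \<star> psi3"

lemmas psi_defs = dlt_def psi_def psi1_def psi2_def psi3_def

context
begin

text \<open>The letters i, m, c and o name the factors of the inner, middle, coacted and outer
  copies of \<open>psi\<close> in the pentagon, and \<open>p0\<close>, \<open>q0\<close> the
  reassociators. The letters n, k, j, d, e and the tensor \<open>o4\<close> are the inner edges of
  the subdivided diagram.\<close>

private definition "i1 = [(1, a, c, w, b, 1, 1). (a, v, b) \<leftarrow> B, (c, w) \<leftarrow> lam v]"
private definition "i2 = [(1, a, c, w, y, z, 1). (z, y, v) \<leftarrow> C, (a, v') \<leftarrow> lam v, (c, w) \<leftarrow> lam v']"
private definition "i3 = [(1, a, b, v, 1, 1, 1). (a, b, v) \<leftarrow> A]"
private definition "m1 = [(a, b, c, w, x, y, 1). (a, v, xy) \<leftarrow> B, (bc, w) \<leftarrow> lam v, (b, c) \<leftarrow> D1 bc, (y, x) \<leftarrow> D2 xy]"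
private definition "m2 = [(a, b, c, w, x, y, z). (z, xy, v) \<leftarrow> C, (a, v') \<leftarrow> lam v, (bc, w) \<leftarrow> lam v', (b, c) \<leftarrow> D1
  bc, (y, x) \<leftarrow> D2 xy]"
private definition "m3 = [(a, b, c, v, 1, 1, 1). (a, bc, v) \<leftarrow> A, (b, c) \<leftarrow> D1 bc]"
private definition "p0 = [(a, b, c, 1, 1, 1, 1). (a, b, c) \<leftarrow> P1]"
private definition "q0 = [(1, 1, 1, 1, x, y, z). (z, y, x) \<leftarrow> P2]"
private definition "n1 = [(a, b, c, w, x, y, 1). (a, v, xy) \<leftarrow> B, (b, v') \<leftarrow> lam v, (c, w) \<leftarrow> lam v', (y, x) \<leftarrow> D2 xy]"
private definition "n2 = [(a, b, c, w, x, y, z). (z, xy, v) \<leftarrow> C, (a, v1) \<leftarrow> lam v, (b, v2) \<leftarrow> lam v1, (c, w) \<leftarrow> lam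
  v2, (y, x) \<leftarrow> D2 xy]"
private definition "k1 = [(a, b, c, w, 1, 1, 1). (a, b, v) \<leftarrow> A, (c, w) \<leftarrow> lam v]"
private definition "o1 = [(a, b, c, w, x, 1, 1). (ab, v, x) \<leftarrow> B, (a, b) \<leftarrow> D1 ab, (c, w) \<leftarrow> lam v]"
private definition "o2 = [(a, b, c, w, x, y, z). (yz, x, v) \<leftarrow> C, (ab, v') \<leftarrow> lam v, (c, w) \<leftarrow> lam v', (a, b) \<leftarrow> D1
  ab, (z, y) \<leftarrow> D2 yz]"
private definition "o3 = [(a, b, c, v, 1, 1, 1). (ab, c, v) \<leftarrow> A, (a, b) \<leftarrow> D1 ab]"
private definition "c1 = [(a, b, c, w, x, y, 1). (a, v, y) \<leftarrow> B, (b, v') \<leftarrow> lam v, (x, v2) \<leftarrow> rho v', (c, w) \<leftarrow> lam v2]"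
private definition "c2 = [(a, b, c, w, x, y, z). (z, y, v) \<leftarrow> C, (a, v1) \<leftarrow> lam v, (b, v2) \<leftarrow> lam v1, (x, v3) \<leftarrow> rho
  v2, (c, w) \<leftarrow> lam v3]"
private definition "c3 = [(a, b, c, w, x, 1, 1). (a, b, v) \<leftarrow> A, (x, v') \<leftarrow> rho v, (c, w) \<leftarrow> lam v']"
private definition "d2 = [(a, b, c, w, x, y, z). (z, y, v) \<leftarrow> C, (ab, v2) \<leftarrow> lam v, (a, b) \<leftarrow> D1 ab, (x, v3) \<leftarrow> rho
  v2, (c, w) \<leftarrow> lam v3]"
private definition "d3 = [(a, b, c, w, x, y, z). (z, y, v) \<leftarrow> C, (x, v1) \<leftarrow> rho v, (ab, v2) \<leftarrow> lam v1, (a, b) \<leftarrow> D1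
  ab, (c, w) \<leftarrow> lam v2]"
private definition "d4 = [(a, b, c, w, x, y, z). (z, y, v) \<leftarrow> C, (x, v1) \<leftarrow> rho v, (a, v2) \<leftarrow> lam v1, (b, v3) \<leftarrow> lam
  v2, (c, w) \<leftarrow> lam v3]"
private definition "j1 = [(a, b, c, w, x, 1, 1). (a, v, x) \<leftarrow> B, (b, v1) \<leftarrow> lam v, (c, w) \<leftarrow> lam v1]"
private definition "d1 = [(a, b, c, w, x, y, 1). (a, v, y) \<leftarrow> B, (x, v1) \<leftarrow> rho v, (b, v2) \<leftarrow> lam v1, (c, w) \<leftarrow> lam v2]"
private definition "o4 = [(a, b, c, w, x, y, z). (yz, x, v) \<leftarrow> C, (a, v1) \<leftarrow> lam v, (b, v2) \<leftarrow> lam v1, (c, w) \<leftarrow> lam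
  v2, (z, y) \<leftarrow> D2 yz]"
private definition "e1 = [(a, b, c, w, x, y, 1). (y, x, v) \<leftarrow> C, (a, v1) \<leftarrow> lam v, (b, v2) \<leftarrow> lam v1, (c, w) \<leftarrow> lam v2]"

private lemmas defs = i1_def i2_def i3_def m1_def m2_def m3_def p0_def q0_def n1_def n2_def k1_def o1_def o2_def
  o3_def c1_def c2_def c3_def d2_def d3_def d4_def j1_def d1_def o4_def e1_def

text \<open>Naturality of \<Phi>_\<lambda> at the algebra leg of the mixed associator. In all these
  squares \<open>G\<close> carries the remaining coactions and comultiplications, so that
  \<open>law\<close> is a plain instance of an axiom.\<close>

private lemma N1: "tens T7 (i3 \<star> m1) = tens T7 (n1 \<star> i3)"
proof (rule tens_eqI)
  fix F assume F: "resp T7 F"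
  note [simp] = resp7_lin[OF F]
  define G where "G = (\<lambda>a xy b c w. sm2 (D2 xy) (\<lambda>y x. F (a, b, c, w, x, y, 1)))"
  have law: "sm3 A (\<lambda>p' q' r'. sm2 (lam v) (\<lambda>a' v'. sm2 (D1 a') (\<lambda>s' t'. G a xy (p' * s') (q' * t') (r' * v'))))
    = sm2 (lam v) (\<lambda>a' v'. sm2 (lam v') (\<lambda>b' w'. sm3 A (\<lambda>p' q' r'. G a xy (a' * p') (b' * q') (w' * r'))))" for a v xy
    by (rule L.A_coassoc[symmetric]) (simp_all add: G_def)
  have "sm (i3 \<star> m1) F = sm3 B (\<lambda>a v xy. sm3 A (\<lambda>p' q' r'. sm2 (lam v) (\<lambda>a' v'. sm2 (D1 a') (\<lambda>s' t'. G a xy (p'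
    * s') (q' * t') (r' * v')))))"
    by (simp add: G_def defs) (simp only: smn_defs, iprover intro: sm_perm)
  also have "\<dots> = sm3 B (\<lambda>a v xy. sm2 (lam v) (\<lambda>a' v'. sm2 (lam v') (\<lambda>b' w'. sm3 A (\<lambda>p' q' r'. G a xy (a' * p')
    (b' * q') (w' * r')))))"
    unfolding law ..
  also have "\<dots> = sm (n1 \<star> i3) F"
    by (simp add: G_def defs) (simp only: smn_defs, iprover intro: sm_perm)
  finally show "sm (i3 \<star> m1) F = sm (n1 \<star> i3) F" .
qed

private lemma N2: "tens T7 (i3 \<star> m2) = tens T7 (n2 \<star> i3)"
proof (rule tens_eqI)
  fix F assume F: "resp T7 F"
  note [simp] = resp7_lin[OF F]
  define G where "G = (\<lambda>z xy a b c w. sm2 (D2 xy) (\<lambda>y x. F (a, b, c, w, x, y, z)))"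
  have law: "sm3 A (\<lambda>p' q' r'. sm2 (lam v') (\<lambda>a' v'. sm2 (D1 a') (\<lambda>s' t'. G z xy a (p' * s') (q' * t') (r' *
    v')))) = sm2 (lam v') (\<lambda>a' v'. sm2 (lam v') (\<lambda>b' w'. sm3 A (\<lambda>p' q' r'. G z xy a (a' * p') (b' * q') (w' *
      r'))))" for z xy v a v'
    by (rule L.A_coassoc[symmetric]) (simp_all add: G_def)
  have "sm (i3 \<star> m2) F = sm3 C (\<lambda>z xy v. sm2 (lam v) (\<lambda>a v'. sm3 A (\<lambda>p' q' r'. sm2 (lam v') (\<lambda>a' v'. sm2 (D1 a')
    (\<lambda>s' t'. G z xy a (p' * s') (q' * t') (r' * v'))))))"
    by (simp add: G_def defs) (simp only: smn_defs, iprover intro: sm_perm)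
  also have "\<dots> = sm3 C (\<lambda>z xy v. sm2 (lam v) (\<lambda>a v'. sm2 (lam v') (\<lambda>a' v'. sm2 (lam v') (\<lambda>b' w'. sm3 A (\<lambda>p' q'
    r'. G z xy a (a' * p') (b' * q') (w' * r'))))))"
    unfolding law ..
  also have "\<dots> = sm (n2 \<star> i3) F"
    by (simp add: G_def defs) (simp only: smn_defs, iprover intro: sm_perm)
  finally show "sm (i3 \<star> m2) F = sm (n2 \<star> i3) F" .
qed

private lemma N3: "tens T7 (c2 \<star> c3) = tens T7 (c3 \<star> d2)"
proof (rule tens_eqI)
  fix F assume F: "resp T7 F"
  note [simp] = resp7_lin[OF F]
  define G where "G = (\<lambda>z y a b u. sm2 (rho u) (\<lambda>x u'. sm2 (lam u') (\<lambda>c w. F (a, b, c, w, x, y, z))))"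
  have law: "sm2 (lam v) (\<lambda>a' v'. sm2 (lam v') (\<lambda>b' w'. sm3 A (\<lambda>p' q' r'. G z y (a' * p') (b' * q') (w' * r'))))
    = sm3 A (\<lambda>p' q' r'. sm2 (lam v) (\<lambda>a' v'. sm2 (D1 a') (\<lambda>s' t'. G z y (p' * s') (q' * t') (r' * v'))))" for z y v
    by (rule L.A_coassoc) (simp_all add: G_def)
  have "sm (c2 \<star> c3) F = sm3 C (\<lambda>z y v. sm2 (lam v) (\<lambda>a' v'. sm2 (lam v') (\<lambda>b' w'. sm3 A (\<lambda>p' q' r'. G z y (a' *
    p') (b' * q') (w' * r')))))"
    by (simp add: G_def defs) (simp only: smn_defs, iprover intro: sm_perm)
  also have "\<dots> = sm3 C (\<lambda>z y v. sm3 A (\<lambda>p' q' r'. sm2 (lam v) (\<lambda>a' v'. sm2 (D1 a') (\<lambda>s' t'. G z y (p' * s') (q'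
    * t') (r' * v')))))"
    unfolding law ..
  also have "\<dots> = sm (c3 \<star> d2) F"
    by (simp add: G_def defs) (simp only: smn_defs, iprover intro: sm_perm)
  finally show "sm (c2 \<star> c3) F = sm (c3 \<star> d2) F" .
qed

text \<open>Naturality of \<Phi>_{\<lambda>,\<rho>}. \<open>N5\<close> rests on the same law; the
  other squares are naturality of \<Phi>_\<lambda>.\<close>

private lemma N4: "tens T7 (d2 \<star> o1) = tens T7 (o1 \<star> d3)"
proof (rule tens_eqI)
  fix F assume F: "resp T7 F"
  note [simp] = resp7_lin[OF F]
  define G where "G = (\<lambda>z y d u x. sm2 (D1 d) (\<lambda>a b. sm2 (lam u) (\<lambda>c w. F (a, b, c, w, x, y, z))))"
  have law: "sm2 (lam v) (\<lambda>a' v'. sm2 (rho v') (\<lambda>b' w'. sm3 B (\<lambda>p' r' q'. G z y (a' * p') (w' * r') (b' * q'))))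
    = sm3 B (\<lambda>p' r' q'. sm2 (rho v) (\<lambda>b' v'. sm2 (lam v') (\<lambda>a' w'. G z y (p' * a') (r' * w') (q' * b'))))" for z y v
    by (rule B_nat) (simp_all add: G_def)
  have "sm (d2 \<star> o1) F = sm3 C (\<lambda>z y v. sm2 (lam v) (\<lambda>a' v'. sm2 (rho v') (\<lambda>b' w'. sm3 B (\<lambda>p' r' q'. G z y (a' *
    p') (w' * r') (b' * q')))))"
    by (simp add: G_def defs) (simp only: smn_defs, iprover intro: sm_perm)
  also have "\<dots> = sm3 C (\<lambda>z y v. sm3 B (\<lambda>p' r' q'. sm2 (rho v) (\<lambda>b' v'. sm2 (lam v') (\<lambda>a' w'. G z y (p' * a') (r'
    * w') (q' * b')))))"
    unfolding law ..
  also have "\<dots> = sm (o1 \<star> d3) F"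
    by (simp add: G_def defs) (simp only: smn_defs, iprover intro: sm_perm)
  finally show "sm (d2 \<star> o1) F = sm (o1 \<star> d3) F" .
qed

private lemma N5: "tens T7 (c1 \<star> i1) = tens T7 (i1 \<star> d1)"
proof (rule tens_eqI)
  fix F assume F: "resp T7 F"
  note [simp] = resp7_lin[OF F]
  define G where "G = (\<lambda>a y b u x. sm2 (lam u) (\<lambda>c w. F (a, b, c, w, x, y, 1)))"
  have law: "sm2 (lam v) (\<lambda>a' v'. sm2 (rho v') (\<lambda>b' w'. sm3 B (\<lambda>p' r' q'. G a y (a' * p') (w' * r') (b' * q'))))
    = sm3 B (\<lambda>p' r' q'. sm2 (rho v) (\<lambda>b' v'. sm2 (lam v') (\<lambda>a' w'. G a y (p' * a') (r' * w') (q' * b'))))" for a v y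
    by (rule B_nat) (simp_all add: G_def)
  have "sm (c1 \<star> i1) F = sm3 B (\<lambda>a v y. sm2 (lam v) (\<lambda>a' v'. sm2 (rho v') (\<lambda>b' w'. sm3 B (\<lambda>p' r' q'. G a y (a' *
    p') (w' * r') (b' * q')))))"
    by (simp add: G_def defs) (simp only: smn_defs, iprover intro: sm_perm)
  also have "\<dots> = sm3 B (\<lambda>a v y. sm3 B (\<lambda>p' r' q'. sm2 (rho v) (\<lambda>b' v'. sm2 (lam v') (\<lambda>a' w'. G a y (p' * a') (r'
    * w') (q' * b')))))"
    unfolding law ..
  also have "\<dots> = sm (i1 \<star> d1) F"
    by (simp add: G_def defs) (simp only: smn_defs, iprover intro: sm_perm)
  finally show "sm (c1 \<star> i1) F = sm (i1 \<star> d1) F" .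
qed

private lemma N6: "tens T7 (k1 \<star> d3) = tens T7 (d4 \<star> k1)"
proof (rule tens_eqI)
  fix F assume F: "resp T7 F"
  note [simp] = resp7_lin[OF F]
  define G where "G = (\<lambda>z y x a b u. sm2 (lam u) (\<lambda>c w. F (a, b, c, w, x, y, z)))"
  have law: "sm3 A (\<lambda>p' q' r'. sm2 (lam v1) (\<lambda>a' v'. sm2 (D1 a') (\<lambda>s' t'. G z y x (p' * s') (q' * t') (r' *
    v')))) = sm2 (lam v1) (\<lambda>a' v'. sm2 (lam v') (\<lambda>b' w'. sm3 A (\<lambda>p' q' r'. G z y x (a' * p') (b' * q') (w' *
      r'))))" for z y v x v1
    by (rule L.A_coassoc[symmetric]) (simp_all add: G_def)
  have "sm (k1 \<star> d3) F = sm3 C (\<lambda>z y v. sm2 (rho v) (\<lambda>x v1. sm3 A (\<lambda>p' q' r'. sm2 (lam v1) (\<lambda>a' v'. sm2 (D1 a')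
    (\<lambda>s' t'. G z y x (p' * s') (q' * t') (r' * v'))))))"
    by (simp add: G_def defs) (simp only: smn_defs, iprover intro: sm_perm)
  also have "\<dots> = sm3 C (\<lambda>z y v. sm2 (rho v) (\<lambda>x v1. sm2 (lam v1) (\<lambda>a' v'. sm2 (lam v') (\<lambda>b' w'. sm3 A (\<lambda>p' q'
    r'. G z y x (a' * p') (b' * q') (w' * r'))))))"
    unfolding law ..
  also have "\<dots> = sm (d4 \<star> k1) F"
    by (simp add: G_def defs) (simp only: smn_defs, iprover intro: sm_perm)
  finally show "sm (k1 \<star> d3) F = sm (d4 \<star> k1) F" .
qed

private lemma N7: "tens T7 (k1 \<star> o2) = tens T7 (o4 \<star> k1)"
proof (rule tens_eqI)
  fix F assume F: "resp T7 F"
  note [simp] = resp7_lin[OF F]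
  define G where "G = (\<lambda>d x a b u. sm2 (D2 d) (\<lambda>z y. sm2 (lam u) (\<lambda>c w. F (a, b, c, w, x, y, z))))"
  have law: "sm3 A (\<lambda>p' q' r'. sm2 (lam v) (\<lambda>a' v'. sm2 (D1 a') (\<lambda>s' t'. G d x (p' * s') (q' * t') (r' * v'))))
    = sm2 (lam v) (\<lambda>a' v'. sm2 (lam v') (\<lambda>b' w'. sm3 A (\<lambda>p' q' r'. G d x (a' * p') (b' * q') (w' * r'))))" for d x v
    by (rule L.A_coassoc[symmetric]) (simp_all add: G_def)
  have "sm (k1 \<star> o2) F = sm3 C (\<lambda>d x v. sm3 A (\<lambda>p' q' r'. sm2 (lam v) (\<lambda>a' v'. sm2 (D1 a') (\<lambda>s' t'. G d x (p' *
    s') (q' * t') (r' * v')))))"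
    by (simp add: G_def defs) (simp only: smn_defs, iprover intro: sm_perm)
  also have "\<dots> = sm3 C (\<lambda>d x v. sm2 (lam v) (\<lambda>a' v'. sm2 (lam v') (\<lambda>b' w'. sm3 A (\<lambda>p' q' r'. G d x (a' * p') (b'
    * q') (w' * r')))))"
    unfolding law ..
  also have "\<dots> = sm (o4 \<star> k1) F"
    by (simp add: G_def defs) (simp only: smn_defs, iprover intro: sm_perm)
  finally show "sm (k1 \<star> o2) F = sm (o4 \<star> k1) F" .
qed

text \<open>The pentagon of \<Phi>_\<lambda>, on the first four positions.\<close>

private lemma P1: "tens T7 (i3 \<star> m3 \<star> p0) = tens T7 (k1 \<star> o3)"
proof (rule tens_eqI)
  fix F assume F: "resp T7 F"
  note [simp] = resp7_lin[OF F]
  define G where "G = (\<lambda>a b c w. F (a, b, c, w, 1, 1, 1))"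
  have law: "sm3 A (\<lambda>a' b' v'. sm3 A (\<lambda>d' e' w'. sm2 (D1 e') (\<lambda>s' t'. sm3 P1 (\<lambda>x' y' z'. G (d' * x') (a' * (s' *
    y')) (b' * (t' * z')) (v' * w'))))) = sm3 A (\<lambda>a' b' v'. sm2 (lam v') (\<lambda>c' w'. sm3 A (\<lambda>d' e' u'. sm2 (D1 d')
      (\<lambda>s' t'. G (a' * s') (b' * t') (c' * e') (w' * u')))))"
    by (rule L.A_pentagon) (simp_all add: G_def)
  have "sm (i3 \<star> m3 \<star> p0) F = sm3 A (\<lambda>a' b' v'. sm3 A (\<lambda>d' e' w'. sm2 (D1 e') (\<lambda>s' t'. sm3 P1 (\<lambda>x' y' z'. G (d'
    * x') (a' * (s' * y')) (b' * (t' * z')) (v' * w')))))"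
    by (simp add: G_def defs)
  also have "\<dots> = sm3 A (\<lambda>a' b' v'. sm2 (lam v') (\<lambda>c' w'. sm3 A (\<lambda>d' e' u'. sm2 (D1 d') (\<lambda>s' t'. G (a' * s') (b'
    * t') (c' * e') (w' * u')))))"
    unfolding law ..
  also have "\<dots> = sm (k1 \<star> o3) F"
    by (simp add: G_def defs)
  finally show "sm (i3 \<star> m3 \<star> p0) F = sm (k1 \<star> o3) F" .
qed

text \<open>The left mixed pentagon with \<lambda> applied once more to the algebra factor.\<close>

private lemma P2: "tens T7 (c3 \<star> o1) = tens T7 (i1 \<star> j1 \<star> k1)"
proof (rule tens_eqI)
  fix F assume F: "resp T7 F"
  note [simp] = resp7_lin[OF F]
  define G where "G = (\<lambda>a b u x. sm2 (lam u) (\<lambda>c w. F (a, b, c, w, x, 1, 1)))"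
  have law: "sm3 A (\<lambda>p' q' r'. sm2 (rho r') (\<lambda>x' w'. sm3 B (\<lambda>a' v' y'. sm2 (D1 a') (\<lambda>s' t'. G (p' * s') (q' *
    t') (w' * v') (x' * y'))))) = sm3 B (\<lambda>b' v' x'. sm3 B (\<lambda>a' u' y'. sm2 (lam u') (\<lambda>c' w'. sm3 A (\<lambda>p' q' r'. G
      (a' * p') (b' * (c' * q')) (v' * (w' * r')) (x' * y')))))"
    by (rule left_pentagon[symmetric]) (simp_all add: G_def)
  have "sm (c3 \<star> o1) F = sm3 A (\<lambda>p' q' r'. sm2 (rho r') (\<lambda>x' w'. sm3 B (\<lambda>a' v' y'. sm2 (D1 a') (\<lambda>s' t'. G (p' *
    s') (q' * t') (w' * v') (x' * y')))))"
    by (simp add: G_def defs) (simp only: smn_defs, iprover intro: sm_perm)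
  also have "\<dots> = sm3 B (\<lambda>b' v' x'. sm3 B (\<lambda>a' u' y'. sm2 (lam u') (\<lambda>c' w'. sm3 A (\<lambda>p' q' r'. G (a' * p') (b' *
    (c' * q')) (v' * (w' * r')) (x' * y')))))"
    unfolding law ..
  also have "\<dots> = sm (i1 \<star> j1 \<star> k1) F"
    by (simp add: G_def defs) (simp only: smn_defs, iprover intro: sm_perm)
  finally show "sm (c3 \<star> o1) F = sm (i1 \<star> j1 \<star> k1) F" .
qed

text \<open>The pentagon of the right side with \<lambda> applied three times to the algebra
  factor.\<close>

private lemma P3: "tens T7 (d4 \<star> o4) = tens T7 (e1 \<star> n2 \<star> q0)"
proof (rule tens_eqI)
  fix F assume F: "resp T7 F"
  note [simp] = resp7_lin[OF F]
  define G where "G = (\<lambda>z y x u. sm2 (lam u) (\<lambda>a u1. sm2 (lam u1) (\<lambda>b u2. sm2 (lam u2) (\<lambda>c w. F (a, b, c, w, x,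
    y, z)))))"
  have law: "sm3 C (\<lambda>a' b' v'. sm2 (rho v') (\<lambda>c' w'. sm3 C (\<lambda>d' e' u'. sm2 (D2 d') (\<lambda>s' t'. G (a' * s') (b' *
    t') (c' * e') (w' * u'))))) = sm3 C (\<lambda>a' b' v'. sm3 C (\<lambda>d' e' w'. sm2 (D2 e') (\<lambda>s' t'. sm3 P2 (\<lambda>x' y' z'. G
      (d' * x') (a' * (s' * y')) (b' * (t' * z')) (v' * w')))))"
    by (rule R.A_pentagon[symmetric]) (simp_all add: G_def)
  have "sm (d4 \<star> o4) F = sm3 C (\<lambda>a' b' v'. sm2 (rho v') (\<lambda>c' w'. sm3 C (\<lambda>d' e' u'. sm2 (D2 d') (\<lambda>s' t'. G (a' *
    s') (b' * t') (c' * e') (w' * u')))))"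
    by (simp add: G_def defs) (simp only: smn_defs, iprover intro: sm_perm)
  also have "\<dots> = sm3 C (\<lambda>a' b' v'. sm3 C (\<lambda>d' e' w'. sm2 (D2 e') (\<lambda>s' t'. sm3 P2 (\<lambda>x' y' z'. G (d' * x') (a' *
    (s' * y')) (b' * (t' * z')) (v' * w')))))"
    unfolding law ..
  also have "\<dots> = sm (e1 \<star> n2 \<star> q0) F"
    by (simp add: G_def defs) (simp only: smn_defs, iprover intro: sm_perm)
  finally show "sm (d4 \<star> o4) F = sm (e1 \<star> n2 \<star> q0) F" .
qed

text \<open>The right mixed pentagon with \<lambda> applied twice to its algebra factor.\<close>

private lemma P4: "tens T7 (d1 \<star> j1 \<star> e1) = tens T7 (i2 \<star> n1)"
proof (rule tens_eqI)
  fix F assume F: "resp T7 F"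
  note [simp] = resp7_lin[OF F]
  define G where "G = (\<lambda>a u x y. sm2 (lam u) (\<lambda>b u1. sm2 (lam u1) (\<lambda>c w. F (a, b, c, w, x, y, 1))))"
  have law: "sm3 B (\<lambda>a' v' y'. sm2 (rho v') (\<lambda>x' w'. sm3 B (\<lambda>b' u' z'. sm3 C (\<lambda>q' p' r'. sm2 (lam r') (\<lambda>c' s'. G
    (a' * (b' * c')) (w' * (u' * s')) (x' * (z' * p')) (y' * q')))))) = sm3 C (\<lambda>q' p' r'. sm3 B (\<lambda>a' v' y'. sm2
      (D2 y') (\<lambda>s' t'. G a' (r' * v') (p' * t') (q' * s'))))"
    by (rule right_pentagon) (simp_all add: G_def)
  have "sm (d1 \<star> j1 \<star> e1) F = sm3 B (\<lambda>a' v' y'. sm2 (rho v') (\<lambda>x' w'. sm3 B (\<lambda>b' u' z'. sm3 C (\<lambda>q' p' r'. sm2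
    (lam r') (\<lambda>c' s'. G (a' * (b' * c')) (w' * (u' * s')) (x' * (z' * p')) (y' * q'))))))"
    by (simp add: G_def defs) (simp only: smn_defs, iprover intro: sm_perm)
  also have "\<dots> = sm3 C (\<lambda>q' p' r'. sm3 B (\<lambda>a' v' y'. sm2 (D2 y') (\<lambda>s' t'. G a' (r' * v') (p' * t') (q' * s'))))"
    unfolding law ..
  also have "\<dots> = sm (i2 \<star> n1) F"
    by (simp add: G_def defs) (simp only: smn_defs, iprover intro: sm_perm)
  finally show "sm (d1 \<star> j1 \<star> e1) F = sm (i2 \<star> n1) F" .
qed

private lemma K: "tens T7 (k1 \<star> o3 \<star> q0) = tens T7 (q0 \<star> k1 \<star> o3)"
proof (rule tens_eqI)
  fix F assume F: "resp T7 F"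
  note [simp] = resp7_lin[OF F]
  show "sm (k1 \<star> o3 \<star> q0) F = sm (q0 \<star> k1 \<star> o3) F"
    by (simp add: defs) (simp only: smn_defs, iprover intro: sm_perm)
qed

text \<open>Comultiplications and coactions are multiplicative, so each copy of \<open>psi\<close>
  splits along its three factors.\<close>

private lemma pentagon_factors:
  "tens T7 [(1, a, b, v, c, d, 1). (a, b, v, c, d) \<leftarrow> psi] = tens T7 (i1 \<star> i2 \<star> i3)"
  "tens T7 [(a, b, c, v, x, y, z). (a, bc, v, xy, z) \<leftarrow> psi, (b, c) \<leftarrow> D1 bc, (y, x) \<leftarrow> D2 xy] = tens T7 (m1 \<star> m2 \<star> m3)"
  "tens T7 [(a, b, c, v, x, y, z). (a, b, w, y, z) \<leftarrow> psi, (c, v, x) \<leftarrow> dlt w] = tens T7 (c1 \<star> c2 \<star> c3)"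
  "tens T7 [(a, b, c, v, x, y, z). (ab, c, v, x, yz) \<leftarrow> psi, (a, b) \<leftarrow> D1 ab, (z, y) \<leftarrow> D2 yz] = tens T7 (o1 \<star> o2 \<star> o3)"
  "tens T7 [(a, b, c, 1, x, y, z). (a, b, c) \<leftarrow> P1, (z, y, x) \<leftarrow> P2] = tens T7 (p0 \<star> q0)"
proof -
  show "tens T7 [(1, a, b, v, c, d, 1). (a, b, v, c, d) \<leftarrow> psi] = tens T7 (i1 \<star> i2 \<star> i3)"
  proof (rule tens_eqI, goal_cases)
    case (1 F)
    note [simp] = resp7_lin[OF 1]
    show ?case by (simp add: psi_defs defs case_prod_unfold)
  qed
  show "tens T7 [(a, b, c, v, x, y, z). (a, bc, v, xy, z) \<leftarrow> psi, (b, c) \<leftarrow> D1 bc, (y, x) \<leftarrow> D2 xy] = tens T7 (m1 \<star>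
    m2 \<star> m3)"
  proof (rule tens_eqI, goal_cases)
    case (1 F)
    note [simp] = resp7_lin[OF 1]
    show ?case by (simp add: psi_defs defs case_prod_unfold) (simp only: smn_defs, iprover intro: sm_perm)
  qed
  show "tens T7 [(a, b, c, v, x, y, z). (a, b, w, y, z) \<leftarrow> psi, (c, v, x) \<leftarrow> dlt w] = tens T7 (c1 \<star> c2 \<star> c3)"
  proof (rule tens_eqI, goal_cases)
    case (1 F)
    note [simp] = resp7_lin[OF 1]
    show ?case by (simp add: psi_defs defs case_prod_unfold) (simp only: smn_defs, iprover intro: sm_perm)
  qed
  show "tens T7 [(a, b, c, v, x, y, z). (ab, c, v, x, yz) \<leftarrow> psi, (a, b) \<leftarrow> D1 ab, (z, y) \<leftarrow> D2 yz] = tens T7 (o1 \<star>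
    o2 \<star> o3)"
  proof (rule tens_eqI, goal_cases)
    case (1 F)
    note [simp] = resp7_lin[OF 1]
    show ?case by (simp add: psi_defs defs case_prod_unfold) (simp only: smn_defs, iprover intro: sm_perm)
  qed
  show "tens T7 [(a, b, c, 1, x, y, z). (a, b, c) \<leftarrow> P1, (z, y, x) \<leftarrow> P2] = tens T7 (p0 \<star> q0)"
  proof (rule tens_eqI, goal_cases)
    case (1 F)
    note [simp] = resp7_lin[OF 1]
    show ?case by (simp add: defs case_prod_unfold)
  qed
qed

lemma psi_pentagon:
  "tens T7 ([(1, a, b, v, c, d, 1). (a, b, v, c, d) \<leftarrow> psi] \<star>
     [(a, b, c, v, x, y, z). (a, bc, v, xy, z) \<leftarrow> psi, (b, c) \<leftarrow> D1 bc, (y, x) \<leftarrow> D2 xy] \<star>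
     [(a, b, c, 1, x, y, z). (a, b, c) \<leftarrow> P1, (z, y, x) \<leftarrow> P2]) =
   tens T7 ([(a, b, c, v, x, y, z). (a, b, w, y, z) \<leftarrow> psi, (c, v, x) \<leftarrow> dlt w] \<star>
     [(a, b, c, v, x, y, z). (ab, c, v, x, yz) \<leftarrow> psi, (a, b) \<leftarrow> D1 ab, (z, y) \<leftarrow> D2 yz])"
proof -
  interpret monoid "talg T7" by (rule monoid_talg) simp
  have m: "tens T7 xs \<otimes>\<^bsub>talg T7\<^esub> tens T7 ys = tens T7 (xs \<star> ys)" for xs ys
    by (rule talg_mult_tens) simp
  have C: "tens T7 xs \<in> carrier (talg T7)" for xs by simp
  show ?thesis
    unfolding m[symmetric] pentagon_factors
    by (rule two_sided_pentagon[where ?d1.0 = "tens T7 d1" and ?d2.0 = "tens T7 d2" and ?d3.0 = "tens T7 d3" and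
      ?d4.0 = "tens T7 d4"
      and ?n1.0 = "tens T7 n1" and ?n2.0 = "tens T7 n2" and ?k1.0 = "tens T7 k1" and ?j1.0 = "tens T7 j1" and
        ?o4.0 = "tens T7 o4"
      and ?e1.0 = "tens T7 e1"]; (rule C | (simp only: m, rule N1 N2 N3 N4 N5 N6 N7 P1 P2 P3 P4 K)))
qed

end

text \<open>The doubled coaction passes the factors of \<open>psi\<close> one after the other: the
  mixed associator exchanges \<lambda> and \<rho>, then \<open>C\<close> merges the two right
  coactions, and \<open>A\<close> merges the two left ones.\<close>

lemma psi_coassoc:
  "tens T5 ([(a, b, v, c, d). (a, w, d) \<leftarrow> dlt u, (b, v, c) \<leftarrow> dlt w] \<star> psi) =
   tens T5 (psi \<star> [(a, b, v, c, d). (ab, v, cd) \<leftarrow> dlt u, (a, b) \<leftarrow> D1 ab, (d, c) \<leftarrow> D2 cd])"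
proof -
  \<comment> \<open>The stages of this passage, from the coaction applied twice to the coaction with
    both outer legs comultiplied.\<close>
  define X0 X1 X2 X3 where "X0 = [(a, b, v, c, d). (a, w, d) \<leftarrow> dlt u, (b, v, c) \<leftarrow> dlt w]"
    and "X1 = [(a, b, w, x, y). (y, u1) \<leftarrow> rho u, (x, u2) \<leftarrow> rho u1, (a, u3) \<leftarrow> lam u2, (b, w) \<leftarrow> lam u3]"
    and "X2 = [(a, b, w, x, y). (xy, u1) \<leftarrow> rho u, (y, x) \<leftarrow> D2 xy, (a, u3) \<leftarrow> lam u1, (b, w) \<leftarrow> lam u3]"
    and "X3 = [(a, b, v, c, d). (ab, v, cd) \<leftarrow> dlt u, (a, b) \<leftarrow> D1 ab, (d, c) \<leftarrow> D2 cd]"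
  note defs = X0_def X1_def X2_def X3_def psi1_def psi2_def psi3_def dlt_def
  have 1: "tens T5 (X0 \<star> psi1) = tens T5 (psi1 \<star> X1)"
  proof (rule tens_eqI)
    fix F assume F: "resp T5 F"
    note [simp] = resp5_lin[OF F]
    define G where "G = (\<lambda>y a u x. sm2 (lam u) (\<lambda>b w. F (a, b, w, x, y)))"
    have law: "sm2 (lam v) (\<lambda>a v. sm2 (rho v) (\<lambda>b w. sm3 B (\<lambda>p r q. G y (a * p) (w * r) (b * q)))) =
      sm3 B (\<lambda>p r q. sm2 (rho v) (\<lambda>b v. sm2 (lam v) (\<lambda>a w. G y (p * a) (r * w) (q * b))))" for y v
      by (rule B_nat) (simp_all add: G_def)
    have "sm (X0 \<star> psi1) F = sm2 (rho u) (\<lambda>y v. sm2 (lam v) (\<lambda>a v. sm2 (rho v) (\<lambda>b w. sm3 B (\<lambda>p r q. G y (a * p)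
      (w * r) (b * q)))))"
      by (simp add: G_def defs case_prod_unfold) (simp only: smn_defs, iprover intro: sm_perm)
    also have "\<dots> = sm2 (rho u) (\<lambda>y v. sm3 B (\<lambda>p r q. sm2 (rho v) (\<lambda>b v. sm2 (lam v) (\<lambda>a w. G y (p * a) (r * w)
      (q * b)))))"
      unfolding law ..
    also have "\<dots> = sm (psi1 \<star> X1) F"
      by (simp add: G_def defs case_prod_unfold) (simp only: smn_defs, iprover intro: sm_perm)
    finally show "sm (X0 \<star> psi1) F = sm (psi1 \<star> X1) F" .
  qed
  have 2: "tens T5 (X1 \<star> psi2) = tens T5 (psi2 \<star> X2)"
  proof (rule tens_eqI)
    fix F assume F: "resp T5 F"
    note [simp] = resp5_lin[OF F]
    define G where "G = (\<lambda>y x u. sm2 (lam u) (\<lambda>a u'. sm2 (lam u') (\<lambda>b w. F (a, b, w, x, y))))"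
    have law: "sm2 (rho u) (\<lambda>a v. sm2 (rho v) (\<lambda>b w. sm3 C (\<lambda>p q r. G (a * p) (b * q) (w * r)))) =
      sm3 C (\<lambda>p q r. sm2 (rho u) (\<lambda>a v. sm2 (D2 a) (\<lambda>s t. G (p * s) (q * t) (r * v))))"
      by (rule R.A_coassoc) (simp_all add: G_def)
    have "sm (X1 \<star> psi2) F = sm2 (rho u) (\<lambda>a v. sm2 (rho v) (\<lambda>b w. sm3 C (\<lambda>p q r. G (a * p) (b * q) (w * r))))"
      by (simp add: G_def defs case_prod_unfold) (simp only: smn_defs, iprover intro: sm_perm)
    also have "\<dots> = sm (psi2 \<star> X2) F"
      unfolding law by (simp add: G_def defs case_prod_unfold) (simp only: smn_defs, iprover intro: sm_perm)
    finally show "sm (X1 \<star> psi2) F = sm (psi2 \<star> X2) F" .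
  qed
  have 3: "tens T5 (X2 \<star> psi3) = tens T5 (psi3 \<star> X3)"
  proof (rule tens_eqI)
    fix F assume F: "resp T5 F"
    note [simp] = resp5_lin[OF F]
    have law: "sm2 (lam v) (\<lambda>a v. sm2 (lam v) (\<lambda>b w. sm3 A (\<lambda>p q r. F (a * p, b * q, w * r, x, y)))) =
      sm3 A (\<lambda>p q r. sm2 (lam v) (\<lambda>a v. sm2 (D1 a) (\<lambda>s t. F (p * s, q * t, r * v, x, y))))" for v x y
      by (rule L.A_coassoc) simp_all
    have "sm (X2 \<star> psi3) F = sm2 (rho u) (\<lambda>xy v. sm2 (D2 xy) (\<lambda>y x. sm2 (lam v) (\<lambda>a v. sm2 (lam v) (\<lambda>b w. sm3 A
      (\<lambda>p q r. F (a * p, b * q, w * r, x, y))))))"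
      by (simp add: defs case_prod_unfold)
    also have "\<dots> = sm (psi3 \<star> X3) F"
      unfolding law by (simp add: defs case_prod_unfold) (simp only: smn_defs, iprover intro: sm_perm)
    finally show "sm (X2 \<star> psi3) F = sm (psi3 \<star> X3) F" .
  qed
  have c: "tens T5 (X \<star> Y) = tens T5 (X' \<star> Y')" if "tens T5 X = tens T5 X'" "tens T5 Y = tens T5 Y'" for X Y X' Y'
    by (rule tens_lmul_cong) (simp_all add: that)
  have "tens T5 ((X0 \<star> psi1) \<star> psi2 \<star> psi3) = tens T5 ((psi1 \<star> X1) \<star> psi2 \<star> psi3)"
    by (rule c[OF 1 refl])
  also have "\<dots> = tens T5 (psi1 \<star> (X1 \<star> psi2) \<star> psi3)" by (simp only: lmul_assoc)
  also have "\<dots> = tens T5 (psi1 \<star> (psi2 \<star> X2) \<star> psi3)" by (rule c[OF refl c[OF 2 refl]])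
  also have "\<dots> = tens T5 (psi1 \<star> psi2 \<star> X2 \<star> psi3)" by (simp only: lmul_assoc)
  also have "\<dots> = tens T5 (psi1 \<star> psi2 \<star> psi3 \<star> X3)" by (rule c[OF refl c[OF refl 3]])
  finally show ?thesis by (simp only: psi_def lmul_assoc X0_def X3_def)
qed

definition "psi1' = [(a, c, w, b, 1 :: 'h). (a, v, b) \<leftarrow> B', (c, w) \<leftarrow> lam v]"
definition "psi2' = [(a, c, w, y, z). (z, y, v) \<leftarrow> C', (a, v') \<leftarrow> lam v, (c, w) \<leftarrow> lam v']"
definition "psi3' = [(a, b, v, 1 :: 'h, 1 :: 'h). (a, b, v) \<leftarrow> A']"
definition "psi' = psi3' \<star> psi2' \<star> psi1'"

lemma psi_inverse: "tens T5 (psi \<star> psi') = tens T5 [1]" "tens T5 (psi' \<star> psi) = tens T5 [1]"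
proof -
  have *: "tens T5 (psi1 \<star> psi1') = tens T5 [1]" "tens T5 (psi1' \<star> psi1) = tens T5 [1]"
    "tens T5 (psi2 \<star> psi2') = tens T5 [1]" "tens T5 (psi2' \<star> psi2) = tens T5 [1]"
    "tens T5 (psi3 \<star> psi3') = tens T5 [1]" "tens T5 (psi3' \<star> psi3) = tens T5 [1]"
  proof -
    have "sm (psi1 \<star> psi1') F = F 1 \<and> sm (psi1' \<star> psi1) F = F 1 \<and> sm (psi2 \<star> psi2') F = F 1 \<and> sm (psi2' \<star> psi2)
      F = F 1 \<and>
      sm (psi3 \<star> psi3') F = F 1 \<and> sm (psi3' \<star> psi3) F = F 1" if F: "resp T5 F" for F
    proof (intro conjI)
      note [simp] = resp5_lin[OF F] one_prod_def psi1_def psi2_def psi3_def psi1'_def psi2'_def psi3'_def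
      have b: "sm3 B (\<lambda>a v b. sm3 B' (\<lambda>a' v' b'. sm2 (lam (v * v')) (\<lambda>c w. F (a * a', c, w, b * b', 1)))) = F 1 \<and>
        sm3 B' (\<lambda>a v b. sm3 B (\<lambda>a' v' b'. sm2 (lam (v * v')) (\<lambda>c w. F (a * a', c, w, b * b', 1)))) = F 1"
        using B_inv[of "\<lambda>a v b. sm2 (lam v) (\<lambda>c w. F (a, c, w, b, 1))"] by simp
      have c: "sm3 C (\<lambda>a b v. sm3 C' (\<lambda>a' b' v'. sm2 (lam (v * v')) (\<lambda>d w. sm2 (lam w) (\<lambda>c w. F (d, c, w, b *
        b', a * a'))))) = F 1 \<and>
        sm3 C' (\<lambda>a b v. sm3 C (\<lambda>a' b' v'. sm2 (lam (v * v')) (\<lambda>d w. sm2 (lam w) (\<lambda>c w. F (d, c, w, b * b', a *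
          a'))))) = F 1"
        using R.A_inv[of "\<lambda>z y v. sm2 (lam v) (\<lambda>d w. sm2 (lam w) (\<lambda>c w. F (d, c, w, y, z)))"] by simp
      show "sm (psi1 \<star> psi1') F = F 1" using conjunct1[OF b]
        by simp (erule trans[rotated], simp only: smn_defs, iprover intro: sm_perm)
      show "sm (psi1' \<star> psi1) F = F 1" using conjunct2[OF b]
        by simp (erule trans[rotated], simp only: smn_defs, iprover intro: sm_perm)
      show "sm (psi2 \<star> psi2') F = F 1" using conjunct1[OF c]
        by simp (erule trans[rotated], simp only: smn_defs, iprover intro: sm_perm)
      show "sm (psi2' \<star> psi2) F = F 1" using conjunct2[OF c]
        by simp (erule trans[rotated], simp only: smn_defs, iprover intro: sm_perm)
      show "sm (psi3 \<star> psi3') F = F 1" "sm (psi3' \<star> psi3) F = F 1"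
        using L.A_inv[of "\<lambda>a b v. F (a, b, v, 1, 1)"] by simp_all
    qed
    then show "tens T5 (psi1 \<star> psi1') = tens T5 [1]" "tens T5 (psi1' \<star> psi1) = tens T5 [1]"
      "tens T5 (psi2 \<star> psi2') = tens T5 [1]" "tens T5 (psi2' \<star> psi2) = tens T5 [1]"
      "tens T5 (psi3 \<star> psi3') = tens T5 [1]" "tens T5 (psi3' \<star> psi3) = tens T5 [1]"
      by (simp_all add: tens_eq_iff del: sm_lmul resp_trel)
  qed
  have cancel: "tens T5 (X \<star> (Y \<star> Y') \<star> Z) = tens T5 (X \<star> Z)" if "tens T5 (Y \<star> Y') = tens T5 [1]" for X Y Y' Z
  proof -
    have "tens T5 (X \<star> (Y \<star> Y') \<star> Z) = tens T5 (X \<star> [1] \<star> Z)"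
      by (intro tens_lmul_cong mult_ideal_T that refl)
    then show ?thesis by simp
  qed
  show "tens T5 (psi \<star> psi') = tens T5 [1]"
    using cancel[OF *(5), of "psi1 \<star> psi2" "psi2' \<star> psi1'"] cancel[OF *(3), of psi1 psi1'] *(1)
    by (simp add: psi_def psi'_def lmul_assoc)
  show "tens T5 (psi' \<star> psi) = tens T5 [1]"
    using cancel[OF *(2), of "psi3' \<star> psi2'" "psi2 \<star> psi3"] cancel[OF *(4), of psi3' psi3] *(6)
    by (simp add: psi_def psi'_def lmul_assoc)
qed

lemma eps_lin [simp]: "lmap t hs g \<Longrightarrow> lin t (\<lambda>x. \<epsilon> (g x))"
  using lin_comp[OF L.eps(1)] .

text \<open>Derived like the outer counits of \<Phi>: a counit at the place where the middle leg of
  \<open>A\<close> or \<open>C\<close> sits reduces a mixed pentagon to the statement that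
  multiplication by the contracted associator fixes \<open>B\<close>, and \<open>B\<close>
  cancels.\<close>

lemma B_counit:
  assumes "\<And>y. lin hs (\<lambda>x. F x y)" "\<And>x. lin s (F x)"
  shows "sm3 B (\<lambda>a v b. \<epsilon> a * F b v) = F 1 1" "sm3 B (\<lambda>a v b. \<epsilon> b * F a v) = F 1 1"
proof -
  note [simp] = lin_comp[OF assms(1)] lin_comp[OF assms(2)] L.eps(2,3)
  \<comment> \<open>The left pentagon with \<epsilon> on its second factor.\<close>
  have 1: "sm3 B (\<lambda>b v x. sm3 B (\<lambda>a u y. \<epsilon> b * N a (x * y) (v * u))) = sm3 B (\<lambda>a v y. N a y v)"
    if N: "\<And>y v. lin hs (\<lambda>a. N a y v)" "\<And>a v. lin hs (\<lambda>y. N a y v)" "\<And>a y. lin s (N a y)" for N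
  proof -
    note [simp] = lin_comp[OF N(1)] lin_comp[OF N(2)] lin_comp[OF N(3)]
    have "sm3 B (\<lambda>b v x. sm3 B (\<lambda>a u y. \<epsilon> b * N a (x * y) (v * u))) =
      sm3 B (\<lambda>b v x. sm3 B (\<lambda>a u y. \<epsilon> b * sm2 (lam u) (\<lambda>c w. \<epsilon> c * sm3 A (\<lambda>p q r. \<epsilon> q * N (a * p) (x * y) (v *
        (w * r))))))"
      by (simp add: L.A_counit L.lam_counit)
    also have "\<dots> = sm3 A (\<lambda>p q r. \<epsilon> q * sm2 (rho r) (\<lambda>x w. sm3 B (\<lambda>a v y. sm2 (D1 a) (\<lambda>s t. \<epsilon> t * N (p * s) (x *
      y) (w * v)))))"
      using left_pentagon[of "\<lambda>a b v x. \<epsilon> b * N a x v"] by (simp add: mult.assoc mult.left_commute flip: sm_pull)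
    also have "\<dots> = sm3 B (\<lambda>a v y. N a y v)"
      by (simp add: L.A_counit L.side_D_counit)
    finally show ?thesis .
  qed
  have "sm3 B (\<lambda>a v b. \<epsilon> a * F b v) = sm3 B (\<lambda>b v x. sm3 B (\<lambda>a u y. sm3 B' (\<lambda>a' v' b'. \<epsilon> b * (\<epsilon> (a * a') * F (x
    * (y * b')) (v * (u * v'))))))"
  proof -
    have "sm3 B (\<lambda>a u y. sm3 B' (\<lambda>a' v' b'. \<epsilon> b * (\<epsilon> (a * a') * F (x * (y * b')) (v * (u * v'))))) = \<epsilon> b * F x
      v" for b x v
      using B_inv[of "\<lambda>a u y. \<epsilon> b * (\<epsilon> a * F (x * y) (v * u))"] by simp
    then show ?thesis by simp
  qed
  also have "\<dots> = sm3 B' (\<lambda>a' v' b'. sm3 B (\<lambda>b v x. sm3 B (\<lambda>a u y. \<epsilon> b * (\<epsilon> (a * a') * F ((x * y) * b') ((v * u)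
    * v')))))"
    by (simp only: smn_defs mult.assoc, iprover intro: sm_perm)
  also have "\<dots> = sm3 B' (\<lambda>a' v' b'. sm3 B (\<lambda>a v y. \<epsilon> (a * a') * F (y * b') (v * v')))"
    by (subst 1) simp_all
  also have "\<dots> = sm3 B (\<lambda>a v y. sm3 B' (\<lambda>a' v' b'. \<epsilon> (a * a') * F (y * b') (v * v')))"
    by (simp only: smn_defs, iprover intro: sm_perm)
  also have "\<dots> = F 1 1"
    using B_inv[of "\<lambda>a u y. \<epsilon> a * F y u"] by simp
  finally show "sm3 B (\<lambda>a v b. \<epsilon> a * F b v) = F 1 1" .
  \<comment> \<open>The right pentagon with \<epsilon> on its third factor.\<close>
  have 2: "sm3 B (\<lambda>a v y. sm3 B (\<lambda>b u z. \<epsilon> z * N (a * b) (v * u) y)) = sm3 B (\<lambda>a v y. N a v y)"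
    if N: "\<And>y v. lin hs (\<lambda>a. N a v y)" "\<And>a v. lin hs (\<lambda>y. N a v y)" "\<And>a y. lin s (\<lambda>v. N a v y)" for N
  proof -
    note [simp] = lin_comp[OF N(1)] lin_comp[OF N(2)] lin_comp[OF N(3)]
    have "sm3 B (\<lambda>a v y. sm3 B (\<lambda>b u z. \<epsilon> z * N (a * b) (v * u) y)) =
      sm3 B (\<lambda>a v y. sm2 (rho v) (\<lambda>x w. \<epsilon> x * sm3 B (\<lambda>b u z. \<epsilon> z * sm3 C (\<lambda>q p r. \<epsilon> p * sm2 (lam r) (\<lambda>c s. N (a
        * (b * c)) (w * (u * s)) (y * q))))))"
      by (simp add: R.A_counit R.lam_counit)
    also have "\<dots> = sm3 C (\<lambda>q p r. \<epsilon> p * sm3 B (\<lambda>a v y. sm2 (D2 y) (\<lambda>s t. \<epsilon> t * N a (r * v) (q * s))))"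
      using right_pentagon[of "\<lambda>a v x y. \<epsilon> x * N a v y"] by (simp add: mult.assoc mult.left_commute flip: sm_pull)
    also have "\<dots> = sm3 B (\<lambda>a v y. N a v y)"
      by (simp add: R.A_counit R.side_D_counit)
    finally show ?thesis .
  qed
  have "sm3 B (\<lambda>a v b. \<epsilon> b * F a v) = sm3 B' (\<lambda>a' v' y'. sm3 B (\<lambda>a v y. sm3 B (\<lambda>b u z. \<epsilon> z * (\<epsilon> (y' * y) * F
    ((a' * a) * b) ((v' * v) * u)))))"
    using B_inv[of "\<lambda>a v y. sm3 B (\<lambda>b u z. \<epsilon> z * (\<epsilon> y * F (a * b) (v * u)))"] by simp
  also have "\<dots> = sm3 B' (\<lambda>a' v' y'. sm3 B (\<lambda>a v y. \<epsilon> (y' * y) * F (a' * a) (v' * v)))"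
  proof -
    have "sm3 B (\<lambda>a v y. sm3 B (\<lambda>b u z. \<epsilon> z * (\<epsilon> (y' * y) * F ((a' * a) * b) ((v' * v) * u)))) = sm3 B (\<lambda>a v y.
      \<epsilon> (y' * y) * F (a' * a) (v' * v))" for a' v' y'
      using 2[of "\<lambda>a v y. \<epsilon> (y' * y) * F (a' * a) (v' * v)"] by (simp add: mult.assoc)
    then show ?thesis by simp
  qed
  also have "\<dots> = F 1 1"
    using B_inv[of "\<lambda>a u y. \<epsilon> y * F a u"] by simp
  finally show "sm3 B (\<lambda>a v b. \<epsilon> b * F a v) = F 1 1" .
qed

context
  fixes F :: "'h \<Rightarrow> 'u \<Rightarrow> 'h \<Rightarrow> 'k"
  assumes F: "\<And>y z. lin hs (\<lambda>x. F x y z)" "\<And>x z. lin s (\<lambda>y. F x y z)" "\<And>x y. lin hs (\<lambda>z. F x y z)"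
begin

private lemmas F_lin [simp] = lin_comp[OF F(1)] lin_comp[OF F(2)] lin_comp[OF F(3)]

lemma psi_counit:
  "sm5 psi (\<lambda>a b v c d. \<epsilon> b * (\<epsilon> c * F a v d)) = F 1 1 1"
  "sm5 psi (\<lambda>a b v c d. \<epsilon> a * (\<epsilon> d * F b v c)) = F 1 1 1"
proof -
  note [simp] = L.eps(2,3)
  have "sm psi (\<lambda>(a, b, v, c, d). \<epsilon> b * (\<epsilon> c * F a v d)) =
    sm3 B (\<lambda>a1 v1 b1. \<epsilon> b1 * sm2 (lam v1) (\<lambda>c1 w1. \<epsilon> c1 * sm3 C (\<lambda>z y v2. \<epsilon> y * sm2 (lam v2) (\<lambda>a2 u. sm2 (lam u)
      (\<lambda>c2 w2.
      \<epsilon> c2 * sm3 A (\<lambda>a b v. \<epsilon> b * F (a1 * (a2 * a)) (w1 * (w2 * v)) z))))))"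
    by (simp add: psi_defs case_prod_unfold mult.assoc mult.left_commute flip: sm_pull)
  also have "\<dots> = F 1 1 1"
    by (simp add: L.A_counit L.lam_counit R.A_counit B_counit)
  finally show "sm5 psi (\<lambda>a b v c d. \<epsilon> b * (\<epsilon> c * F a v d)) = F 1 1 1"
    by (simp add: sm5_def case_prod_unfold)
  have "sm psi (\<lambda>(a, b, v, c, d). \<epsilon> a * (\<epsilon> d * F b v c)) =
    sm3 B (\<lambda>a1 v1 b1. \<epsilon> a1 * sm2 (lam v1) (\<lambda>c1 w1. sm3 C (\<lambda>z y v2. \<epsilon> z * sm2 (lam v2) (\<lambda>a2 u. \<epsilon> a2 * sm2 (lam u)
      (\<lambda>c2 w2.
      sm3 A (\<lambda>a b v. \<epsilon> a * F (c1 * (c2 * b)) (w1 * (w2 * v)) (b1 * y)))))))"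
    by (simp add: psi_defs case_prod_unfold mult.assoc mult.left_commute flip: sm_pull)
  also have "\<dots> = F 1 1 1"
    by (simp add: L.A_counit L.lam_counit R.A_counit B_counit)
  finally show "sm5 psi (\<lambda>a b v c d. \<epsilon> a * (\<epsilon> d * F b v c)) = F 1 1 1"
    by (simp add: sm5_def case_prod_unfold)
qed

lemma dlt_hom:
  "sm3 (dlt 1) F = F 1 1 1"
  "sm3 (dlt (u * v)) F = sm3 (dlt u) (\<lambda>a w d. sm3 (dlt v) (\<lambda>a' w' d'. F (a * a') (w * w') (d * d')))"
  "lin s (\<lambda>u. sm3 (dlt u) F)"
proof -
  have e: "sm3 (dlt u) G = sm2 (rho u) (\<lambda>b v. sm2 (lam v) (\<lambda>a w. G a w b))" for u and G :: "'h \<Rightarrow> 'u \<Rightarrow> 'h \<Rightarrow> 'k"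
    by (simp add: dlt_def sm3_def case_prod_unfold del: L.side_uncurry R.side_uncurry) (simp add: sm2_def
      case_prod_unfold del: L.side_uncurry R.side_uncurry)
  show "sm3 (dlt 1) F = F 1 1 1" "lin s (\<lambda>u. sm3 (dlt u) F)"
    by (simp_all add: e)
  show "sm3 (dlt (u * v)) F = sm3 (dlt u) (\<lambda>a w d. sm3 (dlt v) (\<lambda>a' w' d'. F (a * a') (w * w') (d * d')))"
    by (simp add: e) (simp only: smn_defs, iprover intro: sm_perm)
qed

end

lemma dlt_counit: "lin s G \<Longrightarrow> sm3 (dlt u) (\<lambda>a v d. \<epsilon> a * (\<epsilon> d * G v)) = G u"
proof -
  assume G: "lin s G"
  have "sm (dlt u) (\<lambda>(a, v, d). \<epsilon> a * (\<epsilon> d * G v)) = sm2 (rho u) (\<lambda>d v. \<epsilon> d * sm2 (lam v) (\<lambda>a w. \<epsilon> a * G w))"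
    by (simp add: dlt_def case_prod_unfold mult.left_commute flip: sm_pull)
  also have "\<dots> = G u" using G by (simp add: L.lam_counit R.lam_counit)
  finally show ?thesis by (simp add: sm3_def case_prod_unfold)
qed

end

section \<open>Comodule algebras in one-sided form\<close>

text \<open>Inverts the whole pentagon, as the reversed right side works with inverse associators
  throughout.\<close>

lemma (in monoid) pentagon_inverse:
  assumes C: "a \<in> carrier G" "b \<in> carrier G" "c \<in> carrier G" "d \<in> carrier G" "e \<in> carrier G"
      "a' \<in> carrier G" "b' \<in> carrier G" "c' \<in> carrier G" "d' \<in> carrier G" "e' \<in> carrier G"
    and I: "a' \<otimes> a = \<one>" "b' \<otimes> b = \<one>" "c' \<otimes> c = \<one>" "d \<otimes> d' = \<one>" "e \<otimes> e' = \<one>"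
    and p: "a \<otimes> (b \<otimes> c) = d \<otimes> e"
  shows "c' \<otimes> (b' \<otimes> a') = e' \<otimes> d'"
proof -
  have I': "x \<in> carrier G \<Longrightarrow> a' \<otimes> (a \<otimes> x) = x" "x \<in> carrier G \<Longrightarrow> b' \<otimes> (b \<otimes> x) = x"
    "x \<in> carrier G \<Longrightarrow> c' \<otimes> (c \<otimes> x) = x" "x \<in> carrier G \<Longrightarrow> e \<otimes> (e' \<otimes> x) = x" for x
    by (simp_all add: C I flip: m_assoc)
  have "c' \<otimes> (b' \<otimes> a') = c' \<otimes> (b' \<otimes> (a' \<otimes> ((d \<otimes> e) \<otimes> (e' \<otimes> d'))))" by (simp add: C m_assoc I I')
  also have "\<dots> = e' \<otimes> d'" by (simp add: C m_assoc I' flip: p)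
  finally show ?thesis .
qed

text \<open>Solves a mixed pentagon so that the three faces with the mixed associator appear
  inverted, which the exchange of left and right requires.\<close>

lemma (in monoid) pentagon_rotate:
  assumes C: "a \<in> carrier G" "b \<in> carrier G" "c \<in> carrier G" "d \<in> carrier G" "e \<in> carrier G"
      "a' \<in> carrier G" "b' \<in> carrier G" "e' \<in> carrier G"
    and I: "a' \<otimes> a = \<one>" "b' \<otimes> b = \<one>" "e \<otimes> e' = \<one>"
    and p: "a \<otimes> (b \<otimes> c) = d \<otimes> e"
  shows "b' \<otimes> (a' \<otimes> d) = c \<otimes> e'"
proof -
  have I': "x \<in> carrier G \<Longrightarrow> a' \<otimes> (a \<otimes> x) = x" "x \<in> carrier G \<Longrightarrow> b' \<otimes> (b \<otimes> x) = x" for x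
    by (simp_all add: C I flip: m_assoc)
  have "b' \<otimes> (a' \<otimes> d) = b' \<otimes> (a' \<otimes> ((d \<otimes> e) \<otimes> e'))" by (simp add: C m_assoc I)
  also have "\<dots> = c \<otimes> e'" by (simp add: C m_assoc I' flip: p)
  finally show ?thesis .
qed

lemma sm2_swap_list: "sm2 (map prod.swap xs) F = sm2 xs (\<lambda>a b. F b a)"
  by (simp add: sm2_def)

abbreviation rev3 :: "'a \<times> 'b \<times> 'c \<Rightarrow> 'c \<times> 'b \<times> 'a" where "rev3 \<equiv> \<lambda>(a, b, c). (c, b, a)"

lemma sm3_rev3: "sm3 (map rev3 xs) F = sm3 xs (\<lambda>a b c. F c b a)"
  by (simp add: sm3_def case_prod_unfold)

context quasi_bialgebra
begin

lemma left_side: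
  fixes s :: "'k \<Rightarrow> 'u::{ring,monoid_mult} \<Rightarrow> 'u"
  assumes "left_comodule_algebra H s lam \<Phi>"
  shows "side_coaction hs s \<epsilon> D P (\<lambda>u. terms (lam u)) (terms \<Phi>) (terms (inv\<^bsub>talg (HHU H s)\<^esub> \<Phi>))"
proof -
  interpret C: left_comodule_algebra H s lam \<Phi> by fact
  have [simp]: "mult_ideal (vrel s)" by (rule mult_ideal_vrel[OF C.algebra])
  note [simp] = lmap_mult[OF C.algebra]
  have m: "mult_ideal (HU H s)" "mult_ideal (HHU H s)" "mult_ideal (HHHU H s)" by simp_all
  have [simp]: "sm (terms (lam u)) F = sm2 (terms (lam u)) (\<lambda>a b. F (a, b))" for u F by (rule sm_uncurry)
  have [simp]: "sm (terms \<Phi>) F = sm3 (terms \<Phi>) (\<lambda>a b c. F (a, b, c))" for F by (rule sm_uncurry)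
  let ?\<Phi>' = "terms (inv\<^bsub>talg (HHU H s)\<^esub> \<Phi>)"
  have [simp]: "sm ?\<Phi>' F = sm3 ?\<Phi>' (\<lambda>a b c. F (a, b, c))" for F by (rule sm_uncurry)
  note \<Phi> = Units_terms[OF C.phi_unit m(2)]
  have lam: "sm2 (terms (lam 1)) L = L 1 1"
    "sm2 (terms (lam (u * v))) L = sm2 (terms (lam u)) (\<lambda>a b. sm2 (terms (lam v)) (\<lambda>c d. L (a * c) (b * d)))"
    "lin s (\<lambda>u. sm2 (terms (lam u)) L)" if L: "\<And>y. lin hs (\<lambda>x. L x y)" "\<And>x. lin s (L x)" for L u v
    using alg_hom_terms[OF C.coact_hom m(1), of "case_prod L"] L by (simp_all add: one_prod_def)
  have lam_lin [simp]: "lmap t s g \<Longrightarrow> lin t (\<lambda>u. sm2 (terms (lam (g u))) L)" if L: "\<And>y. lin hs (\<lambda>x. L x y)" "\<And>x.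
    lin s (L x)" for t g L
    using lin_comp[OF lam(3)[OF L]] .
  show ?thesis
  proof
    fix L :: "'h \<Rightarrow> 'u \<Rightarrow> 'k" and u v assume L: "\<And>y. lin hs (\<lambda>x. L x y)" "\<And>x. lin s (L x)"
    show "sm2 (terms (lam 1)) L = L 1 1 \<and>
      sm2 (terms (lam (u * v))) L = sm2 (terms (lam u)) (\<lambda>a b. sm2 (terms (lam v)) (\<lambda>c d. L (a * c) (b * d))) \<and>
        lin s (\<lambda>u. sm2 (terms (lam u)) L)"
      using lam[OF L] by blast
    show "sm3 (terms \<Phi>) (\<lambda>a b v. \<epsilon> b * L a v) = L 1 1 \<and> sm3 (terms \<Phi>) (\<lambda>a b v. \<epsilon> a * L b v) = L 1 1"
      using tens_eqD[OF C.phi_counit_inner, of "case_prod L"] tens_eqD[OF C.phi_counit_outer, of "case_prod L"] L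
      by (simp add: lin_scale[OF L(2)])
  next
    fix g u assume g: "lin s g"
    show "sm2 (terms (lam u)) (\<lambda>a v. \<epsilon> a * g v) = g u"
      using arg_cong[OF C.coact_counit[of u], of g] by (simp add: lin_sum_list[OF g] lin_scale[OF g] case_prod_unfold)
  next
    fix K :: "'h \<Rightarrow> 'h \<Rightarrow> 'u \<Rightarrow> 'k" and u assume K: "\<And>b v. lin hs (\<lambda>a. K a b v)" "\<And>a v. lin hs (\<lambda>b. K a b v)" "\<And>a
      b. lin s (K a b)"
    show "sm3 (terms \<Phi>) (\<lambda>a b v. sm3 ?\<Phi>' (\<lambda>a' b' v'. K (a * a') (b * b') (v * v'))) = K 1 1 1 \<and>
      sm3 ?\<Phi>' (\<lambda>a b v. sm3 (terms \<Phi>) (\<lambda>a' b' v'. K (a * a') (b * b') (v * v'))) = K 1 1 1"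
      using tens_eqD[OF \<Phi>(3), of "\<lambda>(a, b, v). K a b v"] tens_eqD[OF \<Phi>(4), of "\<lambda>(a, b, v). K a b v"] K by (simp
        add: one_prod_def)
    have "tens (HHU H s) ([(a, b, w). (a, v) \<leftarrow> terms (lam u), (b, w) \<leftarrow> terms (lam v)] \<star> terms \<Phi>) =
      tens (HHU H s) (terms \<Phi> \<star> [(a1, a2, v). (a, v) \<leftarrow> terms (lam u), (a1, a2) \<leftarrow> D a])"
      using C.coact_coassoc[of u] by (simp only: \<Phi>(1) flip: talg_mult_tens[OF m(2)])
    from tens_eqD[OF this, of "\<lambda>(a, b, v). K a b v"] K
    show "sm2 (terms (lam u)) (\<lambda>a v. sm2 (terms (lam v)) (\<lambda>b w. sm3 (terms \<Phi>) (\<lambda>p q r. K (a * p) (b * q) (w * r)))) =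
      sm3 (terms \<Phi>) (\<lambda>p q r. sm2 (terms (lam u)) (\<lambda>a v. sm2 (D a) (\<lambda>s t. K (p * s) (q * t) (r * v))))"
      by simp
  next
    fix M :: "'h \<Rightarrow> 'h \<Rightarrow> 'h \<Rightarrow> 'u \<Rightarrow> 'k"
    assume M: "\<And>b c v. lin hs (\<lambda>a. M a b c v)" "\<And>a c v. lin hs (\<lambda>b. M a b c v)" "\<And>a b v. lin hs (\<lambda>c. M a b c v)"
      "\<And>a b c. lin s (M a b c)"
    from tens_eqD[OF C.phi_pentagon[unfolded talg_mult_tens[OF m(3)] lmul_assoc], of "\<lambda>(a, b, c, v). M a b c v"] M
    show "sm3 (terms \<Phi>) (\<lambda>a b v. sm3 (terms \<Phi>) (\<lambda>d e w. sm2 (D e) (\<lambda>s t. sm3 P (\<lambda>x y z. M (d * x) (a * (s * y))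
      (b * (t * z)) (v * w))))) =
      sm3 (terms \<Phi>) (\<lambda>a b v. sm2 (terms (lam v)) (\<lambda>c w. sm3 (terms \<Phi>) (\<lambda>d e u. sm2 (D d) (\<lambda>s t. M (a * s) (b *
        t) (c * e) (w * u)))))"
      by simp
  next
    show "lin hs \<epsilon>" by (rule counit_lin)
    show "lin hs f \<Longrightarrow> sm2 (D h) (\<lambda>x y. \<epsilon> x * f y) = f h" "lin hs f \<Longrightarrow> sm2 (D h) (\<lambda>x y. \<epsilon> y * f x) = f h" for f h
      by simp_all
  qed (simp_all add: algebra C.algebra)
qed

text \<open>Reversing all legs turns the right coaction into a left one for the reversed
  comultiplication. The order of legs in the reassociator is reversed as well, which forces the
  passage to inverses; each axiom has to be restated for the inverse associator.\<close>

lemma right_side: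
  fixes s :: "'k \<Rightarrow> 'u::{ring,monoid_mult} \<Rightarrow> 'u"
  assumes "right_comodule_algebra H s \<rho> \<Phi>"
  shows "side_coaction hs s \<epsilon> (\<lambda>h. map prod.swap (D h)) (map rev3 Q) (\<lambda>u. map prod.swap (terms (\<rho> u)))
    (map rev3 (terms (inv\<^bsub>talg (UHH H s)\<^esub> \<Phi>))) (map rev3 (terms \<Phi>))"
proof -
  interpret C: right_comodule_algebra H s \<rho> \<Phi> by fact
  have [simp]: "mult_ideal (vrel s)" by (rule mult_ideal_vrel[OF C.algebra])
  note [simp] = lmap_mult[OF C.algebra] sm2_swap_list sm3_rev3
  have m: "mult_ideal (UH H s)" "mult_ideal (UHH H s)" "mult_ideal (UHHH H s)" by simp_all
  have [simp]: "sm (terms (\<rho> u)) F = sm2 (terms (\<rho> u)) (\<lambda>a b. F (a, b))" for u F by (rule sm_uncurry)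
  have [simp]: "sm (terms \<Phi>) F = sm3 (terms \<Phi>) (\<lambda>a b c. F (a, b, c))" for F by (rule sm_uncurry)
  let ?\<Phi>' = "terms (inv\<^bsub>talg (UHH H s)\<^esub> \<Phi>)"
  have [simp]: "sm ?\<Phi>' F = sm3 ?\<Phi>' (\<lambda>a b c. F (a, b, c))" for F by (rule sm_uncurry)
  note \<Phi> = Units_terms[OF C.phi_unit m(2)]
  have rho: "sm2 (terms (\<rho> 1)) L = L 1 1"
    "sm2 (terms (\<rho> (u * v))) L = sm2 (terms (\<rho> u)) (\<lambda>a b. sm2 (terms (\<rho> v)) (\<lambda>c d. L (a * c) (b * d)))"
    "lin s (\<lambda>u. sm2 (terms (\<rho> u)) L)" if L: "\<And>y. lin s (\<lambda>x. L x y)" "\<And>x. lin hs (L x)" for L u v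
    using alg_hom_terms[OF C.coact_hom m(1), of "case_prod L"] L by (simp_all add: one_prod_def)
  have rho_lin [simp]: "lmap t s g \<Longrightarrow> lin t (\<lambda>u. sm2 (terms (\<rho> (g u))) L)" if L: "\<And>y. lin s (\<lambda>x. L x y)" "\<And>x. lin
    hs (L x)" for t g L
    using lin_comp[OF rho(3)[OF L]] .
  note [simp] = rho(1,2)
  have inv: "sm3 (terms \<Phi>) (\<lambda>v a b. sm3 ?\<Phi>' (\<lambda>v' a' b'. K (v * v') (a * a') (b * b'))) = K 1 1 1"
      "sm3 ?\<Phi>' (\<lambda>v a b. sm3 (terms \<Phi>) (\<lambda>v' a' b'. K (v * v') (a * a') (b * b'))) = K 1 1 1"
    if K: "\<And>a b. lin s (\<lambda>v. K v a b)" "\<And>v b. lin hs (\<lambda>a. K v a b)" "\<And>v a. lin hs (K v a)" for K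
    using tens_eqD[OF \<Phi>(3), of "\<lambda>(a, b, v). K a b v"] tens_eqD[OF \<Phi>(4), of "\<lambda>(a, b, v). K a b v"] K by (simp_all
      add: one_prod_def)
  show ?thesis
  proof
    fix L :: "'h \<Rightarrow> 'u \<Rightarrow> 'k" and u v assume L: "\<And>y. lin hs (\<lambda>x. L x y)" "\<And>x. lin s (L x)"
    note [simp] = lin_comp[OF L(1)] lin_comp[OF L(2)]
    show "sm2 (map prod.swap (terms (\<rho> 1))) L = L 1 1 \<and>
      sm2 (map prod.swap (terms (\<rho> (u * v)))) L = sm2 (map prod.swap (terms (\<rho> u))) (\<lambda>a b. sm2 (map prod.swap
        (terms (\<rho> v))) (\<lambda>c d. L (a * c) (b * d))) \<and>
      lin s (\<lambda>u. sm2 (map prod.swap (terms (\<rho> u))) L)"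
      by simp
    have 1: "sm3 (terms \<Phi>) (\<lambda>v a b. \<epsilon> a * L b v) = L 1 1" "sm3 (terms \<Phi>) (\<lambda>v a b. \<epsilon> b * L a v) = L 1 1"
      if L: "\<And>y. lin hs (\<lambda>x. L x y)" "\<And>x. lin s (L x)" for L
      using tens_eqD[OF C.phi_counit_inner, of "\<lambda>(v, b). L b v"] tens_eqD[OF C.phi_counit_outer, of "\<lambda>(v, b). L b v"] L
      by (simp_all add: lin_scale[OF L(2)])
    have "sm3 ?\<Phi>' (\<lambda>v a b. \<epsilon> a * sm3 (terms \<Phi>) (\<lambda>v' a' b'. \<epsilon> a' * L (b * b') (v * v'))) = L 1 1"
      "sm3 ?\<Phi>' (\<lambda>v a b. \<epsilon> b * sm3 (terms \<Phi>) (\<lambda>v' a' b'. \<epsilon> b' * L (a * a') (v * v'))) = L 1 1"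
      using inv(2)[of "\<lambda>v a b. \<epsilon> a * L b v"] inv(2)[of "\<lambda>v a b. \<epsilon> b * L a v"] by (simp_all add: mult.assoc flip:
        sm_pull)
    then show "sm3 (map rev3 ?\<Phi>') (\<lambda>a b v. \<epsilon> b * L a v) = L 1 1 \<and> sm3 (map rev3 ?\<Phi>') (\<lambda>a b v. \<epsilon> a * L b v) = L 1 1"
      by (simp add: 1)
  next
    fix g u assume g: "lin s g"
    show "sm2 (map prod.swap (terms (\<rho> u))) (\<lambda>a v. \<epsilon> a * g v) = g u"
      using arg_cong[OF C.coact_counit[of u], of g] by (simp add: lin_sum_list[OF g] lin_scale[OF g] case_prod_unfold)
  next
    fix K :: "'h \<Rightarrow> 'h \<Rightarrow> 'u \<Rightarrow> 'k" and u assume K: "\<And>b v. lin hs (\<lambda>a. K a b v)" "\<And>a v. lin hs (\<lambda>b. K a b v)" "\<And>a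
      b. lin s (K a b)"
    show "sm3 (map rev3 ?\<Phi>') (\<lambda>a b v. sm3 (map rev3 (terms \<Phi>)) (\<lambda>a' b' v'. K (a * a') (b * b') (v * v'))) = K 1 1 1 \<and>
      sm3 (map rev3 (terms \<Phi>)) (\<lambda>a b v. sm3 (map rev3 ?\<Phi>') (\<lambda>a' b' v'. K (a * a') (b * b') (v * v'))) = K 1 1 1"
      using inv[of "\<lambda>v a b. K b a v"] K by simp
    interpret monoid "talg (UHH H s)" by (rule monoid_talg[OF m(2)])
    have mm: "tens (UHH H s) xs \<otimes>\<^bsub>talg (UHH H s)\<^esub> tens (UHH H s) ys = tens (UHH H s) (xs \<star> ys)" for xs ys
      by (rule talg_mult_tens[OF m(2)])
    have CC: "tens (UHH H s) xs \<in> carrier (talg (UHH H s))" for xs by simp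
    \<comment> \<open>Naturality of the associator, converted into naturality of its
      inverse.\<close>
    have "tens (UHH H s) ([(w, b, a). (v, a) \<leftarrow> terms (\<rho> u), (w, b) \<leftarrow> terms (\<rho> v)] \<star> ?\<Phi>') =
      tens (UHH H s) (?\<Phi>' \<star> [(v, a1, a2). (v, a) \<leftarrow> terms (\<rho> u), (a1, a2) \<leftarrow> D a])"
      unfolding mm[symmetric]
    proof (rule commute_inverse[OF CC CC CC CC])
      show "tens (UHH H s) (terms \<Phi>) \<otimes>\<^bsub>talg (UHH H s)\<^esub> tens (UHH H s) ?\<Phi>' = \<one>\<^bsub>talg (UHH H s)\<^esub>"
        "tens (UHH H s) ?\<Phi>' \<otimes>\<^bsub>talg (UHH H s)\<^esub> tens (UHH H s) (terms \<Phi>) = \<one>\<^bsub>talg (UHH H s)\<^esub>"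
        by (simp_all only: mm \<Phi>(3,4) talg_simps)
    qed (use C.coact_coassoc[of u] in \<open>simp only: \<Phi>(1)\<close>)
    from tens_eqD[OF this, of "\<lambda>(v, b, a). K a b v"] K
    show "sm2 (map prod.swap (terms (\<rho> u))) (\<lambda>a v. sm2 (map prod.swap (terms (\<rho> v))) (\<lambda>b w. sm3 (map rev3 ?\<Phi>')
      (\<lambda>p q r. K (a * p) (b * q) (w * r)))) =
      sm3 (map rev3 ?\<Phi>') (\<lambda>p q r. sm2 (map prod.swap (terms (\<rho> u))) (\<lambda>a v. sm2 (map prod.swap (D a)) (\<lambda>s t. K (p
        * s) (q * t) (r * v))))"
      by simp
  next
    fix M :: "'h \<Rightarrow> 'h \<Rightarrow> 'h \<Rightarrow> 'u \<Rightarrow> 'k"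
    assume M: "\<And>b c v. lin hs (\<lambda>a. M a b c v)" "\<And>a c v. lin hs (\<lambda>b. M a b c v)" "\<And>a b v. lin hs (\<lambda>c. M a b c v)"
      "\<And>a b c. lin s (M a b c)"
    interpret monoid "talg (UHHH H s)" by (rule monoid_talg[OF m(3)])
    let ?t = "tens (UHHH H s)"
    have mm: "?t xs \<otimes>\<^bsub>talg (UHHH H s)\<^esub> ?t ys = ?t (xs \<star> ys)" for xs ys
      by (rule talg_mult_tens[OF m(3)])
    have CC: "?t xs \<in> carrier (talg (UHHH H s))" for xs by simp
    define a where "a X = [(1 :: 'u, x, y, z). (x, y, z) \<leftarrow> X]" for X :: "('h \<times> 'h \<times> 'h) list"
    define b where "b X = [(v, a1, a2, b). (v, a, b) \<leftarrow> X, (a1, a2) \<leftarrow> D a]" for X :: "('u \<times> 'h \<times> 'h) list"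
    define c where "c X = [(v, a, b, 1 :: 'h). (v, a, b) \<leftarrow> X]" for X :: "('u \<times> 'h \<times> 'h) list"
    define d where "d X = [(v, a, b1, b2). (v, a, b) \<leftarrow> X, (b1, b2) \<leftarrow> D b]" for X :: "('u \<times> 'h \<times> 'h) list"
    define e where "e X = [(w, c, a, b). (v, a, b) \<leftarrow> X, (w, c) \<leftarrow> terms (\<rho> v)]" for X :: "('u \<times> 'h \<times> 'h) list"
    note defs = a_def b_def c_def d_def e_def
    \<comment> \<open>The one-sided inverses of the five faces that \<open>pentagon_inverse\<close>
      asks for.\<close>
    have "?t (a Q \<star> a P) = ?t [1] \<and> ?t (b ?\<Phi>' \<star> b (terms \<Phi>)) = ?t [1] \<and> ?t (c ?\<Phi>' \<star> c (terms \<Phi>)) = ?t [1] \<and>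
      ?t (d (terms \<Phi>) \<star> d ?\<Phi>') = ?t [1] \<and> ?t (e (terms \<Phi>) \<star> e ?\<Phi>') = ?t [1]"
    proof -
      have "sm (a Q \<star> a P) F = F 1 \<and> sm (b ?\<Phi>' \<star> b (terms \<Phi>)) F = F 1 \<and> sm (c ?\<Phi>' \<star> c (terms \<Phi>)) F = F 1 \<and>
        sm (d (terms \<Phi>) \<star> d ?\<Phi>') F = F 1 \<and> sm (e (terms \<Phi>) \<star> e ?\<Phi>') F = F 1" if F: "resp (UHHH H s) F" for F
      proof (intro conjI)
        from F have F': "lin s (\<lambda>v. F (v, x, y, z))" "lin hs (\<lambda>x. F (v, x, y, z))" "lin hs (\<lambda>y. F (v, x, y, z))"
          "lin hs (\<lambda>z. F (v, x, y, z))" for v x y z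
          by simp_all
        note [simp] = lin_comp[OF F'(1)] lin_comp[OF F'(2)] lin_comp[OF F'(3)] lin_comp[OF F'(4)]
        show "sm (a Q \<star> a P) F = F 1" using PQ(2)[of "\<lambda>x y z. F (1, x, y, z)"] by (simp add: defs one_prod_def)
        show "sm (c ?\<Phi>' \<star> c (terms \<Phi>)) F = F 1" using inv(2)[of "\<lambda>x y z. F (x, y, z, 1)"] by (simp add: defs
          one_prod_def)
        show "sm (b ?\<Phi>' \<star> b (terms \<Phi>)) F = F 1" using inv(2)[of "\<lambda>v a b. sm2 (D a) (\<lambda>a1 a2. F (v, a1, a2, b))"]
          by (simp add: defs one_prod_def) (erule trans[rotated], simp only: smn_defs, iprover intro: sm_perm)
        show "sm (d (terms \<Phi>) \<star> d ?\<Phi>') F = F 1" using inv(1)[of "\<lambda>v a b. sm2 (D b) (\<lambda>a1 a2. F (v, a, a1, a2))"]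
          by (simp add: defs one_prod_def) (erule trans[rotated], simp only: smn_defs, iprover intro: sm_perm)
        show "sm (e (terms \<Phi>) \<star> e ?\<Phi>') F = F 1" using inv(1)[of "\<lambda>v a b. sm2 (terms (\<rho> v)) (\<lambda>w c. F (w, c, a, b))"]
          by (simp add: defs one_prod_def) (erule trans[rotated], simp only: smn_defs, iprover intro: sm_perm)
      qed
      then show ?thesis by (simp add: tens_eq_iff del: sm_lmul resp_trel)
    qed
    note I = this
    have "?t (c ?\<Phi>' \<star> (b ?\<Phi>' \<star> a Q)) = ?t (e ?\<Phi>' \<star> d ?\<Phi>')"
      unfolding mm[symmetric]
      by (rule pentagon_inverse[where a = "?t (a P)" and b = "?t (b (terms \<Phi>))" and c = "?t (c (terms \<Phi>))" and d
        = "?t (d (terms \<Phi>))" and e = "?t (e (terms \<Phi>))",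
          OF CC CC CC CC CC CC CC CC CC CC])
        (simp_all only: I mm talg_simps(2), use C.phi_pentagon[unfolded mm lmul_assoc] in \<open>simp only: defs\<close>)
    from tens_eqD[OF this, of "\<lambda>(v, c, b, a). M a b c v"] M
    show "sm3 (map rev3 ?\<Phi>') (\<lambda>a b v. sm3 (map rev3 ?\<Phi>') (\<lambda>d e w. sm2 (map prod.swap (D e)) (\<lambda>s t. sm3 (map rev3
      Q) (\<lambda>x y z.
        M (d * x) (a * (s * y)) (b * (t * z)) (v * w))))) =
      sm3 (map rev3 ?\<Phi>') (\<lambda>a b v. sm2 (map prod.swap (terms (\<rho> v))) (\<lambda>c w. sm3 (map rev3 ?\<Phi>') (\<lambda>d e u. sm2 (map
        prod.swap (D d)) (\<lambda>s t.
        M (a * s) (b * t) (c * e) (w * u)))))"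
      by (simp add: defs)
  next
    show "lin hs \<epsilon>" by (rule counit_lin)
    show "lin hs f \<Longrightarrow> sm2 (map prod.swap (D h)) (\<lambda>x y. \<epsilon> x * f y) = f h" "lin hs f \<Longrightarrow> sm2 (map prod.swap (D h))
      (\<lambda>x y. \<epsilon> y * f x) = f h" for f h
      by simp_all
  next
    fix F :: "'h \<Rightarrow> 'h \<Rightarrow> 'k" and h k assume F: "\<And>y. lin hs (\<lambda>x. F x y)" "\<And>x. lin hs (F x)"
    show "sm2 (map prod.swap (D 1)) F = F 1 1 \<and>
      sm2 (map prod.swap (D (h * k))) F = sm2 (map prod.swap (D h)) (\<lambda>a b. sm2 (map prod.swap (D k)) (\<lambda>c d. F (a
        * c) (b * d))) \<and>
      lin hs (\<lambda>h. sm2 (map prod.swap (D h)) F)"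
      using F by simp
  qed (simp_all add: algebra C.algebra)
qed

end

section \<open>Exchange of left and right\<close>

context bicoaction
begin

abbreviation "HUH3 \<equiv> h1 \<boxtimes> vrel s \<boxtimes> h1"
abbreviation "HHUH4 \<equiv> h1 \<boxtimes> h1 \<boxtimes> vrel s \<boxtimes> h1"
abbreviation "HUHH4 \<equiv> h1 \<boxtimes> vrel s \<boxtimes> h1 \<boxtimes> h1"

lemma mult_ideals [simp]: "mult_ideal HUH3" "mult_ideal HHUH4" "mult_ideal HUHH4"
  by (intro mult_ideal_trel mult_ideal_vrel L.alg_hs L.alg_s)+

lemma B_nat_inverse:
  assumes K: "\<And>v b. lin hs (\<lambda>a. K a v b)" "\<And>a b. lin s (\<lambda>v. K a v b)" "\<And>a v. lin hs (K a v)"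
  shows "sm3 B' (\<lambda>p r q. sm2 (lam u) (\<lambda>a v. sm2 (rho v) (\<lambda>b w. K (p * a) (r * w) (q * b)))) =
    sm2 (rho u) (\<lambda>b v. sm2 (lam v) (\<lambda>a w. sm3 B' (\<lambda>p r q. K (a * p) (w * r) (b * q))))"
proof -
  interpret monoid "talg HUH3" by (rule monoid_talg) simp
  have mm: "tens HUH3 xs \<otimes>\<^bsub>talg HUH3\<^esub> tens HUH3 ys = tens HUH3 (xs \<star> ys)" for xs ys
    by (rule talg_mult_tens) simp
  have CC: "tens HUH3 xs \<in> carrier (talg HUH3)" for xs by simp
  define X Y where "X = [(a, w, b). (b, v) \<leftarrow> rho u, (a, w) \<leftarrow> lam v]" and "Y = [(a, w, b). (a, v) \<leftarrow> lam u, (b, w)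
    \<leftarrow> rho v]"
  have "sm (B \<star> X) F = sm (Y \<star> B) F \<and> sm (B \<star> B') F = F 1 \<and> sm (B' \<star> B) F = F 1" if F: "resp HUH3 F" for F
    using B_nat[of "\<lambda>a v b. F (a, v, b)" u] B_inv[of "\<lambda>a v b. F (a, v, b)"] F by (simp add: X_def Y_def one_prod_def)
  then have I: "tens HUH3 (B \<star> X) = tens HUH3 (Y \<star> B)" "tens HUH3 (B \<star> B') = tens HUH3 [1]" "tens HUH3 (B' \<star> B)
    = tens HUH3 [1]"
    by (simp_all add: tens_eq_iff del: sm_lmul resp_trel)
  have "tens HUH3 (X \<star> B') = tens HUH3 (B' \<star> Y)"
    unfolding mm[symmetric]
    by (rule commute_inverse[of "tens HUH3 B", OF CC CC CC CC]) (simp_all only: mm I talg_simps(2))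
  from tens_eqD[OF this, of "\<lambda>(a, v, b). K a v b"] K show ?thesis by (simp add: X_def Y_def)
qed

text \<open>The left pentagon, solved so that the mixed associator occurs only through its inverse;
  with reversed legs it is the right pentagon of the exchanged structure.\<close>

lemma left_pentagon_rotated:
  assumes M: "\<And>b v x. lin hs (\<lambda>a. M a b v x)" "\<And>a v x. lin hs (\<lambda>b. M a b v x)" "\<And>a b x. lin s (\<lambda>v. M a b v x)"
    "\<And>a b v. lin hs (M a b v)"
  shows "sm3 B' (\<lambda>a v y. sm2 (lam v) (\<lambda>x w. sm3 B' (\<lambda>b u z. sm3 A (\<lambda>q p r. sm2 (rho r) (\<lambda>c s. M (a * q) (x * (b
    * p)) (w * (u * s)) (y * (z * c))))))) =
    sm3 A (\<lambda>q p r. sm3 B' (\<lambda>a v y. sm2 (D1 a) (\<lambda>s t. M (q * s) (p * t) (r * v) y)))"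
proof -
  interpret monoid "talg HHUH4" by (rule monoid_talg) simp
  let ?t = "tens HHUH4"
  have mm: "?t xs \<otimes>\<^bsub>talg HHUH4\<^esub> ?t ys = ?t (xs \<star> ys)" for xs ys by (rule talg_mult_tens) simp
  have CC: "?t xs \<in> carrier (talg HHUH4)" for xs by simp
  define a where "a X = [(1 :: 'h, b, v, x). (b, v, x) \<leftarrow> X]" for X :: "('h \<times> 'u \<times> 'h) list"
  define b where "b X = [(a, c, w, y). (a, u, y) \<leftarrow> X, (c, w) \<leftarrow> lam u]" for X :: "('h \<times> 'u \<times> 'h) list"
  define c where "c = [(p, q, r, 1 :: 'h). (p, q, r) \<leftarrow> A]"
  define d where "d = [(p, q, w, x). (p, q, r) \<leftarrow> A, (x, w) \<leftarrow> rho r]"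
  define e where "e X = [(s, t, v, y). (a, v, y) \<leftarrow> X, (s, t) \<leftarrow> D1 a]" for X :: "('h \<times> 'u \<times> 'h) list"
  note defs = a_def b_def c_def d_def e_def
  have "sm (a B \<star> (b B \<star> c)) F = sm (d \<star> e B) F \<and> sm (a B' \<star> a B) F = F 1 \<and> sm (b B' \<star> b B) F = F 1 \<and> sm (e B \<star>
    e B') F = F 1"
    if F: "resp HHUH4 F" for F
  proof (intro conjI)
    from F have F': "lin hs (\<lambda>v. F (v, x, y, z))" "lin hs (\<lambda>x. F (v, x, y, z))" "lin s (\<lambda>y. F (v, x, y, z))"
      "lin hs (\<lambda>z. F (v, x, y, z))" for v x y z
      by simp_all
    note [simp] = lin_comp[OF F'(1)] lin_comp[OF F'(2)] lin_comp[OF F'(3)] lin_comp[OF F'(4)]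
    show "sm (a B \<star> (b B \<star> c)) F = sm (d \<star> e B) F"
      using left_pentagon[of "\<lambda>a b c d. F (a, b, c, d)"] by (simp add: defs)
    show "sm (a B' \<star> a B) F = F 1"
      using B_inv[of "\<lambda>a v b. F (1, a, v, b)"] by (simp add: defs one_prod_def)
    have 1: "sm3 B' (\<lambda>a v b. sm3 B (\<lambda>a' v' b'. sm2 (lam (v * v')) (\<lambda>c w. F (a * a', c, w, b * b')))) = F 1"
      using B_inv[of "\<lambda>a v b. sm2 (lam v) (\<lambda>c w. F (a, c, w, b))"] by (simp add: one_prod_def)
    show "sm (b B' \<star> b B) F = F 1"
      using 1 by (simp add: defs one_prod_def) (erule trans[rotated], simp only: smn_defs, iprover intro: sm_perm)
    have 2: "sm3 B (\<lambda>a v b. sm3 B' (\<lambda>a' v' b'. sm2 (D1 (a * a')) (\<lambda>s t. F (s, t, v * v', b * b')))) = F 1"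
      using B_inv[of "\<lambda>a v b. sm2 (D1 a) (\<lambda>s t. F (s, t, v, b))"] by (simp add: one_prod_def)
    show "sm (e B \<star> e B') F = F 1"
      using 2 by (simp add: defs one_prod_def) (erule trans[rotated], simp only: smn_defs, iprover intro: sm_perm)
  qed
  then have I: "?t (a B \<star> (b B \<star> c)) = ?t (d \<star> e B)" "?t (a B' \<star> a B) = ?t [1]" "?t (b B' \<star> b B) = ?t [1]" "?t
    (e B \<star> e B') = ?t [1]"
    by (simp_all add: tens_eq_iff del: sm_lmul resp_trel)
  have "?t (b B' \<star> (a B' \<star> d)) = ?t (c \<star> e B')"
    unfolding mm[symmetric]
    by (rule pentagon_rotate[where a = "?t (a B)" and b = "?t (b B)" and c = "?t c" and d = "?t d" and e = "?t
      (e B)", OF CC CC CC CC CC CC CC CC])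
      (simp_all only: I mm talg_simps(2))
  from tens_eqD[OF this, of "\<lambda>(a, b, v, x). M a b v x"] M show ?thesis by (simp add: defs)
qed

text \<open>Likewise, the right pentagon becomes the left pentagon of the exchanged
  structure.\<close>

lemma right_pentagon_rotated:
  assumes N: "\<And>v x y. lin hs (\<lambda>a. N a v x y)" "\<And>a x y. lin s (\<lambda>v. N a v x y)" "\<And>a v y. lin hs (\<lambda>x. N a v x y)"
    "\<And>a v x. lin hs (N a v x)"
  shows "sm3 B' (\<lambda>a v y. sm3 B' (\<lambda>b u z. sm2 (rho u) (\<lambda>x w. sm3 C (\<lambda>q p r. N (a * b) (v * (w * r)) (y * (x * p))
    (z * q))))) =
    sm3 C (\<lambda>q p r. sm2 (lam r) (\<lambda>c s. sm3 B' (\<lambda>a v y. sm2 (D2 y) (\<lambda>y2 y1. N (c * a) (s * v) (p * y1) (q * y2)))))"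
proof -
  interpret monoid "talg HUHH4" by (rule monoid_talg) simp
  let ?t = "tens HUHH4"
  have mm: "?t xs \<otimes>\<^bsub>talg HUHH4\<^esub> ?t ys = ?t (xs \<star> ys)" for xs ys by (rule talg_mult_tens) simp
  have CC: "?t xs \<in> carrier (talg HUHH4)" for xs by simp
  define a where "a X = [(a, w, x, y). (a, v, y) \<leftarrow> X, (x, w) \<leftarrow> rho v]" for X :: "('h \<times> 'u \<times> 'h) list"
  define b where "b X = [(b, u, z, 1 :: 'h). (b, u, z) \<leftarrow> X]" for X :: "('h \<times> 'u \<times> 'h) list"
  define c where "c = [(c, s, p, q). (q, p, r) \<leftarrow> C, (c, s) \<leftarrow> lam r]"
  define d where "d = [(1 :: 'h, r, p, q). (q, p, r) \<leftarrow> C]"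
  define e where "e X = [(a, v, t, s). (a, v, y) \<leftarrow> X, (s, t) \<leftarrow> D2 y]" for X :: "('h \<times> 'u \<times> 'h) list"
  note defs = a_def b_def c_def d_def e_def
  have "sm (a B \<star> (b B \<star> c)) F = sm (d \<star> e B) F \<and> sm (a B' \<star> a B) F = F 1 \<and> sm (b B' \<star> b B) F = F 1 \<and> sm (e B \<star>
    e B') F = F 1"
    if F: "resp HUHH4 F" for F
  proof (intro conjI)
    from F have F': "lin hs (\<lambda>v. F (v, x, y, z))" "lin s (\<lambda>x. F (v, x, y, z))" "lin hs (\<lambda>y. F (v, x, y, z))"
      "lin hs (\<lambda>z. F (v, x, y, z))" for v x y z
      by simp_all
    note [simp] = lin_comp[OF F'(1)] lin_comp[OF F'(2)] lin_comp[OF F'(3)] lin_comp[OF F'(4)]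
    show "sm (a B \<star> (b B \<star> c)) F = sm (d \<star> e B) F"
      using right_pentagon[of "\<lambda>a b c d. F (a, b, c, d)"] by (simp add: defs)
    show "sm (b B' \<star> b B) F = F 1"
      using B_inv[of "\<lambda>a v b. F (a, v, b, 1)"] by (simp add: defs one_prod_def)
    have 1: "sm3 B' (\<lambda>a v b. sm3 B (\<lambda>a' v' b'. sm2 (rho (v * v')) (\<lambda>c w. F (a * a', w, c, b * b')))) = F 1"
      using B_inv[of "\<lambda>a v b. sm2 (rho v) (\<lambda>c w. F (a, w, c, b))"] by (simp add: one_prod_def)
    show "sm (a B' \<star> a B) F = F 1"
      using 1 by (simp add: defs one_prod_def) (erule trans[rotated], simp only: smn_defs, iprover intro: sm_perm)
    have 2: "sm3 B (\<lambda>a v b. sm3 B' (\<lambda>a' v' b'. sm2 (D2 (b * b')) (\<lambda>s t. F (a * a', v * v', t, s)))) = F 1"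
      using B_inv[of "\<lambda>a v b. sm2 (D2 b) (\<lambda>s t. F (a, v, t, s))"] by (simp add: one_prod_def)
    show "sm (e B \<star> e B') F = F 1"
      using 2 by (simp add: defs one_prod_def) (erule trans[rotated], simp only: smn_defs, iprover intro: sm_perm)
  qed
  then have I: "?t (a B \<star> (b B \<star> c)) = ?t (d \<star> e B)" "?t (a B' \<star> a B) = ?t [1]" "?t (b B' \<star> b B) = ?t [1]" "?t
    (e B \<star> e B') = ?t [1]"
    by (simp_all add: tens_eq_iff del: sm_lmul resp_trel)
  have "?t (b B' \<star> (a B' \<star> d)) = ?t (c \<star> e B')"
    unfolding mm[symmetric]
    by (rule pentagon_rotate[where a = "?t (a B)" and b = "?t (b B)" and c = "?t c" and d = "?t d" and e = "?t
      (e B)", OF CC CC CC CC CC CC CC CC])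
      (simp_all only: I mm talg_simps(2))
  from tens_eqD[OF this, of "\<lambda>(a, b, v, x). N a b v x"] N show ?thesis by (simp add: defs)
qed

text \<open>The mixed associator leads from one order of the two coactions to the other, so the
  exchange replaces it by its inverse with reversed legs. The results about \<open>psi\<close> then
  apply to the exchanged structure.\<close>

lemma swap: "bicoaction hs s \<epsilon> D2 D1 P2 P1 rho lam C C' A A' (map rev3 B') (map rev3 B)"
proof (intro bicoaction.intro bicoaction_axioms.intro)
  show "side_coaction hs s \<epsilon> D2 P2 rho C C'" "side_coaction hs s \<epsilon> D1 P1 lam A A'" by unfold_locales
next
  fix K :: "'h \<Rightarrow> 'u \<Rightarrow> 'h \<Rightarrow> 'k" and u
  assume K: "\<And>v b. lin hs (\<lambda>a. K a v b)" "\<And>a b. lin s (\<lambda>v. K a v b)" "\<And>a v. lin hs (K a v)"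
  show "sm3 (map rev3 B') (\<lambda>a v b. sm3 (map rev3 B) (\<lambda>a' v' b'. K (a * a') (v * v') (b * b'))) = K 1 1 1 \<and>
    sm3 (map rev3 B) (\<lambda>a v b. sm3 (map rev3 B') (\<lambda>a' v' b'. K (a * a') (v * v') (b * b'))) = K 1 1 1"
    using B_inv[of "\<lambda>b v a. K a v b"] K by (simp add: sm3_rev3)
  show "sm2 (rho u) (\<lambda>a v. sm2 (lam v) (\<lambda>b w. sm3 (map rev3 B') (\<lambda>p r q. K (a * p) (w * r) (b * q)))) =
    sm3 (map rev3 B') (\<lambda>p r q. sm2 (lam u) (\<lambda>b v. sm2 (rho v) (\<lambda>a w. K (p * a) (r * w) (q * b))))"
    using B_nat_inverse[of "\<lambda>b v a. K a v b" u] K by (simp add: sm3_rev3)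
next
  fix M :: "'h \<Rightarrow> 'h \<Rightarrow> 'u \<Rightarrow> 'h \<Rightarrow> 'k"
  assume M: "\<And>b v x. lin hs (\<lambda>a. M a b v x)" "\<And>a v x. lin hs (\<lambda>b. M a b v x)" "\<And>a b x. lin s (\<lambda>v. M a b v x)"
    "\<And>a b v. lin hs (M a b v)"
  show "sm3 (map rev3 B') (\<lambda>b v x. sm3 (map rev3 B') (\<lambda>a u y. sm2 (rho u) (\<lambda>c w. sm3 C (\<lambda>p q r. M (a * p) (b *
    (c * q)) (v * (w * r)) (x * y))))) =
    sm3 C (\<lambda>p q r. sm2 (lam r) (\<lambda>x w. sm3 (map rev3 B') (\<lambda>a v y. sm2 (D2 a) (\<lambda>s t. M (p * s) (q * t) (w * v) (x
      * y)))))"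
    using right_pentagon_rotated[of "\<lambda>x v b a. M a b v x"] M by (simp add: sm3_rev3)
next
  fix N :: "'h \<Rightarrow> 'u \<Rightarrow> 'h \<Rightarrow> 'h \<Rightarrow> 'k"
  assume N: "\<And>v x y. lin hs (\<lambda>a. N a v x y)" "\<And>a x y. lin s (\<lambda>v. N a v x y)" "\<And>a v y. lin hs (\<lambda>x. N a v x y)"
    "\<And>a v x. lin hs (N a v x)"
  show "sm3 (map rev3 B') (\<lambda>a v y. sm2 (lam v) (\<lambda>x w. sm3 (map rev3 B') (\<lambda>b u z. sm3 A (\<lambda>q p r. sm2 (rho r) (\<lambda>c
    s. N (a * (b * c)) (w * (u * s)) (x * (z * p)) (y * q)))))) =
    sm3 A (\<lambda>q p r. sm3 (map rev3 B') (\<lambda>a v y. sm2 (D1 y) (\<lambda>s t. N a (r * v) (p * t) (q * s))))"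
    using left_pentagon_rotated[of "\<lambda>y x v a. N a v x y"] N by (simp add: sm3_rev3)
qed

end

lemma eq_via_functionals:
  assumes "vector_space sc" "\<And>F. lin sc F \<Longrightarrow> F x = F y"
  shows "x = y"
proof (rule ccontr)
  assume "x \<noteq> y"
  then obtain F where F: "lin sc F" "F (x - y) \<noteq> 0" using vector_space_functional[OF assms(1), of "x - y"] by auto
  then have "F (x - y) + F y = F x" using lin_add[OF F(1), of "x - y" y] by simp
  then show False using assms(2)[OF F(1)] F(2) by simp
qed

text \<open>Moves the two faces with \<Phi>_\<rho> to the opposite sides of the right pentagon as
  inverses.\<close>

lemma (in monoid) pentagon_shift:
  assumes C: "a \<in> carrier G" "b \<in> carrier G" "c \<in> carrier G" "d \<in> carrier G" "e \<in> carrier G" "a' \<in> carrier G"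
    "e' \<in> carrier G"
    and I: "a' \<otimes> a = \<one>" "e \<otimes> e' = \<one>"
    and p: "a \<otimes> (b \<otimes> c) = d \<otimes> e"
  shows "b \<otimes> (c \<otimes> e') = a' \<otimes> d"
proof -
  have I': "x \<in> carrier G \<Longrightarrow> a' \<otimes> (a \<otimes> x) = x" for x
    by (simp add: C I flip: m_assoc)
  have "b \<otimes> (c \<otimes> e') = a' \<otimes> ((a \<otimes> (b \<otimes> c)) \<otimes> e')" by (simp add: C m_assoc I')
  also have "\<dots> = a' \<otimes> d" unfolding p by (simp add: C m_assoc I)
  finally show ?thesis .
qed

context quasi_bialgebra
begin

text \<open>Mostly a translation into forms; only the right pentagon has to be rearranged until
  \<Phi>_\<rho> occurs through its inverse alone.\<close>

lemma bicoaction_of_bicomodule: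
  fixes s :: "'k \<Rightarrow> 'u::{ring,monoid_mult} \<Rightarrow> 'u"
  assumes "bicomodule_algebra H s lam \<rho> \<Phi>l \<Phi>r \<Phi>lr"
  shows "bicoaction hs s \<epsilon> D (\<lambda>h. map prod.swap (D h)) P (map rev3 Q) (\<lambda>u. terms (lam u)) (\<lambda>u. map prod.swap
    (terms (\<rho> u)))
    (terms \<Phi>l) (terms (inv\<^bsub>talg (HHU H s)\<^esub> \<Phi>l)) (map rev3 (terms (inv\<^bsub>talg (UHH H s)\<^esub> \<Phi>r))) (map rev3 (terms \<Phi>r))
    (terms \<Phi>lr) (terms (inv\<^bsub>talg (HUH H s)\<^esub> \<Phi>lr))"
proof -
  interpret C: bicomodule_algebra H s lam \<rho> \<Phi>l \<Phi>r \<Phi>lr by fact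
  have left: "left_comodule_algebra H s lam \<Phi>l" and right: "right_comodule_algebra H s \<rho> \<Phi>r" by unfold_locales
  interpret L: side_coaction hs s \<epsilon> D P "\<lambda>u. terms (lam u)" "terms \<Phi>l" "terms (inv\<^bsub>talg (HHU H s)\<^esub> \<Phi>l)"
    by (rule left_side[OF left])
  have [simp]: "mult_ideal (vrel s)" by (rule mult_ideal_vrel[OF C.left.algebra])
  note [simp] = sm2_swap_list sm3_rev3
  have m: "mult_ideal (HUH H s)" "mult_ideal (HHUH H s)" "mult_ideal (HUHH H s)" "mult_ideal (UHH H s)" by simp_all
  let ?B = "terms \<Phi>lr" and ?B' = "terms (inv\<^bsub>talg (HUH H s)\<^esub> \<Phi>lr)" and ?R = "terms \<Phi>r" and ?R' = "terms
    (inv\<^bsub>talg (UHH H s)\<^esub> \<Phi>r)"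
  have [simp]: "sm (terms (\<rho> u)) F = sm2 (terms (\<rho> u)) (\<lambda>a b. F (a, b))" for u F by (rule sm_uncurry)
  have [simp]: "sm ?B F = sm3 ?B (\<lambda>a b c. F (a, b, c))" "sm ?B' F = sm3 ?B' (\<lambda>a b c. F (a, b, c))" for F by
    (rule sm_uncurry)+
  have [simp]: "sm ?R F = sm3 ?R (\<lambda>a b c. F (a, b, c))" "sm ?R' F = sm3 ?R' (\<lambda>a b c. F (a, b, c))" for F by
    (rule sm_uncurry)+
  note \<Phi> = Units_terms[OF C.philr_unit m(1)]
  note \<Phi>r = Units_terms[OF C.right.phi_unit m(4)]
  show ?thesis
  proof (intro bicoaction.intro bicoaction_axioms.intro left_side[OF left] right_side[OF right])
    fix K :: "'h \<Rightarrow> 'u \<Rightarrow> 'h \<Rightarrow> 'k" and u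
    assume K: "\<And>v b. lin hs (\<lambda>a. K a v b)" "\<And>a b. lin s (\<lambda>v. K a v b)" "\<And>a v. lin hs (K a v)"
    show "sm3 ?B (\<lambda>a v b. sm3 ?B' (\<lambda>a' v' b'. K (a * a') (v * v') (b * b'))) = K 1 1 1 \<and>
      sm3 ?B' (\<lambda>a v b. sm3 ?B (\<lambda>a' v' b'. K (a * a') (v * v') (b * b'))) = K 1 1 1"
      using tens_eqD[OF \<Phi>(3), of "\<lambda>(a, b, v). K a b v"] tens_eqD[OF \<Phi>(4), of "\<lambda>(a, b, v). K a b v"] K by (simp
        add: one_prod_def)
    have "tens (HUH H s) (?B \<star> [(a, w, b). (v, b) \<leftarrow> terms (\<rho> u), (a, w) \<leftarrow> terms (lam v)]) =
      tens (HUH H s) ([(a, w, b). (a, v) \<leftarrow> terms (lam u), (w, b) \<leftarrow> terms (\<rho> v)] \<star> ?B)"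
      using C.bicoassoc[of u] by (simp only: \<Phi>(1) flip: talg_mult_tens[OF m(1)])
    from tens_eqD[OF this, of "\<lambda>(a, v, b). K a v b"] K
    show "sm2 (terms (lam u)) (\<lambda>a v. sm2 (map prod.swap (terms (\<rho> v))) (\<lambda>b w. sm3 ?B (\<lambda>p r q. K (a * p) (w * r)
      (b * q)))) =
      sm3 ?B (\<lambda>p r q. sm2 (map prod.swap (terms (\<rho> u))) (\<lambda>b v. sm2 (terms (lam v)) (\<lambda>a w. K (p * a) (r * w) (q * b))))"
      by simp
  next
    fix M :: "'h \<Rightarrow> 'h \<Rightarrow> 'u \<Rightarrow> 'h \<Rightarrow> 'k"
    assume M: "\<And>b v x. lin hs (\<lambda>a. M a b v x)" "\<And>a v x. lin hs (\<lambda>b. M a b v x)" "\<And>a b x. lin s (\<lambda>v. M a b v x)"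
      "\<And>a b v. lin hs (M a b v)"
    from tens_eqD[OF C.philr_pentagon_left[unfolded talg_mult_tens[OF m(2)] lmul_assoc], of "\<lambda>(a, b, v, x). M a
      b v x"] M
    show "sm3 ?B (\<lambda>b v x. sm3 ?B (\<lambda>a u y. sm2 (terms (lam u)) (\<lambda>c w. sm3 (terms \<Phi>l) (\<lambda>p q r. M (a * p) (b * (c *
      q)) (v * (w * r)) (x * y))))) =
      sm3 (terms \<Phi>l) (\<lambda>p q r. sm2 (map prod.swap (terms (\<rho> r))) (\<lambda>x w. sm3 ?B (\<lambda>a v y. sm2 (D a) (\<lambda>s t. M (p *
        s) (q * t) (w * v) (x * y)))))"
      by simp
  next
    fix N :: "'h \<Rightarrow> 'u \<Rightarrow> 'h \<Rightarrow> 'h \<Rightarrow> 'k"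
    assume N: "\<And>v x y. lin hs (\<lambda>a. N a v x y)" "\<And>a x y. lin s (\<lambda>v. N a v x y)" "\<And>a v y. lin hs (\<lambda>x. N a v x y)"
      "\<And>a v x. lin hs (N a v x)"
    interpret monoid "talg (HUHH H s)" by (rule monoid_talg[OF m(3)])
    let ?t = "tens (HUHH H s)"
    have mm: "?t xs \<otimes>\<^bsub>talg (HUHH H s)\<^esub> ?t ys = ?t (xs \<star> ys)" for xs ys
      by (rule talg_mult_tens[OF m(3)])
    have CC: "?t xs \<in> carrier (talg (HUHH H s))" for xs by simp
    define a where "a X = [(1 :: 'h, v, a, b). (v, a, b) \<leftarrow> X]" for X :: "('u \<times> 'h \<times> 'h) list"
    define b where "b = [(a, w, c, b). (a, v, b) \<leftarrow> ?B, (w, c) \<leftarrow> terms (\<rho> v)]"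
    define c where "c = [(a, v, b, 1 :: 'h). (a, v, b) \<leftarrow> ?B]"
    define d where "d = [(a, v, b1, b2). (a, v, b) \<leftarrow> ?B, (b1, b2) \<leftarrow> D b]"
    define e where "e X = [(c, w, a, b). (v, a, b) \<leftarrow> X, (c, w) \<leftarrow> terms (lam v)]" for X :: "('u \<times> 'h \<times> 'h) list"
    note defs = a_def b_def c_def d_def e_def
    have inv: "sm3 ?R (\<lambda>v a b. sm3 ?R' (\<lambda>v' a' b'. K (v * v') (a * a') (b * b'))) = K 1 1 1"
        "sm3 ?R' (\<lambda>v a b. sm3 ?R (\<lambda>v' a' b'. K (v * v') (a * a') (b * b'))) = K 1 1 1"
      if K: "\<And>a b. lin s (\<lambda>v. K v a b)" "\<And>v b. lin hs (\<lambda>a. K v a b)" "\<And>v a. lin hs (K v a)" for K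
      using tens_eqD[OF \<Phi>r(3), of "\<lambda>(a, b, v). K a b v"] tens_eqD[OF \<Phi>r(4), of "\<lambda>(a, b, v). K a b v"] K by
        (simp_all add: one_prod_def)
    have "sm (a ?R' \<star> a ?R) F = F 1 \<and> sm (e ?R \<star> e ?R') F = F 1" if F: "resp (HUHH H s) F" for F
    proof
      from F have F': "lin hs (\<lambda>v. F (v, x, y, z))" "lin s (\<lambda>x. F (v, x, y, z))" "lin hs (\<lambda>y. F (v, x, y, z))"
        "lin hs (\<lambda>z. F (v, x, y, z))" for v x y z
        by simp_all
      note [simp] = lin_comp[OF F'(1)] lin_comp[OF F'(2)] lin_comp[OF F'(3)] lin_comp[OF F'(4)]
      show "sm (a ?R' \<star> a ?R) F = F 1"
        using inv(2)[of "\<lambda>x y z. F (1, x, y, z)"] by (simp add: defs one_prod_def)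
      have 1: "sm3 ?R (\<lambda>v a b. sm3 ?R' (\<lambda>v' a' b'. sm2 (terms (lam (v * v'))) (\<lambda>c w. F (c, w, a * a', b * b')))) = F 1"
        using inv(1)[of "\<lambda>v a b. sm2 (terms (lam v)) (\<lambda>c w. F (c, w, a, b))"] by (simp add: one_prod_def)
      show "sm (e ?R \<star> e ?R') F = F 1"
        using 1 by (simp add: defs one_prod_def) (erule trans[rotated], simp only: smn_defs, iprover intro: sm_perm)
    qed
    then have I: "?t (a ?R' \<star> a ?R) = ?t [1]" "?t (e ?R \<star> e ?R') = ?t [1]"
      by (simp_all add: tens_eq_iff del: sm_lmul resp_trel)
    have "?t (b \<star> (c \<star> e ?R')) = ?t (a ?R' \<star> d)"
      unfolding mm[symmetric]
      by (rule pentagon_shift[where a = "?t (a ?R)" and b = "?t b" and c = "?t c" and d = "?t d" and e = "?t (e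
        ?R)", OF CC CC CC CC CC CC CC])
        (simp_all only: I mm talg_simps(2), use C.philr_pentagon_right[unfolded mm lmul_assoc] in \<open>simp only: defs\<close>)
    from tens_eqD[OF this, of "\<lambda>(a, v, x, y). N a v x y"] N
    show "sm3 ?B (\<lambda>a v y. sm2 (map prod.swap (terms (\<rho> v))) (\<lambda>x w. sm3 ?B (\<lambda>b u z. sm3 (map rev3 ?R') (\<lambda>q p r.
      sm2 (terms (lam r)) (\<lambda>c s.
        N (a * (b * c)) (w * (u * s)) (x * (z * p)) (y * q)))))) =
      sm3 (map rev3 ?R') (\<lambda>q p r. sm3 ?B (\<lambda>a v y. sm2 (map prod.swap (D y)) (\<lambda>s t. N a (r * v) (p * t) (q * s))))"
      by (simp add: defs)
  qed
qed

section \<open>The two-sided coactions of a bicomodule algebra\<close>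

text \<open>Replaces the unspecified lists behind the coaction and its associator by given lists
  \<open>d u\<close> and \<open>p\<close>. The choices made by \<open>terms\<close> are dealt with
  here once for both coactions.\<close>

lemma two_sided_coactionI:
  fixes s :: "'k \<Rightarrow> 'u::{ring,monoid_mult} \<Rightarrow> 'u"
  assumes U: "k_algebra (alg_of s)" and \<delta>: "\<And>u. \<delta> u = tens (HUH H s) (d u)" and \<Psi>: "\<Psi> = tens (HHUHH H s) p"
    and d_hom: "\<And>F u v. \<lbrakk>\<And>y z. lin hs (\<lambda>x. F x y z); \<And>x z. lin s (\<lambda>y. F x y z); \<And>x y. lin hs (F x y)\<rbrakk> \<Longrightarrow> sm3 (d
      1) F = F 1 1 1 \<and>
      sm3 (d (u * v)) F = sm3 (d u) (\<lambda>a w e. sm3 (d v) (\<lambda>a' w' e'. F (a * a') (w * w') (e * e'))) \<and> lin s (\<lambda>u.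
        sm3 (d u) F)"
    and p_inv: "tens (HHUHH H s) (p \<star> p') = tens (HHUHH H s) [1]" "tens (HHUHH H s) (p' \<star> p) = tens (HHUHH H s) [1]"
    and coassoc: "\<And>u. tens (HHUHH H s) ([(a, b, v, c, e). (a, w, e) \<leftarrow> d u, (b, v, c) \<leftarrow> d w] \<star> p) =
      tens (HHUHH H s) (p \<star> [(a1, a2, v, d1, d2). (a, v, e) \<leftarrow> d u, (a1, a2) \<leftarrow> D a, (d1, d2) \<leftarrow> D e])"
    and pentagon: "tens (HHHUHHH H s) ([(1, a, b, v, c, e, 1). (a, b, v, c, e) \<leftarrow> p] \<star>
        [(a, b1, b2, v, c1, c2, e). (a, b, v, c, e) \<leftarrow> p, (b1, b2) \<leftarrow> D b, (c1, c2) \<leftarrow> D c] \<star>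
        [(X, Y, Z, 1, x, y, z). (X, Y, Z) \<leftarrow> P, (x, y, z) \<leftarrow> Q]) =
      tens (HHHUHHH H s) ([(a, b, v1, v, v2, c, e). (a, b, w, c, e) \<leftarrow> p, (v1, v, v2) \<leftarrow> d w] \<star>
        [(a1, a2, b, v, c, d1, d2). (a, b, v, c, e) \<leftarrow> p, (a1, a2) \<leftarrow> D a, (d1, d2) \<leftarrow> D e])"
    and d_counit: "\<And>G u. lin s G \<Longrightarrow> sm3 (d u) (\<lambda>a v e. \<epsilon> a * (\<epsilon> e * G v)) = G u"
    and p_counit: "\<And>F. \<lbrakk>\<And>y z. lin hs (\<lambda>x. F x y z); \<And>x z. lin s (\<lambda>y. F x y z); \<And>x y. lin hs (F x y)\<rbrakk> \<Longrightarrow>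
      sm5 p (\<lambda>a b v c e. \<epsilon> b * (\<epsilon> c * F a v e)) = F 1 1 1 \<and> sm5 p (\<lambda>a b v c e. \<epsilon> a * (\<epsilon> e * F b v c)) = F 1 1 1"
  shows "two_sided_coaction H s \<delta> \<Psi>"
proof -
  have [simp]: "mult_ideal (vrel s)" by (rule mult_ideal_vrel[OF U])
  note [simp] = lmap_mult[OF U]
  have m: "mult_ideal (HUH H s)" "mult_ideal (HHUHH H s)" "mult_ideal (HHHUHHH H s)" by simp_all
  have ud [simp]: "sm (d u) F = sm3 (d u) (\<lambda>a b c. F (a, b, c))" for u F by (rule sm_uncurry)
  have up [simp]: "sm p F = sm5 p (\<lambda>a b c x y. F (a, b, c, x, y))" for F by (rule sm_uncurry)
  have t\<delta>: "sm (terms (\<delta> u)) F = sm (d u) F" if "resp (HUH H s) F" for u F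
    unfolding \<delta> by (rule sm_terms_tens[OF that])
  have t\<Psi>: "sm (terms \<Psi>) F = sm p F" if "resp (HHUHH H s) F" for F
    unfolding \<Psi> by (rule sm_terms_tens[OF that])
  have d_lin: "lin t (\<lambda>u. sm3 (d (g u)) F)" if "\<And>y z. lin hs (\<lambda>x. F x y z)" "\<And>x z. lin s (\<lambda>y. F x y z)" "\<And>x y.
    lin hs (F x y)" "lmap t s g" for F g t
    using lin_comp[OF _ that(4)] d_hom[OF that(1-3)] by blast
  have E: "tens R X = tens R Y" if "\<And>F. resp R F \<Longrightarrow> sm X F = sm Y F" for R :: "('z \<Rightarrow>\<^sub>0 'k) set" and X Y
    using that by (rule tens_eqI)
  show ?thesis
  proof
    show "k_algebra (alg_of s)" by fact
    have "\<delta> (x * y) = \<delta> x \<otimes>\<^bsub>talg (HUH H s)\<^esub> \<delta> y" "\<delta> (x + y) = \<delta> x \<oplus>\<^bsub>talg (HUH H s)\<^esub> \<delta> y" "\<delta> 1 = \<one>\<^bsub>talg (HUH H s)\<^esub>"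
      "\<delta> (s c x) = c \<odot>\<^bsub>talg (HUH H s)\<^esub> \<delta> x" for x y c
    proof -
      have h: "sm (d 1) F = F 1 \<and> sm (d (x * y)) F = sm (d x \<star> d y) F \<and> lin s (\<lambda>u. sm (d u) F)" if "resp (HUH H
        s) F" for F
        using d_hom[of "\<lambda>a b c. F (a, b, c)" x y] that by (simp add: one_prod_def)
      show "\<delta> (x * y) = \<delta> x \<otimes>\<^bsub>talg (HUH H s)\<^esub> \<delta> y"
        unfolding \<delta> talg_mult_tens[OF m(1)] by (rule tens_eqI) (use h in \<open>simp del: ud resp_trel sm_lmul\<close>)
      show "\<delta> 1 = \<one>\<^bsub>talg (HUH H s)\<^esub>"
        unfolding \<delta> talg_simps by (rule tens_eqI) (use h in \<open>simp del: ud resp_trel\<close>)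
      show "\<delta> (x + y) = \<delta> x \<oplus>\<^bsub>talg (HUH H s)\<^esub> \<delta> y"
        unfolding \<delta> talg_def tspace_add by (rule tens_eqI) (use h in \<open>simp del: ud resp_trel add: lin_def\<close>)
      show "\<delta> (s c x) = c \<odot>\<^bsub>talg (HUH H s)\<^esub> \<delta> x"
        unfolding \<delta> talg_def set_eq_iff mem_tspace_smult mem_tens using h by (simp del: ud resp_trel add: lin_def)
    qed
    then show "\<delta> \<in> alg_hom (alg_of s) (talg (HUH H s))"
      by (simp add: alg_hom_def ring_hom_def alg_of_def \<delta>)
    have "tens (HHUHH H s) p \<otimes>\<^bsub>talg (HHUHH H s)\<^esub> tens (HHUHH H s) p' = \<one>\<^bsub>talg (HHUHH H s)\<^esub>"
      "tens (HHUHH H s) p' \<otimes>\<^bsub>talg (HHUHH H s)\<^esub> tens (HHUHH H s) p = \<one>\<^bsub>talg (HHUHH H s)\<^esub>"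
      by (simp_all only: talg_mult_tens[OF m(2)] p_inv talg_simps)
    then show "\<Psi> \<in> Units (talg (HHUHH H s))" unfolding \<Psi> by (auto simp: Units_def)
    fix u
    have 1: "tens (HHUHH H s) [(a, b, v, c, e). (a, w, e) \<leftarrow> terms (\<delta> u), (b, v, c) \<leftarrow> terms (\<delta> w)] =
      tens (HHUHH H s) [(a, b, v, c, e). (a, w, e) \<leftarrow> d u, (b, v, c) \<leftarrow> d w]"
      "tens (HHUHH H s) [(a1, a2, v, d1, d2). (a, v, e) \<leftarrow> terms (\<delta> u), (a1, a2) \<leftarrow> D a, (d1, d2) \<leftarrow> D e] =
      tens (HHUHH H s) [(a1, a2, v, d1, d2). (a, v, e) \<leftarrow> d u, (a1, a2) \<leftarrow> D a, (d1, d2) \<leftarrow> D e]"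
      by (rule E, simp add: t\<delta> d_lin case_prod_unfold)+
    show "tens (HHUHH H s) [(a, b, v, c, e). (a, w, e) \<leftarrow> terms (\<delta> u), (b, v, c) \<leftarrow> terms (\<delta> w)] \<otimes>\<^bsub>talg (HHUHH H s)\<^esub> \<Psi> =
      \<Psi> \<otimes>\<^bsub>talg (HHUHH H s)\<^esub> tens (HHUHH H s) [(a1, a2, v, d1, d2). (a, v, e) \<leftarrow> terms (\<delta> u), (a1, a2) \<leftarrow> D a, (d1,
        d2) \<leftarrow> D e]"
      unfolding 1 \<Psi> talg_mult_tens[OF m(2)] by (rule coassoc)
    have 2: "tens (HHHUHHH H s) [(1, a, b, v, c, e, 1). (a, b, v, c, e) \<leftarrow> terms \<Psi>] = tens (HHHUHHH H s) [(1, a,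
      b, v, c, e, 1). (a, b, v, c, e) \<leftarrow> p]"
      "tens (HHHUHHH H s) [(a, b1, b2, v, c1, c2, e). (a, b, v, c, e) \<leftarrow> terms \<Psi>, (b1, b2) \<leftarrow> D b, (c1, c2) \<leftarrow> D c] =
       tens (HHHUHHH H s) [(a, b1, b2, v, c1, c2, e). (a, b, v, c, e) \<leftarrow> p, (b1, b2) \<leftarrow> D b, (c1, c2) \<leftarrow> D c]"
      "tens (HHHUHHH H s) [(a, b, v1, v, v2, c, e). (a, b, w, c, e) \<leftarrow> terms \<Psi>, (v1, v, v2) \<leftarrow> terms (\<delta> w)] =
       tens (HHHUHHH H s) [(a, b, v1, v, v2, c, e). (a, b, w, c, e) \<leftarrow> p, (v1, v, v2) \<leftarrow> d w]"
      "tens (HHHUHHH H s) [(a1, a2, b, v, c, d1, d2). (a, b, v, c, e) \<leftarrow> terms \<Psi>, (a1, a2) \<leftarrow> D a, (d1, d2) \<leftarrow> D e] =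
       tens (HHHUHHH H s) [(a1, a2, b, v, c, d1, d2). (a, b, v, c, e) \<leftarrow> p, (a1, a2) \<leftarrow> D a, (d1, d2) \<leftarrow> D e]"
      by (rule E, simp add: t\<delta> t\<Psi> d_lin case_prod_unfold)+
    show "tens (HHHUHHH H s) [(1, a, b, v, c, e, 1). (a, b, v, c, e) \<leftarrow> terms \<Psi>] \<otimes>\<^bsub>talg (HHHUHHH H s)\<^esub>
        tens (HHHUHHH H s) [(a, b1, b2, v, c1, c2, e). (a, b, v, c, e) \<leftarrow> terms \<Psi>, (b1, b2) \<leftarrow> D b, (c1, c2) \<leftarrow> D
          c] \<otimes>\<^bsub>talg (HHHUHHH H s)\<^esub>
        tens (HHHUHHH H s) [(X, Y, Z, 1, x, y, z). (X, Y, Z) \<leftarrow> P, (x, y, z) \<leftarrow> Q] =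
      tens (HHHUHHH H s) [(a, b, v1, v, v2, c, e). (a, b, w, c, e) \<leftarrow> terms \<Psi>, (v1, v, v2) \<leftarrow> terms (\<delta> w)] \<otimes>\<^bsub>talg
        (HHHUHHH H s)\<^esub>
        tens (HHHUHHH H s) [(a1, a2, b, v, c, d1, d2). (a, b, v, c, e) \<leftarrow> terms \<Psi>, (a1, a2) \<leftarrow> D a, (d1, d2) \<leftarrow> D e]"
      unfolding 2 talg_mult_tens[OF m(3)] lmul_assoc by (rule pentagon)
    show "(\<Sum>(a, v, e)\<leftarrow>terms (\<delta> u). s (\<epsilon> a * \<epsilon> e) v) = u"
    proof (rule eq_via_functionals[OF k_algebra_alg_ofD(1)[OF U]])
      fix F assume F: "lin s F"
      note [simp] = lin_comp[OF F]
      have "F (\<Sum>(a, v, e)\<leftarrow>terms (\<delta> u). s (\<epsilon> a * \<epsilon> e) v) = sm (terms (\<delta> u)) (\<lambda>(a, v, e). \<epsilon> a * (\<epsilon> e * F v))"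
        by (simp add: lin_sum_list[OF F] lin_scale[OF F] case_prod_unfold mult.assoc)
      also have "\<dots> = F u" using d_counit[OF F] by (subst t\<delta>) simp_all
      finally show "F (\<Sum>(a, v, e)\<leftarrow>terms (\<delta> u). s (\<epsilon> a * \<epsilon> e) v) = F u" .
    qed
    have "sm [(a, s (\<epsilon> b * \<epsilon> c) v, e). (a, b, v, c, e) \<leftarrow> terms \<Psi>] F = sm [(1, 1, 1)] F \<and>
      sm [(b, s (\<epsilon> a * \<epsilon> e) v, c). (a, b, v, c, e) \<leftarrow> terms \<Psi>] F = sm [(1, 1, 1)] F" if F: "resp (HUH H s) F" for F
    proof -
      from F have F': "lin hs (\<lambda>x. F (x, y, z))" "lin s (\<lambda>y. F (x, y, z))" "lin hs (\<lambda>z. F (x, y, z))" for x y z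
        by simp_all
      note [simp] = lin_comp[OF F'(1)] lin_comp[OF F'(2)] lin_comp[OF F'(3)] lin_scale[OF F'(2)]
      show ?thesis
        using p_counit[of "\<lambda>a b c. F (a, b, c)"] F' by (simp add: case_prod_unfold t\<Psi> mult.assoc)
    qed
    then show "tens (HUH H s) [(a, s (\<epsilon> b * \<epsilon> c) v, e). (a, b, v, c, e) \<leftarrow> terms \<Psi>] = tens (HUH H s) [(1, 1, 1)]"
      "tens (HUH H s) [(b, s (\<epsilon> a * \<epsilon> e) v, c). (a, b, v, c, e) \<leftarrow> terms \<Psi>] = tens (HUH H s) [(1, 1, 1)]"
      by (simp_all only: tens_eq_iff) blast+
  qed
qed

end

abbreviation rev5 :: "'a \<times> 'b \<times> 'c \<times> 'd \<times> 'e \<Rightarrow> 'e \<times> 'd \<times> 'c \<times> 'b \<times> 'a" where "rev5 \<equiv> \<lambda>(a, b, c, d, e). (e, d, c, b, a)"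

lemma sm5_rev5: "sm5 (map rev5 xs) F = sm5 xs (\<lambda>a b c d e. F e d c b a)"
  by (simp add: sm5_def case_prod_unfold)

context quasi_bialgebra
begin

lemma two_sided_coaction_l:
  fixes s :: "'k \<Rightarrow> 'u::{ring,monoid_mult} \<Rightarrow> 'u"
  assumes bicomod: "bicomodule_algebra H s lam \<rho> \<Phi>l \<Phi>r \<Phi>lr"
  shows "two_sided_coaction H s (delta_l H s lam \<rho>) (Psi_l H s lam \<Phi>l \<Phi>r \<Phi>lr)"
proof -
  interpret C: bicomodule_algebra H s lam \<rho> \<Phi>l \<Phi>r \<Phi>lr by fact
  interpret B: bicoaction hs s \<epsilon> D "\<lambda>h. map prod.swap (D h)" P "map rev3 Q" "\<lambda>u. terms (lam u)" "\<lambda>u. map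
    prod.swap (terms (\<rho> u))"
    "terms \<Phi>l" "terms (inv\<^bsub>talg (HHU H s)\<^esub> \<Phi>l)" "map rev3 (terms (inv\<^bsub>talg (UHH H s)\<^esub> \<Phi>r))" "map rev3 (terms \<Phi>r)"
    "terms \<Phi>lr" "terms (inv\<^bsub>talg (HUH H s)\<^esub> \<Phi>lr)"
    by (rule bicoaction_of_bicomodule[OF bicomod])
  have [simp]: "mult_ideal (vrel s)" by (rule mult_ideal_vrel[OF C.left.algebra])
  define p p' where "p = B.psi" and "p' = B.psi'"
  note coassoc = B.psi_coassoc[folded p_def] and pentagon = B.psi_pentagon[folded p_def]
    and inverse = B.psi_inverse[folded p_def p'_def] and counit = B.psi_counit[folded p_def]
  have [simp]: "sm p F = sm5 p (\<lambda>a b c d e. F (a, b, c, d, e))" "sm (B.dlt u) G = sm3 (B.dlt u) (\<lambda>a b c. G (a,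
    b, c))" for F G u
    by (rule sm_uncurry)+
  note [simp] = sm2_swap_list sm3_rev3
  show ?thesis
  proof (rule two_sided_coactionI[where d = B.dlt and p = p and p' = p'])
    show "delta_l H s lam \<rho> u = tens (HUH H s) (B.dlt u)" for u
      by (simp add: delta_l_def B.dlt_def o_def case_prod_unfold)
    let ?R' = "terms (inv\<^bsub>talg (UHH H s)\<^esub> \<Phi>r)"
    have m: "mult_ideal (HUHH H s)" "mult_ideal (HHUHH H s)" by simp_all
    \<comment> \<open>The definition of \<Psi>_l passes through a chosen list for an inner product
      of tensors; under forms that list may be replaced by \<open>X\<close>.\<close>
    define X where "X = [(a, v, b, 1 :: 'h). (a, v, b) \<leftarrow> terms \<Phi>lr] \<star> [(c, w, a, b). (v, a, b) \<leftarrow> ?R', (c, w) \<leftarrow>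
      terms (lam v)]"
    have X: "sm (terms (tens (HUHH H s) X)) F = sm X F" if "resp (HUHH H s) F" for F by (rule sm_terms_tens[OF that])
    have "tens (HHUHH H s) ([(a, c, w, b, d). (a, v, b, d) \<leftarrow> terms (tens (HUHH H s) X), (c, w) \<leftarrow> terms (lam v)] \<star>
        [(a, b, v, 1, 1). (a, b, v) \<leftarrow> terms \<Phi>l]) = tens (HHUHH H s) p"
    proof (rule tens_eqI)
      fix F assume F: "resp (HHUHH H s) F"
      note [simp] = resp5_lin[OF F]
      have [simp]: "sm ?R' F = sm3 ?R' (\<lambda>a b c. F (a, b, c))" for F by (rule sm_uncurry)
      show "sm ([(a, c, w, b, d). (a, v, b, d) \<leftarrow> terms (tens (HUHH H s) X), (c, w) \<leftarrow> terms (lam v)] \<star>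
        [(a, b, v, 1, 1). (a, b, v) \<leftarrow> terms \<Phi>l]) F = sm p F"
        unfolding p_def B.psi_def B.psi1_def B.psi2_def B.psi3_def
        by (simp add: X case_prod_unfold) (simp add: X_def case_prod_unfold mult.assoc, simp only: smn_defs,
          iprover intro: sm_perm)
    qed
    then show "Psi_l H s lam \<Phi>l \<Phi>r \<Phi>lr = tens (HHUHH H s) p"
      unfolding Psi_l_def talg_mult_tens[OF m(1)] talg_mult_tens[OF m(2)] X_def .
    show "tens (HHUHH H s) ([(a, b, v, c, e). (a, w, e) \<leftarrow> B.dlt u, (b, v, c) \<leftarrow> B.dlt w] \<star> p) =
      tens (HHUHH H s) (p \<star> [(a1, a2, v, d1, d2). (a, v, e) \<leftarrow> B.dlt u, (a1, a2) \<leftarrow> D a, (d1, d2) \<leftarrow> D e])" for u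
      by (rule tens_eqI, use tens_eqD[OF coassoc] in \<open>simp add: case_prod_unfold\<close>)
    show "tens (HHHUHHH H s) ([(1, a, b, v, c, e, 1). (a, b, v, c, e) \<leftarrow> p] \<star>
        [(a, b1, b2, v, c1, c2, e). (a, b, v, c, e) \<leftarrow> p, (b1, b2) \<leftarrow> D b, (c1, c2) \<leftarrow> D c] \<star>
        [(X, Y, Z, 1, x, y, z). (X, Y, Z) \<leftarrow> P, (x, y, z) \<leftarrow> Q]) =
      tens (HHHUHHH H s) ([(a, b, v1, v, v2, c, e). (a, b, w, c, e) \<leftarrow> p, (v1, v, v2) \<leftarrow> B.dlt w] \<star>
        [(a1, a2, b, v, c, d1, d2). (a, b, v, c, e) \<leftarrow> p, (a1, a2) \<leftarrow> D a, (d1, d2) \<leftarrow> D e])"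
      by (rule tens_eqI, use tens_eqD[OF pentagon] in \<open>simp add: case_prod_unfold\<close>)
  qed (simp_all add: C.left.algebra B.dlt_hom inverse B.dlt_counit counit del: sm_lmul)
qed

text \<open>The coaction and associator of index r are the leg-reversed \<open>dlt\<close> and
  \<open>psi\<close> of the exchanged structure. The inverses introduced by the exchange are the
  \<Phi>_{\<lambda>,\<rho>}^{-1} and \<Phi>_\<rho>^{-1} in the formula of \<Psi>_r.\<close>

lemma two_sided_coaction_r:
  fixes s :: "'k \<Rightarrow> 'u::{ring,monoid_mult} \<Rightarrow> 'u"
  assumes bicomod: "bicomodule_algebra H s lam \<rho> \<Phi>l \<Phi>r \<Phi>lr"
  shows "two_sided_coaction H s (delta_r H s lam \<rho>) (Psi_r H s \<rho> \<Phi>l \<Phi>r \<Phi>lr)"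
proof -
  interpret C: bicomodule_algebra H s lam \<rho> \<Phi>l \<Phi>r \<Phi>lr by fact
  interpret B: bicoaction hs s \<epsilon> "\<lambda>h. map prod.swap (D h)" D "map rev3 Q" P "\<lambda>u. map prod.swap (terms (\<rho> u))"
    "\<lambda>u. terms (lam u)"
    "map rev3 (terms (inv\<^bsub>talg (UHH H s)\<^esub> \<Phi>r))" "map rev3 (terms \<Phi>r)" "terms \<Phi>l" "terms (inv\<^bsub>talg (HHU H s)\<^esub> \<Phi>l)"
    "map rev3 (terms (inv\<^bsub>talg (HUH H s)\<^esub> \<Phi>lr))" "map rev3 (terms \<Phi>lr)"
    by (rule bicoaction.swap[OF bicoaction_of_bicomodule[OF bicomod]])
  have [simp]: "mult_ideal (vrel s)" by (rule mult_ideal_vrel[OF C.left.algebra])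
  define p p' where "p = B.psi" and "p' = B.psi'"
  note coassoc = B.psi_coassoc[folded p_def] and pentagon = B.psi_pentagon[folded p_def]
    and inverse = B.psi_inverse[folded p_def p'_def] and counit = B.psi_counit[folded p_def]
  have [simp]: "sm p F = sm5 p (\<lambda>a b c d e. F (a, b, c, d, e))" "sm (B.dlt u) G = sm3 (B.dlt u) (\<lambda>a b c. G (a, b, c))"
    "sm p' F = sm5 p' (\<lambda>a b c d e. F (a, b, c, d, e))" for F G u
    by (rule sm_uncurry)+
  note [simp] = sm2_swap_list sm3_rev3 sm5_rev5
  show ?thesis
  proof (rule two_sided_coactionI[where d = "\<lambda>u. map rev3 (B.dlt u)" and p = "map rev5 p" and p' = "map rev5 p'"])
    show "delta_r H s lam \<rho> u = tens (HUH H s) (map rev3 (B.dlt u))" for u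
      by (simp add: delta_r_def B.dlt_def o_def case_prod_unfold map_concat)
    let ?R' = "terms (inv\<^bsub>talg (UHH H s)\<^esub> \<Phi>r)" and ?B' = "terms (inv\<^bsub>talg (HUH H s)\<^esub> \<Phi>lr)"
    have m: "mult_ideal (HHUH H s)" "mult_ideal (HHUHH H s)" by simp_all
    define X where "X = [(1 :: 'h, a, v, b). (a, v, b) \<leftarrow> ?B'] \<star> [(a, b, w, c). (a, b, v) \<leftarrow> terms \<Phi>l, (w, c) \<leftarrow>
      terms (\<rho> v)]"
    have X: "sm (terms (tens (HHUH H s) X)) F = sm X F" if "resp (HHUH H s) F" for F by (rule sm_terms_tens[OF that])
    have "tens (HHUHH H s) ([(a, b, w, c, d). (a, b, v, d) \<leftarrow> terms (tens (HHUH H s) X), (w, c) \<leftarrow> terms (\<rho> v)] \<star>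
        [(1, 1, v, a, b). (v, a, b) \<leftarrow> ?R']) = tens (HHUHH H s) (map rev5 p)"
    proof (rule tens_eqI)
      fix F assume F: "resp (HHUHH H s) F"
      note [simp] = resp5_lin[OF F]
      have [simp]: "sm ?R' F = sm3 ?R' (\<lambda>a b c. F (a, b, c))" "sm ?B' G = sm3 ?B' (\<lambda>a b c. G (a, b, c))"
        "sm (terms (\<rho> u)) K = sm2 (terms (\<rho> u)) (\<lambda>a b. K (a, b))" for F G u K by (rule sm_uncurry)+
      have r: "sm2 (terms (\<rho> 1)) L = L 1 1"
        "sm2 (terms (\<rho> (u * v))) L = sm2 (terms (\<rho> u)) (\<lambda>a b. sm2 (terms (\<rho> v)) (\<lambda>c d. L (a * c) (b * d)))"
        "lmap t s g \<Longrightarrow> lin t (\<lambda>u. sm2 (terms (\<rho> (g u))) L)" if L: "\<And>y. lin s (\<lambda>x. L x y)" "\<And>x. lin hs (L x)" for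
          L u v t g
        using B.L.side_coact[of "\<lambda>a b. L b a"] L by simp_all
      note [simp] = r
      show "sm ([(a, b, w, c, d). (a, b, v, d) \<leftarrow> terms (tens (HHUH H s) X), (w, c) \<leftarrow> terms (\<rho> v)] \<star>
        [(1, 1, v, a, b). (v, a, b) \<leftarrow> ?R']) F = sm (map rev5 p) F"
        unfolding p_def B.psi_def B.psi1_def B.psi2_def B.psi3_def
        by (simp add: X case_prod_unfold) (simp add: X_def case_prod_unfold mult.assoc, simp only: smn_defs,
          iprover intro: sm_perm)
    qed
    then show "Psi_r H s \<rho> \<Phi>l \<Phi>r \<Phi>lr = tens (HHUHH H s) (map rev5 p)"
      unfolding Psi_r_def talg_mult_tens[OF m(1)] talg_mult_tens[OF m(2)] X_def .
    show "tens (HHUHH H s) ([(a, b, v, c, e). (a, w, e) \<leftarrow> map rev3 (B.dlt u), (b, v, c) \<leftarrow> map rev3 (B.dlt w)] \<star>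
      map rev5 p) =
      tens (HHUHH H s) (map rev5 p \<star> [(a1, a2, v, d1, d2). (a, v, e) \<leftarrow> map rev3 (B.dlt u), (a1, a2) \<leftarrow> D a, (d1,
        d2) \<leftarrow> D e])" for u
    proof (rule tens_eqI)
      fix F assume F: "resp (HHUHH H s) F"
      \<comment> \<open>Reversing the legs respects products, so the law for \<open>p\<close>
        carries over when it is evaluated on the reversed form; only the order of some sums has to
        be adjusted.\<close>
      then have F': "resp (HHUHH H s) (\<lambda>x. F (rev5 x))" by (simp add: case_prod_unfold)
      show "sm ([(a, b, v, c, e). (a, w, e) \<leftarrow> map rev3 (B.dlt u), (b, v, c) \<leftarrow> map rev3 (B.dlt w)] \<star> map rev5 p) F =
        sm (map rev5 p \<star> [(a1, a2, v, d1, d2). (a, v, e) \<leftarrow> map rev3 (B.dlt u), (a1, a2) \<leftarrow> D a, (d1, d2) \<leftarrow> D e]) F"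
        using tens_eqD[OF coassoc F', of u] by (simp add: case_prod_unfold) (erule thin_rl, simp only: smn_defs,
          iprover intro: sm_perm)
    qed
    show "tens (HHHUHHH H s) ([(1, a, b, v, c, e, 1). (a, b, v, c, e) \<leftarrow> map rev5 p] \<star>
        [(a, b1, b2, v, c1, c2, e). (a, b, v, c, e) \<leftarrow> map rev5 p, (b1, b2) \<leftarrow> D b, (c1, c2) \<leftarrow> D c] \<star>
        [(X, Y, Z, 1, x, y, z). (X, Y, Z) \<leftarrow> P, (x, y, z) \<leftarrow> Q]) =
      tens (HHHUHHH H s) ([(a, b, v1, v, v2, c, e). (a, b, w, c, e) \<leftarrow> map rev5 p, (v1, v, v2) \<leftarrow> map rev3 (B.dlt w)] \<star>
        [(a1, a2, b, v, c, d1, d2). (a, b, v, c, e) \<leftarrow> map rev5 p, (a1, a2) \<leftarrow> D a, (d1, d2) \<leftarrow> D e])"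
    proof (rule tens_eqI)
      fix F assume F: "resp (HHHUHHH H s) F"
      show "sm ([(1, a, b, v, c, e, 1). (a, b, v, c, e) \<leftarrow> map rev5 p] \<star>
          [(a, b1, b2, v, c1, c2, e). (a, b, v, c, e) \<leftarrow> map rev5 p, (b1, b2) \<leftarrow> D b, (c1, c2) \<leftarrow> D c] \<star>
          [(X, Y, Z, 1, x, y, z). (X, Y, Z) \<leftarrow> P, (x, y, z) \<leftarrow> Q]) F =
        sm ([(a, b, v1, v, v2, c, e). (a, b, w, c, e) \<leftarrow> map rev5 p, (v1, v, v2) \<leftarrow> map rev3 (B.dlt w)] \<star>
          [(a1, a2, b, v, c, d1, d2). (a, b, v, c, e) \<leftarrow> map rev5 p, (a1, a2) \<leftarrow> D a, (d1, d2) \<leftarrow> D e]) F"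
        using tens_eqD[OF pentagon, of "\<lambda>(x, y, z, v, a, b, c). F (c, b, a, v, z, y, x)"] F
        by (simp add: case_prod_unfold) (erule eq_via; simp only: smn_defs, iprover intro: sm_perm)
    qed
    have "sm (map rev5 p \<star> map rev5 p') F = F 1 \<and> sm (map rev5 p' \<star> map rev5 p) F = F 1" if F: "resp (HHUHH H s)
      F" for F
      using tens_eqD[OF inverse(1), of "\<lambda>x. F (rev5 x)"] tens_eqD[OF inverse(2), of "\<lambda>x. F (rev5 x)"] F by (simp
        add: one_prod_def)
    then show "tens (HHUHH H s) (map rev5 p \<star> map rev5 p') = tens (HHUHH H s) [1]"
      "tens (HHUHH H s) (map rev5 p' \<star> map rev5 p) = tens (HHUHH H s) [1]"
      by (simp_all add: tens_eq_iff del: sm_lmul resp_trel sm_map)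
    show "sm3 (map rev3 (B.dlt u)) (\<lambda>a v e. \<epsilon> a * (\<epsilon> e * G v)) = G u" if "lin s G" for G u
      using B.dlt_counit[OF that] by (simp add: mult.left_commute)
    fix F :: "'h \<Rightarrow> 'u \<Rightarrow> 'h \<Rightarrow> 'k" and u v
    assume F: "\<And>y z. lin hs (\<lambda>x. F x y z)" "\<And>x z. lin s (\<lambda>y. F x y z)" "\<And>x y. lin hs (F x y)"
    show "sm3 (map rev3 (B.dlt 1)) F = F 1 1 1 \<and>
      sm3 (map rev3 (B.dlt (u * v))) F = sm3 (map rev3 (B.dlt u)) (\<lambda>a w e. sm3 (map rev3 (B.dlt v)) (\<lambda>a' w' e'.
        F (a * a') (w * w') (e * e'))) \<and>
      lin s (\<lambda>u. sm3 (map rev3 (B.dlt u)) F)"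
      using F by (simp add: B.dlt_hom)
    show "sm5 (map rev5 p) (\<lambda>a b v c e. \<epsilon> b * (\<epsilon> c * F a v e)) = F 1 1 1 \<and> sm5 (map rev5 p) (\<lambda>a b v c e. \<epsilon> a *
      (\<epsilon> e * F b v c)) = F 1 1 1"
      using counit[of "\<lambda>a v b. F b v a"] F by (simp add: mult.left_commute)
  qed (rule C.left.algebra)
qed

end

section \<open>Crossed products for general coactions and for bicomodule algebras\<close>

theorem proposition3p2:
  fixes H :: "('k::field, 'h::{ring,monoid_mult}) quasi_hopf"
    and A :: "('k, 'h, 'a::ab_group_add) bimodule_alg"
    and s :: "'k \<Rightarrow> 'u::{ring,monoid_mult} \<Rightarrow> 'u"
  assumes "quasi_hopf_algebra H"
    and "bimodule_algebra H A"
    and "k_algebra (alg_of s)"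
  shows "(\<forall>\<delta> \<Psi>. two_sided_coaction H s \<delta> \<Psi> \<longrightarrow>
       (\<forall>x y. tens (AU A s) [x] \<otimes>\<^bsub>lcross H A s \<delta> \<Psi>\<^esub> tens (AU A s) [y]
              = tens (AU A s) (lprod H A s \<delta> \<Psi> x y)) \<and>
       k_algebra (lcross H A s \<delta> \<Psi>) \<and>
       \<one>\<^bsub>lcross H A s \<delta> \<Psi>\<^esub> = tens (AU A s) [(bunit A, 1)] \<and>
       lincl A s \<in> alg_hom (alg_of s) (lcross H A s \<delta> \<Psi>) \<and>
       (bunit A \<noteq> 0 \<longrightarrow> inj (lincl A s)) \<and>
       (\<forall>x y. tens (UA s A) [x] \<otimes>\<^bsub>rcross H A s \<delta> \<Psi>\<^esub> tens (UA s A) [y]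
              = tens (UA s A) (rprod H A s \<delta> \<Psi> x y)) \<and>
       k_algebra (rcross H A s \<delta> \<Psi>) \<and>
       \<one>\<^bsub>rcross H A s \<delta> \<Psi>\<^esub> = tens (UA s A) [(1, bunit A)] \<and>
       rincl A s \<in> alg_hom (alg_of s) (rcross H A s \<delta> \<Psi>) \<and>
       (bunit A \<noteq> 0 \<longrightarrow> inj (rincl A s)))
   \<and> (\<forall>lam \<rho> \<Phi>l \<Phi>r \<Phi>lr. bicomodule_algebra H s lam \<rho> \<Phi>l \<Phi>r \<Phi>lr \<longrightarrow>
       (\<forall>(\<delta>, \<Psi>) \<in> {(delta_l H s lam \<rho>, Psi_l H s lam \<Phi>l \<Phi>r \<Phi>lr),
                     (delta_r H s lam \<rho>, Psi_r H s \<rho> \<Phi>l \<Phi>r \<Phi>lr)}.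
         (\<forall>x y. tens (AU A s) [x] \<otimes>\<^bsub>lcross H A s \<delta> \<Psi>\<^esub> tens (AU A s) [y]
                = tens (AU A s) (lprod H A s \<delta> \<Psi> x y)) \<and>
         k_algebra (lcross H A s \<delta> \<Psi>) \<and>
         lincl A s \<in> alg_hom (alg_of s) (lcross H A s \<delta> \<Psi>) \<and>
         (bunit A \<noteq> 0 \<longrightarrow> inj (lincl A s)) \<and>
         (\<forall>x y. tens (UA s A) [x] \<otimes>\<^bsub>rcross H A s \<delta> \<Psi>\<^esub> tens (UA s A) [y]
                = tens (UA s A) (rprod H A s \<delta> \<Psi> x y)) \<and>
         k_algebra (rcross H A s \<delta> \<Psi>) \<and>
         rincl A s \<in> alg_hom (alg_of s) (rcross H A s \<delta> \<Psi>) \<and>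
         (bunit A \<noteq> 0 \<longrightarrow> inj (rincl A s))))"
proof -
  interpret hopf: quasi_hopf_algebra H by fact
  have coaction: "crossed_product_data H s \<delta> \<Psi> A" if "two_sided_coaction H s \<delta> \<Psi>" for \<delta> \<Psi>
    by (intro crossed_product_data.intro quasi_hopf_coaction.intro assms that)
  note product = crossed_product_data.left_crossed_product crossed_product_data.right_crossed_product
  show ?thesis
  proof ((rule conjI; intro allI impI), goal_cases)
    case (1 \<delta> \<Psi>)
    show ?case using product[OF coaction[OF 1]] by simp
  next
    case (2 lam \<rho> \<Phi>l \<Phi>r \<Phi>lr)
    show ?case
      using product[OF coaction[OF hopf.two_sided_coaction_l[OF 2]]] product[OF coaction[OF
        hopf.two_sided_coaction_r[OF 2]]]
      by simp
  qed
qed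

end
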